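(* Let $\mathcal{B}$ be a small category with Yoneda embeddings $Y:\mathcal{B}\to[\mathcal{B}^{op},\mathcal{V}]$ and $Y':\mathcal{B}^{op}\to[\mathcal{B},\mathcal{V}]$. The Isbell adjunction $L\dashv R:[\mathcal{B},\mathcal{V}]^{op}\to[\mathcal{B}^{op},\mathcal{V}]$, where $L(\phi)=[\mathcal{B}^{op},\mathcal{V}](\phi,Y-)$ and $R(\psi)=[\mathcal{B},\mathcal{V}](\psi,Y'-)$, restricts to an equivalence $$(\mathcal{Q}(\mathcal{B}^{op}))^{op}\simeq\mathcal{Q}(\mathcal{B})$$ between the full subcategories determined by the small projectives in $[\mathcal{B},\mathcal{V}]$ and in $[\mathcal{B}^{op},\mathcal{V}]$.
   Context: Throughout, $\mathcal{V}$ is a symmetric monoidal closed category whose underlying ordinary category is locally small, complete and cocomplete. "Category", "functor", "natural transformation" mean $\mathcal{V}$-category, $\mathcal{V}$-functor, $\mathcal{V}$-natural transformation. A category is small if its set of isomorphism classes of objects is small; $[\mathcal{X},\mathcal{Y}]$ denotes the functor $\mathcal{V}$-category. Colimits are weighted colimits: for $\phi:\mathcal{K}^{op}\to\mathcal{V}$ with $\mathcal{K}$ small (a weight) and $S:\mathcal{K}\to\mathcal{A}$, $\phi*S$ is defined by $\mathcal{A}(\phi*S,a)\cong[\mathcal{K}^{op},\mathcal{V}](\phi,\mathcal{A}(S-,a))$. A functor $\phi:\mathcal{K}^{op}\to\mathcal{V}$ with $\mathcal{K}$ small is a small projective (in $[\mathcal{K}^{op},\mathcal{V}]$) if $[\mathcal{K}^{op},\mathcal{V}](\phi,-):[\mathcal{K}^{op},\mathcal{V}]\to\mathcal{V}$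 preserves all small (weighted) colimits. For $\mathcal{K}$ small, $\mathcal{Q}(\mathcal{K})$ is the full subcategory of $[\mathcal{K}^{op},\mathcal{V}]$ given by the small projectives; so $\mathcal{Q}(\mathcal{B})\subset[\mathcal{B}^{op},\mathcal{V}]$ and $\mathcal{Q}(\mathcal{B}^{op})\subset[\mathcal{B},\mathcal{V}]$. *)

theory Defs
  imports Main
begin

unbundle cardinal_syntax

section \<open>Smallness\<close>

text \<open>
  A Grothendieck universe is represented by a cardinal \<open>\<kappa>\<close>: the small sets, of
  any type, are those of cardinality less than \<open>\<kappa>\<close>. Thus \<open>\<kappa>\<close> is an infinite regular strong
  limit, i.e. inaccessible or \<open>\<omega>\<close> (the latter keeps the hypothesis satisfiable in HOL).
\<close>

definition universe_card :: "'u rel \<Rightarrow> bool" where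
  "universe_card \<kappa> \<longleftrightarrow> Card_order \<kappa> \<and> infinite (Field \<kappa>) \<and> regularCard \<kappa> \<and>
     (\<forall>X \<subseteq> Field \<kappa>. |X| <o \<kappa> \<longrightarrow> |Pow X| <o \<kappa>)"

definition small :: "'u rel \<Rightarrow> 'a set \<Rightarrow> bool" where
  "small \<kappa> X \<longleftrightarrow> |X| <o \<kappa>"


section \<open>Ordinary categories, limits and colimits\<close>

record ('o, 'm) cat =
  obj :: "'o set"
  arr :: "'m set"
  src :: "'m \<Rightarrow> 'o"
  trg :: "'m \<Rightarrow> 'o"
  idn :: "'o \<Rightarrow> 'm"
  cmp :: "'m \<Rightarrow> 'm \<Rightarrow> 'm" (infixr \<open>\<cdot>\<index>\<close> 70)

definition hom :: "('o, 'm, 'x) cat_scheme \<Rightarrow> 'o \<Rightarrow> 'o \<Rightarrow> 'm set" where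
  "hom C a b = {f \<in> arr C. src C f = a \<and> trg C f = b}"

locale category =
  fixes C :: "('o, 'm, 'x) cat_scheme" (structure)
  assumes src_obj: "f \<in> arr C \<Longrightarrow> src C f \<in> obj C"
    and trg_obj: "f \<in> arr C \<Longrightarrow> trg C f \<in> obj C"
    and idn_hom: "a \<in> obj C \<Longrightarrow> idn C a \<in> hom C a a"
    and cmp_hom: "\<lbrakk>f \<in> hom C a b; g \<in> hom C b c\<rbrakk> \<Longrightarrow> g \<cdot> f \<in> hom C a c"
    and cmp_idn: "f \<in> hom C a b \<Longrightarrow> f \<cdot> idn C a = f"
    and idn_cmp: "f \<in> hom C a b \<Longrightarrow> idn C b \<cdot> f = f"
    and cmp_assoc: "\<lbrakk>f \<in> hom C a b; g \<in> hom C b c; h \<in> hom C c d\<rbrakk>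
          \<Longrightarrow> (h \<cdot> g) \<cdot> f = h \<cdot> (g \<cdot> f)"

definition iso_arr :: "('o, 'm, 'x) cat_scheme \<Rightarrow> 'm \<Rightarrow> bool" where
  "iso_arr C f \<longleftrightarrow> f \<in> arr C \<and>
     (\<exists>g \<in> hom C (trg C f) (src C f).
        g \<cdot>\<^bsub>C\<^esub> f = idn C (src C f) \<and> f \<cdot>\<^bsub>C\<^esub> g = idn C (trg C f))"

definition inv_arr :: "('o, 'm, 'x) cat_scheme \<Rightarrow> 'm \<Rightarrow> 'm" where
  "inv_arr C f = (THE g. g \<in> hom C (trg C f) (src C f) \<and>
     g \<cdot>\<^bsub>C\<^esub> f = idn C (src C f) \<and> f \<cdot>\<^bsub>C\<^esub> g = idn C (trg C f))"

definition dual_cat :: "('o, 'm, 'x) cat_scheme \<Rightarrow> ('o, 'm) cat" where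
  "dual_cat C = \<lparr>obj = obj C, arr = arr C, src = trg C, trg = src C, idn = idn C,
     cmp = (\<lambda>g f. f \<cdot>\<^bsub>C\<^esub> g)\<rparr>"

definition diagram ::
  "('j, 'k, 'y) cat_scheme \<Rightarrow> ('o, 'm, 'x) cat_scheme \<Rightarrow> ('j \<Rightarrow> 'o) \<Rightarrow> ('k \<Rightarrow> 'm) \<Rightarrow> bool" where
  "diagram D C Fo Fa \<longleftrightarrow>
     (\<forall>d \<in> obj D. Fo d \<in> obj C) \<and>
     (\<forall>f \<in> arr D. Fa f \<in> hom C (Fo (src D f)) (Fo (trg D f))) \<and>
     (\<forall>d \<in> obj D. Fa (idn D d) = idn C (Fo d)) \<and>
     (\<forall>f \<in> arr D. \<forall>g \<in> arr D. trg D f = src D g \<longrightarrow> Fa (g \<cdot>\<^bsub>D\<^esub> f) = Fa g \<cdot>\<^bsub>C\<^esub> Fa f)"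

definition cone ::
  "('j, 'k, 'y) cat_scheme \<Rightarrow> ('o, 'm, 'x) cat_scheme \<Rightarrow> ('j \<Rightarrow> 'o) \<Rightarrow> ('k \<Rightarrow> 'm) \<Rightarrow>
   'o \<Rightarrow> ('j \<Rightarrow> 'm) \<Rightarrow> bool" where
  "cone D C Fo Fa X \<tau> \<longleftrightarrow> X \<in> obj C \<and>
     (\<forall>d \<in> obj D. \<tau> d \<in> hom C X (Fo d)) \<and>
     (\<forall>f \<in> arr D. Fa f \<cdot>\<^bsub>C\<^esub> \<tau> (src D f) = \<tau> (trg D f))"

definition limit_cone ::
  "('j, 'k, 'y) cat_scheme \<Rightarrow> ('o, 'm, 'x) cat_scheme \<Rightarrow> ('j \<Rightarrow> 'o) \<Rightarrow> ('k \<Rightarrow> 'm) \<Rightarrow>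
   'o \<Rightarrow> ('j \<Rightarrow> 'm) \<Rightarrow> bool" where
  "limit_cone D C Fo Fa Z \<pi> \<longleftrightarrow> cone D C Fo Fa Z \<pi> \<and>
     (\<forall>X \<tau>. cone D C Fo Fa X \<tau> \<longrightarrow>
        (\<exists>!h. h \<in> hom C X Z \<and> (\<forall>d \<in> obj D. \<pi> d \<cdot>\<^bsub>C\<^esub> h = \<tau> d)))"

definition locally_small :: "'u rel \<Rightarrow> ('o, 'm, 'x) cat_scheme \<Rightarrow> bool" where
  "locally_small \<kappa> C \<longleftrightarrow> (\<forall>a \<in> obj C. \<forall>b \<in> obj C. small \<kappa> (hom C a b))"

text \<open>
  Since \<open>\<kappa>\<close> lives on \<open>'u\<close>, every small category is isomorphic to one whose objects and arrows
  are elements of \<open>'u\<close>; so these are enough as shapes of diagrams.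
\<close>

definition complete_cat :: "'u rel \<Rightarrow> ('o, 'm, 'x) cat_scheme \<Rightarrow> bool" where
  "complete_cat \<kappa> C \<longleftrightarrow>
     (\<forall>(D :: ('u, 'u) cat) Fo Fa.
        category D \<and> small \<kappa> (obj D) \<and> small \<kappa> (arr D) \<and> diagram D C Fo Fa \<longrightarrow>
        (\<exists>Z \<pi>. limit_cone D C Fo Fa Z \<pi>))"

definition cocomplete_cat :: "'u rel \<Rightarrow> ('o, 'm, 'x) cat_scheme \<Rightarrow> bool" where
  "cocomplete_cat \<kappa> C \<longleftrightarrow> complete_cat \<kappa> (dual_cat C)"


section \<open>Symmetric monoidal closed categories\<close>

text \<open>
  Directions: \<open>asc a b c : (a \<otimes> b) \<otimes> c \<rightarrow> a \<otimes> (b \<otimes> c)\<close>, \<open>lun a : I \<otimes> a \<rightarrow> a\<close>,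
  \<open>run a : a \<otimes> I \<rightarrow> a\<close>, \<open>brd a b : a \<otimes> b \<rightarrow> b \<otimes> a\<close>, and \<open>evl a b : [a, b] \<otimes> a \<rightarrow> b\<close>
  where \<open>[a, b] = ihom a b\<close>.
\<close>

record ('o, 'm) smc = "('o, 'm) cat" +
  unt :: 'o
  tob :: "'o \<Rightarrow> 'o \<Rightarrow> 'o" (infixr \<open>\<odot>\<index>\<close> 75)
  tar :: "'m \<Rightarrow> 'm \<Rightarrow> 'm" (infixr \<open>\<otimes>\<index>\<close> 75)
  asc :: "'o \<Rightarrow> 'o \<Rightarrow> 'o \<Rightarrow> 'm"
  lun :: "'o \<Rightarrow> 'm"
  run :: "'o \<Rightarrow> 'm"
  brd :: "'o \<Rightarrow> 'o \<Rightarrow> 'm"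
  ihom :: "'o \<Rightarrow> 'o \<Rightarrow> 'o"
  evl :: "'o \<Rightarrow> 'o \<Rightarrow> 'm"

locale sym_mon_closed = category V for V :: "('o, 'm) smc" (structure) +
  assumes unt_obj: "unt V \<in> obj V"
    and tob_obj: "\<lbrakk>a \<in> obj V; b \<in> obj V\<rbrakk> \<Longrightarrow> a \<odot> b \<in> obj V"
    and tar_hom: "\<lbrakk>f \<in> hom V a b; g \<in> hom V c d\<rbrakk> \<Longrightarrow> f \<otimes> g \<in> hom V (a \<odot> c) (b \<odot> d)"
    and tar_idn: "\<lbrakk>a \<in> obj V; b \<in> obj V\<rbrakk> \<Longrightarrow> idn V a \<otimes> idn V b = idn V (a \<odot> b)"
    and tar_cmp: "\<lbrakk>f \<in> hom V a b; f' \<in> hom V b c; g \<in> hom V a' b'; g' \<in> hom V b' c'\<rbrakk>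
          \<Longrightarrow> (f' \<cdot> f) \<otimes> (g' \<cdot> g) = (f' \<otimes> g') \<cdot> (f \<otimes> g)"
    and asc_hom: "\<lbrakk>a \<in> obj V; b \<in> obj V; c \<in> obj V\<rbrakk>
          \<Longrightarrow> asc V a b c \<in> hom V ((a \<odot> b) \<odot> c) (a \<odot> (b \<odot> c)) \<and> iso_arr V (asc V a b c)"
    and lun_hom: "a \<in> obj V \<Longrightarrow> lun V a \<in> hom V (unt V \<odot> a) a \<and> iso_arr V (lun V a)"
    and run_hom: "a \<in> obj V \<Longrightarrow> run V a \<in> hom V (a \<odot> unt V) a \<and> iso_arr V (run V a)"
    and brd_hom: "\<lbrakk>a \<in> obj V; b \<in> obj V\<rbrakk> \<Longrightarrow> brd V a b \<in> hom V (a \<odot> b) (b \<odot> a)"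
    and asc_nat: "\<lbrakk>f \<in> hom V a a'; g \<in> hom V b b'; h \<in> hom V c c'\<rbrakk>
          \<Longrightarrow> asc V a' b' c' \<cdot> ((f \<otimes> g) \<otimes> h) = (f \<otimes> (g \<otimes> h)) \<cdot> asc V a b c"
    and lun_nat: "f \<in> hom V a b \<Longrightarrow> lun V b \<cdot> (idn V (unt V) \<otimes> f) = f \<cdot> lun V a"
    and run_nat: "f \<in> hom V a b \<Longrightarrow> run V b \<cdot> (f \<otimes> idn V (unt V)) = f \<cdot> run V a"
    and brd_nat: "\<lbrakk>f \<in> hom V a a'; g \<in> hom V b b'\<rbrakk>
          \<Longrightarrow> brd V a' b' \<cdot> (f \<otimes> g) = (g \<otimes> f) \<cdot> brd V a b"
    and pentagon: "\<lbrakk>a \<in> obj V; b \<in> obj V; c \<in> obj V; d \<in> obj V\<rbrakk>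
          \<Longrightarrow> asc V a b (c \<odot> d) \<cdot> asc V (a \<odot> b) c d =
              (idn V a \<otimes> asc V b c d) \<cdot> asc V a (b \<odot> c) d \<cdot> (asc V a b c \<otimes> idn V d)"
    and triangle: "\<lbrakk>a \<in> obj V; b \<in> obj V\<rbrakk>
          \<Longrightarrow> (idn V a \<otimes> lun V b) \<cdot> asc V a (unt V) b = run V a \<otimes> idn V b"
    and lun_unt: "lun V (unt V) = run V (unt V)"
    and symmetry: "\<lbrakk>a \<in> obj V; b \<in> obj V\<rbrakk> \<Longrightarrow> brd V b a \<cdot> brd V a b = idn V (a \<odot> b)"
    and brd_unt: "a \<in> obj V \<Longrightarrow> lun V a \<cdot> brd V a (unt V) = run V a"
    and hexagon: "\<lbrakk>a \<in> obj V; b \<in> obj V; c \<in> obj V\<rbrakk>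
          \<Longrightarrow> asc V b c a \<cdot> brd V a (b \<odot> c) \<cdot> asc V a b c =
              (idn V b \<otimes> brd V a c) \<cdot> asc V b a c \<cdot> (brd V a b \<otimes> idn V c)"
    and ihom_obj: "\<lbrakk>a \<in> obj V; b \<in> obj V\<rbrakk> \<Longrightarrow> ihom V a b \<in> obj V"
    and evl_hom: "\<lbrakk>a \<in> obj V; b \<in> obj V\<rbrakk> \<Longrightarrow> evl V a b \<in> hom V (ihom V a b \<odot> a) b"
    and closed: "\<lbrakk>x \<in> obj V; a \<in> obj V; b \<in> obj V; f \<in> hom V (x \<odot> a) b\<rbrakk>
          \<Longrightarrow> \<exists>!g. g \<in> hom V x (ihom V a b) \<and> evl V a b \<cdot> (g \<otimes> idn V a) = f"

definition curry_arr :: "('o, 'm) smc \<Rightarrow> 'o \<Rightarrow> 'o \<Rightarrow> 'o \<Rightarrow> 'm \<Rightarrow> 'm" where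
  "curry_arr V x a b f =
     (THE g. g \<in> hom V x (ihom V a b) \<and> evl V a b \<cdot>\<^bsub>V\<^esub> (g \<otimes>\<^bsub>V\<^esub> idn V a) = f)"

text \<open>The element \<open>I \<rightarrow> [a, b]\<close> corresponding to \<open>f : a \<rightarrow> b\<close>.\<close>

definition name_arr :: "('o, 'm) smc \<Rightarrow> 'o \<Rightarrow> 'o \<Rightarrow> 'm \<Rightarrow> 'm" where
  "name_arr V a b f = curry_arr V (unt V) a b (f \<cdot>\<^bsub>V\<^esub> lun V a)"


section \<open>Enriched categories\<close>

text \<open>\<open>Comp A x y z : A(y, z) \<otimes> A(x, y) \<rightarrow> A(x, z)\<close>.\<close>

record ('a, 'o, 'm) vcat =
  Ob :: "'a set"
  Hom :: "'a \<Rightarrow> 'a \<Rightarrow> 'o"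
  Id :: "'a \<Rightarrow> 'm"
  Comp :: "'a \<Rightarrow> 'a \<Rightarrow> 'a \<Rightarrow> 'm"

definition vcategory :: "('o, 'm) smc \<Rightarrow> ('a, 'o, 'm) vcat \<Rightarrow> bool" where
  "vcategory V A \<longleftrightarrow>
     (\<forall>x \<in> Ob A. \<forall>y \<in> Ob A. Hom A x y \<in> obj V) \<and>
     (\<forall>x \<in> Ob A. Id A x \<in> hom V (unt V) (Hom A x x)) \<and>
     (\<forall>x \<in> Ob A. \<forall>y \<in> Ob A. \<forall>z \<in> Ob A.
        Comp A x y z \<in> hom V (Hom A y z \<odot>\<^bsub>V\<^esub> Hom A x y) (Hom A x z)) \<and>
     (\<forall>w \<in> Ob A. \<forall>x \<in> Ob A. \<forall>y \<in> Ob A. \<forall>z \<in> Ob A.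
        Comp A w x z \<cdot>\<^bsub>V\<^esub> (Comp A x y z \<otimes>\<^bsub>V\<^esub> idn V (Hom A w x)) =
        Comp A w y z \<cdot>\<^bsub>V\<^esub> (idn V (Hom A y z) \<otimes>\<^bsub>V\<^esub> Comp A w x y) \<cdot>\<^bsub>V\<^esub>
          asc V (Hom A y z) (Hom A x y) (Hom A w x)) \<and>
     (\<forall>x \<in> Ob A. \<forall>y \<in> Ob A.
        Comp A x y y \<cdot>\<^bsub>V\<^esub> (Id A y \<otimes>\<^bsub>V\<^esub> idn V (Hom A x y)) = lun V (Hom A x y) \<and>
        Comp A x x y \<cdot>\<^bsub>V\<^esub> (idn V (Hom A x y) \<otimes>\<^bsub>V\<^esub> Id A x) = run V (Hom A x y))"

text \<open>\<open>V\<close> as a category enriched in itself.\<close>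

definition vself :: "('o, 'm) smc \<Rightarrow> ('o, 'o, 'm) vcat" where
  "vself V = \<lparr>Ob = obj V, Hom = ihom V,
     Id = (\<lambda>a. curry_arr V (unt V) a a (lun V a)),
     Comp = (\<lambda>a b c. curry_arr V (ihom V b c \<odot>\<^bsub>V\<^esub> ihom V a b) a c
        (evl V b c \<cdot>\<^bsub>V\<^esub> (idn V (ihom V b c) \<otimes>\<^bsub>V\<^esub> evl V a b) \<cdot>\<^bsub>V\<^esub>
           asc V (ihom V b c) (ihom V a b) a))\<rparr>"

text \<open>The irrelevant values of \<open>Comp\<close> off \<open>Ob A\<close> are chosen to make \<open>vop\<close> strictly involutive.\<close>

definition vop :: "('o, 'm) smc \<Rightarrow> ('a, 'o, 'm) vcat \<Rightarrow> ('a, 'o, 'm) vcat" where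
  "vop V A = \<lparr>Ob = Ob A, Hom = (\<lambda>x y. Hom A y x), Id = Id A,
     Comp = (\<lambda>x y z. if x \<in> Ob A \<and> y \<in> Ob A \<and> z \<in> Ob A
        then Comp A z y x \<cdot>\<^bsub>V\<^esub> brd V (Hom A z y) (Hom A y x) else Comp A z y x)\<rparr>"

definition full_sub :: "('a, 'o, 'm) vcat \<Rightarrow> 'a set \<Rightarrow> ('a, 'o, 'm) vcat" where
  "full_sub A P = A\<lparr>Ob := P\<rparr>"

text \<open>
  Morphisms \<open>x \<rightarrow> y\<close> of the underlying ordinary category of \<open>A\<close> are arrows \<open>I \<rightarrow> A(x, y)\<close>;
  \<open>ecomp\<close> is their composition.
\<close>

definition ecomp ::
  "('o, 'm) smc \<Rightarrow> ('a, 'o, 'm) vcat \<Rightarrow> 'a \<Rightarrow> 'a \<Rightarrow> 'a \<Rightarrow> 'm \<Rightarrow> 'm \<Rightarrow> 'm" where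
  "ecomp V A x y z g f = Comp A x y z \<cdot>\<^bsub>V\<^esub> (g \<otimes>\<^bsub>V\<^esub> f) \<cdot>\<^bsub>V\<^esub> inv_arr V (lun V (unt V))"

definition viso :: "('o, 'm) smc \<Rightarrow> ('a, 'o, 'm) vcat \<Rightarrow> 'a \<Rightarrow> 'a \<Rightarrow> 'm \<Rightarrow> bool" where
  "viso V A x y f \<longleftrightarrow> f \<in> hom V (unt V) (Hom A x y) \<and>
     (\<exists>g \<in> hom V (unt V) (Hom A y x).
        ecomp V A x y x g f = Id A x \<and> ecomp V A y x y f g = Id A y)"

definition iso_rel :: "('o, 'm) smc \<Rightarrow> ('a, 'o, 'm) vcat \<Rightarrow> 'a rel" where
  "iso_rel V A = {(x, y). x \<in> Ob A \<and> y \<in> Ob A \<and> (\<exists>f. viso V A x y f)}"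

definition vsmall :: "'u rel \<Rightarrow> ('o, 'm) smc \<Rightarrow> ('a, 'o, 'm) vcat \<Rightarrow> bool" where
  "vsmall \<kappa> V A \<longleftrightarrow> small \<kappa> (Ob A // iso_rel V A)"


section \<open>Enriched functors and natural transformations\<close>

record ('a, 'b, 'm) vfun =
  fob :: "'a \<Rightarrow> 'b"
  far :: "'a \<Rightarrow> 'a \<Rightarrow> 'm"

text \<open>
  Functors take the value \<open>undefined\<close> off their domain, so that equality of
  functors is equality of records.
\<close>

definition mk_vfun ::
  "('a, 'o, 'm) vcat \<Rightarrow> ('a \<Rightarrow> 'b) \<Rightarrow> ('a \<Rightarrow> 'a \<Rightarrow> 'm) \<Rightarrow> ('a, 'b, 'm) vfun" where
  "mk_vfun A fo fa =
     \<lparr>fob = (\<lambda>x. if x \<in> Ob A then fo x else undefined),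
      far = (\<lambda>x y. if x \<in> Ob A \<and> y \<in> Ob A then fa x y else undefined)\<rparr>"

definition vfunctor ::
  "('o, 'm) smc \<Rightarrow> ('a, 'o, 'm) vcat \<Rightarrow> ('b, 'o, 'm) vcat \<Rightarrow> ('a, 'b, 'm) vfun \<Rightarrow> bool" where
  "vfunctor V A C F \<longleftrightarrow> F = mk_vfun A (fob F) (far F) \<and>
     (\<forall>x \<in> Ob A. fob F x \<in> Ob C) \<and>
     (\<forall>x \<in> Ob A. \<forall>y \<in> Ob A. far F x y \<in> hom V (Hom A x y) (Hom C (fob F x) (fob F y))) \<and>
     (\<forall>x \<in> Ob A. far F x x \<cdot>\<^bsub>V\<^esub> Id A x = Id C (fob F x)) \<and>
     (\<forall>x \<in> Ob A. \<forall>y \<in> Ob A. \<forall>z \<in> Ob A.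
        far F x z \<cdot>\<^bsub>V\<^esub> Comp A x y z =
        Comp C (fob F x) (fob F y) (fob F z) \<cdot>\<^bsub>V\<^esub> (far F y z \<otimes>\<^bsub>V\<^esub> far F x y))"

definition vid :: "('o, 'm) smc \<Rightarrow> ('a, 'o, 'm) vcat \<Rightarrow> ('a, 'a, 'm) vfun" where
  "vid V A = mk_vfun A (\<lambda>x. x) (\<lambda>x y. idn V (Hom A x y))"

text \<open>\<open>vcompose V A G F\<close> is \<open>G \<circ> F\<close>, where \<open>A\<close> is the domain of \<open>F\<close>.\<close>

definition vcompose ::
  "('o, 'm) smc \<Rightarrow> ('a, 'o, 'm) vcat \<Rightarrow> ('b, 'c, 'm) vfun \<Rightarrow> ('a, 'b, 'm) vfun
     \<Rightarrow> ('a, 'c, 'm) vfun" where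
  "vcompose V A G F = mk_vfun A (\<lambda>x. fob G (fob F x))
     (\<lambda>x y. far G (fob F x) (fob F y) \<cdot>\<^bsub>V\<^esub> far F x y)"

text \<open>\<open>F\<^sup>o\<^sup>p : A\<^sup>o\<^sup>p \<rightarrow> C\<^sup>o\<^sup>p\<close> for \<open>F : A \<rightarrow> C\<close>.\<close>

definition vopfun :: "('a, 'b, 'm) vfun \<Rightarrow> ('a, 'b, 'm) vfun" where
  "vopfun F = \<lparr>fob = fob F, far = (\<lambda>x y. far F y x)\<rparr>"

definition restrict_vfun :: "('a, 'o, 'm) vcat \<Rightarrow> ('a, 'b, 'm) vfun \<Rightarrow> ('a, 'b, 'm) vfun" where
  "restrict_vfun A F = mk_vfun A (fob F) (far F)"

definition vnat ::
  "('o, 'm) smc \<Rightarrow> ('a, 'o, 'm) vcat \<Rightarrow> ('b, 'o, 'm) vcat \<Rightarrow>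
   ('a, 'b, 'm) vfun \<Rightarrow> ('a, 'b, 'm) vfun \<Rightarrow> ('a \<Rightarrow> 'm) \<Rightarrow> bool" where
  "vnat V A C F G \<alpha> \<longleftrightarrow>
     (\<forall>x \<in> Ob A. \<alpha> x \<in> hom V (unt V) (Hom C (fob F x) (fob G x))) \<and>
     (\<forall>x \<in> Ob A. \<forall>y \<in> Ob A.
        Comp C (fob F x) (fob F y) (fob G y) \<cdot>\<^bsub>V\<^esub> (\<alpha> y \<otimes>\<^bsub>V\<^esub> far F x y) \<cdot>\<^bsub>V\<^esub>
          inv_arr V (lun V (Hom A x y)) =
        Comp C (fob F x) (fob G x) (fob G y) \<cdot>\<^bsub>V\<^esub> (far G x y \<otimes>\<^bsub>V\<^esub> \<alpha> x) \<cdot>\<^bsub>V\<^esub>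
          inv_arr V (run V (Hom A x y)))"

definition vnat_iso ::
  "('o, 'm) smc \<Rightarrow> ('a, 'o, 'm) vcat \<Rightarrow> ('b, 'o, 'm) vcat \<Rightarrow>
   ('a, 'b, 'm) vfun \<Rightarrow> ('a, 'b, 'm) vfun \<Rightarrow> ('a \<Rightarrow> 'm) \<Rightarrow> bool" where
  "vnat_iso V A C F G \<alpha> \<longleftrightarrow> vnat V A C F G \<alpha> \<and>
     (\<forall>x \<in> Ob A. viso V C (fob F x) (fob G x) (\<alpha> x))"

text \<open>\<open>F \<stileturn> G\<close> with \<open>F : A \<rightarrow> C\<close>, unit \<open>\<eta>\<close> and counit \<open>\<epsilon>\<close>.\<close>

definition vadjunction ::
  "('o, 'm) smc \<Rightarrow> ('a, 'o, 'm) vcat \<Rightarrow> ('b, 'o, 'm) vcat \<Rightarrow>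
   ('a, 'b, 'm) vfun \<Rightarrow> ('b, 'a, 'm) vfun \<Rightarrow> ('a \<Rightarrow> 'm) \<Rightarrow> ('b \<Rightarrow> 'm) \<Rightarrow> bool" where
  "vadjunction V A C F G \<eta> \<epsilon> \<longleftrightarrow> vfunctor V A C F \<and> vfunctor V C A G \<and>
     vnat V A A (vid V A) (vcompose V A G F) \<eta> \<and>
     vnat V C C (vcompose V C F G) (vid V C) \<epsilon> \<and>
     (\<forall>a \<in> Ob A. let Fa = fob F a; GFa = fob G Fa in
        ecomp V C Fa (fob F GFa) Fa (\<epsilon> Fa) (far F a GFa \<cdot>\<^bsub>V\<^esub> \<eta> a) = Id C Fa) \<and>
     (\<forall>c \<in> Ob C. let Gc = fob G c; FGc = fob F Gc in
        ecomp V A Gc (fob G FGc) Gc (far G FGc c \<cdot>\<^bsub>V\<^esub> \<epsilon> c) (\<eta> Gc) = Id A Gc)"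

definition vequivalence ::
  "('o, 'm) smc \<Rightarrow> ('a, 'o, 'm) vcat \<Rightarrow> ('b, 'o, 'm) vcat \<Rightarrow>
   ('a, 'b, 'm) vfun \<Rightarrow> ('b, 'a, 'm) vfun \<Rightarrow> ('a \<Rightarrow> 'm) \<Rightarrow> ('b \<Rightarrow> 'm) \<Rightarrow> bool" where
  "vequivalence V A C F G \<eta> \<epsilon> \<longleftrightarrow> vfunctor V A C F \<and> vfunctor V C A G \<and>
     vnat_iso V A A (vid V A) (vcompose V A G F) \<eta> \<and>
     vnat_iso V C C (vcompose V C F G) (vid V C) \<epsilon>"


section \<open>Functor categories\<close>

text \<open>
  \<open>[A, C](F, G)\<close> is the end of \<open>C(F-, G-)\<close>; \<open>wedge\<close> equates the two composites
  \<open>A(x, y) \<otimes> X \<rightarrow> C(F x, G y)\<close>.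
\<close>

definition wedge ::
  "('o, 'm) smc \<Rightarrow> ('a, 'o, 'm) vcat \<Rightarrow> ('b, 'o, 'm) vcat \<Rightarrow>
   ('a, 'b, 'm) vfun \<Rightarrow> ('a, 'b, 'm) vfun \<Rightarrow> 'o \<Rightarrow> ('a \<Rightarrow> 'm) \<Rightarrow> bool" where
  "wedge V A C F G X \<tau> \<longleftrightarrow> X \<in> obj V \<and>
     (\<forall>x \<in> Ob A. \<tau> x \<in> hom V X (Hom C (fob F x) (fob G x))) \<and>
     (\<forall>x \<in> Ob A. \<forall>y \<in> Ob A.
        Comp C (fob F x) (fob G x) (fob G y) \<cdot>\<^bsub>V\<^esub> (far G x y \<otimes>\<^bsub>V\<^esub> \<tau> x) =
        Comp C (fob F x) (fob F y) (fob G y) \<cdot>\<^bsub>V\<^esub> (\<tau> y \<otimes>\<^bsub>V\<^esub> far F x y) \<cdot>\<^bsub>V\<^esub>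
          brd V (Hom A x y) X)"

definition nat_end ::
  "('o, 'm) smc \<Rightarrow> ('a, 'o, 'm) vcat \<Rightarrow> ('b, 'o, 'm) vcat \<Rightarrow>
   ('a, 'b, 'm) vfun \<Rightarrow> ('a, 'b, 'm) vfun \<Rightarrow> 'o \<Rightarrow> ('a \<Rightarrow> 'm) \<Rightarrow> bool" where
  "nat_end V A C F G E \<pi> \<longleftrightarrow> wedge V A C F G E \<pi> \<and>
     (\<forall>X \<tau>. wedge V A C F G X \<tau> \<longrightarrow>
        (\<exists>!h. h \<in> hom V X E \<and> (\<forall>x \<in> Ob A. \<pi> x \<cdot>\<^bsub>V\<^esub> h = \<tau> x)))"

definition the_end ::
  "('o, 'm) smc \<Rightarrow> ('a, 'o, 'm) vcat \<Rightarrow> ('b, 'o, 'm) vcat \<Rightarrow>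
   ('a, 'b, 'm) vfun \<Rightarrow> ('a, 'b, 'm) vfun \<Rightarrow> 'o \<times> ('a \<Rightarrow> 'm)" where
  "the_end V A C F G = (SOME p. nat_end V A C F G (fst p) (snd p))"

definition nat_ob ::
  "('o, 'm) smc \<Rightarrow> ('a, 'o, 'm) vcat \<Rightarrow> ('b, 'o, 'm) vcat \<Rightarrow>
   ('a, 'b, 'm) vfun \<Rightarrow> ('a, 'b, 'm) vfun \<Rightarrow> 'o" where
  "nat_ob V A C F G = fst (the_end V A C F G)"

definition nat_proj ::
  "('o, 'm) smc \<Rightarrow> ('a, 'o, 'm) vcat \<Rightarrow> ('b, 'o, 'm) vcat \<Rightarrow>
   ('a, 'b, 'm) vfun \<Rightarrow> ('a, 'b, 'm) vfun \<Rightarrow> 'a \<Rightarrow> 'm" where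
  "nat_proj V A C F G = snd (the_end V A C F G)"

definition nat_lift ::
  "('o, 'm) smc \<Rightarrow> ('a, 'o, 'm) vcat \<Rightarrow> ('b, 'o, 'm) vcat \<Rightarrow>
   ('a, 'b, 'm) vfun \<Rightarrow> ('a, 'b, 'm) vfun \<Rightarrow> 'o \<Rightarrow> ('a \<Rightarrow> 'm) \<Rightarrow> 'm" where
  "nat_lift V A C F G X \<tau> = (THE h. h \<in> hom V X (nat_ob V A C F G) \<and>
     (\<forall>x \<in> Ob A. nat_proj V A C F G x \<cdot>\<^bsub>V\<^esub> h = \<tau> x))"

definition fun_cat ::
  "('o, 'm) smc \<Rightarrow> ('a, 'o, 'm) vcat \<Rightarrow> ('b, 'o, 'm) vcat \<Rightarrow> (('a, 'b, 'm) vfun, 'o, 'm) vcat" where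
  "fun_cat V A C = \<lparr>Ob = {F. vfunctor V A C F}, Hom = nat_ob V A C,
     Id = (\<lambda>F. nat_lift V A C F F (unt V) (\<lambda>x. Id C (fob F x))),
     Comp = (\<lambda>F G H. nat_lift V A C F H (nat_ob V A C G H \<odot>\<^bsub>V\<^esub> nat_ob V A C F G)
        (\<lambda>x. Comp C (fob F x) (fob G x) (fob H x) \<cdot>\<^bsub>V\<^esub>
           (nat_proj V A C G H x \<otimes>\<^bsub>V\<^esub> nat_proj V A C F G x)))\<rparr>"

text \<open>\<open>vpsh V A\<close> is the functor category \<open>[A, V]\<close>; presheaves on \<open>K\<close> form \<open>vpsh V (vop V K)\<close>.\<close>

abbreviation vpsh ::
  "('o, 'm) smc \<Rightarrow> ('a, 'o, 'm) vcat \<Rightarrow> (('a, 'o, 'm) vfun, 'o, 'm) vcat" where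
  "vpsh V A \<equiv> fun_cat V A (vself V)"


section \<open>Representables and Yoneda embeddings\<close>

text \<open>\<open>A(c, -) : A \<rightarrow> V\<close>.\<close>

definition rep :: "('o, 'm) smc \<Rightarrow> ('a, 'o, 'm) vcat \<Rightarrow> 'a \<Rightarrow> ('a, 'o, 'm) vfun" where
  "rep V A c = mk_vfun A (Hom A c)
     (\<lambda>x y. curry_arr V (Hom A x y) (Hom A c x) (Hom A c y) (Comp A c x y))"

text \<open>\<open>A \<rightarrow> [K\<^sup>o\<^sup>p, V]\<close>, \<open>a \<mapsto> A(S-, a)\<close>, for \<open>S : K \<rightarrow> A\<close>.\<close>

definition nerve ::
  "('o, 'm) smc \<Rightarrow> ('k, 'o, 'm) vcat \<Rightarrow> ('a, 'o, 'm) vcat \<Rightarrow> ('k, 'a, 'm) vfun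
     \<Rightarrow> ('a, ('k, 'o, 'm) vfun, 'm) vfun" where
  "nerve V K A S =
     (let N = (\<lambda>a. vcompose V (vop V K) (rep V (vop V A) a) (vopfun S))
      in mk_vfun A N (\<lambda>a b. nat_lift V (vop V K) (vself V) (N a) (N b) (Hom A a b)
           (\<lambda>k. far (rep V A (fob S k)) a b)))"

text \<open>\<open>A \<rightarrow> [K, V]\<^sup>o\<^sup>p\<close>, \<open>a \<mapsto> A(a, Z-)\<close>, for \<open>Z : K \<rightarrow> A\<close>.\<close>

definition conerve ::
  "('o, 'm) smc \<Rightarrow> ('k, 'o, 'm) vcat \<Rightarrow> ('a, 'o, 'm) vcat \<Rightarrow> ('k, 'a, 'm) vfun
     \<Rightarrow> ('a, ('k, 'o, 'm) vfun, 'm) vfun" where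
  "conerve V K A Z =
     (let N = (\<lambda>a. vcompose V K (rep V A a) Z)
      in mk_vfun A N (\<lambda>a b. nat_lift V K (vself V) (N b) (N a) (Hom A a b)
           (\<lambda>k. far (rep V (vop V A) (fob Z k)) b a)))"

definition yoneda ::
  "('o, 'm) smc \<Rightarrow> ('a, 'o, 'm) vcat \<Rightarrow> ('a, ('a, 'o, 'm) vfun, 'm) vfun" where
  "yoneda V A = nerve V A A (vid V A)"


section \<open>Weighted colimits and small projectives\<close>

text \<open>
  \<open>c = \<phi> * S\<close>, with representation \<open>\<beta>\<^sub>a : A(c, a) \<cong> [K\<^sup>o\<^sup>p, V](\<phi>, A(S-, a))\<close> natural in \<open>a\<close>.
\<close>

definition weighted_colimit ::
  "('o, 'm) smc \<Rightarrow> ('k, 'o, 'm) vcat \<Rightarrow> ('a, 'o, 'm) vcat \<Rightarrow> ('k, 'o, 'm) vfun \<Rightarrow>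
   ('k, 'a, 'm) vfun \<Rightarrow> 'a \<Rightarrow> ('a \<Rightarrow> 'm) \<Rightarrow> bool" where
  "weighted_colimit V K A \<phi> S c \<beta> \<longleftrightarrow> c \<in> Ob A \<and>
     vnat_iso V A (vself V) (rep V A c)
       (vcompose V A (rep V (vpsh V (vop V K)) \<phi>) (nerve V K A S)) \<beta>"

text \<open>
  The image of the identity under \<open>\<beta>\<^sub>c\<close> is an element of \<open>[K\<^sup>o\<^sup>p, V](\<phi>, A(S-, c))\<close>, the unit
  of the representation; \<open>colimit_unit\<close> gives its components \<open>I \<rightarrow> [\<phi> k, A(S k, c)]\<close>.
\<close>

definition colimit_unit ::
  "('o, 'm) smc \<Rightarrow> ('k, 'o, 'm) vcat \<Rightarrow> ('a, 'o, 'm) vcat \<Rightarrow> ('k, 'o, 'm) vfun \<Rightarrow>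
   ('k, 'a, 'm) vfun \<Rightarrow> 'a \<Rightarrow> ('a \<Rightarrow> 'm) \<Rightarrow> 'k \<Rightarrow> 'm" where
  "colimit_unit V K A \<phi> S c \<beta> k =
     (let N = fob (nerve V K A S) c
      in nat_proj V (vop V K) (vself V) \<phi> N k \<cdot>\<^bsub>V\<^esub>
         evl V (Hom A c c) (nat_ob V (vop V K) (vself V) \<phi> N) \<cdot>\<^bsub>V\<^esub>
         (\<beta> c \<otimes>\<^bsub>V\<^esub> Id A c) \<cdot>\<^bsub>V\<^esub> inv_arr V (lun V (unt V)))"

definition preserves_colimit ::
  "('o, 'm) smc \<Rightarrow> ('k, 'o, 'm) vcat \<Rightarrow> ('a, 'o, 'm) vcat \<Rightarrow> ('b, 'o, 'm) vcat \<Rightarrow>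
   ('a, 'b, 'm) vfun \<Rightarrow> ('k, 'o, 'm) vfun \<Rightarrow> ('k, 'a, 'm) vfun \<Rightarrow> 'a \<Rightarrow> ('a \<Rightarrow> 'm) \<Rightarrow> bool" where
  "preserves_colimit V K A C F \<phi> S c \<beta> \<longleftrightarrow>
     (\<exists>\<beta>'. weighted_colimit V K C \<phi> (vcompose V K F S) (fob F c) \<beta>' \<and>
        (\<forall>k \<in> Ob K.
           colimit_unit V K C \<phi> (vcompose V K F S) (fob F c) \<beta>' k =
           ecomp V (vself V) (fob \<phi> k) (Hom A (fob S k) c) (Hom C (fob F (fob S k)) (fob F c))
             (name_arr V (Hom A (fob S k) c) (Hom C (fob F (fob S k)) (fob F c))
                (far F (fob S k) c))
             (colimit_unit V K A \<phi> S c \<beta> k)))"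

text \<open>
  As for limits in \<open>V\<close>, shapes \<open>K\<close> with objects in \<open>'u\<close> suffice: every small category is equivalent
  to one with fewer than \<open>\<kappa>\<close> objects.
\<close>

definition preserves_small_colimits ::
  "'u rel \<Rightarrow> ('o, 'm) smc \<Rightarrow> ('a, 'o, 'm) vcat \<Rightarrow> ('b, 'o, 'm) vcat \<Rightarrow>
   ('a, 'b, 'm) vfun \<Rightarrow> bool" where
  "preserves_small_colimits \<kappa> V A C F \<longleftrightarrow>
     (\<forall>(K :: ('u, 'o, 'm) vcat) \<phi> S c \<beta>.
        vcategory V K \<and> vsmall \<kappa> V K \<and> vfunctor V (vop V K) (vself V) \<phi> \<and> vfunctor V K A S \<and>
        weighted_colimit V K A \<phi> S c \<beta> \<longrightarrow>
        preserves_colimit V K A C F \<phi> S c \<beta>)"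

definition small_projective ::
  "'u rel \<Rightarrow> ('o, 'm) smc \<Rightarrow> ('k, 'o, 'm) vcat \<Rightarrow> ('k, 'o, 'm) vfun \<Rightarrow> bool" where
  "small_projective \<kappa> V K \<phi> \<longleftrightarrow> vfunctor V (vop V K) (vself V) \<phi> \<and>
     preserves_small_colimits \<kappa> V (vpsh V (vop V K)) (vself V) (rep V (vpsh V (vop V K)) \<phi>)"

text \<open>\<open>\<Q>(K)\<close>, the full subcategory of \<open>[K\<^sup>o\<^sup>p, V]\<close> given by the small projectives.\<close>

definition Qcat ::
  "'u rel \<Rightarrow> ('o, 'm) smc \<Rightarrow> ('k, 'o, 'm) vcat \<Rightarrow> (('k, 'o, 'm) vfun, 'o, 'm) vcat" where
  "Qcat \<kappa> V K = full_sub (vpsh V (vop V K)) {\<phi>. small_projective \<kappa> V K \<phi>}"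


section \<open>The Isbell adjunction\<close>

text \<open>\<open>L : [B\<^sup>o\<^sup>p, V] \<rightarrow> [B, V]\<^sup>o\<^sup>p\<close> and \<open>R : [B, V]\<^sup>o\<^sup>p \<rightarrow> [B\<^sup>o\<^sup>p, V]\<close>.\<close>

definition isbell_L ::
  "('o, 'm) smc \<Rightarrow> ('a, 'o, 'm) vcat \<Rightarrow> (('a, 'o, 'm) vfun, ('a, 'o, 'm) vfun, 'm) vfun" where
  "isbell_L V B = conerve V B (vpsh V (vop V B)) (yoneda V B)"

definition isbell_R ::
  "('o, 'm) smc \<Rightarrow> ('a, 'o, 'm) vcat \<Rightarrow> (('a, 'o, 'm) vfun, ('a, 'o, 'm) vfun, 'm) vfun" where
  "isbell_R V B = vopfun (conerve V (vop V B) (vpsh V B) (yoneda V (vop V B)))"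

text \<open>
  The unit \<open>\<phi> \<rightarrow> R (L \<phi>)\<close> is evaluation: its component \<open>u b : \<phi> b \<rightarrow> [B, V](L \<phi>, B(b, -))\<close>
  corresponds to the family
  \<open>\<phi> b \<otimes> [B\<^sup>o\<^sup>p, V](\<phi>, B(-, c)) \<rightarrow> [\<phi> b, B(b, c)] \<otimes> \<phi> b \<rightarrow> B(b, c)\<close>.
\<close>

definition isbell_unit :: "('o, 'm) smc \<Rightarrow> ('a, 'o, 'm) vcat \<Rightarrow> ('a, 'o, 'm) vfun \<Rightarrow> 'm" where
  "isbell_unit V B \<phi> =
     (let Y = fob (yoneda V B); Y' = fob (yoneda V (vop V B));
          L\<phi> = fob (isbell_L V B) \<phi>; RL\<phi> = fob (isbell_R V B) L\<phi>;
          u = (\<lambda>b. nat_lift V B (vself V) L\<phi> (Y' b) (fob \<phi> b)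
                 (\<lambda>c. curry_arr V (fob \<phi> b) (fob L\<phi> c) (Hom B b c)
                    (evl V (fob \<phi> b) (Hom B b c) \<cdot>\<^bsub>V\<^esub>
                     (nat_proj V (vop V B) (vself V) \<phi> (Y c) b \<otimes>\<^bsub>V\<^esub> idn V (fob \<phi> b)) \<cdot>\<^bsub>V\<^esub>
                     brd V (fob \<phi> b) (fob L\<phi> c))))
      in nat_lift V (vop V B) (vself V) \<phi> RL\<phi> (unt V)
           (\<lambda>b. name_arr V (fob \<phi> b) (fob RL\<phi> b) (u b)))"

text \<open>
  The counit at \<open>\<psi>\<close> is a morphism \<open>L (R \<psi>) \<rightarrow> \<psi>\<close> of \<open>[B, V]\<^sup>o\<^sup>p\<close>, i.e. \<open>\<psi> \<rightarrow> L (R \<psi>)\<close> in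
  \<open>[B, V]\<close>; it is the evaluation above with \<open>B\<^sup>o\<^sup>p\<close> in place of \<open>B\<close>.
\<close>

definition isbell_counit :: "('o, 'm) smc \<Rightarrow> ('a, 'o, 'm) vcat \<Rightarrow> ('a, 'o, 'm) vfun \<Rightarrow> 'm" where
  "isbell_counit V B = isbell_unit V (vop V B)"

end

theory Submission
  imports Defs
begin

text \<open>
  Equations in \<open>V\<close> are verified on generalized elements, so that enriched category theory can be
  done as if \<open>V\<close> were the category of sets.

  Let \<open>\<phi>\<close> be small projective. By the Yoneda lemma \<open>\<phi> = \<phi> * Y\<close>, and \<open>[B\<^sup>o\<^sup>p, V](\<phi>, -)\<close> preserves this
  colimit; as \<open>[B\<^sup>o\<^sup>p, V](\<phi>, Y b) = L \<phi> b\<close>, this exhibits \<open>[B\<^sup>o\<^sup>p, V](\<phi>, \<phi>)\<close> as the coend of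
  \<open>\<phi> b \<otimes> L \<phi> b\<close>. The identity of \<open>\<phi>\<close> thus becomes an element of this coend, in which one can integrate
  any extranatural family out of \<open>\<phi> b \<otimes> L \<phi> b\<close>. Integrating \<open>p \<otimes> q \<mapsto> \<phi>(s q) p\<close> for \<open>s : L \<phi> \<rightarrow> B(b, -)\<close>
  yields the inverse of the unit \<open>\<phi> b \<rightarrow> R (L \<phi>) b\<close>. Similarly \<open>[B, V](L \<phi>, G)\<close> is the coend of
  \<open>\<phi> b \<otimes> G b\<close>, so that \<open>[B, V](L \<phi>, -)\<close> is left adjoint to \<open>v \<mapsto> [\<phi>-, v]\<close> and preserves all
  colimits; that is, \<open>L \<phi>\<close> is small projective. The statements about \<open>R\<close> and the counit are those
  about \<open>L\<close> and the unit for \<open>B\<^sup>o\<^sup>p\<close>.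
\<close>


section \<open>Coherence\<close>

text \<open>The model is a finitely generated projective module, whose identity is a finite sum of
  rank-one endomorphisms given by a dual basis. For general \<open>V\<close> there is no such sum,
  so the identity of \<phi> is never decomposed. Instead a map out of
  \<open>NT (vop V B) \<phi> \<phi>\<close> can be prescribed on rank-one endomorphisms and is
  determined by its values there, and evaluating it at the identity does the work of the sum. Both
  inverses that are needed, of the unit and of the transposition for L \<phi>, arise in this way,
  and both equations for each of them compare two maps on rank-one endomorphisms before the identity
  is inserted. Two circumstances shape the rest. Hom objects of functor categories are chosen ends,
  so their existence must be known, while the objects of a small category need not form a small set;
  a limit over representatives of isomorphism classes settles this. And duality is used literally:
  \<open>vop\<close> is involutive up to equality, so results for the opposite of \<open>B\<close>
  can be rewritten into results for \<open>B\<close>.\<close>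

context category
begin

lemma hom_iff [simp]: "f \<in> hom C a b \<longleftrightarrow> f \<in> arr C \<and> src C f = a \<and> trg C f = b"
  by (simp add: hom_def)

lemmas src_obj [simp] trg_obj [simp]

lemma idn_arr [simp]:
  assumes "a \<in> obj C"
  shows "idn C a \<in> arr C" "src C (idn C a) = a" "trg C (idn C a) = a"
  using idn_hom[OF assms] by auto

lemma cmp_arr [simp]:
  assumes "f \<in> arr C" "g \<in> arr C" "trg C f = src C g"
  shows "g \<cdot> f \<in> arr C" "src C (g \<cdot> f) = src C f" "trg C (g \<cdot> f) = trg C g"
  using cmp_hom[of f "src C f" "trg C f" g "trg C g"] assms by auto

lemma cmp_idn_arr [simp]: "\<lbrakk>f \<in> arr C; src C f = a\<rbrakk> \<Longrightarrow> f \<cdot> idn C a = f"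
  using cmp_idn[of f] by auto

lemma idn_cmp_arr [simp]: "\<lbrakk>f \<in> arr C; trg C f = a\<rbrakk> \<Longrightarrow> idn C a \<cdot> f = f"
  using idn_cmp[of f] by auto

lemma cmp_assoc_arr [simp]:
  "\<lbrakk>f \<in> arr C; g \<in> arr C; h \<in> arr C; trg C f = src C g; trg C g = src C h\<rbrakk>
    \<Longrightarrow> (h \<cdot> g) \<cdot> f = h \<cdot> (g \<cdot> f)"
  using cmp_assoc[of f "src C f" "trg C f" g "trg C g" h "trg C h"] by auto

text \<open>With \<open>cmp_assoc_arr\<close> as a rewrite rule composites are nested to the right,
  so the left side of an equation \<open>p \<cdot> q = r\<close> is hidden as soon as another factor
  follows it. This is the form that still matches.\<close>

lemma cmp_eq_extend:
  assumes "p \<cdot> q = r" "p \<in> arr C" "q \<in> arr C" "k \<in> arr C" "trg C q = src C p" "trg C k = src C q"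
  shows "p \<cdot> (q \<cdot> k) = r \<cdot> k"
  using assms cmp_assoc_arr by metis

lemma inverse_unique:
  assumes "f \<in> arr C" "g \<in> hom C (trg C f) (src C f)" "h \<in> hom C (trg C f) (src C f)"
    and "g \<cdot> f = idn C (src C f)" "f \<cdot> h = idn C (trg C f)"
  shows "g = h"
proof -
  have "g = g \<cdot> (f \<cdot> h)" using assms by simp
  also have "\<dots> = (g \<cdot> f) \<cdot> h" using assms(1-3) by simp
  also have "\<dots> = h" using assms by simp
  finally show ?thesis .
qed

lemma inv_arr_props:
  assumes "iso_arr C f"
  shows "inv_arr C f \<in> hom C (trg C f) (src C f) \<and>
    inv_arr C f \<cdot> f = idn C (src C f) \<and> f \<cdot> inv_arr C f = idn C (trg C f)"
proof -
  obtain g where g: "g \<in> hom C (trg C f) (src C f)"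
      "g \<cdot> f = idn C (src C f)" "f \<cdot> g = idn C (trg C f)"
    using assms unfolding iso_arr_def by blast
  have f: "f \<in> arr C" using assms by (simp add: iso_arr_def)
  show ?thesis unfolding inv_arr_def
    by (rule theI[where a = g]) (use g f inverse_unique in blast)+
qed

lemma inv_arr_simps [simp]:
  assumes "iso_arr C f"
  shows "inv_arr C f \<in> arr C" "src C (inv_arr C f) = trg C f" "trg C (inv_arr C f) = src C f"
    "inv_arr C f \<cdot> f = idn C (src C f)" "f \<cdot> inv_arr C f = idn C (trg C f)"
  using inv_arr_props[OF assms] by auto

lemma iso_arr_arr: "iso_arr C f \<Longrightarrow> f \<in> arr C"
  by (simp add: iso_arr_def)

lemma iso_arrI:
  assumes "f \<in> arr C" "g \<in> arr C" "src C g = trg C f" "trg C g = src C f"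
    "g \<cdot> f = idn C (src C f)" "f \<cdot> g = idn C (trg C f)"
  shows "iso_arr C f"
  using assms unfolding iso_arr_def by auto

lemma iso_cancel_right:
  assumes "iso_arr C e" "f \<in> arr C" "g \<in> arr C" "src C f = trg C e" "src C g = trg C e"
    and "f \<cdot> e = g \<cdot> e"
  shows "f = g"
proof -
  note e = iso_arr_arr[OF assms(1)]
  have "(f \<cdot> e) \<cdot> inv_arr C e = (g \<cdot> e) \<cdot> inv_arr C e" using assms by simp
  then show ?thesis using assms(1-5) e by simp
qed

lemma iso_cancel_left:
  assumes "iso_arr C e" "f \<in> arr C" "g \<in> arr C" "trg C f = src C e" "trg C g = src C e"
    and "e \<cdot> f = e \<cdot> g"
  shows "f = g"
proof -
  note e = iso_arr_arr[OF assms(1)]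
  have "inv_arr C e \<cdot> (e \<cdot> h) = h" if "h \<in> arr C" "trg C h = src C e" for h
    using cmp_eq_extend[OF inv_arr_simps(4)[OF assms(1)], of h] that assms(1) e by simp
  then show ?thesis using assms by metis
qed

lemma iso_inv_arr [simp]: "iso_arr C f \<Longrightarrow> iso_arr C (inv_arr C f)"
  using iso_arr_arr by (intro iso_arrI[where g = f]) auto

lemma iso_idn [simp]: "a \<in> obj C \<Longrightarrow> iso_arr C (idn C a)"
  by (rule iso_arrI[where g = "idn C a"]) auto

lemma iso_cmp [simp]:
  assumes "iso_arr C f" "iso_arr C g" "trg C f = src C g"
  shows "iso_arr C (g \<cdot> f)"
proof -
  note fg = iso_arr_arr[OF assms(1)] iso_arr_arr[OF assms(2)]
  have 1: "inv_arr C g \<cdot> (g \<cdot> f) = f"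
    using assms fg cmp_eq_extend[OF inv_arr_simps(4)[OF assms(2)], of f] by simp
  have 2: "f \<cdot> (inv_arr C f \<cdot> inv_arr C g) = inv_arr C g"
    using assms fg cmp_eq_extend[OF inv_arr_simps(5)[OF assms(1)], of "inv_arr C g"] by simp
  show ?thesis
    by (rule iso_arrI[where g = "inv_arr C f \<cdot> inv_arr C g"]) (use assms fg 1 2 in simp_all)
qed

end

section \<open>The constraints of a symmetric monoidal category, their inverses and unit
  coherence\<close>

context sym_mon_closed
begin

abbreviation "asci a b c \<equiv> inv_arr V (asc V a b c)"
abbreviation "luni a \<equiv> inv_arr V (lun V a)"
abbreviation "runi a \<equiv> inv_arr V (run V a)"

lemma tar_arr [simp]:
  assumes "f \<in> arr V" "g \<in> arr V"
  shows "f \<otimes> g \<in> arr V" "src V (f \<otimes> g) = src V f \<odot> src V g"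
    "trg V (f \<otimes> g) = trg V f \<odot> trg V g"
  using tar_hom[of f "src V f" "trg V f" g "src V g" "trg V g"] assms by auto

lemmas unt_obj [simp] tob_obj [simp] ihom_obj [simp] tar_idn [simp]

lemma asc_arr [simp]:
  assumes "a \<in> obj V" "b \<in> obj V" "c \<in> obj V"
  shows "asc V a b c \<in> arr V" "src V (asc V a b c) = (a \<odot> b) \<odot> c"
    "trg V (asc V a b c) = a \<odot> (b \<odot> c)" "iso_arr V (asc V a b c)"
  using asc_hom[OF assms] by auto

lemma lun_arr [simp]:
  assumes "a \<in> obj V"
  shows "lun V a \<in> arr V" "src V (lun V a) = unt V \<odot> a" "trg V (lun V a) = a" "iso_arr V (lun V a)"
  using lun_hom[OF assms] by auto

lemma run_arr [simp]:
  assumes "a \<in> obj V"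
  shows "run V a \<in> arr V" "src V (run V a) = a \<odot> unt V" "trg V (run V a) = a" "iso_arr V (run V a)"
  using run_hom[OF assms] by auto

lemma brd_arr [simp]:
  assumes "a \<in> obj V" "b \<in> obj V"
  shows "brd V a b \<in> arr V" "src V (brd V a b) = a \<odot> b" "trg V (brd V a b) = b \<odot> a"
    "iso_arr V (brd V a b)"
  using brd_hom[OF assms] symmetry assms brd_hom[OF assms(2,1)]
  by (auto intro!: iso_arrI[where g = "brd V b a"])

lemma evl_arr [simp]:
  assumes "a \<in> obj V" "b \<in> obj V"
  shows "evl V a b \<in> arr V" "src V (evl V a b) = ihom V a b \<odot> a" "trg V (evl V a b) = b"
  using evl_hom[OF assms] by auto

lemma interchange [simp]:
  assumes "f \<in> arr V" "f' \<in> arr V" "g \<in> arr V" "g' \<in> arr V" "trg V f = src V f'" "trg V g = src V g'"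
  shows "(f' \<otimes> g') \<cdot> (f \<otimes> g) = (f' \<cdot> f) \<otimes> (g' \<cdot> g)"
  using tar_cmp[of f "src V f" "trg V f" f' "trg V f'" g "src V g" "trg V g" g' "trg V g'"] assms
  by simp

lemma interchange_extend [simp]:
  assumes "f \<in> arr V" "f' \<in> arr V" "g \<in> arr V" "g' \<in> arr V" "trg V f = src V f'" "trg V g = src V g'"
    "k \<in> arr V" "trg V k = src V f \<odot> src V g"
  shows "(f' \<otimes> g') \<cdot> ((f \<otimes> g) \<cdot> k) = ((f' \<cdot> f) \<otimes> (g' \<cdot> g)) \<cdot> k"
  using cmp_eq_extend[OF interchange, of f f' g g' k] assms by simp

lemma iso_tar [simp]:
  assumes "iso_arr V f" "iso_arr V g"
  shows "iso_arr V (f \<otimes> g)"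
  using assms iso_arr_arr[OF assms(1)] iso_arr_arr[OF assms(2)]
  by (intro iso_arrI[where g = "inv_arr V f \<otimes> inv_arr V g"]) simp_all

lemma asc_nat_arr:
  "\<lbrakk>f \<in> arr V; g \<in> arr V; h \<in> arr V; trg V f = a; trg V g = b; trg V h = c\<rbrakk>
   \<Longrightarrow> asc V a b c \<cdot> ((f \<otimes> g) \<otimes> h) = (f \<otimes> (g \<otimes> h)) \<cdot> asc V (src V f) (src V g) (src V h)"
  using asc_nat[of f "src V f" "trg V f" g "src V g" "trg V g" h "src V h" "trg V h"] by auto

lemma brd_nat_arr:
  "\<lbrakk>f \<in> arr V; g \<in> arr V; trg V f = a; trg V g = b\<rbrakk>
   \<Longrightarrow> brd V a b \<cdot> (f \<otimes> g) = (g \<otimes> f) \<cdot> brd V (src V f) (src V g)"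
  using brd_nat[of f "src V f" "trg V f" g "src V g" "trg V g"] by auto

lemma lun_nat_arr:
  "\<lbrakk>f \<in> arr V; trg V f = b\<rbrakk> \<Longrightarrow> lun V b \<cdot> (idn V (unt V) \<otimes> f) = f \<cdot> lun V (src V f)"
  using lun_nat[of f "src V f" "trg V f"] by auto

lemma run_nat_arr:
  "\<lbrakk>f \<in> arr V; trg V f = b\<rbrakk> \<Longrightarrow> run V b \<cdot> (f \<otimes> idn V (unt V)) = f \<cdot> run V (src V f)"
  using run_nat[of f "src V f" "trg V f"] by auto

text \<open>A commuting square with two parallel invertible sides, turned upside down; naturality of
  the inverse constraints follows from it.\<close>

lemma inv_square:
  assumes "iso_arr V i" "iso_arr V j" "f \<in> arr V" "g \<in> arr V"
    "src V g = src V i" "trg V g = src V j" "src V f = trg V i" "trg V f = trg V j"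
    and eq: "j \<cdot> g = f \<cdot> i"
  shows "inv_arr V j \<cdot> f = g \<cdot> inv_arr V i"
proof (rule iso_cancel_left[OF assms(2)])
  note ij = iso_arr_arr[OF assms(1)] iso_arr_arr[OF assms(2)]
  have "j \<cdot> (g \<cdot> inv_arr V i) = (f \<cdot> i) \<cdot> inv_arr V i" using assms(1-8) ij eq[symmetric] by simp
  also have "\<dots> = f" using assms(1-8) ij by simp
  moreover have "j \<cdot> (inv_arr V j \<cdot> f) = f"
    using cmp_eq_extend[OF inv_arr_simps(5)[OF assms(2)], of f] assms(1-8) ij by simp
  ultimately show "j \<cdot> (inv_arr V j \<cdot> f) = j \<cdot> (g \<cdot> inv_arr V i)" by simp
qed (use assms iso_arr_arr in auto)

lemma asci_nat:
  assumes "f \<in> arr V" "g \<in> arr V" "h \<in> arr V" "trg V f = a" "trg V g = b" "trg V h = c"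
  shows "asci a b c \<cdot> (f \<otimes> (g \<otimes> h)) = ((f \<otimes> g) \<otimes> h) \<cdot> asci (src V f) (src V g) (src V h)"
  using assms by (intro inv_square) (auto simp: asc_nat_arr)

lemma luni_nat:
  "\<lbrakk>f \<in> arr V; trg V f = b\<rbrakk> \<Longrightarrow> luni b \<cdot> f = (idn V (unt V) \<otimes> f) \<cdot> luni (src V f)"
  by (intro inv_square) (auto simp: lun_nat_arr)

lemma runi_nat:
  "\<lbrakk>f \<in> arr V; trg V f = b\<rbrakk> \<Longrightarrow> runi b \<cdot> f = (f \<otimes> idn V (unt V)) \<cdot> runi (src V f)"
  by (intro inv_square) (auto simp: run_nat_arr)

text \<open>Naturality of \<open>lun\<close> makes tensoring with the unit object isomorphic to the
  identity functor, hence faithful. This gives room to apply the pentagon in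
  \<open>lun_tob\<close>.\<close>

lemma idn_tar_cancel:
  assumes "f \<in> arr V" "g \<in> arr V" "src V f = src V g" "trg V f = trg V g"
    "idn V (unt V) \<otimes> f = idn V (unt V) \<otimes> g"
  shows "f = g"
  by (rule iso_cancel_right[of "lun V (src V f)"])
    (use assms lun_nat_arr[of f] lun_nat_arr[of g] in auto)

lemma tar_idn_cancel:
  assumes "f \<in> arr V" "g \<in> arr V" "src V f = src V g" "trg V f = trg V g"
    "f \<otimes> idn V (unt V) = g \<otimes> idn V (unt V)"
  shows "f = g"
  by (rule iso_cancel_right[of "run V (src V f)"])
    (use assms run_nat_arr[of f] run_nat_arr[of g] in auto)

text \<open>Kelly's argument. The triangle axiom has the unit object in the middle; after tensoring
  with the unit on the left, one pentagon and two triangles give the law with the unit in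
  front.\<close>

lemma lun_tob:
  assumes [simp]: "a \<in> obj V" "b \<in> obj V"
  shows "lun V (a \<odot> b) \<cdot> asc V (unt V) a b = lun V a \<otimes> idn V b"
proof (rule idn_tar_cancel)
  let ?I = "unt V"
  let ?e = "asc V ?I (?I \<odot> a) b \<cdot> (asc V ?I ?I a \<otimes> idn V b)"
  have "(idn V ?I \<otimes> (lun V (a \<odot> b) \<cdot> asc V ?I a b)) \<cdot> ?e
      = (idn V ?I \<otimes> lun V (a \<odot> b)) \<cdot> ((idn V ?I \<otimes> asc V ?I a b) \<cdot> ?e)" by simp
  also have "\<dots> = (idn V ?I \<otimes> lun V (a \<odot> b)) \<cdot> asc V ?I ?I (a \<odot> b) \<cdot> asc V (?I \<odot> ?I) a b"
    by (subst pentagon) auto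
  also have "\<dots> = ((idn V ?I \<otimes> lun V (a \<odot> b)) \<cdot> asc V ?I ?I (a \<odot> b)) \<cdot> asc V (?I \<odot> ?I) a b"
    by (simp del: tar_idn)
  also have "\<dots> = (run V ?I \<otimes> idn V (a \<odot> b)) \<cdot> asc V (?I \<odot> ?I) a b"
    by (subst triangle) auto
  also have "\<dots> = asc V ?I a b \<cdot> ((run V ?I \<otimes> idn V a) \<otimes> idn V b)"
    by (subst asc_nat_arr) auto
  also have "\<dots> = asc V ?I a b \<cdot> (((idn V ?I \<otimes> lun V a) \<cdot> asc V ?I ?I a) \<otimes> idn V b)"
    by (subst triangle) auto
  also have "\<dots> = (asc V ?I a b \<cdot> ((idn V ?I \<otimes> lun V a) \<otimes> idn V b)) \<cdot> (asc V ?I ?I a \<otimes> idn V b)"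
    by simp
  also have "\<dots> = (idn V ?I \<otimes> (lun V a \<otimes> idn V b)) \<cdot> ?e"
    by (subst asc_nat_arr) auto
  finally show "idn V ?I \<otimes> (lun V (a \<odot> b) \<cdot> asc V ?I a b) = idn V ?I \<otimes> (lun V a \<otimes> idn V b)"
    by - (rule iso_cancel_right[of ?e], simp_all)
qed auto

text \<open>Mirror image of \<open>lun_tob\<close>: tensor with the unit on the right and apply the
  pentagon to \<open>a\<close>, \<open>b\<close> and two units.\<close>

lemma run_tob:
  assumes [simp]: "a \<in> obj V" "b \<in> obj V"
  shows "(idn V a \<otimes> run V b) \<cdot> asc V a b (unt V) = run V (a \<odot> b)"
proof (rule tar_idn_cancel)
  let ?I = "unt V"
  have "asc V a b ?I \<cdot> (((idn V a \<otimes> run V b) \<cdot> asc V a b ?I) \<otimes> idn V ?I)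
    = (asc V a b ?I \<cdot> ((idn V a \<otimes> run V b) \<otimes> idn V ?I)) \<cdot> (asc V a b ?I \<otimes> idn V ?I)" by simp
  also have "\<dots> = (idn V a \<otimes> (run V b \<otimes> idn V ?I)) \<cdot> asc V a (b \<odot> ?I) ?I \<cdot> (asc V a b ?I \<otimes> idn V ?I)"
    by (subst asc_nat_arr) auto
  also have "\<dots> = (idn V a \<otimes> ((idn V b \<otimes> lun V ?I) \<cdot> asc V b ?I ?I)) \<cdot> asc V a (b \<odot> ?I) ?I \<cdot> (asc V a b ?I \<otimes> idn V ?I)"
    by (subst triangle) auto
  also have "\<dots> = (idn V a \<otimes> (idn V b \<otimes> lun V ?I)) \<cdot> ((idn V a \<otimes> asc V b ?I ?I) \<cdot> asc V a (b \<odot> ?I) ?I \<cdot> (asc V a b ?I \<otimes> idn V ?I))"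
    by simp
  also have "\<dots> = (idn V a \<otimes> (idn V b \<otimes> lun V ?I)) \<cdot> asc V a b (?I \<odot> ?I) \<cdot> asc V (a \<odot> b) ?I ?I"
    by (subst pentagon) auto
  also have "\<dots> = ((idn V a \<otimes> (idn V b \<otimes> lun V ?I)) \<cdot> asc V a b (?I \<odot> ?I)) \<cdot> asc V (a \<odot> b) ?I ?I"
    by (simp del: tar_idn)
  also have "\<dots> = (asc V a b ?I \<cdot> ((idn V a \<otimes> idn V b) \<otimes> lun V ?I)) \<cdot> asc V (a \<odot> b) ?I ?I"
    by (subst asc_nat_arr) auto
  also have "\<dots> = asc V a b ?I \<cdot> ((idn V (a \<odot> b) \<otimes> lun V ?I) \<cdot> asc V (a \<odot> b) ?I ?I)"
    by simp
  also have "\<dots> = asc V a b ?I \<cdot> (run V (a \<odot> b) \<otimes> idn V ?I)"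
    by (subst triangle) auto
  finally show "((idn V a \<otimes> run V b) \<cdot> asc V a b ?I) \<otimes> idn V ?I = run V (a \<odot> b) \<otimes> idn V ?I"
    by - (rule iso_cancel_left[of "asc V a b ?I"], simp_all)
qed auto

end

section \<open>Merging contexts, and the coherence of the isomorphisms that separate them
  again\<close>

fun mrg :: "(nat \<times> 'o) list \<Rightarrow> (nat \<times> 'o) list \<Rightarrow> (nat \<times> 'o) list" where
  "mrg [] l = l"
| "mrg (x # xs) [] = x # xs"
| "mrg (x # xs) (y # ys) =
     (if fst x < fst y then x # mrg xs (y # ys) else y # mrg (x # xs) ys)"

lemma mrg_Nil [simp]: "mrg l [] = l"
  by (cases l) auto

lemma set_mrg [simp]: "set (mrg l k) = set l \<union> set k"
  by (induction l k rule: mrg.induct) auto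

lemma sorted_mrg:
  "\<lbrakk>sorted_wrt (<) (map fst l); sorted_wrt (<) (map fst k); fst ` set l \<inter> fst ` set k = {}\<rbrakk>
   \<Longrightarrow> sorted_wrt (<) (map fst (mrg l k))"
proof (induction l k rule: mrg.induct)
  case (3 x xs y ys)
  show ?case
  proof (cases "fst x < fst y")
    case True
    then show ?thesis using 3 by (auto intro: less_trans)
  next
    case False
    then have "fst y < fst x" using 3(5) by auto
    then show ?thesis using 3 False by (auto intro: less_trans)
  qed
qed auto

text \<open>Strict sorting makes a context recoverable from its set of labelled objects, so a set is
  enough to tell when two elements live in the same context.\<close>

lemma sorted_set_unique:
  assumes "sorted_wrt (<) (map fst l)" "sorted_wrt (<) (map fst k)" "set l = set (k :: (nat \<times> 'o) list)"
  shows "l = k"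
proof (rule map_sorted_distinct_set_unique[of fst])
  have "distinct (map fst k)" using assms(2) strict_sorted_iff by blast
  then show "inj_on fst (set l \<union> set k)"
    using assms(3) by (simp add: distinct_map)
qed (use assms strict_sorted_iff in blast)+

context sym_mon_closed
begin

definition ctx :: "(nat \<times> 'o) list \<Rightarrow> bool" where
  "ctx l \<longleftrightarrow> sorted_wrt (<) (map fst l) \<and> snd ` set l \<subseteq> obj V"

primrec tens :: "(nat \<times> 'o) list \<Rightarrow> 'o" where
  "tens [] = unt V"
| "tens (x # xs) = snd x \<odot> tens xs"

lemma tens_obj [simp]: "snd ` set l \<subseteq> obj V \<Longrightarrow> tens l \<in> obj V"
  by (induction l) auto

text \<open>Carries the head \<open>y\<close> past the whole block \<open>p\<close>: the elementary
  move when the next entry of a merged list comes from the second list.\<close>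

definition exch :: "'o \<Rightarrow> 'o \<Rightarrow> 'o \<Rightarrow> 'm" where
  "exch p y q = asc V p y q \<cdot> (brd V y p \<otimes> idn V q) \<cdot> asci y p q"

text \<open>Follows the recursion of \<open>mrg\<close> backwards and separates the merged tensor
  product into its two blocks. \<open>spl_comm\<close> and \<open>spl_assoc\<close> are the part of
  the coherence theorem that the calculus of elements rests on.\<close>

fun spl :: "(nat \<times> 'o) list \<Rightarrow> (nat \<times> 'o) list \<Rightarrow> 'm" where
  "spl [] l = luni (tens l)"
| "spl (x # xs) [] = runi (tens (x # xs))"
| "spl (x # xs) (y # ys) =
     (if fst x < fst y
      then asci (snd x) (tens xs) (tens (y # ys)) \<cdot> (idn V (snd x) \<otimes> spl xs (y # ys))
      else exch (tens (x # xs)) (snd y) (tens ys) \<cdot> (idn V (snd y) \<otimes> spl (x # xs) ys))"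

lemma exch_arr [simp]:
  assumes "p \<in> obj V" "y \<in> obj V" "q \<in> obj V"
  shows "exch p y q \<in> arr V" "src V (exch p y q) = y \<odot> (p \<odot> q)"
    "trg V (exch p y q) = p \<odot> (y \<odot> q)" "iso_arr V (exch p y q)"
  using assms unfolding exch_def by (simp_all add: iso_cmp)

lemma spl_arr [simp]:
  assumes "snd ` set l \<subseteq> obj V" "snd ` set k \<subseteq> obj V"
  shows "spl l k \<in> arr V" "src V (spl l k) = tens (mrg l k)" "trg V (spl l k) = tens l \<odot> tens k"
    "iso_arr V (spl l k)"
proof -
  have "spl l k \<in> arr V \<and> src V (spl l k) = tens (mrg l k) \<and> trg V (spl l k) = tens l \<odot> tens k
    \<and> iso_arr V (spl l k)"
    using assms by (induction l k rule: mrg.induct) auto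
  then show "spl l k \<in> arr V" "src V (spl l k) = tens (mrg l k)" "trg V (spl l k) = tens l \<odot> tens k"
    "iso_arr V (spl l k)" by auto
qed

lemma symmetry_extend [simp]:
  assumes "a \<in> obj V" "b \<in> obj V" "k \<in> arr V" "trg V k = a \<odot> b"
  shows "brd V b a \<cdot> (brd V a b \<cdot> k) = k"
  using cmp_eq_extend[OF symmetry, of a b k] assms by simp

lemmas symmetry [simp]

lemma inv_extend [simp]:
  assumes "iso_arr V e" "k \<in> arr V"
  shows "trg V k = src V e \<Longrightarrow> inv_arr V e \<cdot> (e \<cdot> k) = k"
    "trg V k = trg V e \<Longrightarrow> e \<cdot> (inv_arr V e \<cdot> k) = k"
  using cmp_eq_extend[OF inv_arr_simps(4)[OF assms(1)], of k]
    cmp_eq_extend[OF inv_arr_simps(5)[OF assms(1)], of k] assms iso_arr_arr[OF assms(1)] by auto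

lemma brd_unt_right: "a \<in> obj V \<Longrightarrow> brd V a (unt V) = luni a \<cdot> run V a"
  using brd_unt[of a] inv_extend(1)[of "lun V a" "brd V a (unt V)"] by simp

lemma brd_unt_left:
  assumes [simp]: "a \<in> obj V"
  shows "brd V (unt V) a = runi a \<cdot> lun V a"
proof (rule iso_cancel_right[of "brd V a (unt V)"])
  show "brd V (unt V) a \<cdot> brd V a (unt V) = (runi a \<cdot> lun V a) \<cdot> brd V a (unt V)"
    using brd_unt[of a] by simp
qed simp_all

lemma hexagon_asc:
  assumes [simp]: "a \<in> obj V" "b \<in> obj V" "c \<in> obj V"
  shows "brd V a (b \<odot> c) \<cdot> asc V a b c =
    asci b c a \<cdot> (idn V b \<otimes> brd V a c) \<cdot> asc V b a c \<cdot> (brd V a b \<otimes> idn V c)"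
  using arg_cong[OF hexagon[OF assms], of "\<lambda>f. asci b c a \<cdot> f"] by simp

text \<open>One of the two hexagons: once \<open>y\<close> has been carried past \<open>p\<close>,
  braiding \<open>p\<close> with \<open>y \<odot> q\<close> only has to exchange \<open>p\<close>
  and \<open>q\<close>.\<close>

lemma brd_exch:
  assumes [simp]: "p \<in> obj V" "y \<in> obj V" "q \<in> obj V"
  shows "brd V p (y \<odot> q) \<cdot> exch p y q = asci y q p \<cdot> (idn V y \<otimes> brd V p q)"
proof -
  have "brd V p (y \<odot> q) \<cdot> exch p y q =
    (brd V p (y \<odot> q) \<cdot> asc V p y q) \<cdot> (brd V y p \<otimes> idn V q) \<cdot> asci y p q"
    by (simp add: exch_def)
  also have "\<dots> = asci y q p \<cdot> (idn V y \<otimes> brd V p q)"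
    unfolding hexagon_asc[OF assms] by simp
  finally show ?thesis .
qed

text \<open>The other hexagon, deduced from \<open>brd_exch\<close> by symmetry of the
  braiding.\<close>

lemma brd_asci:
  assumes [simp]: "x \<in> obj V" "p \<in> obj V" "q \<in> obj V"
  shows "brd V (x \<odot> p) q \<cdot> asci x p q = exch q x p \<cdot> (idn V x \<otimes> brd V p q)"
proof (rule iso_cancel_right[of "idn V x \<otimes> brd V q p"])
  have "exch q x p = brd V (x \<odot> p) q \<cdot> (brd V q (x \<odot> p) \<cdot> exch q x p)" by simp
  also have "\<dots> = brd V (x \<odot> p) q \<cdot> asci x p q \<cdot> (idn V x \<otimes> brd V q p)"
    by (subst brd_exch) simp_all
  finally show "(brd V (x \<odot> p) q \<cdot> asci x p q) \<cdot> (idn V x \<otimes> brd V q p)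
    = (exch q x p \<cdot> (idn V x \<otimes> brd V p q)) \<cdot> (idn V x \<otimes> brd V q p)"
    by simp
qed simp_all

text \<open>Induction along the merge: \<open>brd_asci\<close> moves the braiding past an entry of
  the first list, \<open>brd_exch\<close> past one of the second. Disjoint labels ensure that
  exchanging the lists exchanges the two branches of \<open>mrg\<close>.\<close>

lemma spl_comm:
  assumes "snd ` set l \<subseteq> obj V" "snd ` set k \<subseteq> obj V" "fst ` set l \<inter> fst ` set k = {}"
  shows "brd V (tens l) (tens k) \<cdot> spl l k = spl k l"
  using assms
proof (induction l k rule: mrg.induct)
  case (1 l)
  then show ?case by (cases l) (simp_all add: brd_unt_left lun_unt)
next
  case (2 x xs)
  then show ?case by (simp add: brd_unt_right)
next
  case (3 x xs y ys)
  show ?case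
  proof (cases "fst x < fst y")
    case True
    let ?x = "snd x" and ?p = "tens xs" and ?q = "tens (y # ys)"
    have IH: "brd V ?p ?q \<cdot> spl xs (y # ys) = spl (y # ys) xs" using 3 True by simp
    have [simp]: "?x \<in> obj V" "?p \<in> obj V" "?q \<in> obj V" "snd y \<in> obj V" "tens ys \<in> obj V"
      "snd ` set xs \<subseteq> obj V" "snd ` set ys \<subseteq> obj V" using 3 by auto
    have "brd V (tens (x # xs)) ?q \<cdot> spl (x # xs) (y # ys)
      = (brd V (?x \<odot> ?p) ?q \<cdot> asci ?x ?p ?q) \<cdot> (idn V ?x \<otimes> spl xs (y # ys))" using True by simp
    also have "\<dots> = exch ?q ?x ?p \<cdot> (idn V ?x \<otimes> (brd V ?p ?q \<cdot> spl xs (y # ys)))"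
      by (subst brd_asci) simp_all
    also have "\<dots> = spl (y # ys) (x # xs)" unfolding IH using True by simp
    finally show ?thesis .
  next
    case False
    then have xy: "fst y < fst x" using 3 by auto
    let ?y = "snd y" and ?q = "tens ys" and ?p = "tens (x # xs)"
    have IH: "brd V ?p ?q \<cdot> spl (x # xs) ys = spl ys (x # xs)" using 3 False by simp
    have [simp]: "?y \<in> obj V" "?p \<in> obj V" "?q \<in> obj V" "snd x \<in> obj V" "tens xs \<in> obj V"
      "snd ` set xs \<subseteq> obj V" "snd ` set ys \<subseteq> obj V" using 3 by auto
    have "brd V ?p (tens (y # ys)) \<cdot> spl (x # xs) (y # ys)
      = (brd V ?p (?y \<odot> ?q) \<cdot> exch ?p ?y ?q) \<cdot> (idn V ?y \<otimes> spl (x # xs) ys)" using xy by simp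
    also have "\<dots> = asci ?y ?q ?p \<cdot> (idn V ?y \<otimes> (brd V ?p ?q \<cdot> spl (x # xs) ys))"
      by (subst brd_exch) simp_all
    also have "\<dots> = spl (y # ys) (x # xs)" unfolding IH using xy by simp
    finally show ?thesis .
  qed
qed

lemma pentagon_asci:
  assumes [simp]: "a \<in> obj V" "b \<in> obj V" "c \<in> obj V" "d \<in> obj V"
  shows "asci a b (c \<odot> d) \<cdot> (idn V a \<otimes> asc V b c d) =
    asc V (a \<odot> b) c d \<cdot> (asci a b c \<otimes> idn V d) \<cdot> asci a (b \<odot> c) d"
proof (rule iso_cancel_left[of "asc V a b (c \<odot> d)"])
  have "asc V a b (c \<odot> d) \<cdot> (asc V (a \<odot> b) c d \<cdot> (asci a b c \<otimes> idn V d) \<cdot> asci a (b \<odot> c) d)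
    = (asc V a b (c \<odot> d) \<cdot> asc V (a \<odot> b) c d) \<cdot> (asci a b c \<otimes> idn V d) \<cdot> asci a (b \<odot> c) d"
    by simp
  also have "\<dots> = idn V a \<otimes> asc V b c d" unfolding pentagon[OF assms] by simp
  finally show "asc V a b (c \<odot> d) \<cdot> (asci a b (c \<odot> d) \<cdot> (idn V a \<otimes> asc V b c d)) =
    asc V a b (c \<odot> d) \<cdot> (asc V (a \<odot> b) c d \<cdot> (asci a b c \<otimes> idn V d) \<cdot> asci a (b \<odot> c) d)" by simp
qed simp_all

lemma pentagon_left:
  assumes [simp]: "a \<in> obj V" "b \<in> obj V" "c \<in> obj V" "d \<in> obj V"
  shows "(idn V a \<otimes> asci b c d) \<cdot> asc V a b (c \<odot> d) \<cdot> asc V (a \<odot> b) c d =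
    asc V a (b \<odot> c) d \<cdot> (asc V a b c \<otimes> idn V d)"
  by (subst pentagon) simp_all

text \<open>The case of associativity in which the moved entry heads the middle block: two pentagons
  around a naturality square.\<close>

lemma exch_asc_middle:
  assumes [simp]: "p \<in> obj V" "y \<in> obj V" "q \<in> obj V" "r \<in> obj V"
  shows "(idn V p \<otimes> asci y q r) \<cdot> exch p y (q \<odot> r) \<cdot> (idn V y \<otimes> asc V p q r) =
    asc V p (y \<odot> q) r \<cdot> (exch p y q \<otimes> idn V r) \<cdot> asci y (p \<odot> q) r"
proof -
  have "(idn V p \<otimes> asci y q r) \<cdot> exch p y (q \<odot> r) \<cdot> (idn V y \<otimes> asc V p q r) =
    (idn V p \<otimes> asci y q r) \<cdot> asc V p y (q \<odot> r) \<cdot> (brd V y p \<otimes> idn V (q \<odot> r)) \<cdot>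
      (asci y p (q \<odot> r) \<cdot> (idn V y \<otimes> asc V p q r))"
    by (simp add: exch_def)
  also have "\<dots> = (idn V p \<otimes> asci y q r) \<cdot> asc V p y (q \<odot> r) \<cdot>
      ((brd V y p \<otimes> (idn V q \<otimes> idn V r)) \<cdot> asc V (y \<odot> p) q r) \<cdot> (asci y p q \<otimes> idn V r) \<cdot> asci y (p \<odot> q) r"
    by (subst pentagon_asci) simp_all
  also have "(brd V y p \<otimes> (idn V q \<otimes> idn V r)) \<cdot> asc V (y \<odot> p) q r =
      asc V (p \<odot> y) q r \<cdot> ((brd V y p \<otimes> idn V q) \<otimes> idn V r)"
    by (subst asc_nat_arr) simp_all
  also have "(idn V p \<otimes> asci y q r) \<cdot> asc V p y (q \<odot> r) \<cdot>
      (asc V (p \<odot> y) q r \<cdot> ((brd V y p \<otimes> idn V q) \<otimes> idn V r)) \<cdot> (asci y p q \<otimes> idn V r) \<cdot> asci y (p \<odot> q) r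
    = ((idn V p \<otimes> asci y q r) \<cdot> asc V p y (q \<odot> r) \<cdot> asc V (p \<odot> y) q r) \<cdot>
      ((brd V y p \<otimes> idn V q) \<otimes> idn V r) \<cdot> (asci y p q \<otimes> idn V r) \<cdot> asci y (p \<odot> q) r"
    by simp
  also have "\<dots> = asc V p (y \<odot> q) r \<cdot> (exch p y q \<otimes> idn V r) \<cdot> asci y (p \<odot> q) r"
    unfolding pentagon_left[OF assms] by (simp add: exch_def)
  finally show ?thesis .
qed

text \<open>An entry of the third block passes \<open>p\<close> and \<open>q\<close> together or one
  after the other; the comparison is where the hexagon enters.\<close>

lemma exch_asc_right:
  assumes [simp]: "p \<in> obj V" "z \<in> obj V" "q \<in> obj V" "r \<in> obj V"
  shows "(idn V p \<otimes> exch q z r) \<cdot> exch p z (q \<odot> r) \<cdot> (idn V z \<otimes> asc V p q r) =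
    asc V p q (z \<odot> r) \<cdot> exch (p \<odot> q) z r"
proof -
  have "(idn V p \<otimes> exch q z r) \<cdot> exch p z (q \<odot> r) \<cdot> (idn V z \<otimes> asc V p q r)
    = (idn V p \<otimes> asc V q z r) \<cdot> (idn V p \<otimes> (brd V z q \<otimes> idn V r)) \<cdot>
       ((idn V p \<otimes> asci z q r) \<cdot> exch p z (q \<odot> r) \<cdot> (idn V z \<otimes> asc V p q r))"
    by (simp add: exch_def[of q z r])
  also have "\<dots> = (idn V p \<otimes> asc V q z r) \<cdot> ((idn V p \<otimes> (brd V z q \<otimes> idn V r)) \<cdot>
       asc V p (z \<odot> q) r) \<cdot> (exch p z q \<otimes> idn V r) \<cdot> asci z (p \<odot> q) r"
    unfolding exch_asc_middle[OF assms] by simp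
  also have "(idn V p \<otimes> (brd V z q \<otimes> idn V r)) \<cdot> asc V p (z \<odot> q) r
      = asc V p (q \<odot> z) r \<cdot> ((idn V p \<otimes> brd V z q) \<otimes> idn V r)"
    by (subst asc_nat_arr) simp_all
  also have "(idn V p \<otimes> asc V q z r) \<cdot> (asc V p (q \<odot> z) r \<cdot> ((idn V p \<otimes> brd V z q) \<otimes> idn V r)) \<cdot>
      (exch p z q \<otimes> idn V r) \<cdot> asci z (p \<odot> q) r
    = ((idn V p \<otimes> asc V q z r) \<cdot> asc V p (q \<odot> z) r \<cdot> (asc V p q z \<otimes> idn V r)) \<cdot>
      ((asci p q z \<cdot> (idn V p \<otimes> brd V z q) \<cdot> exch p z q) \<otimes> idn V r) \<cdot> asci z (p \<odot> q) r"
    by simp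
  also have "asci p q z \<cdot> (idn V p \<otimes> brd V z q) \<cdot> exch p z q
      = (asci p q z \<cdot> (idn V p \<otimes> brd V z q) \<cdot> asc V p z q \<cdot> (brd V z p \<otimes> idn V q)) \<cdot> asci z p q"
    by (simp add: exch_def)
  also have "\<dots> = brd V z (p \<odot> q)"
    by (subst hexagon_asc[symmetric]) simp_all
  also have "(idn V p \<otimes> asc V q z r) \<cdot> asc V p (q \<odot> z) r \<cdot> (asc V p q z \<otimes> idn V r) =
      asc V p q (z \<odot> r) \<cdot> asc V (p \<odot> q) z r"
    by (subst pentagon) simp_all
  finally show ?thesis by (simp add: exch_def)
qed

text \<open>Induction on the total length, by the block whose head has the least label. That head
  comes first in both iterated merges and is stripped by \<open>pentagon_asci\<close>,
  \<open>exch_asc_middle\<close> or \<open>exch_asc_right\<close>.\<close>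

lemma spl_assoc:
  assumes "snd ` set l \<subseteq> obj V" "snd ` set k \<subseteq> obj V" "snd ` set j \<subseteq> obj V"
    "fst ` set l \<inter> fst ` set k = {}" "fst ` set l \<inter> fst ` set j = {}" "fst ` set k \<inter> fst ` set j = {}"
  shows "mrg (mrg l k) j = mrg l (mrg k j) \<and>
    asc V (tens l) (tens k) (tens j) \<cdot> (spl l k \<otimes> idn V (tens j)) \<cdot> spl (mrg l k) j =
    (idn V (tens l) \<otimes> spl k j) \<cdot> spl l (mrg k j)"
  using assms
proof (induction "length l + length k + length j" arbitrary: l k j rule: less_induct)
  case less
  note obj = less.prems(1-3)
  note image_Un [simp]
  have [simp]: "tens l \<in> obj V" "tens k \<in> obj V" "tens j \<in> obj V" using less.prems by simp_all
  \<comment> \<open>The unit laws for an empty first, third and middle block, in this order.\<close>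
  have asc_unt: "asc V (unt V) b c \<cdot> (luni b \<otimes> idn V c) = luni (b \<odot> c)"
    if [simp]: "b \<in> obj V" "c \<in> obj V" for b c
  proof (rule iso_cancel_left[of "lun V (b \<odot> c)"])
    have "lun V (b \<odot> c) \<cdot> (asc V (unt V) b c \<cdot> (luni b \<otimes> idn V c)) =
      (lun V (b \<odot> c) \<cdot> asc V (unt V) b c) \<cdot> (luni b \<otimes> idn V c)" by simp
    then show "lun V (b \<odot> c) \<cdot> (asc V (unt V) b c \<cdot> (luni b \<otimes> idn V c)) = lun V (b \<odot> c) \<cdot> luni (b \<odot> c)"
      unfolding lun_tob[OF that] by simp
  qed simp_all
  have unt_asc: "asc V a b (unt V) \<cdot> runi (a \<odot> b) = idn V a \<otimes> runi b"
    if [simp]: "a \<in> obj V" "b \<in> obj V" for a b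
  proof (rule iso_cancel_left[of "idn V a \<otimes> run V b"])
    have "(idn V a \<otimes> run V b) \<cdot> (asc V a b (unt V) \<cdot> runi (a \<odot> b)) =
      ((idn V a \<otimes> run V b) \<cdot> asc V a b (unt V)) \<cdot> runi (a \<odot> b)" by simp
    then show "(idn V a \<otimes> run V b) \<cdot> (asc V a b (unt V) \<cdot> runi (a \<odot> b)) = (idn V a \<otimes> run V b) \<cdot> (idn V a \<otimes> runi b)"
      unfolding run_tob[OF that] by simp
  qed simp_all
  have mid_asc: "asc V a (unt V) b \<cdot> (runi a \<otimes> idn V b) = idn V a \<otimes> luni b"
    if [simp]: "a \<in> obj V" "b \<in> obj V" for a b
  proof (rule iso_cancel_left[of "idn V a \<otimes> lun V b"])
    have "(idn V a \<otimes> lun V b) \<cdot> (asc V a (unt V) b \<cdot> (runi a \<otimes> idn V b)) =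
      ((idn V a \<otimes> lun V b) \<cdot> asc V a (unt V) b) \<cdot> (runi a \<otimes> idn V b)" by simp
    then show "(idn V a \<otimes> lun V b) \<cdot> (asc V a (unt V) b \<cdot> (runi a \<otimes> idn V b)) = (idn V a \<otimes> lun V b) \<cdot> (idn V a \<otimes> luni b)"
      unfolding triangle[OF that] by simp
  qed simp_all
  have spl_Nil: "spl m [] = runi (tens m)" for m :: "(nat \<times> 'o) list"
    by (cases m) (simp_all add: lun_unt)
  consider "l = []" | "k = []" | "j = []" |
    x xs y ys z zs where "l = x # xs" "k = y # ys" "j = z # zs"
    by (metis neq_Nil_conv)
  then show ?case
  proof cases
    case 1
    have "asc V (unt V) (tens k) (tens j) \<cdot> (luni (tens k) \<otimes> idn V (tens j)) \<cdot> spl k j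
      = (asc V (unt V) (tens k) (tens j) \<cdot> (luni (tens k) \<otimes> idn V (tens j))) \<cdot> spl k j"
      using obj by simp
    also have "\<dots> = (idn V (unt V) \<otimes> spl k j) \<cdot> luni (tens (mrg k j))"
      using obj by (simp add: asc_unt luni_nat)
    finally show ?thesis using 1 by simp
  next
    case 2
    have "asc V (tens l) (unt V) (tens j) \<cdot> (runi (tens l) \<otimes> idn V (tens j)) \<cdot> spl l j
      = (asc V (tens l) (unt V) (tens j) \<cdot> (runi (tens l) \<otimes> idn V (tens j))) \<cdot> spl l j"
      using obj by simp
    then show ?thesis using 2 obj by (simp add: spl_Nil mid_asc)
  next
    case 3
    have "asc V (tens l) (tens k) (unt V) \<cdot> (spl l k \<otimes> idn V (unt V)) \<cdot> runi (tens (mrg l k))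
      = asc V (tens l) (tens k) (unt V) \<cdot> (runi (tens l \<odot> tens k) \<cdot> spl l k)"
      using obj by (simp add: runi_nat)
    also have "\<dots> = (asc V (tens l) (tens k) (unt V) \<cdot> runi (tens l \<odot> tens k)) \<cdot> spl l k"
      using obj by simp
    finally show ?thesis using 3 obj by (simp add: spl_Nil unt_asc)
  next
    case (4 x xs y ys z zs)
    let ?p = "tens l" and ?q = "tens k" and ?r = "tens j"
    have [simp]: "snd x \<in> obj V" "snd y \<in> obj V" "snd z \<in> obj V"
      "snd ` set xs \<subseteq> obj V" "snd ` set ys \<subseteq> obj V" "snd ` set zs \<subseteq> obj V"
      "tens xs \<in> obj V" "tens ys \<in> obj V" "tens zs \<in> obj V"
      using obj 4 by auto
    have ne: "fst x \<noteq> fst y" "fst x \<noteq> fst z" "fst y \<noteq> fst z"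
      using less.prems 4 by auto
    consider (x) "fst x < fst y" "fst x < fst z" | (y) "fst y < fst x" "fst y < fst z"
      | (z) "fst z < fst x" "fst z < fst y" using ne by linarith
    then show ?thesis
    proof cases
      case x
      let ?x = "snd x" and ?p = "tens xs"
      have IH: "mrg (mrg xs k) j = mrg xs (mrg k j)"
        "asc V ?p ?q ?r \<cdot> (spl xs k \<otimes> idn V ?r) \<cdot> spl (mrg xs k) j = (idn V ?p \<otimes> spl k j) \<cdot> spl xs (mrg k j)"
        using less.hyps[of xs k j] less.prems 4 by auto
      have m: "mrg l k = x # mrg xs k" "mrg (x # mrg xs k) j = x # mrg (mrg xs k) j"
        "mrg l (mrg k j) = x # mrg xs (mrg k j)" using x 4 by auto
      have s: "spl l k = asci ?x ?p ?q \<cdot> (idn V ?x \<otimes> spl xs k)"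
        "spl (x # mrg xs k) j = asci ?x (tens (mrg xs k)) ?r \<cdot> (idn V ?x \<otimes> spl (mrg xs k) j)"
        "spl l (mrg k j) = asci ?x ?p (tens (mrg k j)) \<cdot> (idn V ?x \<otimes> spl xs (mrg k j))"
        using x 4 by auto
      have "asc V (?x \<odot> ?p) ?q ?r \<cdot> (spl l k \<otimes> idn V ?r) \<cdot> spl (x # mrg xs k) j
        = asc V (?x \<odot> ?p) ?q ?r \<cdot> (asci ?x ?p ?q \<otimes> idn V ?r) \<cdot>
           (((idn V ?x \<otimes> spl xs k) \<otimes> idn V ?r) \<cdot> asci ?x (tens (mrg xs k)) ?r) \<cdot> (idn V ?x \<otimes> spl (mrg xs k) j)"
        unfolding s using obj by simp
      also have "((idn V ?x \<otimes> spl xs k) \<otimes> idn V ?r) \<cdot> asci ?x (tens (mrg xs k)) ?r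
          = asci ?x (?p \<odot> ?q) ?r \<cdot> (idn V ?x \<otimes> (spl xs k \<otimes> idn V ?r))"
        using obj by (subst asci_nat) simp_all
      also have "asc V (?x \<odot> ?p) ?q ?r \<cdot> (asci ?x ?p ?q \<otimes> idn V ?r) \<cdot>
          (asci ?x (?p \<odot> ?q) ?r \<cdot> (idn V ?x \<otimes> (spl xs k \<otimes> idn V ?r))) \<cdot> (idn V ?x \<otimes> spl (mrg xs k) j)
        = (asc V (?x \<odot> ?p) ?q ?r \<cdot> (asci ?x ?p ?q \<otimes> idn V ?r) \<cdot> asci ?x (?p \<odot> ?q) ?r) \<cdot>
           (idn V ?x \<otimes> ((spl xs k \<otimes> idn V ?r) \<cdot> spl (mrg xs k) j))"
        using obj by simp
      also have "asc V (?x \<odot> ?p) ?q ?r \<cdot> (asci ?x ?p ?q \<otimes> idn V ?r) \<cdot> asci ?x (?p \<odot> ?q) ?r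
        = asci ?x ?p (?q \<odot> ?r) \<cdot> (idn V ?x \<otimes> asc V ?p ?q ?r)"
        by (subst pentagon_asci) simp_all
      also have "(asci ?x ?p (?q \<odot> ?r) \<cdot> (idn V ?x \<otimes> asc V ?p ?q ?r)) \<cdot>
          (idn V ?x \<otimes> ((spl xs k \<otimes> idn V ?r) \<cdot> spl (mrg xs k) j))
        = asci ?x ?p (?q \<odot> ?r) \<cdot> (idn V ?x \<otimes> (asc V ?p ?q ?r \<cdot> (spl xs k \<otimes> idn V ?r) \<cdot> spl (mrg xs k) j))"
        using obj by simp
      also have "\<dots> = (asci ?x ?p (?q \<odot> ?r) \<cdot> (idn V ?x \<otimes> (idn V ?p \<otimes> spl k j))) \<cdot> (idn V ?x \<otimes> spl xs (mrg k j))"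
        unfolding IH(2) using obj by simp
      also have "asci ?x ?p (?q \<odot> ?r) \<cdot> (idn V ?x \<otimes> (idn V ?p \<otimes> spl k j))
        = (idn V (?x \<odot> ?p) \<otimes> spl k j) \<cdot> asci ?x ?p (tens (mrg k j))"
        using obj by (subst asci_nat) simp_all
      finally have "asc V (?x \<odot> ?p) ?q ?r \<cdot> (spl l k \<otimes> idn V ?r) \<cdot> spl (x # mrg xs k) j =
          (idn V (?x \<odot> ?p) \<otimes> spl k j) \<cdot> spl l (mrg k j)"
        unfolding s(3) using obj by simp
      moreover have "tens l = ?x \<odot> ?p" using 4 by simp
      ultimately show ?thesis using IH(1) by (simp only: m simp_thms)
    next
      case y
      let ?y = "snd y" and ?q = "tens ys"
      have IH: "mrg (mrg l ys) j = mrg l (mrg ys j)"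
        "asc V ?p ?q ?r \<cdot> (spl l ys \<otimes> idn V ?r) \<cdot> spl (mrg l ys) j = (idn V ?p \<otimes> spl ys j) \<cdot> spl l (mrg ys j)"
        using less.hyps[of l ys j] less.prems 4 by auto
      have m: "mrg l k = y # mrg l ys" "mrg (y # mrg l ys) j = y # mrg (mrg l ys) j"
        "mrg k j = y # mrg ys j" "mrg l (y # mrg ys j) = y # mrg l (mrg ys j)" using y 4 by auto
      have s: "spl l k = exch ?p ?y ?q \<cdot> (idn V ?y \<otimes> spl l ys)"
        "spl (y # mrg l ys) j = asci ?y (tens (mrg l ys)) ?r \<cdot> (idn V ?y \<otimes> spl (mrg l ys) j)"
        "spl k j = asci ?y ?q ?r \<cdot> (idn V ?y \<otimes> spl ys j)"
        "spl l (y # mrg ys j) = exch ?p ?y (tens (mrg ys j)) \<cdot> (idn V ?y \<otimes> spl l (mrg ys j))"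
        using y 4 by auto
      have nat: "exch ?p ?y (?q \<odot> ?r) \<cdot> (idn V ?y \<otimes> (idn V ?p \<otimes> f)) = (idn V ?p \<otimes> (idn V ?y \<otimes> f)) \<cdot> exch ?p ?y (src V f)"
        if [simp]: "f \<in> arr V" "trg V f = ?q \<odot> ?r" for f
      proof -
        have "exch ?p ?y (?q \<odot> ?r) \<cdot> (idn V ?y \<otimes> (idn V ?p \<otimes> f)) =
          asc V ?p ?y (?q \<odot> ?r) \<cdot> (brd V ?y ?p \<otimes> idn V (?q \<odot> ?r)) \<cdot> (asci ?y ?p (?q \<odot> ?r) \<cdot> (idn V ?y \<otimes> (idn V ?p \<otimes> f)))"
          by (simp add: exch_def)
        also have "\<dots> = (asc V ?p ?y (?q \<odot> ?r) \<cdot> ((idn V ?p \<otimes> idn V ?y) \<otimes> f)) \<cdot> (brd V ?y ?p \<otimes> idn V (src V f)) \<cdot> asci ?y ?p (src V f)"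
          by (subst asci_nat) simp_all
        also have "\<dots> = (idn V ?p \<otimes> (idn V ?y \<otimes> f)) \<cdot> exch ?p ?y (src V f)"
          by (subst asc_nat_arr) (simp_all add: exch_def)
        finally show ?thesis .
      qed
      have "asc V ?p (?y \<odot> ?q) ?r \<cdot> (spl l k \<otimes> idn V ?r) \<cdot> spl (y # mrg l ys) j
        = asc V ?p (?y \<odot> ?q) ?r \<cdot> (exch ?p ?y ?q \<otimes> idn V ?r) \<cdot>
           (((idn V ?y \<otimes> spl l ys) \<otimes> idn V ?r) \<cdot> asci ?y (tens (mrg l ys)) ?r) \<cdot> (idn V ?y \<otimes> spl (mrg l ys) j)"
        unfolding s using obj by simp
      also have "((idn V ?y \<otimes> spl l ys) \<otimes> idn V ?r) \<cdot> asci ?y (tens (mrg l ys)) ?r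
          = asci ?y (?p \<odot> ?q) ?r \<cdot> (idn V ?y \<otimes> (spl l ys \<otimes> idn V ?r))"
        using obj by (subst asci_nat) simp_all
      also have "asc V ?p (?y \<odot> ?q) ?r \<cdot> (exch ?p ?y ?q \<otimes> idn V ?r) \<cdot>
           (asci ?y (?p \<odot> ?q) ?r \<cdot> (idn V ?y \<otimes> (spl l ys \<otimes> idn V ?r))) \<cdot> (idn V ?y \<otimes> spl (mrg l ys) j)
        = (asc V ?p (?y \<odot> ?q) ?r \<cdot> (exch ?p ?y ?q \<otimes> idn V ?r) \<cdot> asci ?y (?p \<odot> ?q) ?r) \<cdot>
           (idn V ?y \<otimes> ((spl l ys \<otimes> idn V ?r) \<cdot> spl (mrg l ys) j))"
        using obj by simp
      also have "asc V ?p (?y \<odot> ?q) ?r \<cdot> (exch ?p ?y ?q \<otimes> idn V ?r) \<cdot> asci ?y (?p \<odot> ?q) ?r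
        = (idn V ?p \<otimes> asci ?y ?q ?r) \<cdot> exch ?p ?y (?q \<odot> ?r) \<cdot> (idn V ?y \<otimes> asc V ?p ?q ?r)"
        by (subst exch_asc_middle) simp_all
      also have "((idn V ?p \<otimes> asci ?y ?q ?r) \<cdot> exch ?p ?y (?q \<odot> ?r) \<cdot> (idn V ?y \<otimes> asc V ?p ?q ?r)) \<cdot>
           (idn V ?y \<otimes> ((spl l ys \<otimes> idn V ?r) \<cdot> spl (mrg l ys) j))
        = (idn V ?p \<otimes> asci ?y ?q ?r) \<cdot> exch ?p ?y (?q \<odot> ?r) \<cdot>
           (idn V ?y \<otimes> (asc V ?p ?q ?r \<cdot> (spl l ys \<otimes> idn V ?r) \<cdot> spl (mrg l ys) j))"
        using obj by simp
      also have "\<dots> = (idn V ?p \<otimes> asci ?y ?q ?r) \<cdot> (exch ?p ?y (?q \<odot> ?r) \<cdot>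
           (idn V ?y \<otimes> (idn V ?p \<otimes> spl ys j))) \<cdot> (idn V ?y \<otimes> spl l (mrg ys j))"
        unfolding IH(2) using obj by simp
      also have "exch ?p ?y (?q \<odot> ?r) \<cdot> (idn V ?y \<otimes> (idn V ?p \<otimes> spl ys j)) =
          (idn V ?p \<otimes> (idn V ?y \<otimes> spl ys j)) \<cdot> exch ?p ?y (tens (mrg ys j))"
        using obj by (subst nat) simp_all
      finally have "asc V ?p (?y \<odot> ?q) ?r \<cdot> (spl l k \<otimes> idn V ?r) \<cdot> spl (y # mrg l ys) j =
          (idn V ?p \<otimes> spl k j) \<cdot> spl l (y # mrg ys j)"
        unfolding s(3,4) using obj by simp
      moreover have "tens k = ?y \<odot> ?q" using 4 by simp
      ultimately show ?thesis using IH(1) by (simp only: m simp_thms)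
    next
      case z
      let ?z = "snd z" and ?r = "tens zs"
      have IH: "mrg (mrg l k) zs = mrg l (mrg k zs)"
        "asc V ?p ?q ?r \<cdot> (spl l k \<otimes> idn V ?r) \<cdot> spl (mrg l k) zs = (idn V ?p \<otimes> spl k zs) \<cdot> spl l (mrg k zs)"
        using less.hyps[of l k zs] less.prems 4 by auto
      \<comment> \<open>\<open>spl\<close> unfolds only at two nonempty lists, so the head of the
        merged list is exhibited; as it is \<open>x\<close> or \<open>y\<close>, its label exceeds
        that of \<open>z\<close>.\<close>
      obtain h t where ht: "mrg l k = h # t" "fst z < fst h"
        using z 4 by (cases "fst x < fst y") auto
      have m: "mrg (mrg l k) j = z # mrg (mrg l k) zs" "mrg k j = z # mrg k zs"
        "mrg l (z # mrg k zs) = z # mrg l (mrg k zs)" using z 4 ht by auto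
      have "spl (h # t) j = exch (tens (h # t)) ?z ?r \<cdot> (idn V ?z \<otimes> spl (h # t) zs)"
        using 4 ht by auto
      then have s: "spl (mrg l k) j = exch (tens (mrg l k)) ?z ?r \<cdot> (idn V ?z \<otimes> spl (mrg l k) zs)"
        "spl k j = exch ?q ?z ?r \<cdot> (idn V ?z \<otimes> spl k zs)"
        "spl l (z # mrg k zs) = exch ?p ?z (tens (mrg k zs)) \<cdot> (idn V ?z \<otimes> spl l (mrg k zs))"
        unfolding ht using z 4 by auto
      have nat: "exch b ?z d \<cdot> (idn V ?z \<otimes> (f \<otimes> g)) = (f \<otimes> (idn V ?z \<otimes> g)) \<cdot> exch (src V f) ?z (src V g)"
        if [simp]: "f \<in> arr V" "g \<in> arr V" "trg V f = b" "trg V g = d" for f g b d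
      proof -
        have [simp]: "b \<in> obj V" "d \<in> obj V"
          using trg_obj[of f] trg_obj[of g] that by simp_all
        have "exch b ?z d \<cdot> (idn V ?z \<otimes> (f \<otimes> g)) =
          asc V b ?z d \<cdot> (brd V ?z b \<otimes> idn V d) \<cdot> (asci ?z b d \<cdot> (idn V ?z \<otimes> (f \<otimes> g)))"
          by (simp add: exch_def)
        also have "\<dots> = asc V b ?z d \<cdot> ((brd V ?z b \<cdot> (idn V ?z \<otimes> f)) \<otimes> g) \<cdot> asci ?z (src V f) (src V g)"
          by (subst asci_nat) simp_all
        also have "\<dots> = (asc V b ?z d \<cdot> ((f \<otimes> idn V ?z) \<otimes> g)) \<cdot> (brd V ?z (src V f) \<otimes> idn V (src V g)) \<cdot> asci ?z (src V f) (src V g)"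
          by (subst brd_nat_arr) simp_all
        also have "\<dots> = (f \<otimes> (idn V ?z \<otimes> g)) \<cdot> exch (src V f) ?z (src V g)"
          by (subst asc_nat_arr) (simp_all add: exch_def)
        finally show ?thesis .
      qed
      have "asc V ?p ?q (?z \<odot> ?r) \<cdot> (spl l k \<otimes> idn V (?z \<odot> ?r)) \<cdot> spl (mrg l k) j
        = asc V ?p ?q (?z \<odot> ?r) \<cdot> ((spl l k \<otimes> (idn V ?z \<otimes> idn V ?r)) \<cdot>
            exch (tens (mrg l k)) ?z ?r) \<cdot> (idn V ?z \<otimes> spl (mrg l k) zs)"
        unfolding s using obj by simp
      also have "(spl l k \<otimes> (idn V ?z \<otimes> idn V ?r)) \<cdot> exch (tens (mrg l k)) ?z ?r
          = exch (?p \<odot> ?q) ?z ?r \<cdot> (idn V ?z \<otimes> (spl l k \<otimes> idn V ?r))"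
        using obj by (subst nat) simp_all
      also have "asc V ?p ?q (?z \<odot> ?r) \<cdot> (exch (?p \<odot> ?q) ?z ?r \<cdot> (idn V ?z \<otimes> (spl l k \<otimes> idn V ?r))) \<cdot>
          (idn V ?z \<otimes> spl (mrg l k) zs)
        = (asc V ?p ?q (?z \<odot> ?r) \<cdot> exch (?p \<odot> ?q) ?z ?r) \<cdot>
           (idn V ?z \<otimes> ((spl l k \<otimes> idn V ?r) \<cdot> spl (mrg l k) zs))"
        using obj by simp
      also have "asc V ?p ?q (?z \<odot> ?r) \<cdot> exch (?p \<odot> ?q) ?z ?r
        = (idn V ?p \<otimes> exch ?q ?z ?r) \<cdot> exch ?p ?z (?q \<odot> ?r) \<cdot> (idn V ?z \<otimes> asc V ?p ?q ?r)"
        by (subst exch_asc_right) simp_all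
      also have "((idn V ?p \<otimes> exch ?q ?z ?r) \<cdot> exch ?p ?z (?q \<odot> ?r) \<cdot> (idn V ?z \<otimes> asc V ?p ?q ?r)) \<cdot>
           (idn V ?z \<otimes> ((spl l k \<otimes> idn V ?r) \<cdot> spl (mrg l k) zs))
        = (idn V ?p \<otimes> exch ?q ?z ?r) \<cdot> exch ?p ?z (?q \<odot> ?r) \<cdot>
           (idn V ?z \<otimes> (asc V ?p ?q ?r \<cdot> (spl l k \<otimes> idn V ?r) \<cdot> spl (mrg l k) zs))"
        using obj by simp
      also have "\<dots> = (idn V ?p \<otimes> exch ?q ?z ?r) \<cdot> (exch ?p ?z (?q \<odot> ?r) \<cdot>
           (idn V ?z \<otimes> (idn V ?p \<otimes> spl k zs))) \<cdot> (idn V ?z \<otimes> spl l (mrg k zs))"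
        unfolding IH(2) using obj by simp
      also have "exch ?p ?z (?q \<odot> ?r) \<cdot> (idn V ?z \<otimes> (idn V ?p \<otimes> spl k zs)) =
          (idn V ?p \<otimes> (idn V ?z \<otimes> spl k zs)) \<cdot> exch ?p ?z (tens (mrg k zs))"
        using obj by (subst nat) simp_all
      finally have "asc V ?p ?q (?z \<odot> ?r) \<cdot> (spl l k \<otimes> idn V (?z \<odot> ?r)) \<cdot> spl (mrg l k) j =
          (idn V ?p \<otimes> spl k j) \<cdot> spl l (z # mrg k zs)"
        unfolding s(2,3) using obj by simp
      moreover have "tens j = ?z \<odot> ?r" using 4 by simp
      ultimately show ?thesis using IH(1) by (simp only: m simp_thms)
    qed
  qed
qed

end

section \<open>Generalized elements\<close>

text \<open>
  An element of \<open>a\<close> is an arrow into \<open>a\<close> from the tensor product of a context. Since contexts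
  are sorted by their labels, the structural isomorphisms act on elements by re-bracketing and
  permuting tuples, with no coherence isomorphism left over. The tensor \<open>tn u v\<close> of two elements
  makes sense only for disjoint contexts: \<open>dj u v\<close>. As \<open>V\<close> is not cartesian, this is the
  requirement that variables be used linearly.
\<close>

text \<open>Elements are pairs, but are never to be split.\<close>

declare split_paired_All [simp del] split_paired_Ex [simp del]

context sym_mon_closed
begin

definition val :: "(nat \<times> 'o) list \<times> 'm \<Rightarrow> bool" where
  "val u \<longleftrightarrow> ctx (fst u) \<and> snd u \<in> arr V \<and> src V (snd u) = tens (fst u)"

definition ty :: "(nat \<times> 'o) list \<times> 'm \<Rightarrow> 'o" where
  "ty u = trg V (snd u)"

text \<open>The objects are kept beside the labels because equal elements need equal contexts;
  disjointness looks at the labels alone.\<close>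

definition stg :: "(nat \<times> 'o) list \<times> 'm \<Rightarrow> (nat \<times> 'o) set" where
  "stg u = set (fst u)"

definition dj :: "(nat \<times> 'o) list \<times> 'm \<Rightarrow> (nat \<times> 'o) list \<times> 'm \<Rightarrow> bool" where
  "dj u v \<longleftrightarrow> fst ` stg u \<inter> fst ` stg v = {}"

definition ap :: "'m \<Rightarrow> (nat \<times> 'o) list \<times> 'm \<Rightarrow> (nat \<times> 'o) list \<times> 'm" where
  "ap f u = (fst u, f \<cdot> snd u)"

definition tn :: "(nat \<times> 'o) list \<times> 'm \<Rightarrow> (nat \<times> 'o) list \<times> 'm \<Rightarrow> (nat \<times> 'o) list \<times> 'm" where
  "tn u v = (mrg (fst u) (fst v), (snd u \<otimes> snd v) \<cdot> spl (fst u) (fst v))"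

definition star :: "(nat \<times> 'o) list \<times> 'm" where
  "star = ([], idn V (unt V))"

definition var :: "nat \<Rightarrow> 'o \<Rightarrow> (nat \<times> 'o) list \<times> 'm" where
  "var i a = ([(i, a)], run V a)"

abbreviation gl :: "'m \<Rightarrow> (nat \<times> 'o) list \<times> 'm" where
  "gl f \<equiv> ap f star"

lemma stg_simps [simp]:
  "stg (ap f u) = stg u" "stg (tn u v) = stg u \<union> stg v" "stg star = {}" "stg (var i a) = {(i, a)}"
  by (simp_all add: stg_def ap_def tn_def star_def var_def)

lemma dj_simps [simp]:
  "dj (ap f u) w = dj u w" "dj w (ap f u) = dj w u" "dj star w" "dj w star"
  "dj (tn u v) w \<longleftrightarrow> dj u w \<and> dj v w" "dj w (tn u v) \<longleftrightarrow> dj w u \<and> dj w v"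
  "dj (var i a) (var j b) \<longleftrightarrow> i \<noteq> j"
  by (auto simp: dj_def)

lemma dj_sym: "dj u v \<longleftrightarrow> dj v u"
  by (auto simp: dj_def)

lemma ctx_mrg: "\<lbrakk>val u; val v; dj u v\<rbrakk> \<Longrightarrow> ctx (mrg (fst u) (fst v))"
  unfolding val_def ctx_def dj_def stg_def by (auto intro: sorted_mrg)

lemma el_obj:
  assumes "val u"
  shows "ty u \<in> obj V" "snd u \<in> arr V" "src V (snd u) = tens (fst u)" "trg V (snd u) = ty u"
    "snd ` set (fst u) \<subseteq> obj V"
  using assms by (auto simp: val_def ty_def ctx_def)

lemma val_ap [simp]:
  assumes "val u" "f \<in> arr V" "src V f = ty u"
  shows "val (ap f u)" "ty (ap f u) = trg V f"
  using assms by (simp_all add: val_def ty_def ap_def)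

lemma val_tn [simp]:
  assumes "val u" "val v"
  shows "dj u v \<Longrightarrow> val (tn u v)" "ty (tn u v) = ty u \<odot> ty v"
proof -
  note [simp] = el_obj[OF assms(1)] el_obj[OF assms(2)]
  show "dj u v \<Longrightarrow> val (tn u v)"
    using ctx_mrg[OF assms] by (simp add: val_def tn_def)
  show "ty (tn u v) = ty u \<odot> ty v"
    unfolding ty_def[of "tn u v"] by (simp add: tn_def)
qed

lemma val_star [simp]: "val star" "ty star = unt V"
  by (simp_all add: val_def ty_def star_def ctx_def)

lemma val_var [simp]: "a \<in> obj V \<Longrightarrow> val (var i a)" "a \<in> obj V \<Longrightarrow> ty (var i a) = a"
  by (simp_all add: val_def ty_def var_def ctx_def)

lemma ap_cmp [simp]:
  assumes "val u" "f \<in> arr V" "g \<in> arr V" "src V f = ty u" "trg V f = src V g"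
  shows "ap (g \<cdot> f) u = ap g (ap f u)"
  using assms el_obj[OF assms(1)] by (simp add: ap_def)

lemma ap_idn [simp]: "\<lbrakk>val u; a = ty u\<rbrakk> \<Longrightarrow> ap (idn V a) u = u"
  using el_obj[of u] by (simp add: ap_def)

lemma ap_tar [simp]:
  assumes "val u" "val v" "f \<in> arr V" "g \<in> arr V" "src V f = ty u" "src V g = ty v"
  shows "ap (f \<otimes> g) (tn u v) = tn (ap f u) (ap g v)"
  using assms el_obj[OF assms(1)] el_obj[OF assms(2)] by (simp add: ap_def tn_def)

text \<open>The two merges are sorted lists with the same entries, hence equal, and
  \<open>spl_comm\<close> absorbs the braiding.\<close>

lemma ap_brd [simp]:
  assumes "val u" "val v" "dj u v" "a = ty u" "b = ty v"
  shows "ap (brd V a b) (tn u v) = tn v u"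
proof -
  note [simp] = el_obj[OF assms(1)] el_obj[OF assms(2)]
  let ?l = "fst u" and ?k = "fst v"
  have d: "fst ` set ?l \<inter> fst ` set ?k = {}" using assms by (simp add: dj_def stg_def)
  have eq: "mrg ?l ?k = mrg ?k ?l"
    by (rule sorted_set_unique)
      (use ctx_mrg[OF assms(1-3)] ctx_mrg[OF assms(2,1)] assms(3) dj_sym in \<open>auto simp: ctx_def\<close>)
  have "brd V a b \<cdot> (snd u \<otimes> snd v) \<cdot> spl ?l ?k = (brd V a b \<cdot> (snd u \<otimes> snd v)) \<cdot> spl ?l ?k"
    using assms(4,5) by simp
  also have "\<dots> = (snd v \<otimes> snd u) \<cdot> (brd V (tens ?l) (tens ?k) \<cdot> spl ?l ?k)"
    using assms(4,5) by (subst brd_nat_arr) simp_all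
  also have "\<dots> = (snd v \<otimes> snd u) \<cdot> spl ?k ?l"
    using d by (simp add: spl_comm)
  finally show ?thesis using eq by (simp add: ap_def tn_def)
qed

lemma ap_asc [simp]:
  assumes "val u" "val v" "val w" "dj u v" "dj u w" "dj v w" "a = ty u" "b = ty v" "c = ty w"
  shows "ap (asc V a b c) (tn (tn u v) w) = tn u (tn v w)"
proof -
  note [simp] = el_obj[OF assms(1)] el_obj[OF assms(2)] el_obj[OF assms(3)] image_Un
  let ?l = "fst u" and ?k = "fst v" and ?j = "fst w"
  have eq: "mrg (mrg ?l ?k) ?j = mrg ?l (mrg ?k ?j) \<and>
    asc V (tens ?l) (tens ?k) (tens ?j) \<cdot> (spl ?l ?k \<otimes> idn V (tens ?j)) \<cdot> spl (mrg ?l ?k) ?j =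
    (idn V (tens ?l) \<otimes> spl ?k ?j) \<cdot> spl ?l (mrg ?k ?j)"
    by (rule spl_assoc) (use assms in \<open>simp_all add: dj_def stg_def\<close>)
  have "asc V a b c \<cdot> (((snd u \<otimes> snd v) \<cdot> spl ?l ?k) \<otimes> snd w) \<cdot> spl (mrg ?l ?k) ?j
    = (asc V a b c \<cdot> ((snd u \<otimes> snd v) \<otimes> snd w)) \<cdot> (spl ?l ?k \<otimes> idn V (tens ?j)) \<cdot> spl (mrg ?l ?k) ?j"
    using assms(7-9) by simp
  also have "\<dots> = (snd u \<otimes> (snd v \<otimes> snd w)) \<cdot>
      (asc V (tens ?l) (tens ?k) (tens ?j) \<cdot> (spl ?l ?k \<otimes> idn V (tens ?j)) \<cdot> spl (mrg ?l ?k) ?j)"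
    using assms(7-9) by (subst asc_nat_arr) simp_all
  also have "\<dots> = (snd u \<otimes> ((snd v \<otimes> snd w) \<cdot> spl ?k ?j)) \<cdot> spl ?l (mrg ?k ?j)"
    unfolding conjunct2[OF eq] by simp
  finally show ?thesis using eq by (simp add: ap_def tn_def)
qed

lemma ap_inv:
  assumes "val u" "iso_arr V f" "src V f = ty u"
  shows "ap (inv_arr V f) (ap f u) = u"
  using assms iso_arr_arr[OF assms(2)] el_obj[OF assms(1)] by (simp add: ap_def)

lemma ap_asci [simp]:
  assumes "val u" "val v" "val w" "dj u v" "dj u w" "dj v w" "a = ty u" "b = ty v" "c = ty w"
  shows "ap (asci a b c) (tn u (tn v w)) = tn (tn u v) w"
  using ap_inv[of "tn (tn u v) w" "asc V a b c"] assms el_obj by simp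

lemma ap_lun [simp]:
  assumes "val u" "a = ty u"
  shows "ap (lun V a) (tn star u) = u"
proof -
  note [simp] = el_obj[OF assms(1)]
  have "lun V a \<cdot> (idn V (unt V) \<otimes> snd u) \<cdot> luni (tens (fst u)) =
    (lun V a \<cdot> (idn V (unt V) \<otimes> snd u)) \<cdot> luni (tens (fst u))" using assms by simp
  also have "\<dots> = snd u" using assms by (subst lun_nat_arr) simp_all
  finally show ?thesis using assms by (simp add: ap_def tn_def star_def)
qed

lemma ap_luni [simp]:
  assumes "val u" "a = ty u"
  shows "ap (luni a) u = tn star u"
  using ap_inv[of "tn star u" "lun V a"] assms el_obj by simp

lemma ap_run [simp]:
  assumes "val u" "a = ty u"
  shows "ap (run V a) (tn u star) = u"
  using brd_unt[of a] ap_cmp[of "tn u star" "brd V a (unt V)" "lun V a"] assms el_obj[OF assms(1)]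
  by simp

lemma ap_runi [simp]:
  assumes "val u" "a = ty u"
  shows "ap (runi a) u = tn u star"
  using ap_inv[of "tn u star" "run V a"] assms el_obj by simp

lemma curry_props:
  assumes "x \<in> obj V" "a \<in> obj V" "b \<in> obj V" "f \<in> arr V" "src V f = x \<odot> a" "trg V f = b"
  shows "curry_arr V x a b f \<in> hom V x (ihom V a b) \<and> evl V a b \<cdot> (curry_arr V x a b f \<otimes> idn V a) = f"
  unfolding curry_arr_def by (rule theI') (rule closed, use assms in auto)

lemma curry_arr_simps [simp]:
  assumes "x \<in> obj V" "a \<in> obj V" "b \<in> obj V" "f \<in> arr V" "src V f = x \<odot> a" "trg V f = b"
  shows "curry_arr V x a b f \<in> arr V" "src V (curry_arr V x a b f) = x"
    "trg V (curry_arr V x a b f) = ihom V a b"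
  using curry_props[OF assms] by auto

text \<open>Beta reduction for the internal hom.\<close>

lemma ap_evl_curry [simp]:
  assumes "val u" "val v" "dj u v" "f \<in> arr V" "src V f = ty u \<odot> ty v" "x = ty u" "a = ty v" "trg V f = b"
  shows "ap (evl V a b) (tn (ap (curry_arr V x a b f) u) v) = ap f (tn u v)"
proof -
  note [simp] = el_obj[OF assms(1)] el_obj[OF assms(2)]
  have b: "b \<in> obj V" using trg_obj[of f] assms by simp
  have "ap (evl V a b \<cdot> (curry_arr V x a b f \<otimes> idn V a)) (tn u v) = ap f (tn u v)"
    using curry_props[of x a b f] assms b by simp
  then show ?thesis using assms b by simp
qed

lemma name_arr_simps [simp]:
  assumes "f \<in> arr V" "src V f = a" "trg V f = b"
  shows "name_arr V a b f \<in> arr V" "src V (name_arr V a b f) = unt V"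
    "trg V (name_arr V a b f) = ihom V a b"
  using assms src_obj[of f] trg_obj[of f] by (simp_all add: name_arr_def)

lemma ap_evl_name [simp]:
  assumes "val u" "f \<in> arr V" "src V f = ty u" "trg V f = b" "a = ty u"
  shows "ap (evl V a b) (tn (gl (name_arr V a b f)) u) = ap f u"
  using assms el_obj[OF assms(1)] trg_obj[of f] by (simp add: name_arr_def)

subsection \<open>Extensionality\<close>

text \<open>An element with invertible underlying arrow is generic: precomposition with it is
  injective. By \<open>iso_snd\<close> variables, \<open>star\<close> and tensor products of generic
  elements are of this kind, so an equation of arrows can be tested on one tuple of
  variables.\<close>

lemma arr_eq_on_iso:
  assumes "f \<in> arr V" "g \<in> arr V" "src V f = ty e" "src V g = ty e" "val e" "iso_arr V (snd e)"
    "ap f e = ap g e"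
  shows "f = g"
  by (rule iso_cancel_right[of "snd e"]) (use assms in \<open>simp_all add: ap_def ty_def\<close>)

lemma iso_snd [simp]:
  "iso_arr V (snd star)" "a \<in> obj V \<Longrightarrow> iso_arr V (snd (var i a))"
  "\<lbrakk>val u; val v; iso_arr V (snd u); iso_arr V (snd v)\<rbrakk> \<Longrightarrow> iso_arr V (snd (tn u v))"
  using el_obj[of u] el_obj[of v] by (simp_all add: star_def var_def tn_def)

lemma arr_eqI1:
  assumes "f \<in> arr V" "g \<in> arr V" "src V f = a" "src V g = a"
    and "\<And>u. \<lbrakk>val u; ty u = a\<rbrakk> \<Longrightarrow> ap f u = ap g u"
  shows "f = g"
  by (rule arr_eq_on_iso[of _ _ "var 0 a"]) (use assms src_obj[of f] in auto)

lemma arr_eqI_unt: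
  assumes "f \<in> arr V" "g \<in> arr V" "src V f = unt V" "src V g = unt V" "gl f = gl g"
  shows "f = g"
  by (rule arr_eq_on_iso[of _ _ star]) (use assms in auto)

lemma arr_eqI2:
  assumes "f \<in> arr V" "g \<in> arr V" "src V f = a \<odot> b" "src V g = a \<odot> b" "a \<in> obj V" "b \<in> obj V"
    and "\<And>u v. \<lbrakk>val u; ty u = a; val v; ty v = b; dj u v; dj v u\<rbrakk> \<Longrightarrow> ap f (tn u v) = ap g (tn u v)"
  shows "f = g"
  by (rule arr_eq_on_iso[of _ _ "tn (var 0 a) (var 1 b)"]) (use assms in auto)

lemma arr_eqI3:
  assumes "f \<in> arr V" "g \<in> arr V" "src V f = (a \<odot> b) \<odot> c" "src V g = (a \<odot> b) \<odot> c"
    "a \<in> obj V" "b \<in> obj V" "c \<in> obj V"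
    and "\<And>u v w. \<lbrakk>val u; ty u = a; val v; ty v = b; val w; ty w = c; dj u v; dj v u; dj u w; dj w u;
      dj v w; dj w v\<rbrakk> \<Longrightarrow> ap f (tn (tn u v) w) = ap g (tn (tn u v) w)"
  shows "f = g"
  by (rule arr_eq_on_iso[of _ _ "tn (tn (var 0 a) (var 1 b)) (var 2 c)"]) (use assms in auto)

text \<open>Extensionality inside a context: a fresh variable plays the arbitrary argument, and the
  uniqueness of transposes turns agreement on it into equality.\<close>

lemma ihom_eqI:
  assumes g: "val g" "val g'" "ty g = ihom V a b" "ty g' = ihom V a b" "stg g = stg g'"
    and ab: "a \<in> obj V" "b \<in> obj V"
    and eq: "\<And>u. \<lbrakk>val u; ty u = a; dj g u; dj u g\<rbrakk> \<Longrightarrow> ap (evl V a b) (tn g u) = ap (evl V a b) (tn g' u)"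
  shows "g = g'"
proof -
  define l where "l = fst g"
  have l': "fst g' = l" using sorted_set_unique[of "fst g" "fst g'"] g
    by (auto simp: val_def ctx_def stg_def l_def)
  note [simp] = el_obj[OF g(1)] el_obj[OF g(2)] ab g(3,4)
  have l: "ctx l" "snd ` set l \<subseteq> obj V" using g(1) by (auto simp: val_def l_def ctx_def)
  then have [simp]: "tens l \<in> obj V" by simp
  have "finite (fst ` stg g)" by (simp add: stg_def)
  then obtain n where n: "n \<notin> fst ` stg g" using ex_new_if_finite infinite_UNIV_nat by blast
  have d: "dj g (var n a)" "dj (var n a) g" using n by (auto simp: dj_def)
  define k where "k = [(n, a)]"
  have e: "ap (evl V a b) (tn g (var n a)) = ap (evl V a b) (tn g' (var n a))"
    by (rule eq) (use d in simp_all)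
  have fl: "fst g = l" by (simp add: l_def)
  have k: "snd ` set k \<subseteq> obj V" by (simp add: k_def)
  have src: "src V (snd g) = tens l" "src V (snd g') = tens l" using fl l' by simp_all
  have tk: "tens k = a \<odot> unt V" by (simp add: k_def)
  \<comment> \<open>The arrow of a variable is a right unit constraint; together with
    \<open>spl\<close> it is split off as an invertible factor that can be cancelled.\<close>
  have m: "f \<cdot> (snd h \<otimes> run V a) \<cdot> spl l k = (f \<cdot> (snd h \<otimes> idn V a)) \<cdot> (idn V (tens l) \<otimes> run V a) \<cdot> spl l k"
    if "f \<in> arr V" "src V f = ihom V a b \<odot> a" "val h" "fst h = l" "ty h = ihom V a b" for f h
    using that el_obj[OF that(3)] l k tk by simp
  have "(evl V a b \<cdot> (snd g \<otimes> idn V a)) \<cdot> ((idn V (tens l) \<otimes> run V a) \<cdot> spl l k)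
    = (evl V a b \<cdot> (snd g' \<otimes> idn V a)) \<cdot> ((idn V (tens l) \<otimes> run V a) \<cdot> spl l k)"
    using e m[of "evl V a b" g] m[of "evl V a b" g'] g fl l'
    by (simp add: ap_def tn_def var_def k_def)
  then have E: "evl V a b \<cdot> (snd g \<otimes> idn V a) = evl V a b \<cdot> (snd g' \<otimes> idn V a)"
    by - (rule iso_cancel_right[of "(idn V (tens l) \<otimes> run V a) \<cdot> spl l k"], use l k tk src in simp_all)
  have "\<exists>!h. h \<in> hom V (tens l) (ihom V a b) \<and> evl V a b \<cdot> (h \<otimes> idn V a) = evl V a b \<cdot> (snd g \<otimes> idn V a)"
    by (rule closed) (use src in simp_all)
  moreover have "snd g \<in> hom V (tens l) (ihom V a b)" "snd g' \<in> hom V (tens l) (ihom V a b)"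
    using src by simp_all
  ultimately have "snd g = snd g'" using E by metis
  then show ?thesis using l' by (simp add: prod_eq_iff l_def)
qed

lemma curry_eqI:
  assumes "f \<in> arr V" "g \<in> arr V" "src V f = x" "src V g = x" "trg V f = ihom V a b" "trg V g = ihom V a b"
    "a \<in> obj V" "b \<in> obj V"
    and "\<And>u v. \<lbrakk>val u; ty u = x; val v; ty v = a; dj u v; dj v u\<rbrakk>
      \<Longrightarrow> ap (evl V a b) (tn (ap f u) v) = ap (evl V a b) (tn (ap g u) v)"
  shows "f = g"
proof (rule arr_eqI1[of f g x])
  fix u assume u: "val u" "ty u = x"
  show "ap f u = ap g u"
    by (rule ihom_eqI[of _ _ a b]) (use assms u in simp_all)
qed (use assms in simp_all)

end

section \<open>Enriched categories, elementwise\<close>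

context sym_mon_closed
begin

abbreviation cm :: "('a, 'o, 'm) vcat \<Rightarrow> 'a \<Rightarrow> 'a \<Rightarrow> 'a \<Rightarrow> (nat \<times> 'o) list \<times> 'm \<Rightarrow>
    (nat \<times> 'o) list \<times> 'm \<Rightarrow> (nat \<times> 'o) list \<times> 'm" where
  "cm A x y z g f \<equiv> ap (Comp A x y z) (tn g f)"

abbreviation app :: "'o \<Rightarrow> 'o \<Rightarrow> (nat \<times> 'o) list \<times> 'm \<Rightarrow> (nat \<times> 'o) list \<times> 'm \<Rightarrow>
    (nat \<times> 'o) list \<times> 'm" where
  "app a b g u \<equiv> ap (evl V a b) (tn g u)"

lemma vcat_arr [simp]:
  assumes "vcategory V A"
  shows "\<lbrakk>x \<in> Ob A; y \<in> Ob A\<rbrakk> \<Longrightarrow> Hom A x y \<in> obj V"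
    "x \<in> Ob A \<Longrightarrow> Id A x \<in> arr V" "x \<in> Ob A \<Longrightarrow> src V (Id A x) = unt V"
    "x \<in> Ob A \<Longrightarrow> trg V (Id A x) = Hom A x x"
    "\<lbrakk>x \<in> Ob A; y \<in> Ob A; z \<in> Ob A\<rbrakk> \<Longrightarrow> Comp A x y z \<in> arr V"
    "\<lbrakk>x \<in> Ob A; y \<in> Ob A; z \<in> Ob A\<rbrakk> \<Longrightarrow> src V (Comp A x y z) = Hom A y z \<odot> Hom A x y"
    "\<lbrakk>x \<in> Ob A; y \<in> Ob A; z \<in> Ob A\<rbrakk> \<Longrightarrow> trg V (Comp A x y z) = Hom A x z"
  using assms unfolding vcategory_def by auto

lemma cm_assoc [simp]:
  assumes A: "vcategory V A" and ob: "w \<in> Ob A" "x \<in> Ob A" "y \<in> Ob A" "z \<in> Ob A"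
    and el: "val h" "val g" "val f" "ty h = Hom A y z" "ty g = Hom A x y" "ty f = Hom A w x"
      "dj h g" "dj h f" "dj g f"
  shows "cm A w x z (cm A x y z h g) f = cm A w y z h (cm A w x y g f)"
proof -
  have "Comp A w x z \<cdot> (Comp A x y z \<otimes> idn V (Hom A w x)) =
        Comp A w y z \<cdot> (idn V (Hom A y z) \<otimes> Comp A w x y) \<cdot> asc V (Hom A y z) (Hom A x y) (Hom A w x)"
    using A ob unfolding vcategory_def by blast
  from arg_cong[OF this, of "\<lambda>m. ap m (tn (tn h g) f)"] show ?thesis
    using assms by simp
qed

lemma cm_Id [simp]:
  assumes A: "vcategory V A" and ob: "x \<in> Ob A" "y \<in> Ob A" and el: "val f" "ty f = Hom A x y"
  shows "cm A x y y (gl (Id A y)) f = f" "cm A x x y f (gl (Id A x)) = f"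
proof -
  have "Comp A x y y \<cdot> (Id A y \<otimes> idn V (Hom A x y)) = lun V (Hom A x y)"
      "Comp A x x y \<cdot> (idn V (Hom A x y) \<otimes> Id A x) = run V (Hom A x y)"
    using A ob unfolding vcategory_def by blast+
  from arg_cong[OF this(1), of "\<lambda>m. ap m (tn star f)"] arg_cong[OF this(2), of "\<lambda>m. ap m (tn f star)"]
  show "cm A x y y (gl (Id A y)) f = f" "cm A x x y f (gl (Id A x)) = f"
    using assms by simp_all
qed

text \<open>Converse of \<open>cm_assoc\<close> and \<open>cm_Id\<close>: generic elements recover
  the equations of arrows, so a category may be verified as if it were enriched in sets.\<close>

lemma vcategoryI:
  assumes "\<And>x y. \<lbrakk>x \<in> Ob A; y \<in> Ob A\<rbrakk> \<Longrightarrow> Hom A x y \<in> obj V"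
    and "\<And>x. x \<in> Ob A \<Longrightarrow> Id A x \<in> hom V (unt V) (Hom A x x)"
    and "\<And>x y z. \<lbrakk>x \<in> Ob A; y \<in> Ob A; z \<in> Ob A\<rbrakk>
      \<Longrightarrow> Comp A x y z \<in> hom V (Hom A y z \<odot> Hom A x y) (Hom A x z)"
    and "\<And>w x y z h g f. \<lbrakk>w \<in> Ob A; x \<in> Ob A; y \<in> Ob A; z \<in> Ob A; val h; val g; val f;
      ty h = Hom A y z; ty g = Hom A x y; ty f = Hom A w x; dj h g; dj h f; dj g f; dj g h; dj f h; dj f g\<rbrakk>
      \<Longrightarrow> cm A w x z (cm A x y z h g) f = cm A w y z h (cm A w x y g f)"
    and "\<And>x y f. \<lbrakk>x \<in> Ob A; y \<in> Ob A; val f; ty f = Hom A x y\<rbrakk>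
      \<Longrightarrow> cm A x y y (gl (Id A y)) f = f \<and> cm A x x y f (gl (Id A x)) = f"
  shows "vcategory V A"
proof -
  have 1: "Comp A w x z \<cdot> (Comp A x y z \<otimes> idn V (Hom A w x)) =
        Comp A w y z \<cdot> (idn V (Hom A y z) \<otimes> Comp A w x y) \<cdot> asc V (Hom A y z) (Hom A x y) (Hom A w x)"
    if "w \<in> Ob A" "x \<in> Ob A" "y \<in> Ob A" "z \<in> Ob A" for w x y z
    by (rule arr_eqI3[of _ _ "Hom A y z" "Hom A x y" "Hom A w x"]) (use that assms(1-3) assms(4)[OF that] in simp_all)
  have 2: "Comp A x y y \<cdot> (Id A y \<otimes> idn V (Hom A x y)) = lun V (Hom A x y)"
      "Comp A x x y \<cdot> (idn V (Hom A x y) \<otimes> Id A x) = run V (Hom A x y)"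
    if ob: "x \<in> Ob A" "y \<in> Ob A" for x y
  proof -
    let ?f = "var 0 (Hom A x y)"
    show "Comp A x y y \<cdot> (Id A y \<otimes> idn V (Hom A x y)) = lun V (Hom A x y)"
      by (rule arr_eq_on_iso[of _ _ "tn star ?f"]) (use that assms(1-3) assms(5)[of x y ?f] in auto)
    show "Comp A x x y \<cdot> (idn V (Hom A x y) \<otimes> Id A x) = run V (Hom A x y)"
      by (rule arr_eq_on_iso[of _ _ "tn ?f star"]) (use that assms(1-3) assms(5)[of x y ?f] in auto)
  qed
  show ?thesis unfolding vcategory_def using assms(1-3) 1 2 by blast
qed

lemma gl_eqD: "\<lbrakk>gl f = gl g; f \<in> hom V (unt V) a; g \<in> hom V (unt V) a\<rbrakk> \<Longrightarrow> f = g"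
  by (rule arr_eqI_unt) auto

lemma ecomp_simps [simp]:
  assumes "vcategory V A" "x \<in> Ob A" "y \<in> Ob A" "z \<in> Ob A" "g \<in> arr V" "src V g = unt V"
    "trg V g = Hom A y z" "f \<in> arr V" "src V f = unt V" "trg V f = Hom A x y"
  shows "ecomp V A x y z g f \<in> arr V" "src V (ecomp V A x y z g f) = unt V"
    "trg V (ecomp V A x y z g f) = Hom A x z" "gl (ecomp V A x y z g f) = cm A x y z (gl g) (gl f)"
  using assms unfolding ecomp_def by simp_all

lemma viso_iff:
  assumes "vcategory V A" "x \<in> Ob A" "y \<in> Ob A"
  shows "viso V A x y f \<longleftrightarrow> f \<in> hom V (unt V) (Hom A x y) \<and> (\<exists>g \<in> hom V (unt V) (Hom A y x).
    cm A x y x (gl g) (gl f) = gl (Id A x) \<and> cm A y x y (gl f) (gl g) = gl (Id A y))"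
proof -
  have "ecomp V A x y x g f = Id A x \<longleftrightarrow> cm A x y x (gl g) (gl f) = gl (Id A x)"
      "ecomp V A y x y f g = Id A y \<longleftrightarrow> cm A y x y (gl f) (gl g) = gl (Id A y)"
    if "f \<in> hom V (unt V) (Hom A x y)" "g \<in> hom V (unt V) (Hom A y x)" for f g
  proof -
    have e: "gl (ecomp V A x y x g f) = cm A x y x (gl g) (gl f)" "gl (ecomp V A y x y f g) = cm A y x y (gl f) (gl g)"
      using that assms by simp_all
    have m: "ecomp V A x y x g f \<in> hom V (unt V) (Hom A x x)" "Id A x \<in> hom V (unt V) (Hom A x x)"
      "ecomp V A y x y f g \<in> hom V (unt V) (Hom A y y)" "Id A y \<in> hom V (unt V) (Hom A y y)"
      using that assms by simp_all
    show "ecomp V A x y x g f = Id A x \<longleftrightarrow> cm A x y x (gl g) (gl f) = gl (Id A x)"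
      using gl_eqD[OF _ m(1,2)] e(1) by metis
    show "ecomp V A y x y f g = Id A y \<longleftrightarrow> cm A y x y (gl f) (gl g) = gl (Id A y)"
      using gl_eqD[OF _ m(3,4)] e(2) by metis
  qed
  then show ?thesis unfolding viso_def by blast
qed

subsection \<open>The self-enrichment, opposites and full subcategories\<close>

lemma vself_sel [simp]: "Ob (vself V) = obj V" "Hom (vself V) = ihom V"
  by (simp_all add: vself_def)

lemma vself_arr:
  "a \<in> obj V \<Longrightarrow> Id (vself V) a \<in> hom V (unt V) (ihom V a a)"
  "\<lbrakk>a \<in> obj V; b \<in> obj V; c \<in> obj V\<rbrakk>
    \<Longrightarrow> Comp (vself V) a b c \<in> hom V (ihom V b c \<odot> ihom V a b) (ihom V a c)"
  by (simp_all add: vself_def)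

lemma app_vself [simp]:
  "\<lbrakk>val u; ty u = a\<rbrakk> \<Longrightarrow> app a a (gl (Id (vself V) a)) u = u"
  "\<lbrakk>a \<in> obj V; b \<in> obj V; c \<in> obj V; val g; val f; val u; ty g = ihom V b c; ty f = ihom V a b;
    ty u = a; dj g f; dj g u; dj f u\<rbrakk>
    \<Longrightarrow> app a c (cm (vself V) a b c g f) u = app b c g (app a b f u)"
  using el_obj[of u] by (auto simp add: vself_def)

lemma vcategory_vself [simp]: "vcategory V (vself V)"
proof (rule vcategoryI)
  fix w x y z h g f
  assume *: "w \<in> Ob (vself V)" "x \<in> Ob (vself V)" "y \<in> Ob (vself V)" "z \<in> Ob (vself V)"
    "val h" "val g" "val f" "ty h = Hom (vself V) y z" "ty g = Hom (vself V) x y" "ty f = Hom (vself V) w x"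
    "dj h g" "dj h f" "dj g f" "dj g h" "dj f h" "dj f g"
  show "cm (vself V) w x z (cm (vself V) x y z h g) f = cm (vself V) w y z h (cm (vself V) w x y g f)"
    by (rule ihom_eqI[of _ _ w z]) (use * vself_arr in auto)
next
  fix x y f
  assume *: "x \<in> Ob (vself V)" "y \<in> Ob (vself V)" "val f" "ty f = Hom (vself V) x y"
  show "cm (vself V) x y y (gl (Id (vself V) y)) f = f \<and> cm (vself V) x x y f (gl (Id (vself V) x)) = f"
    by (intro conjI; rule ihom_eqI[of _ _ x y]) (use * vself_arr in auto)
qed (use vself_arr in auto)

lemma vop_sel [simp]: "Ob (vop V A) = Ob A" "Hom (vop V A) x y = Hom A y x" "Id (vop V A) = Id A"
  by (simp_all add: vop_def)

lemma cm_vop [simp]: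
  assumes "vcategory V A" "x \<in> Ob A" "y \<in> Ob A" "z \<in> Ob A"
    "val g" "val f" "dj g f" "ty g = Hom A z y" "ty f = Hom A y x"
  shows "cm (vop V A) x y z g f = cm A z y x f g"
  using assms by (simp add: vop_def)

lemma vcategory_vop [simp]:
  assumes "vcategory V A"
  shows "vcategory V (vop V A)"
proof (rule vcategoryI)
  fix x y z
  assume "x \<in> Ob (vop V A)" "y \<in> Ob (vop V A)" "z \<in> Ob (vop V A)"
  then show "Comp (vop V A) x y z \<in> hom V (Hom (vop V A) y z \<odot> Hom (vop V A) x y) (Hom (vop V A) x z)"
    using assms by (simp add: vop_def)
qed (use assms in auto)

text \<open>The two braidings cancel by symmetry, and off the objects \<open>vop\<close> merely
  reverses the arguments. Having an equality is what allows statements about the double opposite to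
  be rewritten.\<close>

lemma vop_vop [simp]:
  assumes "vcategory V A"
  shows "vop V (vop V A) = A"
proof -
  have "Comp (vop V (vop V A)) x y z = Comp A x y z" for x y z
    using assms by (simp add: vop_def)
  then show ?thesis by (auto simp: vop_def intro!: vcat.equality)
qed

lemma full_sub_sel [simp]:
  "Ob (full_sub A P) = P" "Hom (full_sub A P) = Hom A" "Id (full_sub A P) = Id A"
  "Comp (full_sub A P) = Comp A"
  by (simp_all add: full_sub_def)

lemma vcategory_full_sub [simp]:
  assumes "vcategory V A" "P \<subseteq> Ob A"
  shows "vcategory V (full_sub A P)"
  using assms unfolding vcategory_def full_sub_sel by blast

subsection \<open>Functors and natural transformations\<close>

lemma mk_vfun_sel [simp]:
  "x \<in> Ob A \<Longrightarrow> fob (mk_vfun A fo fa) x = fo x"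
  "\<lbrakk>x \<in> Ob A; y \<in> Ob A\<rbrakk> \<Longrightarrow> far (mk_vfun A fo fa) x y = fa x y"
  by (simp_all add: mk_vfun_def)

lemma mk_vfun_cong:
  assumes "Ob A = Ob A'" "\<And>x. x \<in> Ob A \<Longrightarrow> fo x = fo' x"
    "\<And>x y. \<lbrakk>x \<in> Ob A; y \<in> Ob A\<rbrakk> \<Longrightarrow> fa x y = fa' x y"
  shows "mk_vfun A fo fa = mk_vfun A' fo' fa'"
  using assms by (auto simp: mk_vfun_def fun_eq_iff)

lemma mk_vfun_idem: "mk_vfun A (fob (mk_vfun A fo fa)) (far (mk_vfun A fo fa)) = mk_vfun A fo fa"
  by (rule mk_vfun_cong) simp_all

lemma vfunctor_arr [simp]:
  assumes "vfunctor V A C F"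
  shows "x \<in> Ob A \<Longrightarrow> fob F x \<in> Ob C"
    "\<lbrakk>x \<in> Ob A; y \<in> Ob A\<rbrakk> \<Longrightarrow> far F x y \<in> arr V"
    "\<lbrakk>x \<in> Ob A; y \<in> Ob A\<rbrakk> \<Longrightarrow> src V (far F x y) = Hom A x y"
    "\<lbrakk>x \<in> Ob A; y \<in> Ob A\<rbrakk> \<Longrightarrow> trg V (far F x y) = Hom C (fob F x) (fob F y)"
  using assms unfolding vfunctor_def by auto

lemma vfunctor_mk: "vfunctor V A C F \<Longrightarrow> mk_vfun A (fob F) (far F) = F"
  unfolding vfunctor_def by simp

lemma vfunctor_eqI:
  assumes "vfunctor V A C F" "vfunctor V A C G" "\<And>x. x \<in> Ob A \<Longrightarrow> fob F x = fob G x"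
    "\<And>x y. \<lbrakk>x \<in> Ob A; y \<in> Ob A\<rbrakk> \<Longrightarrow> far F x y = far G x y"
  shows "F = G"
  using vfunctor_mk[OF assms(1)] vfunctor_mk[OF assms(2)] mk_vfun_cong[of A A "fob F" "fob G" "far F" "far G"]
    assms(3,4) by metis

lemma far_Id [simp]:
  assumes "vfunctor V A C F" "vcategory V A" "x \<in> Ob A"
  shows "ap (far F x x) (gl (Id A x)) = gl (Id C (fob F x))"
proof -
  have "far F x x \<cdot> Id A x = Id C (fob F x)" using assms unfolding vfunctor_def by auto
  from arg_cong[OF this, of gl] show ?thesis using assms by simp
qed

lemma far_cm:
  assumes "vfunctor V A C F" "vcategory V A" "x \<in> Ob A" "y \<in> Ob A" "z \<in> Ob A"
    "val g" "val f" "dj g f" "ty g = Hom A y z" "ty f = Hom A x y" "vcategory V C"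
  shows "ap (far F x z) (cm A x y z g f) = cm C (fob F x) (fob F y) (fob F z) (ap (far F y z) g) (ap (far F x y) f)"
proof -
  have "far F x z \<cdot> Comp A x y z = Comp C (fob F x) (fob F y) (fob F z) \<cdot> (far F y z \<otimes> far F x y)"
    using assms unfolding vfunctor_def by auto
  from arg_cong[OF this, of "\<lambda>m. ap m (tn g f)"] show ?thesis using assms by simp
qed

lemma vfunctorI:
  assumes "vcategory V A" "vcategory V C" "F = mk_vfun A (fob F) (far F)"
    and "\<And>x. x \<in> Ob A \<Longrightarrow> fob F x \<in> Ob C"
    and "\<And>x y. \<lbrakk>x \<in> Ob A; y \<in> Ob A\<rbrakk> \<Longrightarrow> far F x y \<in> hom V (Hom A x y) (Hom C (fob F x) (fob F y))"
    and "\<And>x. x \<in> Ob A \<Longrightarrow> ap (far F x x) (gl (Id A x)) = gl (Id C (fob F x))"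
    and "\<And>x y z g f. \<lbrakk>x \<in> Ob A; y \<in> Ob A; z \<in> Ob A; val g; val f; ty g = Hom A y z; ty f = Hom A x y;
      dj g f; dj f g\<rbrakk>
      \<Longrightarrow> ap (far F x z) (cm A x y z g f) = cm C (fob F x) (fob F y) (fob F z) (ap (far F y z) g) (ap (far F x y) f)"
  shows "vfunctor V A C F"
proof -
  have 1: "far F x x \<cdot> Id A x = Id C (fob F x)" if "x \<in> Ob A" for x
    by (rule arr_eqI_unt) (use that assms(1,2,4-6) in auto)
  have 2: "far F x z \<cdot> Comp A x y z = Comp C (fob F x) (fob F y) (fob F z) \<cdot> (far F y z \<otimes> far F x y)"
    if "x \<in> Ob A" "y \<in> Ob A" "z \<in> Ob A" for x y z
    by (rule arr_eqI2[of _ _ "Hom A y z" "Hom A x y"]) (use that assms(1,2,4,5,7) in auto)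
  show ?thesis unfolding vfunctor_def using assms(3-5) 1 2 by blast
qed

lemma vfunctor_vself_objD: "\<lbrakk>vfunctor V A (vself V) F; x \<in> Ob A\<rbrakk> \<Longrightarrow> fob F x \<in> obj V"
  using vfunctor_arr(1)[of A "vself V" F x] by simp

text \<open>A functor to \<open>V\<close> is an action of the morphisms of \<open>A\<close> on
  elements; extensionality of internal homs turns the two laws of an action into
  functoriality.\<close>

lemma vself_functorI:
  assumes "vcategory V A" "F = mk_vfun A (fob F) (far F)"
    and ob: "\<And>x. x \<in> Ob A \<Longrightarrow> fob F x \<in> obj V"
    and ar: "\<And>x y. \<lbrakk>x \<in> Ob A; y \<in> Ob A\<rbrakk> \<Longrightarrow> far F x y \<in> hom V (Hom A x y) (ihom V (fob F x) (fob F y))"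
    and one: "\<And>x u. \<lbrakk>x \<in> Ob A; val u; ty u = fob F x\<rbrakk>
      \<Longrightarrow> app (fob F x) (fob F x) (ap (far F x x) (gl (Id A x))) u = u"
    and mult: "\<And>x y z g f u. \<lbrakk>x \<in> Ob A; y \<in> Ob A; z \<in> Ob A; val g; val f; ty g = Hom A y z;
      ty f = Hom A x y; dj g f; dj f g; val u; ty u = fob F x; dj g u; dj u g; dj f u; dj u f\<rbrakk>
      \<Longrightarrow> app (fob F x) (fob F z) (ap (far F x z) (cm A x y z g f)) u =
        app (fob F y) (fob F z) (ap (far F y z) g) (app (fob F x) (fob F y) (ap (far F x y) f) u)"
  shows "vfunctor V A (vself V) F"
proof (rule vfunctorI)
  fix x assume x: "x \<in> Ob A"
  show "ap (far F x x) (gl (Id A x)) = gl (Id (vself V) (fob F x))"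
    by (rule ihom_eqI[of _ _ "fob F x" "fob F x"])
      (use x assms(1) ob ar one in \<open>simp_all add: vcategory_vself[THEN vcat_arr(4)]\<close>)
next
  fix x y z g f
  assume *: "x \<in> Ob A" "y \<in> Ob A" "z \<in> Ob A" "val g" "val f" "ty g = Hom A y z" "ty f = Hom A x y"
    "dj g f" "dj f g"
  show "ap (far F x z) (cm A x y z g f) =
    cm (vself V) (fob F x) (fob F y) (fob F z) (ap (far F y z) g) (ap (far F x y) f)"
    by (rule ihom_eqI[of _ _ "fob F x" "fob F z"])
      (use * assms(1) ob ar mult in \<open>simp_all add: vcategory_vself[THEN vcat_arr(7)]\<close>)
qed (use assms in simp_all)

lemma app_far_Id:
  assumes "vfunctor V A (vself V) F" "vcategory V A" "x \<in> Ob A" "val u" "ty u = fob F x"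
  shows "app (fob F x) (fob F x) (ap (far F x x) (gl (Id A x))) u = u"
  using assms by simp

lemma app_far_cm:
  assumes "vfunctor V A (vself V) F" "vcategory V A" "x \<in> Ob A" "y \<in> Ob A" "z \<in> Ob A"
    "val g" "val f" "dj g f" "ty g = Hom A y z" "ty f = Hom A x y" "val u" "ty u = fob F x" "dj g u" "dj f u"
  shows "app (fob F x) (fob F z) (ap (far F x z) (cm A x y z g f)) u =
    app (fob F y) (fob F z) (ap (far F y z) g) (app (fob F x) (fob F y) (ap (far F x y) f) u)"
proof -
  have "fob F x \<in> obj V" "fob F y \<in> obj V" "fob F z \<in> obj V"
    using assms(3-5) vfunctor_vself_objD[OF assms(1)] by simp_all
  then show ?thesis using assms by (simp add: far_cm[OF assms(1)])
qed

lemma vnatD: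
  assumes "vnat V A C F G \<alpha>"
  shows "x \<in> Ob A \<Longrightarrow> \<alpha> x \<in> hom V (unt V) (Hom C (fob F x) (fob G x))"
    and "\<lbrakk>vfunctor V A C F; vfunctor V A C G; vcategory V A; vcategory V C; x \<in> Ob A; y \<in> Ob A;
       val k; ty k = Hom A x y\<rbrakk>
      \<Longrightarrow> cm C (fob F x) (fob F y) (fob G y) (gl (\<alpha> y)) (ap (far F x y) k) =
          cm C (fob F x) (fob G x) (fob G y) (ap (far G x y) k) (gl (\<alpha> x))"
proof -
  show 1: "\<alpha> x \<in> hom V (unt V) (Hom C (fob F x) (fob G x))" if "x \<in> Ob A" for x
    using assms that unfolding vnat_def by blast
  assume *: "vfunctor V A C F" "vfunctor V A C G" "vcategory V A" "vcategory V C" "x \<in> Ob A" "y \<in> Ob A"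
       "val k" "ty k = Hom A x y"
  have "Comp C (fob F x) (fob F y) (fob G y) \<cdot> (\<alpha> y \<otimes> far F x y) \<cdot> luni (Hom A x y) =
        Comp C (fob F x) (fob G x) (fob G y) \<cdot> (far G x y \<otimes> \<alpha> x) \<cdot> runi (Hom A x y)"
    using assms * unfolding vnat_def by blast
  from arg_cong[OF this, of "\<lambda>m. ap m k"]
  show "cm C (fob F x) (fob F y) (fob G y) (gl (\<alpha> y)) (ap (far F x y) k) =
          cm C (fob F x) (fob G x) (fob G y) (ap (far G x y) k) (gl (\<alpha> x))"
    using * 1[of x] 1[of y] by simp
qed

lemma vnatI:
  assumes *: "vfunctor V A C F" "vfunctor V A C G" "vcategory V A" "vcategory V C"
    and 1: "\<And>x. x \<in> Ob A \<Longrightarrow> \<alpha> x \<in> hom V (unt V) (Hom C (fob F x) (fob G x))"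
    and 2: "\<And>x y k. \<lbrakk>x \<in> Ob A; y \<in> Ob A; val k; ty k = Hom A x y\<rbrakk>
      \<Longrightarrow> cm C (fob F x) (fob F y) (fob G y) (gl (\<alpha> y)) (ap (far F x y) k) =
          cm C (fob F x) (fob G x) (fob G y) (ap (far G x y) k) (gl (\<alpha> x))"
  shows "vnat V A C F G \<alpha>"
proof -
  have "Comp C (fob F x) (fob F y) (fob G y) \<cdot> (\<alpha> y \<otimes> far F x y) \<cdot> luni (Hom A x y) =
        Comp C (fob F x) (fob G x) (fob G y) \<cdot> (far G x y \<otimes> \<alpha> x) \<cdot> runi (Hom A x y)"
    if "x \<in> Ob A" "y \<in> Ob A" for x y
    by (rule arr_eqI1[of _ _ "Hom A x y"]) (use that * 1[of x] 1[of y] 2[of x y] in simp_all)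
  then show ?thesis unfolding vnat_def using 1 by blast
qed

lemma vfunctor_vcompose [simp]:
  assumes "vfunctor V A C F" "vfunctor V C D G" "vcategory V A" "vcategory V C" "vcategory V D"
  shows "vfunctor V A D (vcompose V A G F)"
proof (rule vfunctorI)
  show "vcompose V A G F = mk_vfun A (fob (vcompose V A G F)) (far (vcompose V A G F))"
    unfolding vcompose_def by (rule mk_vfun_idem[symmetric])
qed (use assms in \<open>auto simp: vcompose_def far_cm[OF assms(1)] far_cm[OF assms(2)]\<close>)

lemma vcompose_sel [simp]:
  "x \<in> Ob A \<Longrightarrow> fob (vcompose V A G F) x = fob G (fob F x)"
  "\<lbrakk>x \<in> Ob A; y \<in> Ob A\<rbrakk> \<Longrightarrow> far (vcompose V A G F) x y = far G (fob F x) (fob F y) \<cdot> far F x y"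
  by (simp_all add: vcompose_def)

lemma vid_sel [simp]:
  "x \<in> Ob A \<Longrightarrow> fob (vid V A) x = x"
  "\<lbrakk>x \<in> Ob A; y \<in> Ob A\<rbrakk> \<Longrightarrow> far (vid V A) x y = idn V (Hom A x y)"
  by (simp_all add: vid_def)

lemma vfunctor_vid [simp]:
  assumes "vcategory V A"
  shows "vfunctor V A A (vid V A)"
proof (rule vfunctorI)
  show "vid V A = mk_vfun A (fob (vid V A)) (far (vid V A))"
    unfolding vid_def by (rule mk_vfun_idem[symmetric])
qed (use assms in auto)

lemma vopfun_sel [simp]: "fob (vopfun F) = fob F" "far (vopfun F) x y = far F y x"
  by (simp_all add: vopfun_def)

text \<open>Functors are equal as records, so their values off the objects matter; reversing the
  arguments leaves the undefined ones in place.\<close>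

lemma vfunctor_vopfun:
  assumes "vfunctor V A C F" "vcategory V A" "vcategory V C"
  shows "vfunctor V (vop V A) (vop V C) (vopfun F)"
proof (rule vfunctorI)
  have "fob F = fob (mk_vfun A (fob F) (far F))" "far F = far (mk_vfun A (fob F) (far F))"
    using vfunctor_mk[OF assms(1)] by simp_all
  note sel = this
  have "fob F x = undefined" if "x \<notin> Ob A" for x
    by (subst sel(1)) (simp add: mk_vfun_def that)
  moreover have "far F x y = undefined" if "x \<notin> Ob A \<or> y \<notin> Ob A" for x y
    by (subst sel(2)) (use that in \<open>auto simp: mk_vfun_def\<close>)
  ultimately show "vopfun F = mk_vfun (vop V A) (fob (vopfun F)) (far (vopfun F))"
    unfolding vopfun_def mk_vfun_def by (auto simp: fun_eq_iff)
qed (use assms in \<open>auto simp: far_cm[OF assms(1)]\<close>)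

end

section \<open>Functor categories, elementwise\<close>

context sym_mon_closed
begin

abbreviation vpre :: "('a, 'o, 'm) vcat \<Rightarrow> ('a, 'o, 'm) vfun \<Rightarrow> bool" where
  "vpre A F \<equiv> vfunctor V A (vself V) F"

abbreviation NT :: "('a, 'o, 'm) vcat \<Rightarrow> ('a, 'o, 'm) vfun \<Rightarrow> ('a, 'o, 'm) vfun \<Rightarrow> 'o" where
  "NT A F G \<equiv> nat_ob V A (vself V) F G"

abbreviation pr :: "('a, 'o, 'm) vcat \<Rightarrow> ('a, 'o, 'm) vfun \<Rightarrow> ('a, 'o, 'm) vfun \<Rightarrow> 'a \<Rightarrow> 'm" where
  "pr A F G \<equiv> nat_proj V A (vself V) F G"

abbreviation nv :: "('a, 'o, 'm) vcat \<Rightarrow> ('a, 'o, 'm) vfun \<Rightarrow> ('a, 'o, 'm) vfun \<Rightarrow> 'a \<Rightarrow>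
    (nat \<times> 'o) list \<times> 'm \<Rightarrow> (nat \<times> 'o) list \<times> 'm \<Rightarrow> (nat \<times> 'o) list \<times> 'm" where
  "nv A F G x n u \<equiv> app (fob F x) (fob G x) (ap (pr A F G x) n) u"

abbreviation act :: "('a, 'o, 'm) vfun \<Rightarrow> 'a \<Rightarrow> 'a \<Rightarrow>
    (nat \<times> 'o) list \<times> 'm \<Rightarrow> (nat \<times> 'o) list \<times> 'm \<Rightarrow> (nat \<times> 'o) list \<times> 'm" where
  "act F x y k u \<equiv> app (fob F x) (fob F y) (ap (far F x y) k) u"

lemma vself_comp_arr [simp]:
  "\<lbrakk>a \<in> obj V; b \<in> obj V; c \<in> obj V\<rbrakk> \<Longrightarrow> Comp (vself V) a b c \<in> arr V"
  "\<lbrakk>a \<in> obj V; b \<in> obj V; c \<in> obj V\<rbrakk> \<Longrightarrow> src V (Comp (vself V) a b c) = ihom V b c \<odot> ihom V a b"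
  "\<lbrakk>a \<in> obj V; b \<in> obj V; c \<in> obj V\<rbrakk> \<Longrightarrow> trg V (Comp (vself V) a b c) = ihom V a c"
  "a \<in> obj V \<Longrightarrow> Id (vself V) a \<in> arr V" "a \<in> obj V \<Longrightarrow> src V (Id (vself V) a) = unt V"
  "a \<in> obj V \<Longrightarrow> trg V (Id (vself V) a) = ihom V a a"
  using vself_arr by auto

lemmas vfunctor_vself_objD [simp]

lemma fresh_var:
  assumes "a \<in> obj V"
  obtains n where "dj (var n a) t" "dj t (var n a)"
proof -
  have "finite (fst ` stg t)" by (simp add: stg_def)
  then obtain n where "n \<notin> fst ` stg t" using ex_new_if_finite infinite_UNIV_nat by blast
  then show ?thesis using that by (auto simp: dj_def)
qed

text \<open>One generic parameter \<open>t\<close> suffices. It is left open because the useful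
  choice depends on \<open>X\<close>: a variable in general, \<open>star\<close> for the unit
  object, two variables when \<open>X\<close> is a tensor product whose factors have to be
  seen.\<close>

lemma wedgeI_on_iso:
  assumes A: "vcategory V A" and F: "vpre A F" and G: "vpre A G"
    and t: "val t" "ty t = X" "iso_arr V (snd t)"
    and ar: "\<And>x. x \<in> Ob A \<Longrightarrow> \<tau> x \<in> hom V X (ihom V (fob F x) (fob G x))"
    and nat: "\<And>x y k u. \<lbrakk>x \<in> Ob A; y \<in> Ob A; val k; val u; ty k = Hom A x y;
      ty u = fob F x; dj k t; dj t k; dj k u; dj u k; dj t u; dj u t\<rbrakk>
      \<Longrightarrow> act G x y k (app (fob F x) (fob G x) (ap (\<tau> x) t) u) =
          app (fob F y) (fob G y) (ap (\<tau> y) t) (act F x y k u)"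
  shows "wedge V A (vself V) F G X \<tau>"
proof -
  have X: "X \<in> obj V" using el_obj(1)[OF t(1)] t(2) by simp
  note [simp] = vfunctor_vself_objD[OF F] vfunctor_vself_objD[OF G] A X
    vfunctor_arr[OF F] vfunctor_arr[OF G]
  have "Comp (vself V) (fob F x) (fob G x) (fob G y) \<cdot> (far G x y \<otimes> \<tau> x) =
        Comp (vself V) (fob F x) (fob F y) (fob G y) \<cdot> (\<tau> y \<otimes> far F x y) \<cdot> brd V (Hom A x y) X"
    if [simp]: "x \<in> Ob A" "y \<in> Ob A" for x y
  proof -
    obtain n where n: "dj (var n (Hom A x y)) t" "dj t (var n (Hom A x y))"
      by (rule fresh_var[of "Hom A x y" t]) simp_all
    let ?k = "var n (Hom A x y)"
    have "ap (Comp (vself V) (fob F x) (fob G x) (fob G y) \<cdot> (far G x y \<otimes> \<tau> x)) (tn ?k t) =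
      ap (Comp (vself V) (fob F x) (fob F y) (fob G y) \<cdot> (\<tau> y \<otimes> far F x y) \<cdot> brd V (Hom A x y) X) (tn ?k t)"
      by (rule ihom_eqI[of _ _ "fob F x" "fob G y"])
        (use n t ar[of x] ar[of y] nat[of x y ?k] in auto)
    then show ?thesis
      by - (rule arr_eq_on_iso[of _ _ "tn ?k t"], use n t ar[of x] ar[of y] in simp_all)
  qed
  then show ?thesis unfolding wedge_def using X ar by simp
qed

lemma wedgeI:
  assumes A: "vcategory V A" and F: "vpre A F" and G: "vpre A G" and X: "X \<in> obj V"
    and t: "\<And>x. x \<in> Ob A \<Longrightarrow> \<tau> x \<in> hom V X (ihom V (fob F x) (fob G x))"
    and nat: "\<And>x y k t u. \<lbrakk>x \<in> Ob A; y \<in> Ob A; val k; val t; val u; ty k = Hom A x y; ty t = X;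
      ty u = fob F x; dj k t; dj t k; dj k u; dj u k; dj t u; dj u t\<rbrakk>
      \<Longrightarrow> act G x y k (app (fob F x) (fob G x) (ap (\<tau> x) t) u) =
          app (fob F y) (fob G y) (ap (\<tau> y) t) (act F x y k u)"
  shows "wedge V A (vself V) F G X \<tau>"
  by (rule wedgeI_on_iso[OF A F G, of "var 0 X"]) (use X t nat in simp_all)

lemma wedgeI2:
  assumes A: "vcategory V A" and F: "vpre A F" and G: "vpre A G" and X: "X \<in> obj V" "Y \<in> obj V"
    and t: "\<And>x. x \<in> Ob A \<Longrightarrow> \<tau> x \<in> hom V (X \<odot> Y) (ihom V (fob F x) (fob G x))"
    and nat: "\<And>x y k t s u. \<lbrakk>x \<in> Ob A; y \<in> Ob A; val k; val t; val s; val u; ty k = Hom A x y; ty t = X;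
      ty s = Y; ty u = fob F x; dj t s; dj s t; dj k t; dj t k; dj k s; dj s k; dj k u; dj u k;
      dj t u; dj u t; dj s u; dj u s\<rbrakk>
      \<Longrightarrow> act G x y k (app (fob F x) (fob G x) (ap (\<tau> x) (tn t s)) u) =
          app (fob F y) (fob G y) (ap (\<tau> y) (tn t s)) (act F x y k u)"
  shows "wedge V A (vself V) F G (X \<odot> Y) \<tau>"
  by (rule wedgeI_on_iso[OF A F G, of "tn (var 0 X) (var 1 Y)"]) (use X t nat in simp_all)

lemma wedgeD:
  assumes w: "wedge V A (vself V) F G X \<tau>" and A: "vcategory V A" and F: "vpre A F" and G: "vpre A G"
  shows "X \<in> obj V"
    and "x \<in> Ob A \<Longrightarrow> \<tau> x \<in> arr V" "x \<in> Ob A \<Longrightarrow> src V (\<tau> x) = X"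
      "x \<in> Ob A \<Longrightarrow> trg V (\<tau> x) = ihom V (fob F x) (fob G x)"
    and "\<lbrakk>x \<in> Ob A; y \<in> Ob A; val k; val t; val u; ty k = Hom A x y; ty t = X;
      ty u = fob F x; dj k t; dj k u; dj t u\<rbrakk>
      \<Longrightarrow> app (fob F y) (fob G y) (ap (\<tau> y) t) (act F x y k u) =
          act G x y k (app (fob F x) (fob G x) (ap (\<tau> x) t) u)"
proof -
  show X [simp]: "X \<in> obj V" using w unfolding wedge_def by simp
  show t [simp]: "\<tau> x \<in> arr V" "src V (\<tau> x) = X" "trg V (\<tau> x) = ihom V (fob F x) (fob G x)"
    if "x \<in> Ob A" for x
    using w that unfolding wedge_def by simp_all
  note [simp] = vfunctor_vself_objD[OF F] vfunctor_vself_objD[OF G] A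
    vfunctor_arr[OF F] vfunctor_arr[OF G]
  assume *: "x \<in> Ob A" "y \<in> Ob A" "val k" "val t" "val u" "ty k = Hom A x y" "ty t = X"
      "ty u = fob F x" "dj k t" "dj k u" "dj t u"
  have "Comp (vself V) (fob F x) (fob G x) (fob G y) \<cdot> (far G x y \<otimes> \<tau> x) =
        Comp (vself V) (fob F x) (fob F y) (fob G y) \<cdot> (\<tau> y \<otimes> far F x y) \<cdot> brd V (Hom A x y) X"
    using w * unfolding wedge_def by simp
  from arg_cong[OF this, of "\<lambda>m. app (fob F x) (fob G y) (ap m (tn k t)) u"]
  show "app (fob F y) (fob G y) (ap (\<tau> y) t) (act F x y k u) =
          act G x y k (app (fob F x) (fob G x) (ap (\<tau> x) t) u)"
    using * dj_sym[of t k] by simp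
qed

lemma wedge_cmp:
  assumes w: "wedge V A (vself V) F G X \<tau>" and A: "vcategory V A" and F: "vpre A F" and G: "vpre A G"
    and h: "h \<in> arr V" "trg V h = X"
  shows "wedge V A (vself V) F G (src V h) (\<lambda>x. \<tau> x \<cdot> h)"
  by (rule wedgeI[OF A F G]) (use wedgeD[OF w A F G] h in auto)

text \<open>\<open>the_end\<close> is a choice and says nothing unless an end exists. The theory of
  \<open>vpsh V A\<close> is developed from this assumption; smallness of \<open>A\<close> supplies
  it in \<open>has_ends_small\<close>.\<close>

definition has_ends :: "('a, 'o, 'm) vcat \<Rightarrow> bool" where
  "has_ends A \<longleftrightarrow> vcategory V A \<and> (\<forall>F G. vpre A F \<and> vpre A G \<longrightarrow> (\<exists>E \<pi>. nat_end V A (vself V) F G E \<pi>))"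

lemma has_endsD [simp]: "has_ends A \<Longrightarrow> vcategory V A"
  by (simp add: has_ends_def)

lemma nat_end_nat_ob:
  assumes "has_ends A" "vpre A F" "vpre A G"
  shows "nat_end V A (vself V) F G (NT A F G) (pr A F G)"
proof -
  obtain E \<pi> where "nat_end V A (vself V) F G E \<pi>" using assms unfolding has_ends_def by blast
  then have "\<exists>p. nat_end V A (vself V) F G (fst p) (snd p)" by (intro exI[of _ "(E, \<pi>)"]) simp
  then show ?thesis unfolding nat_ob_def nat_proj_def the_end_def by (rule someI_ex)
qed

lemma nat_ob_arr [simp]:
  assumes "has_ends A" "vpre A F" "vpre A G"
  shows "NT A F G \<in> obj V" "x \<in> Ob A \<Longrightarrow> pr A F G x \<in> arr V" "x \<in> Ob A \<Longrightarrow> src V (pr A F G x) = NT A F G"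
    "x \<in> Ob A \<Longrightarrow> trg V (pr A F G x) = ihom V (fob F x) (fob G x)"
  using wedgeD(1-4)[of A F G "NT A F G" "pr A F G"] nat_end_nat_ob[OF assms] assms
  unfolding nat_end_def by simp_all

lemma nv_act:
  assumes "has_ends A" "vpre A F" "vpre A G" "x \<in> Ob A" "y \<in> Ob A" "val k" "val n" "val u"
    "ty k = Hom A x y" "ty n = NT A F G" "ty u = fob F x" "dj k n" "dj k u" "dj n u"
  shows "nv A F G y n (act F x y k u) = act G x y k (nv A F G x n u)"
  using wedgeD(5)[of A F G "NT A F G" "pr A F G"] nat_end_nat_ob[OF assms(1-3)] assms
  unfolding nat_end_def by simp

lemma nat_lift_props:
  assumes "has_ends A" "vpre A F" "vpre A G" "wedge V A (vself V) F G X \<tau>"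
  shows "nat_lift V A (vself V) F G X \<tau> \<in> hom V X (NT A F G) \<and>
    (\<forall>x \<in> Ob A. pr A F G x \<cdot> nat_lift V A (vself V) F G X \<tau> = \<tau> x)"
  unfolding nat_lift_def
  by (rule theI') (use nat_end_nat_ob[OF assms(1-3)] assms(4) in \<open>simp add: nat_end_def\<close>)

lemma nat_lift_simps:
  assumes "has_ends A" "vpre A F" "vpre A G" "wedge V A (vself V) F G X \<tau>"
  shows "nat_lift V A (vself V) F G X \<tau> \<in> arr V" "src V (nat_lift V A (vself V) F G X \<tau>) = X"
    "trg V (nat_lift V A (vself V) F G X \<tau>) = NT A F G"
    "\<lbrakk>x \<in> Ob A; val t; ty t = X\<rbrakk>
      \<Longrightarrow> ap (pr A F G x) (ap (nat_lift V A (vself V) F G X \<tau>) t) = ap (\<tau> x) t"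
proof -
  note p = nat_lift_props[OF assms]
  then show 1: "nat_lift V A (vself V) F G X \<tau> \<in> arr V" "src V (nat_lift V A (vself V) F G X \<tau>) = X"
    "trg V (nat_lift V A (vself V) F G X \<tau>) = NT A F G" by auto
  assume *: "x \<in> Ob A" "val t" "ty t = X"
  have "pr A F G x \<cdot> nat_lift V A (vself V) F G X \<tau> = \<tau> x" using p * by blast
  from arg_cong[OF this, of "\<lambda>m. ap m t"]
  show "ap (pr A F G x) (ap (nat_lift V A (vself V) F G X \<tau>) t) = ap (\<tau> x) t"
    using 1 * assms by simp
qed

text \<open>The projections of an end are jointly monic, so elements of an end behave like families
  of functions. The tensor product of the context of \<open>n\<close> is the vertex of the wedge to
  which uniqueness is applied.\<close>

lemma nat_ob_eqI:
  assumes FG: "has_ends A" "vpre A F" "vpre A G"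
    and n: "val n" "val n'" "ty n = NT A F G" "ty n' = NT A F G" "stg n = stg n'"
    and eq: "\<And>x u. \<lbrakk>x \<in> Ob A; val u; ty u = fob F x; dj n u; dj u n\<rbrakk> \<Longrightarrow> nv A F G x n u = nv A F G x n' u"
  shows "n = n'"
proof -
  note A = has_endsD[OF FG(1)]
  have p: "ap (pr A F G x) n = ap (pr A F G x) n'" if "x \<in> Ob A" for x
    by (rule ihom_eqI[of _ _ "fob F x" "fob G x"])
      (use that FG n eq[OF that] vfunctor_vself_objD[OF FG(2)] vfunctor_vself_objD[OF FG(3)] in simp_all)
  have E: "nat_end V A (vself V) F G (NT A F G) (pr A F G)" by (rule nat_end_nat_ob[OF FG])
  have w: "wedge V A (vself V) F G (src V (snd n)) (\<lambda>x. pr A F G x \<cdot> snd n)"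
    by (rule wedge_cmp[OF _ A FG(2,3)]) (use E n el_obj in \<open>auto simp: nat_end_def\<close>)
  have "\<exists>!h. h \<in> hom V (src V (snd n)) (NT A F G) \<and> (\<forall>x \<in> Ob A. pr A F G x \<cdot> h = pr A F G x \<cdot> snd n)"
    using E w unfolding nat_end_def by blast
  moreover have f: "fst n = fst n'" using sorted_set_unique[of "fst n" "fst n'"] n
    by (auto simp: val_def ctx_def stg_def)
  moreover have "snd n \<in> hom V (src V (snd n)) (NT A F G)" "snd n' \<in> hom V (src V (snd n)) (NT A F G)"
    using el_obj[OF n(1)] el_obj[OF n(2)] n f by simp_all
  moreover have "\<forall>x \<in> Ob A. pr A F G x \<cdot> snd n' = pr A F G x \<cdot> snd n" using p by (simp add: ap_def)
  ultimately show ?thesis by (metis prod_eq_iff)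
qed

lemma vpsh_sel [simp]:
  "Ob (vpsh V A) = {F. vpre A F}" "Hom (vpsh V A) = NT A"
  by (simp_all add: fun_cat_def)

lemma vpsh_Id [simp]:
  assumes A: "has_ends A" and F: "vpre A F"
  shows "Id (vpsh V A) F \<in> arr V" "src V (Id (vpsh V A) F) = unt V" "trg V (Id (vpsh V A) F) = NT A F F"
    "\<lbrakk>x \<in> Ob A; val u; ty u = fob F x\<rbrakk> \<Longrightarrow> nv A F F x (gl (Id (vpsh V A) F)) u = u"
proof -
  have w: "wedge V A (vself V) F F (unt V) (\<lambda>x. Id (vself V) (fob F x))"
    by (rule wedgeI_on_iso[of A F F star]) (use assms vfunctor_vself_objD[OF F] in simp_all)
  note l = nat_lift_simps[OF A F F w]
  have e: "Id (vpsh V A) F = nat_lift V A (vself V) F F (unt V) (\<lambda>x. Id (vself V) (fob F x))"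
    by (simp add: fun_cat_def)
  show "Id (vpsh V A) F \<in> arr V" "src V (Id (vpsh V A) F) = unt V" "trg V (Id (vpsh V A) F) = NT A F F"
    unfolding e using l by simp_all
  assume "x \<in> Ob A" "val u" "ty u = fob F x"
  then show "nv A F F x (gl (Id (vpsh V A) F)) u = u" unfolding e using l by simp
qed

lemma vpsh_Comp:
  assumes A: "has_ends A" and F: "vpre A F" and G: "vpre A G" and H: "vpre A H"
  shows "Comp (vpsh V A) F G H \<in> arr V" "src V (Comp (vpsh V A) F G H) = NT A G H \<odot> NT A F G"
    "trg V (Comp (vpsh V A) F G H) = NT A F H"
    "\<lbrakk>x \<in> Ob A; val m; val n; val u; ty m = NT A G H; ty n = NT A F G; ty u = fob F x; dj m n; dj m u; dj n u\<rbrakk>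
      \<Longrightarrow> nv A F H x (cm (vpsh V A) F G H m n) u = nv A G H x m (nv A F G x n u)"
proof -
  let ?\<tau> = "\<lambda>x. Comp (vself V) (fob F x) (fob G x) (fob H x) \<cdot> (pr A G H x \<otimes> pr A F G x)"
  let ?X = "NT A G H \<odot> NT A F G"
  have w: "wedge V A (vself V) F H ?X ?\<tau>"
    by (rule wedgeI2) (use assms in \<open>simp_all add: nv_act[OF A F G] nv_act[OF A G H]\<close>)
  note l = nat_lift_simps[OF A F H w]
  have e: "Comp (vpsh V A) F G H = nat_lift V A (vself V) F H ?X ?\<tau>"
    by (simp add: fun_cat_def)
  show "Comp (vpsh V A) F G H \<in> arr V" "src V (Comp (vpsh V A) F G H) = NT A G H \<odot> NT A F G"
    "trg V (Comp (vpsh V A) F G H) = NT A F H"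
    unfolding e using l assms by simp_all
  assume *: "x \<in> Ob A" "val m" "val n" "val u" "ty m = NT A G H" "ty n = NT A F G" "ty u = fob F x"
    "dj m n" "dj m u" "dj n u"
  then show "nv A F H x (cm (vpsh V A) F G H m n) u = nv A G H x m (nv A F G x n u)"
    unfolding e using l assms by simp
qed

lemma vcategory_vpsh [simp]:
  assumes A: "has_ends A"
  shows "vcategory V (vpsh V A)"
proof (rule vcategoryI)
  fix F G H K h g f
  assume *: "F \<in> Ob (vpsh V A)" "G \<in> Ob (vpsh V A)" "H \<in> Ob (vpsh V A)" "K \<in> Ob (vpsh V A)"
    "val h" "val g" "val f" "ty h = Hom (vpsh V A) H K" "ty g = Hom (vpsh V A) G H" "ty f = Hom (vpsh V A) F G"
    "dj h g" "dj h f" "dj g f" "dj g h" "dj f h" "dj f g"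
  show "cm (vpsh V A) F G K (cm (vpsh V A) G H K h g) f = cm (vpsh V A) F H K h (cm (vpsh V A) F G H g f)"
    by (rule nat_ob_eqI[of A F K]) (use A * in \<open>auto simp: vpsh_Comp\<close>)
next
  fix F G f
  assume *: "F \<in> Ob (vpsh V A)" "G \<in> Ob (vpsh V A)" "val f" "ty f = Hom (vpsh V A) F G"
  show "cm (vpsh V A) F G G (gl (Id (vpsh V A) G)) f = f \<and> cm (vpsh V A) F F G f (gl (Id (vpsh V A) F)) = f"
    by (intro conjI; rule nat_ob_eqI[of A F G]) (use A * in \<open>auto simp: vpsh_Comp\<close>)
qed (use A in \<open>simp_all add: vpsh_Comp\<close>)

lemmas vpsh_simps [simp] = vpsh_Comp

end

section \<open>Existence of ends\<close>

text \<open>The shape of the diagram whose limit is an end: vertices \<open>Pt x\<close> and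
  \<open>Pr x y\<close>, with arrows \<open>Lf x y\<close> from \<open>Pt x\<close> and
  \<open>Rt x y\<close> from \<open>Pt y\<close> into \<open>Pr x y\<close>. Vertices double as
  their identity arrows.\<close>

datatype 'a shp = Pt 'a | Pr 'a 'a | Lf 'a 'a | Rt 'a 'a

primrec shp_src :: "'a shp \<Rightarrow> 'a shp" where
  "shp_src (Pt x) = Pt x" | "shp_src (Pr x y) = Pr x y" | "shp_src (Lf x y) = Pt x" | "shp_src (Rt x y) = Pt y"

primrec shp_trg :: "'a shp \<Rightarrow> 'a shp" where
  "shp_trg (Pt x) = Pt x" | "shp_trg (Pr x y) = Pr x y" | "shp_trg (Lf x y) = Pr x y" | "shp_trg (Rt x y) = Pr x y"

lemma small_image: "small \<kappa> X \<Longrightarrow> small \<kappa> (f ` X)"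
  unfolding small_def using card_of_image ordLeq_ordLess_trans by blast

lemma small_Un:
  assumes "universe_card \<kappa>" "small \<kappa> X" "small \<kappa> Y"
  shows "small \<kappa> (X \<union> Y)"
  using assms card_of_Un_ordLess_infinite_Field unfolding universe_card_def small_def by blast

text \<open>Regularity of \<kappa>: the product is a small union of small sets.\<close>

lemma small_Times:
  assumes "universe_card \<kappa>" "small \<kappa> X" "small \<kappa> Y"
  shows "small \<kappa> (X \<times> Y)"
proof -
  have "|\<Union>x \<in> X. Pair x ` Y| <o \<kappa>"
    by (rule card_of_UNION_ordLess_infinite_Field_regularCard)
      (use assms small_image[OF assms(3)] in \<open>auto simp: universe_card_def small_def cinfinite_def\<close>)
  moreover have "(\<Union>x \<in> X. Pair x ` Y) = X \<times> Y" by auto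
  ultimately show ?thesis by (simp add: small_def)
qed

text \<open>Completeness speaks of shapes inside \<open>'u\<close>; this places a small set
  there.\<close>

lemma small_inj:
  assumes "universe_card \<kappa>" "small \<kappa> X"
  obtains e where "inj_on e X" "e ` X \<subseteq> Field \<kappa>"
proof -
  have "Card_order \<kappa>" using assms(1) by (simp add: universe_card_def)
  then have "\<kappa> =o |Field \<kappa>|" using card_of_Field_ordIso ordIso_symmetric by blast
  then have "|X| \<le>o |Field \<kappa>|"
    using assms(2) unfolding small_def by (meson ordLess_imp_ordLeq ordLeq_ordIso_trans)
  then show ?thesis using that by (auto simp: card_of_ordLeq[symmetric])
qed

text \<open>A cone over the shape \<open>shp\<close> is forced at \<open>Pr x y\<close> by its
  component at \<open>Pt x\<close>. The limit can therefore be stated through the components at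
  points and one equation for each pair.\<close>

lemma small_limit:
  fixes \<kappa> :: "'u rel" and C :: "('o, 'm, 'x) cat_scheme" (structure) and R :: "'a set"
  assumes \<kappa>: "universe_card \<kappa>" and C: "category C" and lim: "complete_cat \<kappa> C" and R: "small \<kappa> R"
    and a: "\<And>x. x \<in> R \<Longrightarrow> a x \<in> obj C" and b: "\<And>x y. \<lbrakk>x \<in> R; y \<in> R\<rbrakk> \<Longrightarrow> b x y \<in> obj C"
    and l: "\<And>x y. \<lbrakk>x \<in> R; y \<in> R\<rbrakk> \<Longrightarrow> l x y \<in> hom C (a x) (b x y)"
    and r: "\<And>x y. \<lbrakk>x \<in> R; y \<in> R\<rbrakk> \<Longrightarrow> r x y \<in> hom C (a y) (b x y)"
  obtains Z p where "Z \<in> obj C" "\<And>x. x \<in> R \<Longrightarrow> p x \<in> hom C Z (a x)"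
    "\<And>x y. \<lbrakk>x \<in> R; y \<in> R\<rbrakk> \<Longrightarrow> l x y \<cdot> p x = r x y \<cdot> p y"
    "\<And>X \<tau>. \<lbrakk>X \<in> obj C; \<And>x. x \<in> R \<Longrightarrow> \<tau> x \<in> hom C X (a x);
       \<And>x y. \<lbrakk>x \<in> R; y \<in> R\<rbrakk> \<Longrightarrow> l x y \<cdot> \<tau> x = r x y \<cdot> \<tau> y\<rbrakk>
       \<Longrightarrow> \<exists>!h. h \<in> hom C X Z \<and> (\<forall>x \<in> R. p x \<cdot> h = \<tau> x)"
proof -
  interpret category C by fact
  define SO where "SO = Pt ` R \<union> case_prod Pr ` (R \<times> R)"
  define SA where "SA = SO \<union> (case_prod Lf ` (R \<times> R) \<union> case_prod Rt ` (R \<times> R))"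
  have "small \<kappa> (R \<times> R)" by (rule small_Times[OF \<kappa> R R])
  then have sm: "small \<kappa> SO" "small \<kappa> SA"
    unfolding SA_def SO_def by (intro small_Un[OF \<kappa>] small_image R; assumption)+
  obtain e :: "'a shp \<Rightarrow> 'u" where e: "inj_on e SA" and "e ` SA \<subseteq> Field \<kappa>"
    by (rule small_inj[OF \<kappa> sm(2)])
  define d where "d = inv_into SA e"
  have d [simp]: "d (e s) = s" if "s \<in> SA" for s
    unfolding d_def using e that by simp
  have SOA: "SO \<subseteq> SA" by (auto simp: SA_def)
  have st: "shp_src s \<in> SO" "shp_trg s \<in> SO" if "s \<in> SA" for s
    using that by (auto simp: SA_def SO_def)
  have fixO: "shp_src s = s" "shp_trg s = s" if "s \<in> SO" for s
    using that by (auto simp: SO_def)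
  \<comment> \<open>Of two composable arrows at least one is an identity, so the composite is the
    other one.\<close>
  define D :: "('u, 'u) cat" where "D = \<lparr>obj = e ` SO, arr = e ` SA,
    src = (\<lambda>f. e (shp_src (d f))), trg = (\<lambda>f. e (shp_trg (d f))), idn = (\<lambda>x. x),
    cmp = (\<lambda>g f. if d f \<in> SO then g else f)\<rparr>"
  have D: "obj D = e ` SO" "arr D = e ` SA" "\<And>f. src D f = e (shp_src (d f))"
    "\<And>f. trg D f = e (shp_trg (d f))" "\<And>x. idn D x = x" "\<And>g f. cmp D g f = (if d f \<in> SO then g else f)"
    by (simp_all add: D_def)
  have eqe: "e s = e t \<longleftrightarrow> s = t" if "s \<in> SA" "t \<in> SA" for s t
    using e that by (auto dest: inj_onD)
  \<comment> \<open>An arrow that is not an identity ends at some \<open>Pr x y\<close>, from which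
    only the identity starts.\<close>
  have trgO: "shp_trg s = shp_src t \<Longrightarrow> s \<notin> SO \<Longrightarrow> t \<in> SO \<and> t = shp_trg s"
    if "s \<in> SA" "t \<in> SA" for s t
    using that by (auto simp: SA_def SO_def)
  have homD: "f \<in> hom D u v \<longleftrightarrow> (\<exists>s \<in> SA. f = e s \<and> u = e (shp_src s) \<and> v = e (shp_trg s))" for f u v
    unfolding hom_def by (auto simp: D)
  have catD: "category D"
  proof
    fix f g u v w
    assume fg: "f \<in> hom D u v" "g \<in> hom D v w"
    obtain s t where s: "s \<in> SA" "f = e s" "u = e (shp_src s)" "v = e (shp_trg s)"
      and t: "t \<in> SA" "g = e t" "v = e (shp_src t)" "w = e (shp_trg t)"
      using fg homD by auto
    have "shp_trg s = shp_src t" using s t st SOA by (simp add: eqe subset_iff)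
    note st' = this
    show "g \<cdot>\<^bsub>D\<^esub> f \<in> hom D u w"
    proof (cases "s \<in> SO")
      case True
      then have "u = e (shp_src t)" using fixO[OF True] s st' by simp
      then show ?thesis using True s t unfolding homD by (intro bexI[of _ t]) (simp_all add: D)
    next
      case False
      then have "t \<in> SO" "t = shp_trg s" using trgO[OF s(1) t(1) st'] by blast+
      then have "w = e (shp_trg s)" using fixO[of t] t by simp
      then show ?thesis using False s t unfolding homD by (intro bexI[of _ s]) (simp_all add: D)
    qed
  next
    fix f g h u v w x
    assume fg: "f \<in> hom D u v" "g \<in> hom D v w" "h \<in> hom D w x"
    obtain s t k where s: "s \<in> SA" "f = e s" "v = e (shp_trg s)"
      and t: "t \<in> SA" "g = e t" "v = e (shp_src t)" "w = e (shp_trg t)"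
      and k: "k \<in> SA" "h = e k" "w = e (shp_src k)"
      using fg homD by auto
    have "shp_trg s = shp_src t" "shp_trg t = shp_src k" using s t k st SOA by (simp_all add: eqe subset_iff)
    then show "(h \<cdot>\<^bsub>D\<^esub> g) \<cdot>\<^bsub>D\<^esub> f = h \<cdot>\<^bsub>D\<^esub> (g \<cdot>\<^bsub>D\<^esub> f)"
      using s t k trgO[of s t] trgO[of t k] by (auto simp: D)
  next
    fix f u v assume "f \<in> hom D u v"
    then obtain s where s: "s \<in> SA" "f = e s" "u = e (shp_src s)" "v = e (shp_trg s)"
      using homD by auto
    show "f \<cdot>\<^bsub>D\<^esub> idn D u = f" "idn D v \<cdot>\<^bsub>D\<^esub> f = f"
      using s st[of s] SOA fixO by (auto simp: D)
  next
    fix x assume "x \<in> obj D"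
    then show "idn D x \<in> hom D x x" unfolding homD using SOA fixO by (auto simp: D)
  qed (use st SOA in \<open>auto simp: D\<close>)
  define fo where "fo s = (case s of Pt x \<Rightarrow> a x | Pr x y \<Rightarrow> b x y | Lf x y \<Rightarrow> undefined | Rt x y \<Rightarrow> undefined)" for s
  define fa where "fa s = (case s of Pt x \<Rightarrow> idn C (a x) | Pr x y \<Rightarrow> idn C (b x y) | Lf x y \<Rightarrow> l x y | Rt x y \<Rightarrow> r x y)" for s
  have fo: "fo s \<in> obj C" if "s \<in> SO" for s using that a b by (auto simp: SO_def fo_def)
  have fa: "fa s \<in> hom C (fo (shp_src s)) (fo (shp_trg s))" if "s \<in> SA" for s
    using that a b l r by (auto simp: SA_def SO_def fo_def fa_def)
  have faO: "fa s = idn C (fo s)" if "s \<in> SO" for s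
    using that by (auto simp: SO_def fo_def fa_def)
  have diag: "diagram D C (fo \<circ> d) (fa \<circ> d)"
    unfolding diagram_def
  proof (intro conjI ballI impI)
    fix x assume "x \<in> obj D"
    then show "(fo \<circ> d) x \<in> obj C" "(fa \<circ> d) (idn D x) = idn C ((fo \<circ> d) x)"
      using fo SOA faO by (auto simp: D)
  next
    fix f assume "f \<in> arr D"
    then obtain s where "s \<in> SA" "f = e s" by (auto simp: D)
    then show "(fa \<circ> d) f \<in> hom C ((fo \<circ> d) (src D f)) ((fo \<circ> d) (trg D f))"
      using fa[of s] st[of s] SOA by (auto simp: D)
  next
    fix f g assume "f \<in> arr D" "g \<in> arr D" "trg D f = src D g"
    then obtain s t where s: "s \<in> SA" "f = e s" and t: "t \<in> SA" "g = e t" and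
      "e (shp_trg s) = e (shp_src t)" by (auto simp: D)
    then have st': "shp_trg s = shp_src t" using st SOA by (simp add: eqe subset_iff)
    show "(fa \<circ> d) (g \<cdot>\<^bsub>D\<^esub> f) = (fa \<circ> d) g \<cdot> (fa \<circ> d) f"
    proof (cases "s \<in> SO")
      case True
      then have "shp_src t = s" using fixO st' by simp
      then show ?thesis using True s t fa[of t] faO[of s] by (simp add: D)
    next
      case False
      then have t': "t \<in> SO" "t = shp_trg s" using trgO[of s t] s t st' by auto
      have "fa t \<cdot> fa s = fa s" using faO[OF t'(1)] fa[OF s(1)] unfolding t'(2)[symmetric] by simp
      then show ?thesis using False s t by (simp add: D)
    qed
  qed
  have "small \<kappa> (obj D)" "small \<kappa> (arr D)" using sm by (simp_all add: D small_image)
  then obtain Z \<pi> where L: "limit_cone D C (fo \<circ> d) (fa \<circ> d) Z \<pi>"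
    using lim catD diag unfolding complete_cat_def by blast
  have in_SO: "Pt x \<in> SO" "Pr x y \<in> SO" and in_SA: "Lf x y \<in> SA" "Rt x y \<in> SA"
    if "x \<in> R" "y \<in> R" for x y using that by (auto simp: SO_def SA_def)
  have cone: "cone D C (fo \<circ> d) (fa \<circ> d) X (\<sigma> \<circ> d) \<longleftrightarrow> X \<in> obj C \<and>
      (\<forall>s \<in> SO. \<sigma> s \<in> hom C X (fo s)) \<and> (\<forall>s \<in> SA. fa s \<cdot> \<sigma> (shp_src s) = \<sigma> (shp_trg s))" for X \<sigma>
    unfolding cone_def using SOA st by (auto simp: D subset_iff)
  define q where "q s = \<pi> (e s)" for s
  have coneq: "cone D C (fo \<circ> d) (fa \<circ> d) Z (q \<circ> d)"
    using L SOA st unfolding limit_cone_def cone_def by (auto simp: D q_def subset_iff)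
  then have q: "Z \<in> obj C" "\<And>s. s \<in> SO \<Longrightarrow> q s \<in> hom C Z (fo s)"
    "\<And>s. s \<in> SA \<Longrightarrow> fa s \<cdot> q (shp_src s) = q (shp_trg s)" unfolding cone by blast+
  show thesis
  proof (rule that[of Z "\<lambda>x. q (Pt x)"])
    show "Z \<in> obj C" by (rule q)
    show "q (Pt x) \<in> hom C Z (a x)" if "x \<in> R" for x
      using q(2)[of "Pt x"] in_SO that by (simp add: fo_def)
    show "l x y \<cdot> q (Pt x) = r x y \<cdot> q (Pt y)" if "x \<in> R" "y \<in> R" for x y
      using q(3)[OF in_SA(1)[OF that]] q(3)[OF in_SA(2)[OF that]] by (simp add: fa_def)
  next
    fix X \<tau>
    assume X: "X \<in> obj C" and t: "\<And>x. x \<in> R \<Longrightarrow> \<tau> x \<in> hom C X (a x)"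
      and lr: "\<And>x y. \<lbrakk>x \<in> R; y \<in> R\<rbrakk> \<Longrightarrow> l x y \<cdot> \<tau> x = r x y \<cdot> \<tau> y"
    define \<sigma> where "\<sigma> s = (case s of Pt x \<Rightarrow> \<tau> x | Pr x y \<Rightarrow> l x y \<cdot> \<tau> x | Lf x y \<Rightarrow> undefined | Rt x y \<Rightarrow> undefined)" for s
    have s1: "\<sigma> s \<in> hom C X (fo s)" if "s \<in> SO" for s
      using that t l by (auto simp: SO_def \<sigma>_def fo_def)
    have s2: "fa s \<cdot> \<sigma> (shp_src s) = \<sigma> (shp_trg s)" if "s \<in> SA" for s
      using that t l r lr by (auto simp: SA_def SO_def \<sigma>_def fa_def)
    have "cone D C (fo \<circ> d) (fa \<circ> d) X (\<sigma> \<circ> d)" unfolding cone using X s1 s2 by blast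
    then have ex: "\<exists>!h. h \<in> hom C X Z \<and> (\<forall>o' \<in> obj D. \<pi> o' \<cdot> h = (\<sigma> \<circ> d) o')"
      using L unfolding limit_cone_def by blast
    have "(\<forall>o' \<in> obj D. \<pi> o' \<cdot> h = (\<sigma> \<circ> d) o') \<longleftrightarrow> (\<forall>x \<in> R. q (Pt x) \<cdot> h = \<tau> x)" if h: "h \<in> hom C X Z" for h
    proof
      assume "\<forall>o' \<in> obj D. \<pi> o' \<cdot> h = (\<sigma> \<circ> d) o'"
      then show "\<forall>x \<in> R. q (Pt x) \<cdot> h = \<tau> x"
        using SOA in_SO by (auto simp: D q_def \<sigma>_def subset_iff)
    next
      assume *: "\<forall>x \<in> R. q (Pt x) \<cdot> h = \<tau> x"
      have "q s \<cdot> h = \<sigma> s" if s: "s \<in> SO" for s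
      proof -
        consider x where "x \<in> R" "s = Pt x" | x y where "x \<in> R" "y \<in> R" "s = Pr x y"
          using s by (auto simp: SO_def)
        then show ?thesis
        proof cases
          case 1
          then show ?thesis using * by (simp add: \<sigma>_def)
        next
          case 2
          have "q s = l x y \<cdot> q (Pt x)" using q(3)[OF in_SA(1)[OF 2(1,2)]] 2 by (simp add: fa_def)
          then show ?thesis
            using * 2 h l[OF 2(1,2)] q(2)[OF in_SO(1)[OF 2(1,1)]] by (simp add: \<sigma>_def fo_def)
        qed
      qed
      then show "\<forall>o' \<in> obj D. \<pi> o' \<cdot> h = (\<sigma> \<circ> d) o'"
        using SOA by (auto simp: D q_def subset_iff)
    qed
    then show "\<exists>!h. h \<in> hom C X Z \<and> (\<forall>x \<in> R. q (Pt x) \<cdot> h = \<tau> x)" using ex by (metis (no_types, lifting))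
  qed
qed

section \<open>Small categories have ends\<close>

context sym_mon_closed
begin

lemma viso_sym:
  assumes "vcategory V A" "x \<in> Ob A" "y \<in> Ob A" "viso V A x y f"
  obtains g where "viso V A y x g"
  using assms(4) unfolding viso_iff[OF assms(1-3)] using viso_iff[OF assms(1,3,2)] by blast

lemma viso_vop:
  assumes "vcategory V A" "x \<in> Ob A" "y \<in> Ob A"
  shows "viso V (vop V A) x y f \<longleftrightarrow> viso V A y x f"
  unfolding viso_iff[OF assms(1,3,2)]
  by (subst viso_iff) (use assms in \<open>auto 4 4 simp: cm_vop\<close>)

text \<open>Isomorphisms can be inverted, so isomorphic objects are the same in \<open>A\<close> and
  in its opposite; smallness is therefore self-dual.\<close>

lemma iso_rel_vop:
  assumes A: "vcategory V A"
  shows "iso_rel V (vop V A) = iso_rel V A"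
  unfolding iso_rel_def using viso_vop[OF A] viso_sym[OF A] by auto metis+

lemma vsmall_vop: "vcategory V A \<Longrightarrow> vsmall \<kappa> V A \<Longrightarrow> vsmall \<kappa> V (vop V A)"
  by (simp add: vsmall_def iso_rel_vop)

lemma viso_Id:
  assumes "vcategory V A" "x \<in> Ob A"
  shows "viso V A x x (Id A x)"
  unfolding viso_iff[OF assms(1,2,2)] using assms by (auto intro!: bexI[of _ "Id A x"])

text \<open>One object is chosen from each isomorphism class. As \<open>r\<close> depends on the
  class alone, its range is an image of the small quotient.\<close>

lemma vsmall_representatives:
  assumes A: "vcategory V A" and sm: "vsmall \<kappa> V A"
  obtains R r where "R \<subseteq> Ob A" "small \<kappa> R" "\<And>x. x \<in> Ob A \<Longrightarrow> r x \<in> R \<and> (\<exists>f. viso V A x (r x) f)"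
proof -
  define c where "c X = (SOME y. y \<in> (X :: 'a set))" for X
  define r where "r x = c (iso_rel V A `` {x})" for x
  have *: "(x, r x) \<in> iso_rel V A" if "x \<in> Ob A" for x
  proof -
    have "x \<in> iso_rel V A `` {x}" using that viso_Id[OF A] by (auto simp: iso_rel_def)
    then have "r x \<in> iso_rel V A `` {x}" unfolding r_def c_def by (rule someI)
    then show ?thesis by simp
  qed
  have "r ` Ob A = c ` (Ob A // iso_rel V A)"
    by (auto simp: quotient_def r_def)
  then have "small \<kappa> (r ` Ob A)" using sm small_image by (metis vsmall_def)
  moreover have "r ` Ob A \<subseteq> Ob A" using * by (auto simp: iso_rel_def)
  ultimately show ?thesis using that[of "r ` Ob A" r] * by (auto simp: iso_rel_def)
qed

text \<open>Only the set of isomorphism classes is small. The limit is taken over representatives,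
  and its cone is transported to every other object along the isomorphism \<open>i x\<close> and its
  left inverse \<open>j x\<close>.\<close>

lemma has_ends_small:
  fixes \<kappa> :: "'u rel"
  assumes \<kappa>: "universe_card \<kappa>" and lim: "complete_cat \<kappa> V" and A: "vcategory V A" and sm: "vsmall \<kappa> V A"
  shows "has_ends A"
  unfolding has_ends_def
proof (intro conjI allI impI A, elim conjE)
  fix F G assume F: "vpre A F" and G: "vpre A G"
  obtain R r where R: "R \<subseteq> Ob A" "small \<kappa> R" and r: "\<And>x. x \<in> Ob A \<Longrightarrow> r x \<in> R \<and> (\<exists>f. viso V A x (r x) f)"
    using vsmall_representatives[OF A sm] by blast
  have RO [simp]: "x \<in> R \<Longrightarrow> x \<in> Ob A" for x using R by auto
  define i where "i x = (SOME f. viso V A x (r x) f)" for x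
  have rR [simp]: "x \<in> Ob A \<Longrightarrow> r x \<in> R" for x using r by blast
  have iso: "viso V A x (r x) (i x)" if "x \<in> Ob A" for x
    unfolding i_def using r[OF that] by (auto intro: someI)
  have "\<exists>g. g \<in> hom V (unt V) (Hom A (r x) x) \<and> cm A x (r x) x (gl g) (gl (i x)) = gl (Id A x)"
    if "x \<in> Ob A" for x
    using iso[OF that] unfolding viso_iff[OF A that RO[OF rR[OF that]]] by blast
  then obtain j where j': "\<And>x. x \<in> Ob A \<Longrightarrow> j x \<in> hom V (unt V) (Hom A (r x) x) \<and>
      cm A x (r x) x (gl (j x)) (gl (i x)) = gl (Id A x)" by metis
  have j [simp]: "j x \<in> arr V" "src V (j x) = unt V" "trg V (j x) = Hom A (r x) x"
    "cm A x (r x) x (gl (j x)) (gl (i x)) = gl (Id A x)" if "x \<in> Ob A" for x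
    using j'[OF that] by auto
  have i [simp]: "i x \<in> arr V" "src V (i x) = unt V" "trg V (i x) = Hom A x (r x)" if "x \<in> Ob A" for x
    using iso[OF that] unfolding viso_iff[OF A that RO[OF rR[OF that]]] by auto
  define a where "a x = ihom V (fob F x) (fob G x)" for x
  define b where "b x y = ihom V (Hom A x y) (ihom V (fob F x) (fob G y))" for x y
  \<comment> \<open>\<open>l x y\<close> and \<open>q x y\<close> are the two sides of the wedge
    condition with \<open>Hom A x y\<close> moved to the codomain; the condition becomes an equation
    between arrows out of one vertex, as \<open>small_limit\<close> requires.\<close>
  define l where "l x y = curry_arr V (a x) (Hom A x y) (ihom V (fob F x) (fob G y))
    (Comp (vself V) (fob F x) (fob G x) (fob G y) \<cdot> (far G x y \<otimes> idn V (a x)) \<cdot> brd V (a x) (Hom A x y))" for x y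
  define q where "q x y = curry_arr V (a y) (Hom A x y) (ihom V (fob F x) (fob G y))
    (Comp (vself V) (fob F x) (fob F y) (fob G y) \<cdot> (idn V (a y) \<otimes> far F x y))" for x y
  have ab: "a x \<in> obj V" "b x y \<in> obj V" "l x y \<in> hom V (a x) (b x y)" "q x y \<in> hom V (a y) (b x y)"
    if "x \<in> Ob A" "y \<in> Ob A" for x y
    using that A F G by (auto simp: a_def b_def l_def q_def)
  have cond: "l x y \<cdot> \<tau> x = q x y \<cdot> \<tau> y \<longleftrightarrow>
    (\<forall>k t u. val k \<and> val t \<and> val u \<and> ty k = Hom A x y \<and> ty t = X \<and> ty u = fob F x \<and> dj k t \<and> dj k u \<and> dj t u
      \<longrightarrow> act G x y k (app (fob F x) (fob G x) (ap (\<tau> x) t) u) =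
          app (fob F y) (fob G y) (ap (\<tau> y) t) (act F x y k u))" (is "?L = ?R")
    if xy: "x \<in> Ob A" "y \<in> Ob A" and X: "X \<in> obj V" and t: "\<tau> x \<in> hom V X (a x)" "\<tau> y \<in> hom V X (a y)" for x y X \<tau>
  proof
    assume L: ?L
    show ?R
    proof (intro allI impI, elim conjE)
      fix k t u
      assume *: "val k" "val t" "val u" "ty k = Hom A x y" "ty t = X" "ty u = fob F x" "dj k t" "dj k u" "dj t u"
      from arg_cong[OF L, of "\<lambda>m. app (fob F x) (fob G y) (app (Hom A x y) (ihom V (fob F x) (fob G y)) (ap m t) k) u"]
      show "act G x y k (app (fob F x) (fob G x) (ap (\<tau> x) t) u) =
          app (fob F y) (fob G y) (ap (\<tau> y) t) (act F x y k u)"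
        using xy X t A F G * dj_sym[of t k] by (simp add: a_def l_def q_def)
    qed
  next
    assume R: ?R
    show ?L
    proof (rule curry_eqI[of _ _ X "Hom A x y" "ihom V (fob F x) (fob G y)"])
      fix u v assume *: "val u" "ty u = X" "val v" "ty v = Hom A x y" "dj u v" "dj v u"
      show "app (Hom A x y) (ihom V (fob F x) (fob G y)) (ap (l x y \<cdot> \<tau> x) u) v =
        app (Hom A x y) (ihom V (fob F x) (fob G y)) (ap (q x y \<cdot> \<tau> y) u) v"
        by (rule ihom_eqI[of _ _ "fob F x" "fob G y"])
          (use xy X t A F G * R[rule_format, of v u] in \<open>auto simp: a_def l_def q_def\<close>)
    qed (use xy X t A F G ab[OF xy] in \<open>auto simp: b_def\<close>)
  qed
  show "\<exists>E \<pi>. nat_end V A (vself V) F G E \<pi>"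
  proof (rule small_limit[OF \<kappa> category_axioms lim R(2), of a b l q])
    show "a x \<in> obj V" if "x \<in> R" for x using ab(1)[of x x] that by simp
    show "b x y \<in> obj V" "l x y \<in> hom V (a x) (b x y)" "q x y \<in> hom V (a y) (b x y)"
      if "x \<in> R" "y \<in> R" for x y
      using ab(2-4)[of x y] that by simp_all
  next
  fix Z p
  assume Z [simp]: "Z \<in> obj V" and p: "\<And>x. x \<in> R \<Longrightarrow> p x \<in> hom V Z (a x)"
    and lq: "\<And>x y. \<lbrakk>x \<in> R; y \<in> R\<rbrakk> \<Longrightarrow> l x y \<cdot> p x = q x y \<cdot> p y"
    and univ: "\<And>X \<tau>. \<lbrakk>X \<in> obj V; \<And>x. x \<in> R \<Longrightarrow> \<tau> x \<in> hom V X (a x);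
       \<And>x y. \<lbrakk>x \<in> R; y \<in> R\<rbrakk> \<Longrightarrow> l x y \<cdot> \<tau> x = q x y \<cdot> \<tau> y\<rbrakk>
       \<Longrightarrow> \<exists>!h. h \<in> hom V X Z \<and> (\<forall>x \<in> R. p x \<cdot> h = \<tau> x)"
  have pa [simp]: "p x \<in> arr V" "src V (p x) = Z" "trg V (p x) = ihom V (fob F x) (fob G x)" if "x \<in> R" for x
    using p[OF that] by (auto simp: a_def)
  have pn: "app (fob F y) (fob G y) (ap (p y) z) (act F x y k u) =
      act G x y k (app (fob F x) (fob G x) (ap (p x) z) u)"
    if "x \<in> R" "y \<in> R" "val k" "val z" "val u" "ty k = Hom A x y" "ty z = Z" "ty u = fob F x"
      "dj k z" "dj k u" "dj z u" for x y k z u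
    using cond[of x y Z p] lq[of x y] p that by simp
  \<comment> \<open>On elements: act on \<open>F\<close> by \<open>i x\<close>, apply
    \<open>p\<close> at the representative, act on \<open>G\<close> by \<open>j x\<close>.\<close>
  define \<pi> where "\<pi> x = Comp (vself V) (fob F x) (fob G (r x)) (fob G x) \<cdot> ((far G (r x) x \<cdot> j x) \<otimes>
      (Comp (vself V) (fob F x) (fob F (r x)) (fob G (r x)) \<cdot> (p (r x) \<otimes> (far F x (r x) \<cdot> i x)) \<cdot> runi Z)) \<cdot> luni Z" for x
  have \<pi> [simp]: "\<pi> x \<in> arr V" "src V (\<pi> x) = Z" "trg V (\<pi> x) = ihom V (fob F x) (fob G x)"
    if "x \<in> Ob A" for x
    using that A F G by (simp_all add: \<pi>_def)
  have \<pi>v: "app (fob F x) (fob G x) (ap (\<pi> x) z) u =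
      act G (r x) x (gl (j x)) (app (fob F (r x)) (fob G (r x)) (ap (p (r x)) z) (act F x (r x) (gl (i x)) u))"
    if "x \<in> Ob A" "val z" "ty z = Z" "val u" "ty u = fob F x" "dj z u" for x z u
    using that A F G by (simp add: \<pi>_def)
  have jact: "act G (r x) x (gl (j x)) (act G x (r x) (gl (i x)) v) = v"
    if "x \<in> Ob A" "val v" "ty v = fob G x" for x v
    using app_far_cm[OF G A, of x "r x" x "gl (j x)" "gl (i x)" v] that A G by simp
  have jactF: "act F (r x) x (gl (j x)) (act F x (r x) (gl (i x)) v) = v"
    if "x \<in> Ob A" "val v" "ty v = fob F x" for x v
    using app_far_cm[OF F A, of x "r x" x "gl (j x)" "gl (i x)" v] that A F by simp
  \<comment> \<open>It is not assumed that \<open>r x\<close> is \<open>x\<close> for a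
    representative \<open>x\<close>; naturality of \<open>p\<close> at \<open>j x\<close> closes the
    gap.\<close>
  have \<pi>p: "\<pi> x = p x" if x: "x \<in> R" for x
  proof (rule curry_eqI[of _ _ Z "fob F x" "fob G x"])
    fix u v assume *: "val u" "ty u = Z" "val v" "ty v = fob F x" "dj u v" "dj v u"
    show "app (fob F x) (fob G x) (ap (\<pi> x) u) v = app (fob F x) (fob G x) (ap (p x) u) v"
      using pn[of "r x" x "gl (j x)" u "act F x (r x) (gl (i x)) v"] * x A F G
      by (simp add: \<pi>v jactF)
  qed (use x A F G in simp_all)
  have w: "wedge V A (vself V) F G Z \<pi>"
  proof (rule wedgeI[OF A F G Z])
    fix x y k t u
    assume *: "x \<in> Ob A" "y \<in> Ob A" "val k" "val t" "val u" "ty k = Hom A x y" "ty t = Z"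
      "ty u = fob F x" "dj k t" "dj t k" "dj k u" "dj u k" "dj t u" "dj u t"
    \<comment> \<open>The conjugate of \<open>k\<close> between representatives, where naturality of
      the limit cone is available.\<close>
    let ?k' = "cm A (r x) x (r y) (cm A x y (r y) (gl (i y)) k) (gl (j x))"
    let ?v = "act F x (r x) (gl (i x)) u"
    have "act F (r x) (r y) ?k' ?v = act F y (r y) (gl (i y)) (act F x y k u)"
      using * A F app_far_cm[OF F A] by (simp add: jactF del: cm_assoc)
    then have "app (fob F y) (fob G y) (ap (\<pi> y) t) (act F x y k u) =
        act G (r y) y (gl (j y)) (app (fob F (r y)) (fob G (r y)) (ap (p (r y)) t) (act F (r x) (r y) ?k' ?v))"
      using * A F G by (simp add: \<pi>v)
    also have "\<dots> = act G (r y) y (gl (j y)) (act G (r x) (r y) ?k' (app (fob F (r x)) (fob G (r x)) (ap (p (r x)) t) ?v))"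
      using * A F G pn[of "r x" "r y" ?k' t ?v] by (simp del: cm_assoc)
    also have "\<dots> = act G x y k (app (fob F x) (fob G x) (ap (\<pi> x) t) u)"
      using * A F G app_far_cm[OF G A] by (simp add: jact \<pi>v del: cm_assoc)
    finally show "act G x y k (app (fob F x) (fob G x) (ap (\<pi> x) t) u) =
      app (fob F y) (fob G y) (ap (\<pi> y) t) (act F x y k u)" by simp
  qed simp
  have "\<exists>!h. h \<in> hom V X Z \<and> (\<forall>x \<in> Ob A. \<pi> x \<cdot> h = \<tau> x)" if "wedge V A (vself V) F G X \<tau>" for X \<tau>
  proof -
    note W = wedgeD[OF that A F G]
    have "\<exists>!h. h \<in> hom V X Z \<and> (\<forall>x \<in> R. p x \<cdot> h = \<tau> x)"
    proof (rule univ)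
      show "X \<in> obj V" by (rule W)
      show 1: "\<tau> x \<in> hom V X (a x)" if "x \<in> R" for x using W(2-4) that by (simp add: a_def)
      show "l x y \<cdot> \<tau> x = q x y \<cdot> \<tau> y" if "x \<in> R" "y \<in> R" for x y
        using that 1 W(1,5) by (subst cond[of x y X]) auto
    qed
    moreover have "(\<forall>x \<in> R. p x \<cdot> h = \<tau> x) \<longleftrightarrow> (\<forall>x \<in> Ob A. \<pi> x \<cdot> h = \<tau> x)" if h: "h \<in> hom V X Z" for h
    proof
      assume "\<forall>x \<in> Ob A. \<pi> x \<cdot> h = \<tau> x"
      then show "\<forall>x \<in> R. p x \<cdot> h = \<tau> x" using \<pi>p RO by metis
    next
      assume *: "\<forall>x \<in> R. p x \<cdot> h = \<tau> x"
      show "\<forall>x \<in> Ob A. \<pi> x \<cdot> h = \<tau> x"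
      proof
        fix x assume x: "x \<in> Ob A"
        have e: "p (r x) \<cdot> h = \<tau> (r x)" using * x by simp
        have ph: "ap (p (r x)) (ap h t) = ap (\<tau> (r x)) t" if "val t" "ty t = X" for t
          using arg_cong[OF e, of "\<lambda>m. ap m t"] that h x by simp
        show "\<pi> x \<cdot> h = \<tau> x"
        proof (rule curry_eqI[of _ _ X "fob F x" "fob G x"])
          fix u v assume uv: "val u" "ty u = X" "val v" "ty v = fob F x" "dj u v" "dj v u"
          then show "app (fob F x) (fob G x) (ap (\<pi> x \<cdot> h) u) v = app (fob F x) (fob G x) (ap (\<tau> x) u) v"
            using x h A F G W by (simp add: \<pi>v ph jact)
        qed (use x h F G W in auto)
      qed
    qed
    ultimately show ?thesis by (metis (no_types, lifting))
  qed
  then show "\<exists>E \<pi>. nat_end V A (vself V) F G E \<pi>" using w unfolding nat_end_def by blast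
  qed
qed

end

section \<open>Representables, nerves and the Isbell adjunction\<close>

context sym_mon_closed
begin

text \<open>The objects \<open>a\<close> and \<open>b\<close> are variables tied by equations, so
  that the rule still matches after values such as \<open>fob (rep V A c) x\<close> have been
  simplified. Many later rules have this form for the same reason.\<close>

lemma nv_Comp [simp]:
  assumes "has_ends A" "vpre A F" "vpre A G" "vpre A H" "x \<in> Ob A" "val m" "val n" "val u"
    "ty m = NT A G H" "ty n = NT A F G" "ty u = fob F x" "dj m n" "dj m u" "dj n u"
    "a = fob F x" "b = fob H x"
  shows "app a b (ap (pr A F H x) (cm (vpsh V A) F G H m n)) u = nv A G H x m (nv A F G x n u)"
  using assms by simp

lemma nv_Id [simp]:
  assumes "has_ends A" "vpre A F" "x \<in> Ob A" "val u" "ty u = fob F x" "a = fob F x" "b = fob F x"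
  shows "app a b (ap (pr A F F x) (gl (Id (vpsh V A) F))) u = u"
  using assms by simp

abbreviation yo :: "('a, 'o, 'm) vcat \<Rightarrow> 'a \<Rightarrow> ('a, 'o, 'm) vfun" where
  "yo B \<equiv> rep V (vop V B)"

lemma rep_sel [simp]:
  "x \<in> Ob A \<Longrightarrow> fob (rep V A c) x = Hom A c x"
  "\<lbrakk>x \<in> Ob A; y \<in> Ob A\<rbrakk>
    \<Longrightarrow> far (rep V A c) x y = curry_arr V (Hom A x y) (Hom A c x) (Hom A c y) (Comp A c x y)"
  by (simp_all add: rep_def)

lemma vpre_rep [simp]:
  assumes A: "vcategory V A" and c: "c \<in> Ob A"
  shows "vpre A (rep V A c)"
proof (rule vself_functorI)
  show "rep V A c = mk_vfun A (fob (rep V A c)) (far (rep V A c))"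
    unfolding rep_def by (rule mk_vfun_idem[symmetric])
qed (use A c in simp_all)

abbreviation nerve_ob :: "('k, 'o, 'm) vcat \<Rightarrow> ('a, 'o, 'm) vcat \<Rightarrow> ('k, 'a, 'm) vfun \<Rightarrow> 'a \<Rightarrow>
    ('k, 'o, 'm) vfun" where
  "nerve_ob K A S a \<equiv> vcompose V (vop V K) (rep V (vop V A) a) (vopfun S)"

lemma vpre_nerve_ob:
  assumes "vcategory V K" "vcategory V A" "vfunctor V K A S" "a \<in> Ob A"
  shows "vpre (vop V K) (nerve_ob K A S a)"
  by (rule vfunctor_vcompose[OF vfunctor_vopfun vpre_rep]) (use assms in simp_all)

lemma nerve_ob_act:
  assumes "vcategory V K" "vcategory V A" "vfunctor V K A S" "a \<in> Ob A" "k \<in> Ob K" "k' \<in> Ob K"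
    "val i" "ty i = Hom K k' k" "val f" "ty f = Hom A (fob S k) a" "dj i f" "dj f i"
  shows "act (nerve_ob K A S a) k k' i f = cm A (fob S k') (fob S k) a f (ap (far S k' k) i)"
  using assms by simp

lemma nerve_ob_eq: "a \<in> Ob A \<Longrightarrow> fob (nerve V K A S) a = nerve_ob K A S a"
  by (simp add: nerve_def Let_def)

text \<open>Postcomposition commutes with the precomposition through which \<open>K\<close> acts:
  associativity in \<open>A\<close>.\<close>

lemma nerve_wedge:
  assumes K: "vcategory V K" and A: "vcategory V A" and S: "vfunctor V K A S" and a: "a \<in> Ob A" and b: "b \<in> Ob A"
  shows "wedge V (vop V K) (vself V) (nerve_ob K A S a) (nerve_ob K A S b) (Hom A a b)
    (\<lambda>k. far (rep V A (fob S k)) a b)"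
proof (rule wedgeI)
  fix x y k t u
  assume *: "x \<in> Ob (vop V K)" "y \<in> Ob (vop V K)" "val k" "val t" "val u" "ty k = Hom (vop V K) x y"
    "ty t = Hom A a b" "ty u = fob (nerve_ob K A S a) x"
    "dj k t" "dj t k" "dj k u" "dj u k" "dj t u" "dj u t"
  show "act (nerve_ob K A S b) x y k
      (app (fob (nerve_ob K A S a) x) (fob (nerve_ob K A S b) x) (ap (far (rep V A (fob S x)) a b) t) u) =
    app (fob (nerve_ob K A S a) y) (fob (nerve_ob K A S b) y) (ap (far (rep V A (fob S y)) a b) t)
      (act (nerve_ob K A S a) x y k u)"
    using * assms by simp
qed (use assms vpre_nerve_ob[OF K A S] in simp_all)

lemma nerve_far:
  assumes K: "has_ends (vop V K)" "vcategory V K" and A: "vcategory V A" and S: "vfunctor V K A S"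
    and a: "a \<in> Ob A" and b: "b \<in> Ob A"
  shows "far (nerve V K A S) a b \<in> arr V" "src V (far (nerve V K A S) a b) = Hom A a b"
    "trg V (far (nerve V K A S) a b) = NT (vop V K) (nerve_ob K A S a) (nerve_ob K A S b)"
    "\<lbrakk>k \<in> Ob K; val g; ty g = Hom A a b; val f; ty f = Hom A (fob S k) a; dj g f; dj f g;
      p = Hom A (fob S k) a; q = Hom A (fob S k) b\<rbrakk>
      \<Longrightarrow> app p q (ap (pr (vop V K) (nerve_ob K A S a) (nerve_ob K A S b) k) (ap (far (nerve V K A S) a b) g)) f =
        cm A (fob S k) a b g f"
proof -
  have e: "far (nerve V K A S) a b = nat_lift V (vop V K) (vself V) (nerve_ob K A S a) (nerve_ob K A S b)
    (Hom A a b) (\<lambda>k. far (rep V A (fob S k)) a b)"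
    using a b by (simp add: nerve_def Let_def)
  note l = nat_lift_simps[OF K(1) vpre_nerve_ob[OF K(2) A S a] vpre_nerve_ob[OF K(2) A S b]
      nerve_wedge[OF K(2) A S a b]]
  show "far (nerve V K A S) a b \<in> arr V" "src V (far (nerve V K A S) a b) = Hom A a b"
    "trg V (far (nerve V K A S) a b) = NT (vop V K) (nerve_ob K A S a) (nerve_ob K A S b)"
    unfolding e by (rule l)+
  assume "k \<in> Ob K" "val g" "ty g = Hom A a b" "val f" "ty f = Hom A (fob S k) a" "dj g f" "dj f g"
    "p = Hom A (fob S k) a" "q = Hom A (fob S k) b"
  then show "app p q (ap (pr (vop V K) (nerve_ob K A S a) (nerve_ob K A S b) k) (ap (far (nerve V K A S) a b) g)) f =
        cm A (fob S k) a b g f"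
    unfolding e using l assms by simp
qed

lemma vfunctor_nerve:
  assumes K: "has_ends (vop V K)" "vcategory V K" and A: "vcategory V A" and S: "vfunctor V K A S"
  shows "vfunctor V A (vpsh V (vop V K)) (nerve V K A S)"
proof (rule vfunctorI)
  note N = vpre_nerve_ob[OF K(2) A S]
  note nf = nerve_far[OF K A S]
  show "nerve V K A S = mk_vfun A (fob (nerve V K A S)) (far (nerve V K A S))"
    unfolding nerve_def Let_def by (rule mk_vfun_idem[symmetric])
  show "ap (far (nerve V K A S) a a) (gl (Id A a)) = gl (Id (vpsh V (vop V K)) (fob (nerve V K A S) a))"
    if a: "a \<in> Ob A" for a
    by (rule nat_ob_eqI[OF K(1) N[OF a] N[OF a]])
      (use a K A S N[OF a] nf[OF a a] in \<open>simp_all add: nerve_ob_eq\<close>)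
  show "ap (far (nerve V K A S) x z) (cm A x y z g f) =
    cm (vpsh V (vop V K)) (fob (nerve V K A S) x) (fob (nerve V K A S) y) (fob (nerve V K A S) z)
      (ap (far (nerve V K A S) y z) g) (ap (far (nerve V K A S) x y) f)"
    if ob: "x \<in> Ob A" "y \<in> Ob A" "z \<in> Ob A" and
      el: "val g" "val f" "ty g = Hom A y z" "ty f = Hom A x y" "dj g f" "dj f g" for x y z g f
    by (rule nat_ob_eqI[OF K(1) N[OF ob(1)] N[OF ob(3)]])
      (use ob el K A S N nf in \<open>simp_all add: nerve_ob_eq\<close>)
qed (use K A S vpre_nerve_ob[OF K(2) A S] nerve_far[OF K A S] in \<open>simp_all add: nerve_ob_eq\<close>)

lemma vopfun_vopfun [simp]: "vopfun (vopfun F) = F"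
  by (simp add: vopfun_def)

lemma mk_vfun_vop: "mk_vfun (vop V A) fo fa = vopfun (mk_vfun A fo (\<lambda>x y. fa y x))"
  by (auto simp: mk_vfun_def vopfun_def fun_eq_iff)

text \<open>Homs out of \<open>a\<close> are homs into \<open>a\<close> in the opposite category.
  The equality is literal, so everything about conerves is read off from nerves.\<close>

lemma conerve_eq:
  assumes "vcategory V K" "vcategory V A"
  shows "conerve V K A S = vopfun (nerve V (vop V K) (vop V A) (vopfun S))"
  using assms by (simp add: nerve_def conerve_def Let_def mk_vfun_vop)

lemma vfunctor_conerve:
  assumes K: "has_ends K" and A: "vcategory V A" and S: "vfunctor V K A S"
  shows "vfunctor V A (vop V (vpsh V K)) (conerve V K A S)"
proof -
  note k = has_endsD[OF K]
  have "vfunctor V (vop V A) (vpsh V (vop V (vop V K))) (nerve V (vop V K) (vop V A) (vopfun S))"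
    by (rule vfunctor_nerve) (use K k A vfunctor_vopfun[OF S k A] in simp_all)
  from vfunctor_vopfun[OF this] show ?thesis using K k A by (simp add: conerve_eq)
qed

text \<open>\<open>yoneda\<close> is a nerve along the identity functor, which leaves a composite
  with \<open>vid\<close> behind; this removes it.\<close>

lemma vfunctor_rep_cong:
  assumes "vcategory V A" "c \<in> Ob A"
  shows "vcompose V A (rep V A c) (vid V A) = rep V A c"
proof (rule vfunctor_eqI[of A "vself V"])
  show "vpre A (vcompose V A (rep V A c) (vid V A))"
    by (rule vfunctor_vcompose[OF vfunctor_vid vpre_rep]) (use assms in simp_all)
qed (use assms in simp_all)

lemma vopfun_vid [simp]: "vcategory V A \<Longrightarrow> vopfun (vid V A) = vid V (vop V A)"
  by (auto simp: vid_def mk_vfun_def vopfun_def fun_eq_iff)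

lemma yoneda_ob [simp]: "\<lbrakk>vcategory V B; c \<in> Ob B\<rbrakk> \<Longrightarrow> fob (yoneda V B) c = yo B c"
  by (simp add: yoneda_def nerve_ob_eq vfunctor_rep_cong)

lemma vfunctor_yoneda [simp]:
  "\<lbrakk>has_ends (vop V B); vcategory V B\<rbrakk> \<Longrightarrow> vfunctor V B (vpsh V (vop V B)) (yoneda V B)"
  unfolding yoneda_def by (rule vfunctor_nerve) simp_all

lemma yoneda_far [simp]:
  assumes "has_ends (vop V B)" "vcategory V B" "c \<in> Ob B" "d \<in> Ob B"
  shows "far (yoneda V B) c d \<in> arr V" "src V (far (yoneda V B) c d) = Hom B c d"
    "trg V (far (yoneda V B) c d) = NT (vop V B) (yo B c) (yo B d)"
    "\<lbrakk>b \<in> Ob B; val g; ty g = Hom B c d; val f; ty f = Hom B b c; dj g f; dj f g; p = Hom B b c; q = Hom B b d\<rbrakk>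
      \<Longrightarrow> app p q (ap (pr (vop V B) (yo B c) (yo B d) b) (ap (far (yoneda V B) c d) g)) f =
        cm B b c d g f"
  using assms nerve_far(1-3)[of B B "vid V B" c d] nerve_far(4)[of B B "vid V B" c d b g f p q] by (simp_all add: yoneda_def vfunctor_rep_cong)

text \<open>\<open>Lf B\<close> is the functor \<open>L\<close> on objects; since \<open>R\<close> for \<open>B\<close> is dual to \<open>L\<close> for \<open>B\<^sup>o\<^sup>p\<close>,
  every statement about \<open>R\<close> is an instance of one about \<open>L\<close>.\<close>

abbreviation Lf :: "('a, 'o, 'm) vcat \<Rightarrow> ('a, 'o, 'm) vfun \<Rightarrow> ('a, 'o, 'm) vfun" where
  "Lf B \<phi> \<equiv> fob (isbell_L V B) \<phi>"

lemma isbell_R_eq: "vcategory V B \<Longrightarrow> isbell_R V B = vopfun (isbell_L V (vop V B))"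
  by (simp add: isbell_R_def isbell_L_def)

lemma Lf_eq: "vpre (vop V B) \<phi> \<Longrightarrow> Lf B \<phi> = vcompose V B (rep V (vpsh V (vop V B)) \<phi>) (yoneda V B)"
  by (simp add: isbell_L_def conerve_def Let_def)

context
  fixes B :: "('a, 'o, 'm) vcat"
  assumes E: "has_ends B" and E': "has_ends (vop V B)"
begin

lemma vcategory_B [simp]: "vcategory V B"
  using E by simp

lemma vpre_Lf [simp]:
  assumes "vpre (vop V B) \<phi>"
  shows "vpre B (Lf B \<phi>)"
  unfolding Lf_eq[OF assms] by (rule vfunctor_vcompose[OF vfunctor_yoneda vpre_rep]) (use E' assms in simp_all)

lemma Lf_ob [simp]:
  assumes "vpre (vop V B) \<phi>" "c \<in> Ob B"
  shows "fob (Lf B \<phi>) c = NT (vop V B) \<phi> (yo B c)"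
  using assms by (simp add: Lf_eq)

lemma Lf_far [simp]:
  assumes "vpre (vop V B) \<phi>" "c \<in> Ob B" "d \<in> Ob B"
  shows "far (Lf B \<phi>) c d \<in> arr V" "src V (far (Lf B \<phi>) c d) = Hom B c d"
    "trg V (far (Lf B \<phi>) c d) =
      ihom V (NT (vop V B) \<phi> (yo B c)) (NT (vop V B) \<phi> (yo B d))"
  using vfunctor_arr(2-4)[OF vpre_Lf[OF assms(1)] assms(2,3)] assms by simp_all

lemma Lf_act [simp]:
  assumes "vpre (vop V B) \<phi>" "c \<in> Ob B" "d \<in> Ob B" "b \<in> Ob B" "val g" "val q" "val p" "ty g = Hom B c d"
    "ty q = NT (vop V B) \<phi> (yo B c)" "ty p = fob \<phi> b" "dj g q" "dj g p" "dj q p"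
    "x = fob \<phi> b" "y = Hom B b d" "v = NT (vop V B) \<phi> (yo B c)"
    "w = NT (vop V B) \<phi> (yo B d)"
  shows "app x y (ap (pr (vop V B) \<phi> (yo B d) b) (app v w (ap (far (Lf B \<phi>) c d) g) q)) p =
    cm B b c d g (app x (Hom B b c) (ap (pr (vop V B) \<phi> (yo B c) b) q) p)"
  using assms E' dj_sym[of q g] dj_sym[of p g] dj_sym[of p q] by (simp add: Lf_eq)

lemma vfunctor_isbell_L: "vfunctor V (vpsh V (vop V B)) (vop V (vpsh V B)) (isbell_L V B)"
  unfolding isbell_L_def by (rule vfunctor_conerve) (use E E' in simp_all)

text \<open>On morphisms L is precomposition with \<open>g\<close>, obtained from the formula for
  the nerve of the opposite Yoneda embedding through \<open>conerve_eq\<close>.\<close>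

lemma isbell_L_far [simp]:
  assumes "vpre (vop V B) \<phi>" "vpre (vop V B) \<psi>"
  shows "far (isbell_L V B) \<phi> \<psi> \<in> arr V" "src V (far (isbell_L V B) \<phi> \<psi>) = NT (vop V B) \<phi> \<psi>"
    "trg V (far (isbell_L V B) \<phi> \<psi>) = NT B (Lf B \<psi>) (Lf B \<phi>)"
    "\<lbrakk>c \<in> Ob B; val g; val q; ty g = NT (vop V B) \<phi> \<psi>; ty q = NT (vop V B) \<psi> (yo B c);
      dj g q; dj q g; x = NT (vop V B) \<psi> (yo B c); y = NT (vop V B) \<phi> (yo B c)\<rbrakk>
     \<Longrightarrow> app x y (ap (pr B (Lf B \<psi>) (Lf B \<phi>) c) (ap (far (isbell_L V B) \<phi> \<psi>) g)) q =
       cm (vpsh V (vop V B)) \<phi> \<psi> (yo B c) q g"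
proof -
  let ?P = "vpsh V (vop V B)"
  have P: "vcategory V ?P" using E' by simp
  show "far (isbell_L V B) \<phi> \<psi> \<in> arr V" "src V (far (isbell_L V B) \<phi> \<psi>) = NT (vop V B) \<phi> \<psi>"
    "trg V (far (isbell_L V B) \<phi> \<psi>) = NT B (Lf B \<psi>) (Lf B \<phi>)"
    using vfunctor_arr(2-4)[OF vfunctor_isbell_L, of \<phi> \<psi>] assms by simp_all
  have S: "vfunctor V (vop V B) (vop V ?P) (vopfun (yoneda V B))"
    by (rule vfunctor_vopfun[OF vfunctor_yoneda]) (use E' P in simp_all)
  assume *: "c \<in> Ob B" "val g" "val q" "ty g = NT (vop V B) \<phi> \<psi>" "ty q = NT (vop V B) \<psi> (yo B c)"
      "dj g q" "dj q g" "x = NT (vop V B) \<psi> (yo B c)" "y = NT (vop V B) \<phi> (yo B c)"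
  have "far (isbell_L V B) \<phi> \<psi> = far (nerve V (vop V B) (vop V ?P) (vopfun (yoneda V B))) \<psi> \<phi>"
    using P by (simp add: isbell_L_def conerve_eq)
  then show "app x y (ap (pr B (Lf B \<psi>) (Lf B \<phi>) c) (ap (far (isbell_L V B) \<phi> \<psi>) g)) q =
       cm ?P \<phi> \<psi> (yo B c) q g"
    using nerve_far(4)[of "vop V B" "vop V ?P" "vopfun (yoneda V B)" \<psi> \<phi> c g q x y] S P * assms E
    by (simp add: Lf_eq)
qed

end

end

section \<open>The unit of the Isbell adjunction as evaluation\<close>

context sym_mon_closed
begin

text \<open>The family \<open>u\<close> inside \<open>isbell_unit\<close>, isolated because it is
  what gets inverted at each object. Values of \<open>yoneda\<close> are left unexpanded so that the
  formula coincides with that definition.\<close>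

definition unit_cmp :: "('a, 'o, 'm) vcat \<Rightarrow> ('a, 'o, 'm) vfun \<Rightarrow> 'a \<Rightarrow> 'm" where
  "unit_cmp B \<phi> b = nat_lift V B (vself V) (Lf B \<phi>) (fob (yoneda V (vop V B)) b) (fob \<phi> b)
     (\<lambda>c. curry_arr V (fob \<phi> b) (fob (Lf B \<phi>) c) (Hom B b c)
        (evl V (fob \<phi> b) (Hom B b c) \<cdot>
         (pr (vop V B) \<phi> (fob (yoneda V B) c) b \<otimes> idn V (fob \<phi> b)) \<cdot> brd V (fob \<phi> b) (fob (Lf B \<phi>) c)))"

context
  fixes B :: "('a, 'o, 'm) vcat"
  assumes E: "has_ends B" and E': "has_ends (vop V B)"
begin

lemma vcat_B [simp]: "vcategory V B"
  using E by simp

lemma ends_vop_vop: "has_ends (vop V (vop V B))"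
  using E by simp

lemmas L_facts [simp] = vpre_Lf[OF E E'] Lf_ob[OF E E'] Lf_far[OF E E'] Lf_act[OF E E'] isbell_L_far[OF E E']

text \<open>The facts on L for the opposite of \<open>B\<close>, with the double opposite rewritten
  away; in this form they describe R.\<close>

lemmas R_facts [simp] = vpre_Lf[OF E' ends_vop_vop, unfolded vop_vop[OF vcat_B] vop_sel]
  Lf_ob[OF E' ends_vop_vop, unfolded vop_vop[OF vcat_B] vop_sel]
  Lf_far[OF E' ends_vop_vop, unfolded vop_vop[OF vcat_B] vop_sel]
  Lf_act[OF E' ends_vop_vop, unfolded vop_vop[OF vcat_B] vop_sel]
  isbell_L_far[OF E' ends_vop_vop, unfolded vop_vop[OF vcat_B] vop_sel]

lemma yoneda_op_ob [simp]: "b \<in> Ob B \<Longrightarrow> fob (yoneda V (vop V B)) b = rep V B b"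
  by simp

lemma nv_precomp:
  assumes "vpre (vop V B) \<phi>" "c \<in> Ob B" "b \<in> Ob B" "b' \<in> Ob B" "val k" "val q" "val p"
    "ty k = Hom B b' b" "ty q = NT (vop V B) \<phi> (yo B c)" "ty p = fob \<phi> b"
    "dj k q" "dj k p" "dj q p" "x = fob \<phi> b'" "y = Hom B b' c"
  shows "app x y (ap (pr (vop V B) \<phi> (yo B c) b') q) (act \<phi> b b' k p) =
    cm B b' b c (app (fob \<phi> b) (Hom B b c) (ap (pr (vop V B) \<phi> (yo B c) b) q) p) k"
  using nv_act[of "vop V B" \<phi> "yo B c" b b' k q p] assms E'
    dj_sym[of k q] dj_sym[of k p] dj_sym[of p q]
  by simp

lemma nv_postcomp:
  assumes "vpre B \<psi>" "c \<in> Ob B" "b \<in> Ob B" "b' \<in> Ob B" "val k" "val q" "val p"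
    "ty k = Hom B b b'" "ty q = NT B \<psi> (rep V B c)" "ty p = fob \<psi> b"
    "dj k q" "dj k p" "dj q p" "x = fob \<psi> b'" "y = Hom B c b'"
  shows "app x y (ap (pr B \<psi> (rep V B c) b') q) (act \<psi> b b' k p) =
    cm B c b b' k (app (fob \<psi> b) (Hom B c b) (ap (pr B \<psi> (rep V B c) b) q) p)"
  using nv_act[of B \<psi> "rep V B c" b b' k q p] assms E
    dj_sym[of k q] dj_sym[of k p] dj_sym[of p q]
  by simp

text \<open>Evaluation at \<open>p\<close> is natural in \<open>c\<close> because \<open>B\<close>
  acts on L \<phi> by postcomposition, see \<open>Lf_act\<close>.\<close>

lemma unit_cmp_simps [simp]:
  assumes \<phi>: "vpre (vop V B) \<phi>" and b: "b \<in> Ob B"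
  shows "unit_cmp B \<phi> b \<in> arr V" "src V (unit_cmp B \<phi> b) = fob \<phi> b"
    "trg V (unit_cmp B \<phi> b) = NT B (Lf B \<phi>) (rep V B b)"
    "\<lbrakk>c \<in> Ob B; val p; ty p = fob \<phi> b; val q; ty q = NT (vop V B) \<phi> (yo B c); dj p q; dj q p;
      x = NT (vop V B) \<phi> (yo B c); y = Hom B b c\<rbrakk>
     \<Longrightarrow> app x y (ap (pr B (Lf B \<phi>) (rep V B b) c) (ap (unit_cmp B \<phi> b) p)) q =
         app (fob \<phi> b) y (ap (pr (vop V B) \<phi> (yo B c) b) q) p"
proof -
  let ?\<tau> = "\<lambda>c. curry_arr V (fob \<phi> b) (fob (Lf B \<phi>) c) (Hom B b c)
        (evl V (fob \<phi> b) (Hom B b c) \<cdot>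
         (pr (vop V B) \<phi> (fob (yoneda V B) c) b \<otimes> idn V (fob \<phi> b)) \<cdot> brd V (fob \<phi> b) (fob (Lf B \<phi>) c))"
  have [simp]: "fob \<phi> b \<in> obj V" using vfunctor_vself_objD[OF \<phi>] b by simp
  have w: "wedge V B (vself V) (Lf B \<phi>) (rep V B b) (fob \<phi> b) ?\<tau>"
    by (rule wedgeI) (use \<phi> b E E' in simp_all)
  have Y: "fob (yoneda V (vop V B)) b = rep V B b" using b by (rule yoneda_op_ob)
  have r: "vpre B (rep V B b)" using b by simp
  note l = nat_lift_simps[OF E L_facts(1)[OF \<phi>] r w]
  show "unit_cmp B \<phi> b \<in> arr V" "src V (unit_cmp B \<phi> b) = fob \<phi> b"
    "trg V (unit_cmp B \<phi> b) = NT B (Lf B \<phi>) (rep V B b)"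
    unfolding unit_cmp_def Y by (rule l)+
  assume "c \<in> Ob B" "val p" "ty p = fob \<phi> b" "val q" "ty q = NT (vop V B) \<phi> (yo B c)" "dj p q" "dj q p"
      "x = NT (vop V B) \<phi> (yo B c)" "y = Hom B b c"
  then show "app x y (ap (pr B (Lf B \<phi>) (rep V B b) c) (ap (unit_cmp B \<phi> b) p)) q =
         app (fob \<phi> b) y (ap (pr (vop V B) \<phi> (yo B c) b) q) p"
    unfolding unit_cmp_def Y using l \<phi> b E E' by simp
qed

text \<open>Naturality in \<open>b\<close> becomes \<open>nv_precomp\<close> once both sides are
  evaluated at an element of L \<phi>.\<close>

lemma isbell_unit_simps [simp]:
  assumes \<phi>: "vpre (vop V B) \<phi>"
  shows "isbell_unit V B \<phi> \<in> arr V" "src V (isbell_unit V B \<phi>) = unt V"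
    "trg V (isbell_unit V B \<phi>) = NT (vop V B) \<phi> (Lf (vop V B) (Lf B \<phi>))"
    "\<lbrakk>b \<in> Ob B; val p; ty p = fob \<phi> b; x = fob \<phi> b; y = NT B (Lf B \<phi>) (rep V B b)\<rbrakk>
     \<Longrightarrow> app x y (ap (pr (vop V B) \<phi> (Lf (vop V B) (Lf B \<phi>)) b) (gl (isbell_unit V B \<phi>))) p =
         ap (unit_cmp B \<phi> b) p"
proof -
  let ?R = "Lf (vop V B) (Lf B \<phi>)"
  let ?\<tau> = "\<lambda>b. name_arr V (fob \<phi> b) (fob ?R b) (unit_cmp B \<phi> b)"
  have w: "wedge V (vop V B) (vself V) \<phi> ?R (unt V) ?\<tau>"
  proof (rule wedgeI_on_iso[of _ _ _ star])
    fix b b' k p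
    assume *: "b \<in> Ob (vop V B)" "b' \<in> Ob (vop V B)" "val k" "val p" "ty k = Hom (vop V B) b b'"
      "ty p = fob \<phi> b" "dj k star" "dj star k" "dj k p" "dj p k" "dj star p" "dj p star"
    have "app (fob ?R b) (fob ?R b') (ap (far ?R b b') k) (ap (unit_cmp B \<phi> b) p) =
        ap (unit_cmp B \<phi> b') (act \<phi> b b' k p)"
      by (rule nat_ob_eqI[OF E L_facts(1)[OF \<phi>], of "rep V B b'"])
        (use * \<phi> E E' in \<open>simp_all add: nv_precomp\<close>)
    then show "act ?R b b' k (app (fob \<phi> b) (fob ?R b) (ap (?\<tau> b) star) p) =
      app (fob \<phi> b') (fob ?R b') (ap (?\<tau> b') star) (act \<phi> b b' k p)"
      using * \<phi> by simp
  qed (use \<phi> E E' in simp_all)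
  have e: "isbell_unit V B \<phi> = nat_lift V (vop V B) (vself V) \<phi> ?R (unt V) ?\<tau>"
    by (simp add: isbell_unit_def isbell_R_eq unit_cmp_def Let_def)
  have R: "vpre (vop V B) ?R" using \<phi> by simp
  note l = nat_lift_simps[OF E' \<phi> R w]
  show "isbell_unit V B \<phi> \<in> arr V" "src V (isbell_unit V B \<phi>) = unt V"
    "trg V (isbell_unit V B \<phi>) = NT (vop V B) \<phi> (Lf (vop V B) (Lf B \<phi>))"
    unfolding e by (rule l)+
  assume "b \<in> Ob B" "val p" "ty p = fob \<phi> b" "x = fob \<phi> b" "y = NT B (Lf B \<phi>) (rep V B b)"
  then show "app x y (ap (pr (vop V B) \<phi> ?R b) (gl (isbell_unit V B \<phi>))) p = ap (unit_cmp B \<phi> b) p"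
    unfolding e using l \<phi> by simp
qed

end

context
  fixes B :: "('a, 'o, 'm) vcat"
  assumes E: "has_ends B" and E': "has_ends (vop V B)"
begin

lemmas unit_facts [simp] = vcat_B[OF E E'] L_facts[OF E E'] R_facts[OF E E'] unit_cmp_simps[OF E E'] isbell_unit_simps[OF E E']

lemmas unit_cmp_simps_op = unit_cmp_simps[OF E' ends_vop_vop[OF E E'], unfolded vop_vop[OF vcat_B[OF E E']] vop_sel]
lemmas isbell_unit_simps_op = isbell_unit_simps[OF E' ends_vop_vop[OF E E'], unfolded vop_vop[OF vcat_B[OF E E']] vop_sel]

lemma vfunctor_isbell_R: "vfunctor V (vop V (vpsh V B)) (vpsh V (vop V B)) (isbell_R V B)"
  using vfunctor_vopfun[OF vfunctor_isbell_L[OF E' ends_vop_vop[OF E E']]] E E' by (simp add: isbell_R_eq)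

text \<open>Both sides send \<open>p\<close> to the function taking \<open>q\<close> to the value of
  \<open>q\<close> at \<open>g p\<close>. Extensionality is applied twice, as the unit itself has
  natural transformations for values.\<close>

lemma vnat_isbell_unit:
  "vnat V (vpsh V (vop V B)) (vpsh V (vop V B)) (vid V (vpsh V (vop V B)))
     (vcompose V (vpsh V (vop V B)) (isbell_R V B) (isbell_L V B)) (isbell_unit V B)"
proof (rule vnatI)
  let ?P = "vpsh V (vop V B)"
  let ?RL = "vcompose V ?P (isbell_R V B) (isbell_L V B)"
  fix \<phi> \<psi> g
  assume *: "\<phi> \<in> Ob ?P" "\<psi> \<in> Ob ?P" "val g" "ty g = Hom ?P \<phi> \<psi>"
  have \<phi>: "vpre (vop V B) \<phi>" and \<psi>: "vpre (vop V B) \<psi>" using * by simp_all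
  let ?R = "Lf (vop V B) (Lf B \<psi>)"
  have "cm ?P \<phi> \<psi> ?R (gl (isbell_unit V B \<psi>)) g =
    cm ?P \<phi> (Lf (vop V B) (Lf B \<phi>)) ?R
      (ap (far (isbell_L V (vop V B)) (Lf B \<psi>) (Lf B \<phi>)) (ap (far (isbell_L V B) \<phi> \<psi>) g)) (gl (isbell_unit V B \<phi>))"
  proof (rule nat_ob_eqI[OF E' \<phi>, of ?R])
    fix b p assume b: "b \<in> Ob (vop V B)" "val p" "ty p = fob \<phi> b"
      "dj (cm ?P \<phi> \<psi> ?R (gl (isbell_unit V B \<psi>)) g) p" "dj p (cm ?P \<phi> \<psi> ?R (gl (isbell_unit V B \<psi>)) g)"
    have "ap (unit_cmp B \<psi> b) (nv (vop V B) \<phi> \<psi> b g p) =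
      cm (vpsh V B) (Lf B \<psi>) (Lf B \<phi>) (rep V B b) (ap (unit_cmp B \<phi> b) p) (ap (far (isbell_L V B) \<phi> \<psi>) g)"
      by (rule nat_ob_eqI[OF E L_facts(1)[OF E E' \<psi>], of "rep V B b"])
        (use * b \<phi> \<psi> E E' in \<open>simp_all add: Un_ac\<close>)
    then show "nv (vop V B) \<phi> ?R b (cm ?P \<phi> \<psi> ?R (gl (isbell_unit V B \<psi>)) g) p =
      nv (vop V B) \<phi> ?R b (cm ?P \<phi> (Lf (vop V B) (Lf B \<phi>)) ?R
        (ap (far (isbell_L V (vop V B)) (Lf B \<psi>) (Lf B \<phi>)) (ap (far (isbell_L V B) \<phi> \<psi>) g)) (gl (isbell_unit V B \<phi>))) p"
      using * b \<phi> \<psi> E E' by simp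
  qed (use * \<phi> \<psi> E E' in simp_all)
  then show "cm ?P (fob (vid V ?P) \<phi>) (fob (vid V ?P) \<psi>) (fob ?RL \<psi>) (gl (isbell_unit V B \<psi>)) (ap (far (vid V ?P) \<phi> \<psi>) g) =
    cm ?P (fob (vid V ?P) \<phi>) (fob ?RL \<phi>) (fob ?RL \<psi>) (ap (far ?RL \<phi> \<psi>) g) (gl (isbell_unit V B \<phi>))"
    using * \<phi> \<psi> E E' by (simp add: isbell_R_eq)
next
  show "vfunctor V (vpsh V (vop V B)) (vpsh V (vop V B)) (vcompose V (vpsh V (vop V B)) (isbell_R V B) (isbell_L V B))"
    by (rule vfunctor_vcompose[OF vfunctor_isbell_L[OF E E'] vfunctor_isbell_R]) (use E E' in simp_all)
qed (use E E' in \<open>simp_all add: isbell_R_eq\<close>)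

text \<open>Precomposing evaluation at \<open>q\<close> with the unit sends \<open>p\<close> to the
  value of \<open>q\<close> at \<open>p\<close>, which gives back \<open>q\<close>.\<close>

lemma isbell_triangle:
  assumes \<phi>: "vpre (vop V B) \<phi>"
  shows "ecomp V (vop V (vpsh V B)) (Lf B \<phi>) (Lf B (Lf (vop V B) (Lf B \<phi>))) (Lf B \<phi>)
     (isbell_unit V (vop V B) (Lf B \<phi>))
     (far (isbell_L V B) \<phi> (Lf (vop V B) (Lf B \<phi>)) \<cdot> isbell_unit V B \<phi>) = Id (vpsh V B) (Lf B \<phi>)"
    (is "ecomp V ?C ?L ?LRL ?L ?\<epsilon> ?\<eta> = _")
proof -
  let ?R = "Lf (vop V B) (Lf B \<phi>)"
  have L: "vpre B ?L" and R: "vpre (vop V B) ?R" using \<phi> by simp_all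
  note \<epsilon> = isbell_unit_simps_op[OF L]
  note \<epsilon>' = unit_cmp_simps_op[OF L]
  have C: "vcategory V ?C" using E by simp
  have "cm (vpsh V B) ?L ?LRL ?L (ap (far (isbell_L V B) \<phi> ?R) (gl (isbell_unit V B \<phi>))) (gl ?\<epsilon>) =
      gl (Id (vpsh V B) ?L)"
  proof (rule nat_ob_eqI[OF E L L])
    fix c q assume c: "c \<in> Ob B" "val q" "ty q = fob ?L c"
    have "cm (vpsh V (vop V B)) \<phi> ?R (yo B c) (ap (unit_cmp (vop V B) ?L c) q) (gl (isbell_unit V B \<phi>)) = q"
      by (rule nat_ob_eqI[OF E' \<phi>, of "yo B c"]) (use c \<phi> L R E E' \<epsilon>' in simp_all)
    then show "nv B ?L ?L c (cm (vpsh V B) ?L ?LRL ?L (ap (far (isbell_L V B) \<phi> ?R) (gl (isbell_unit V B \<phi>))) (gl ?\<epsilon>)) q =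
        nv B ?L ?L c (gl (Id (vpsh V B) ?L)) q"
      using c \<phi> L R E E' \<epsilon> \<epsilon>' by simp
  qed (use \<phi> L R E E' \<epsilon> in simp_all)
  then have "gl (ecomp V ?C ?L ?LRL ?L ?\<epsilon> ?\<eta>) = gl (Id (vpsh V B) ?L)"
    using \<phi> L R E E' \<epsilon> C by simp
  then show ?thesis
    by (rule gl_eqD[of _ _ "NT B ?L ?L"]) (use \<phi> L R E E' \<epsilon> C in simp_all)
qed

end

end

section \<open>Duality, and the adjunction assembled from one half\<close>

context sym_mon_closed
begin

lemma vnat_vop:
  assumes n: "vnat V A C F G \<alpha>" and F: "vfunctor V A C F" and G: "vfunctor V A C G"
    and A: "vcategory V A" and C: "vcategory V C"
  shows "vnat V (vop V A) (vop V C) (vopfun G) (vopfun F) \<alpha>"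
proof (rule vnatI)
  note d1 = vnatD(1)[OF n] and d2 = vnatD(2)[OF n F G A C]
  fix x y k assume *: "x \<in> Ob (vop V A)" "y \<in> Ob (vop V A)" "val k" "ty k = Hom (vop V A) x y"
  show "cm (vop V C) (fob (vopfun G) x) (fob (vopfun G) y) (fob (vopfun F) y) (gl (\<alpha> y)) (ap (far (vopfun G) x y) k) =
    cm (vop V C) (fob (vopfun G) x) (fob (vopfun F) x) (fob (vopfun F) y) (ap (far (vopfun F) x y) k) (gl (\<alpha> x))"
    using * F G A C d1[of x] d1[of y] d2[of y x k] by simp
qed (use vnatD(1)[OF n] vfunctor_vopfun F G A C in simp_all)

lemma ecomp_vop:
  assumes "vcategory V A" "x \<in> Ob A" "y \<in> Ob A" "z \<in> Ob A"
    "f \<in> hom V (unt V) (Hom A y x)" "g \<in> hom V (unt V) (Hom A z y)"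
  shows "ecomp V (vop V A) x y z g f = ecomp V A z y x f g"
  by (rule gl_eqD[of _ _ "Hom A z x"]) (use assms in simp_all)

lemma vopfun_vcompose: "vopfun (vcompose V A G F) = vcompose V (vop V A) (vopfun G) (vopfun F)"
  by (simp add: vcompose_def mk_vfun_vop)

lemma isbell_L_op: "vcategory V B \<Longrightarrow> isbell_L V (vop V B) = vopfun (isbell_R V B)"
  by (simp add: isbell_R_eq)

lemma isbell_R_op: "vcategory V B \<Longrightarrow> isbell_R V (vop V B) = vopfun (isbell_L V B)"
  using isbell_R_eq[of "vop V B"] by simp

text \<open>Naturality of the counit and the second triangle are naturality of the unit and the
  first triangle for \<open>vop V B\<close>, read in opposite categories.\<close>

theorem isbell_adjunction:
  assumes E: "has_ends B" and E': "has_ends (vop V B)"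
  shows "vadjunction V (vpsh V (vop V B)) (vop V (vpsh V B))
    (isbell_L V B) (isbell_R V B) (isbell_unit V B) (isbell_counit V B)"
proof -
  let ?P = "vpsh V (vop V B)" and ?Q = "vpsh V B"
  have B: "vcategory V B" and P: "vcategory V ?P" and Q: "vcategory V ?Q" using E E' by simp_all
  have E'': "has_ends (vop V (vop V B))" using E B by simp
  note L = vfunctor_isbell_L[OF E E'] and R = vfunctor_isbell_R[OF E E']
  have RL: "vfunctor V ?Q ?Q (vcompose V ?Q (vopfun (isbell_L V B)) (vopfun (isbell_R V B)))"
    by (rule vfunctor_vcompose[of _ "vop V ?P"]) (use vfunctor_vopfun[OF L] vfunctor_vopfun[OF R] P Q in simp_all)
  have "vnat V ?Q ?Q (vid V ?Q) (vcompose V ?Q (vopfun (isbell_L V B)) (vopfun (isbell_R V B))) (isbell_counit V B)"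
    using vnat_isbell_unit[OF E' E''] B by (simp add: isbell_counit_def isbell_L_op isbell_R_op)
  from vnat_vop[OF this vfunctor_vid[OF Q] RL Q Q]
  have counit: "vnat V (vop V ?Q) (vop V ?Q) (vcompose V (vop V ?Q) (isbell_L V B) (isbell_R V B))
      (vid V (vop V ?Q)) (isbell_counit V B)"
    using Q by (simp add: vopfun_vcompose)
  note u [simp] = unit_facts[OF E E'] isbell_unit_simps_op[OF E E']
  have Rob: "fob (isbell_R V B) \<psi> = Lf (vop V B) \<psi>" for \<psi>
    using B by (simp add: isbell_R_eq)
  have tri2: "ecomp V ?P (Lf (vop V B) \<psi>) (Lf (vop V B) (Lf B (Lf (vop V B) \<psi>))) (Lf (vop V B) \<psi>)
      (far (isbell_R V B) (Lf B (Lf (vop V B) \<psi>)) \<psi> \<cdot> isbell_counit V B \<psi>)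
      (isbell_unit V B (Lf (vop V B) \<psi>)) = Id ?P (Lf (vop V B) \<psi>)" if \<psi>: "vpre B \<psi>" for \<psi>
  proof -
    have "ecomp V (vop V ?P) (Lf (vop V B) \<psi>) (Lf (vop V B) (Lf B (Lf (vop V B) \<psi>))) (Lf (vop V B) \<psi>)
      (isbell_unit V B (Lf (vop V B) \<psi>))
      (far (isbell_L V (vop V B)) \<psi> (Lf B (Lf (vop V B) \<psi>)) \<cdot> isbell_unit V (vop V B) \<psi>) = Id ?P (Lf (vop V B) \<psi>)"
      using isbell_triangle[OF E' E'', of \<psi>] \<psi> B by simp
    then show ?thesis
      by (subst (asm) ecomp_vop) (use \<psi> P B in \<open>simp_all add: isbell_R_eq isbell_counit_def\<close>)
  qed
  show ?thesis
    unfolding vadjunction_def Let_def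
    using L R vnat_isbell_unit[OF E E'] counit isbell_triangle[OF E E'] tri2
    by (simp add: Rob isbell_counit_def)
qed

section \<open>Weighted colimits as universal cocones\<close>

text \<open>A weighted colimit freed from the representation \<beta>: a cocone \<open>l\<close>,
  factorizations with a parameter object \<open>X\<close>, and their uniqueness among elements in an
  arbitrary context, as an enriched universal property demands. Preservation then concerns the
  cocone alone.\<close>

definition universal_cocone :: "('k, 'o, 'm) vcat \<Rightarrow> ('a, 'o, 'm) vcat \<Rightarrow> ('k, 'o, 'm) vfun \<Rightarrow>
    ('k, 'a, 'm) vfun \<Rightarrow> 'a \<Rightarrow> ('k \<Rightarrow> 'm) \<Rightarrow> bool" where
  "universal_cocone K A W S c l \<longleftrightarrow> c \<in> Ob A \<and>
     wedge V (vop V K) (vself V) W (nerve_ob K A S c) (unt V) l \<and>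
     (\<forall>a \<in> Ob A. \<forall>X \<tau>. wedge V (vop V K) (vself V) W (nerve_ob K A S a) X \<tau> \<longrightarrow>
        (\<exists>h \<in> hom V X (Hom A c a). \<forall>k \<in> Ob K. \<forall>x w. val x \<and> ty x = X \<and> val w \<and> ty w = fob W k \<and> dj x w \<longrightarrow>
           cm A (fob S k) c a (ap h x) (app (fob W k) (Hom A (fob S k) c) (gl (l k)) w) =
           app (fob W k) (Hom A (fob S k) a) (ap (\<tau> k) x) w)) \<and>
     (\<forall>a \<in> Ob A. \<forall>u u'. val u \<and> val u' \<and> ty u = Hom A c a \<and> ty u' = Hom A c a \<and> stg u = stg u' \<and>
        (\<forall>k \<in> Ob K. \<forall>w. val w \<and> ty w = fob W k \<and> dj u w \<longrightarrow>
           cm A (fob S k) c a u (app (fob W k) (Hom A (fob S k) c) (gl (l k)) w) =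
           cm A (fob S k) c a u' (app (fob W k) (Hom A (fob S k) c) (gl (l k)) w)) \<longrightarrow> u = u')"

lemma dj_stg: "stg u = stg u' \<Longrightarrow> dj u w = dj u' w" "stg u = stg u' \<Longrightarrow> dj w u = dj w u'"
  by (simp_all add: dj_def)

context
  fixes K :: "('k, 'o, 'm) vcat" and A :: "('a, 'o, 'm) vcat" and W S
  assumes K: "vcategory V K" and EK: "has_ends (vop V K)" and A: "vcategory V A"
    and W: "vpre (vop V K) W" and S: "vfunctor V K A S"
begin

lemma nerve_ob_hom [simp]:
  assumes "a \<in> Ob A"
  shows "vpre (vop V K) (nerve_ob K A S a)"
  using vpre_nerve_ob[OF K A S assms] .

text \<open>By Yoneda \<beta> is determined by its value at the identity of \<open>c\<close>, which
  is the cocone. Factorizations come from the inverses of its components, uniqueness from their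
  injectivity.\<close>

lemma universal_cocone_colimit_unit:
  assumes w: "weighted_colimit V K A W S c \<beta>"
  shows "universal_cocone K A W S c (colimit_unit V K A W S c \<beta>)"
proof -
  let ?N = "nerve_ob K A S"
  let ?G = "vcompose V A (rep V (vpsh V (vop V K)) W) (nerve V K A S)"
  let ?l = "colimit_unit V K A W S c \<beta>"
  have c [simp]: "c \<in> Ob A" and \<beta>: "vnat_iso V A (vself V) (rep V A c) ?G \<beta>"
    using w by (simp_all add: weighted_colimit_def)
  have nS: "vfunctor V A (vpsh V (vop V K)) (nerve V K A S)" by (rule vfunctor_nerve[OF EK K A S])
  have G: "vpre A ?G" by (rule vfunctor_vcompose[OF nS vpre_rep]) (use EK A W in simp_all)
  have n: "vnat V A (vself V) (rep V A c) ?G \<beta>" using \<beta> by (simp add: vnat_iso_def)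
  have b [simp]: "\<beta> a \<in> arr V" "src V (\<beta> a) = unt V" "trg V (\<beta> a) = ihom V (Hom A c a) (NT (vop V K) W (?N a))"
    if "a \<in> Ob A" for a
    using vnatD(1)[OF n that] that by (simp_all add: nerve_ob_eq)
  have Sk [simp]: "fob S k \<in> Ob A" if "k \<in> Ob K" for k using that S by simp
  have Wk [simp]: "fob W k \<in> obj V" if "k \<in> Ob K" for k using vfunctor_vself_objD[OF W] that by simp
  note [simp] = nerve_ob_hom K EK A nat_ob_arr[OF EK W nerve_ob_hom] nerve_far[OF EK K A S]
  let ?one = "app (Hom A c c) (NT (vop V K) W (?N c)) (gl (\<beta> c)) (gl (Id A c))"
  have gl_l: "?l k \<in> arr V" "src V (?l k) = unt V" "trg V (?l k) = ihom V (fob W k) (Hom A (fob S k) c)"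
     "gl (?l k) = ap (pr (vop V K) W (?N c) k) ?one" if "k \<in> Ob K" for k
    using that by (simp_all add: colimit_unit_def Let_def nerve_ob_eq)
  \<comment> \<open>Naturality of \<beta> at \<open>u\<close>, evaluated at the identity of
    \<open>c\<close>.\<close>
  have key: "app (fob W k) (Hom A (fob S k) a) (ap (pr (vop V K) W (?N a) k) (app (Hom A c a) (NT (vop V K) W (?N a)) (gl (\<beta> a)) u)) w
      = cm A (fob S k) c a u (app (fob W k) (Hom A (fob S k) c) (gl (?l k)) w)"
    if *: "a \<in> Ob A" "k \<in> Ob K" "val u" "ty u = Hom A c a" "val w" "ty w = fob W k" "dj u w" "dj w u" for a k u w
  proof -
    have "app (Hom A c c) (NT (vop V K) W (?N a))
        (cm (vself V) (Hom A c c) (Hom A c a) (NT (vop V K) W (?N a)) (gl (\<beta> a)) (ap (far (rep V A c) c a) u)) (gl (Id A c))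
      = app (Hom A c c) (NT (vop V K) W (?N a))
        (cm (vself V) (Hom A c c) (NT (vop V K) W (?N c)) (NT (vop V K) W (?N a)) (ap (far ?G c a) u) (gl (\<beta> c))) (gl (Id A c))"
      using vnatD(2)[OF n vpre_rep[OF A c] G A vcategory_vself c *(1) *(3,4)] * by (simp add: nerve_ob_eq)
    then have "app (Hom A c a) (NT (vop V K) W (?N a)) (gl (\<beta> a)) u =
        cm (vpsh V (vop V K)) W (?N c) (?N a) (ap (far (nerve V K A S) c a) u) ?one"
      using * W by (simp add: nerve_ob_eq)
    then show ?thesis using * W gl_l[OF *(2)] by simp
  qed
  have "\<exists>g. g \<in> hom V (unt V) (ihom V (NT (vop V K) W (?N a)) (Hom A c a)) \<and>
      cm (vself V) (Hom A c a) (NT (vop V K) W (?N a)) (Hom A c a) (gl g) (gl (\<beta> a)) = gl (Id (vself V) (Hom A c a)) \<and>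
      cm (vself V) (NT (vop V K) W (?N a)) (Hom A c a) (NT (vop V K) W (?N a)) (gl (\<beta> a)) (gl g)
        = gl (Id (vself V) (NT (vop V K) W (?N a)))" if "a \<in> Ob A" for a
  proof -
    have "viso V (vself V) (Hom A c a) (NT (vop V K) W (?N a)) (\<beta> a)"
      using \<beta> that unfolding vnat_iso_def by (simp add: nerve_ob_eq)
    then show ?thesis using that by (subst (asm) viso_iff) (auto simp del: hom_iff)
  qed
  then obtain g where g: "\<And>a. a \<in> Ob A \<Longrightarrow> g a \<in> hom V (unt V) (ihom V (NT (vop V K) W (?N a)) (Hom A c a)) \<and>
      cm (vself V) (Hom A c a) (NT (vop V K) W (?N a)) (Hom A c a) (gl (g a)) (gl (\<beta> a)) = gl (Id (vself V) (Hom A c a)) \<and>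
      cm (vself V) (NT (vop V K) W (?N a)) (Hom A c a) (NT (vop V K) W (?N a)) (gl (\<beta> a)) (gl (g a))
        = gl (Id (vself V) (NT (vop V K) W (?N a)))" by metis
  have ga [simp]: "g a \<in> arr V" "src V (g a) = unt V" "trg V (g a) = ihom V (NT (vop V K) W (?N a)) (Hom A c a)"
    if "a \<in> Ob A" for a using g[OF that] by simp_all
  have gb: "app (NT (vop V K) W (?N a)) (Hom A c a) (gl (g a)) (app (Hom A c a) (NT (vop V K) W (?N a)) (gl (\<beta> a)) u) = u"
    if "a \<in> Ob A" "val u" "ty u = Hom A c a" for a u
    using app_vself(2)[of "Hom A c a" "NT (vop V K) W (?N a)" "Hom A c a" "gl (g a)" "gl (\<beta> a)" u] g[OF that(1)] that W
    by simp
  have bg: "app (Hom A c a) (NT (vop V K) W (?N a)) (gl (\<beta> a)) (app (NT (vop V K) W (?N a)) (Hom A c a) (gl (g a)) n) = n"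
    if "a \<in> Ob A" "val n" "ty n = NT (vop V K) W (?N a)" for a n
    using app_vself(2)[of "NT (vop V K) W (?N a)" "Hom A c a" "NT (vop V K) W (?N a)" "gl (\<beta> a)" "gl (g a)" n] g[OF that(1)] that W
    by simp
  show ?thesis unfolding universal_cocone_def
  proof (intro conjI ballI allI impI)
    show "wedge V (vop V K) (vself V) W (?N c) (unt V) ?l"
    proof (rule wedgeI_on_iso[of _ _ _ star])
      fix x y k w
      assume *: "x \<in> Ob (vop V K)" "y \<in> Ob (vop V K)" "val k" "val w" "ty k = Hom (vop V K) x y"
        "ty w = fob W x" "dj k star" "dj star k" "dj k w" "dj w k" "dj star w" "dj w star"
      have "act (?N c) x y k (nv (vop V K) W (?N c) x ?one w) = nv (vop V K) W (?N c) y ?one (act W x y k w)"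
        by (rule nv_act[symmetric]) (use * W in simp_all)
      then show "act (?N c) x y k (app (fob W x) (fob (?N c) x) (gl (?l x)) w) =
        app (fob W y) (fob (?N c) y) (gl (?l y)) (act W x y k w)"
        using * gl_l by simp
    qed (use W gl_l in simp_all)
  next
    fix a X \<tau> assume a: "a \<in> Ob A" and t: "wedge V (vop V K) (vself V) W (?N a) X \<tau>"
    note l = nat_lift_simps[OF EK W nerve_ob_hom[OF a] t] and X = wedgeD(1)[OF t _ W nerve_ob_hom[OF a]]
    let ?f = "nat_lift V (vop V K) (vself V) W (?N a) X \<tau>"
    let ?h = "evl V (NT (vop V K) W (?N a)) (Hom A c a) \<cdot> (g a \<otimes> ?f) \<cdot> luni X"
    have h: "?h \<in> hom V X (Hom A c a)" using a l X W by simp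
    moreover have "cm A (fob S k) c a (ap ?h x) (app (fob W k) (Hom A (fob S k) c) (gl (?l k)) w) =
         app (fob W k) (Hom A (fob S k) a) (ap (\<tau> k) x) w"
      if "k \<in> Ob K" "val x" "ty x = X" "val w" "ty w = fob W k" "dj x w" for k x w
    proof -
      have e: "app (Hom A c a) (NT (vop V K) W (?N a)) (gl (\<beta> a)) (ap ?h x) = ap ?f x"
        using that a l X W by (simp add: bg)
      have "dj w x" using that dj_sym by blast
      then show ?thesis using key[OF a that(1), of "ap ?h x" w] that h l unfolding e by (simp del: ap_cmp)
    qed
    ultimately show "\<exists>h \<in> hom V X (Hom A c a). \<forall>k \<in> Ob K. \<forall>x w. val x \<and> ty x = X \<and> val w \<and> ty w = fob W k \<and> dj x w \<longrightarrow>
           cm A (fob S k) c a (ap h x) (app (fob W k) (Hom A (fob S k) c) (gl (?l k)) w) =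
           app (fob W k) (Hom A (fob S k) a) (ap (\<tau> k) x) w" by blast
  next
    fix a u u'
    assume a: "a \<in> Ob A" and "val u \<and> val u' \<and> ty u = Hom A c a \<and> ty u' = Hom A c a \<and> stg u = stg u' \<and>
        (\<forall>k \<in> Ob K. \<forall>w. val w \<and> ty w = fob W k \<and> dj u w \<longrightarrow>
           cm A (fob S k) c a u (app (fob W k) (Hom A (fob S k) c) (gl (?l k)) w) =
           cm A (fob S k) c a u' (app (fob W k) (Hom A (fob S k) c) (gl (?l k)) w))"
    then have u: "val u" "val u'" "ty u = Hom A c a" "ty u' = Hom A c a" "stg u = stg u'"
      and eq: "\<And>k w. \<lbrakk>k \<in> Ob K; val w; ty w = fob W k; dj u w\<rbrakk> \<Longrightarrow>
           cm A (fob S k) c a u (app (fob W k) (Hom A (fob S k) c) (gl (?l k)) w) =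
           cm A (fob S k) c a u' (app (fob W k) (Hom A (fob S k) c) (gl (?l k)) w)" by blast+
    have "app (Hom A c a) (NT (vop V K) W (?N a)) (gl (\<beta> a)) u = app (Hom A c a) (NT (vop V K) W (?N a)) (gl (\<beta> a)) u'"
    proof (rule nat_ob_eqI[OF EK W nerve_ob_hom[OF a]])
      fix x w assume "x \<in> Ob (vop V K)" "val w" "ty w = fob W x"
        "dj (app (Hom A c a) (NT (vop V K) W (?N a)) (gl (\<beta> a)) u) w"
        "dj w (app (Hom A c a) (NT (vop V K) W (?N a)) (gl (\<beta> a)) u)"
      then show "nv (vop V K) W (?N a) x (app (Hom A c a) (NT (vop V K) W (?N a)) (gl (\<beta> a)) u) w =
        nv (vop V K) W (?N a) x (app (Hom A c a) (NT (vop V K) W (?N a)) (gl (\<beta> a)) u') w"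
        using a u eq[of x w] key[OF a, of x u w] key[OF a, of x u' w] dj_stg[OF u(5)] by simp
    qed (use a u W in simp_all)
    then show "u = u'" using gb[OF a] u by metis
  qed simp
qed

text \<open>The component at \<open>a\<close> composes the cocone with morphisms from
  \<open>c\<close> to \<open>a\<close>. Existence and uniqueness of factorizations make it
  invertible, and its value at the identity is again \<open>l\<close>.\<close>

lemma weighted_colimit_universal_cocone:
  assumes uc: "universal_cocone K A W S c l"
  obtains \<beta> where "weighted_colimit V K A W S c \<beta>" "\<And>k. k \<in> Ob K \<Longrightarrow> colimit_unit V K A W S c \<beta> k = l k"
proof -
  let ?N = "nerve_ob K A S"
  let ?G = "vcompose V A (rep V (vpsh V (vop V K)) W) (nerve V K A S)"
  have c [simp]: "c \<in> Ob A" and l0: "wedge V (vop V K) (vself V) W (?N c) (unt V) l"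
    using uc by (simp_all add: universal_cocone_def)
  have nS: "vfunctor V A (vpsh V (vop V K)) (nerve V K A S)" by (rule vfunctor_nerve[OF EK K A S])
  have G: "vpre A ?G" by (rule vfunctor_vcompose[OF nS vpre_rep]) (use EK A W in simp_all)
  have Sk [simp]: "fob S k \<in> Ob A" if "k \<in> Ob K" for k using that S by simp
  have Wk [simp]: "fob W k \<in> obj V" if "k \<in> Ob K" for k using vfunctor_vself_objD[OF W] that by simp
  note [simp] = nerve_ob_hom K EK A nat_ob_arr[OF EK W nerve_ob_hom] nerve_far[OF EK K A S]
  have l [simp]: "l k \<in> arr V" "src V (l k) = unt V" "trg V (l k) = ihom V (fob W k) (Hom A (fob S k) c)"
    if "k \<in> Ob K" for k
    using wedgeD(2-4)[OF l0 _ W nerve_ob_hom[OF c]] that by simp_all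
  let ?\<tau> = "\<lambda>a k. curry_arr V (Hom A c a) (fob W k) (Hom A (fob S k) a) (Comp A (fob S k) c a \<cdot>
    (idn V (Hom A c a) \<otimes> (evl V (fob W k) (Hom A (fob S k) c) \<cdot> (l k \<otimes> idn V (fob W k)) \<cdot> luni (fob W k))))"
  have w: "wedge V (vop V K) (vself V) W (?N a) (Hom A c a) (?\<tau> a)" if a: "a \<in> Ob A" for a
  proof (rule wedgeI)
    fix x y k t u
    assume *: "x \<in> Ob (vop V K)" "y \<in> Ob (vop V K)" "val k" "val t" "val u" "ty k = Hom (vop V K) x y"
      "ty t = Hom A c a" "ty u = fob W x" "dj k t" "dj t k" "dj k u" "dj u k" "dj t u" "dj u t"
    have "app (fob W y) (fob (?N c) y) (gl (l y)) (act W x y k u) = act (?N c) x y k (app (fob W x) (fob (?N c) x) (gl (l x)) u)"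
      by (rule wedgeD(5)[OF l0 _ W nerve_ob_hom[OF c]]) (use * in simp_all)
    then have "app (fob W y) (Hom A (fob S y) c) (gl (l y)) (act W x y k u) =
      cm A (fob S y) (fob S x) c (app (fob W x) (Hom A (fob S x) c) (gl (l x)) u) (ap (far S y x) k)"
      using * S by simp
    then show "act (?N a) x y k (app (fob W x) (fob (?N a) x) (ap (?\<tau> a x) t) u) =
      app (fob W y) (fob (?N a) y) (ap (?\<tau> a y) t) (act W x y k u)"
      using * a S W by simp
  qed (use W a in simp_all)
  define b where "b a = nat_lift V (vop V K) (vself V) W (?N a) (Hom A c a) (?\<tau> a)" for a
  have b [simp]: "b a \<in> arr V" "src V (b a) = Hom A c a" "trg V (b a) = NT (vop V K) W (?N a)"
    if "a \<in> Ob A" for a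
    unfolding b_def using nat_lift_simps(1-3)[OF EK W nerve_ob_hom[OF that] w[OF that]] by simp_all
  have bv [simp]: "app p q (ap (pr (vop V K) W (?N a) k) (ap (b a) u)) w =
      cm A (fob S k) c a u (app (fob W k) (Hom A (fob S k) c) (gl (l k)) w)"
    if "a \<in> Ob A" "k \<in> Ob K" "val u" "ty u = Hom A c a" "val w" "ty w = fob W k" "dj u w" "dj w u"
      "p = fob W k" "q = Hom A (fob S k) a" for a k u w p q
    unfolding b_def using that nat_lift_simps(4)[OF EK W nerve_ob_hom[OF that(1)] w[OF that(1)]] by simp
  define \<beta> where "\<beta> a = name_arr V (Hom A c a) (NT (vop V K) W (?N a)) (b a)" for a
  have \<beta> [simp]: "\<beta> a \<in> arr V" "src V (\<beta> a) = unt V" "trg V (\<beta> a) = ihom V (Hom A c a) (NT (vop V K) W (?N a))"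
    "\<lbrakk>val u; ty u = Hom A c a\<rbrakk> \<Longrightarrow> app (Hom A c a) (NT (vop V K) W (?N a)) (gl (\<beta> a)) u = ap (b a) u"
    if "a \<in> Ob A" for a u
    unfolding \<beta>_def using that by simp_all
  have n: "vnat V A (vself V) (rep V A c) ?G \<beta>"
  proof (rule vnatI)
    fix x y v assume *: "x \<in> Ob A" "y \<in> Ob A" "val v" "ty v = Hom A x y"
    have "cm (vself V) (Hom A c x) (Hom A c y) (NT (vop V K) W (?N y)) (gl (\<beta> y)) (ap (far (rep V A c) x y) v) =
      cm (vself V) (Hom A c x) (NT (vop V K) W (?N x)) (NT (vop V K) W (?N y)) (ap (far ?G x y) v) (gl (\<beta> x))"
    proof (rule ihom_eqI[of _ _ "Hom A c x" "NT (vop V K) W (?N y)"])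
      fix u assume u: "val u" "ty u = Hom A c x"
        "dj (cm (vself V) (Hom A c x) (Hom A c y) (NT (vop V K) W (?N y)) (gl (\<beta> y)) (ap (far (rep V A c) x y) v)) u"
        "dj u (cm (vself V) (Hom A c x) (Hom A c y) (NT (vop V K) W (?N y)) (gl (\<beta> y)) (ap (far (rep V A c) x y) v))"
      have "ap (b y) (cm A c x y v u) = cm (vpsh V (vop V K)) W (?N x) (?N y) (ap (far (nerve V K A S) x y) v) (ap (b x) u)"
        by (rule nat_ob_eqI[OF EK W nerve_ob_hom[OF *(2)]]) (use * u W in simp_all)
      then show "app (Hom A c x) (NT (vop V K) W (?N y))
         (cm (vself V) (Hom A c x) (Hom A c y) (NT (vop V K) W (?N y)) (gl (\<beta> y)) (ap (far (rep V A c) x y) v)) u =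
        app (Hom A c x) (NT (vop V K) W (?N y))
         (cm (vself V) (Hom A c x) (NT (vop V K) W (?N x)) (NT (vop V K) W (?N y)) (ap (far ?G x y) v) (gl (\<beta> x))) u"
        using * u W by (simp add: nerve_ob_eq)
    qed (use * W in \<open>simp_all add: nerve_ob_eq\<close>)
    then show "cm (vself V) (fob (rep V A c) x) (fob (rep V A c) y) (fob ?G y) (gl (\<beta> y)) (ap (far (rep V A c) x y) v) =
        cm (vself V) (fob (rep V A c) x) (fob ?G x) (fob ?G y) (ap (far ?G x y) v) (gl (\<beta> x))"
      using * by (simp add: nerve_ob_eq)
  qed (use G in \<open>simp_all add: nerve_ob_eq\<close>)
  have "viso V (vself V) (Hom A c a) (NT (vop V K) W (?N a)) (\<beta> a)" if a: "a \<in> Ob A" for a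
  proof -
    \<comment> \<open>The tautological wedge of the end: its factorization through the cocone is the
      inverse of \<open>b a\<close>.\<close>
    have "wedge V (vop V K) (vself V) W (?N a) (NT (vop V K) W (?N a)) (pr (vop V K) W (?N a))"
      using nat_end_nat_ob[OF EK W nerve_ob_hom[OF a]] by (simp add: nat_end_def)
    then obtain h where h: "h \<in> hom V (NT (vop V K) W (?N a)) (Hom A c a)"
      and hv: "\<And>k x w. \<lbrakk>k \<in> Ob K; val x; ty x = NT (vop V K) W (?N a); val w; ty w = fob W k; dj x w\<rbrakk> \<Longrightarrow>
           cm A (fob S k) c a (ap h x) (app (fob W k) (Hom A (fob S k) c) (gl (l k)) w) =
           app (fob W k) (Hom A (fob S k) a) (ap (pr (vop V K) W (?N a) k) x) w"
      using uc a unfolding universal_cocone_def by blast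
    have hb: "ap h (ap (b a) u) = u" if u: "val u" "ty u = Hom A c a" for u
    proof -
      have "cm A (fob S k) c a (ap h (ap (b a) u)) (app (fob W k) (Hom A (fob S k) c) (gl (l k)) w) =
           cm A (fob S k) c a u (app (fob W k) (Hom A (fob S k) c) (gl (l k)) w)"
        if "k \<in> Ob K" "val w" "ty w = fob W k" "dj u w" for k w
        using that u a hv[of k "ap (b a) u" w] dj_sym[of u w] by simp
      moreover have "val (ap h (ap (b a) u))" "ty (ap h (ap (b a) u)) = Hom A c a" using u a h by simp_all
      ultimately show ?thesis
        using uc a u unfolding universal_cocone_def
        by (metis (no_types, lifting) stg_simps(1) dj_simps(1))
    qed
    have bh: "ap (b a) (ap h n) = n" if n: "val n" "ty n = NT (vop V K) W (?N a)" for n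
      by (rule nat_ob_eqI[OF EK W nerve_ob_hom[OF a]]) (use n a h hv in simp_all)
    show ?thesis
    proof (subst viso_iff, simp_all add: a W, rule bexI[of _ "name_arr V (NT (vop V K) W (?N a)) (Hom A c a) h"], rule conjI)
      show "cm (vself V) (Hom A c a) (NT (vop V K) W (?N a)) (Hom A c a)
          (gl (name_arr V (NT (vop V K) W (?N a)) (Hom A c a) h)) (gl (\<beta> a)) = gl (Id (vself V) (Hom A c a))"
        by (rule ihom_eqI[of _ _ "Hom A c a" "Hom A c a"]) (use a h hb W in simp_all)
      show "cm (vself V) (NT (vop V K) W (?N a)) (Hom A c a) (NT (vop V K) W (?N a)) (gl (\<beta> a))
          (gl (name_arr V (NT (vop V K) W (?N a)) (Hom A c a) h)) = gl (Id (vself V) (NT (vop V K) W (?N a)))"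
        by (rule ihom_eqI[of _ _ "NT (vop V K) W (?N a)" "NT (vop V K) W (?N a)"]) (use a h bh W in simp_all)
    qed (use h in simp_all)
  qed
  then have "vnat_iso V A (vself V) (rep V A c) ?G \<beta>"
    using n by (simp add: vnat_iso_def nerve_ob_eq)
  then have "weighted_colimit V K A W S c \<beta>" by (simp add: weighted_colimit_def)
  moreover have "colimit_unit V K A W S c \<beta> k = l k" if k: "k \<in> Ob K" for k
  proof -
    have "gl (colimit_unit V K A W S c \<beta> k) = ap (pr (vop V K) W (?N c) k) (ap (b c) (gl (Id A c)))"
      using k W by (simp add: colimit_unit_def Let_def nerve_ob_eq)
    also have "\<dots> = gl (l k)"
      by (rule ihom_eqI[of _ _ "fob W k" "Hom A (fob S k) c"]) (use k W in simp_all)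
    finally show ?thesis
      by (rule gl_eqD[of _ _ "ihom V (fob W k) (Hom A (fob S k) c)"])
        (use k W in \<open>simp_all add: colimit_unit_def Let_def nerve_ob_eq\<close>)
  qed
  ultimately show ?thesis by (rule that)
qed

end

end

section \<open>Small projectives\<close>

context sym_mon_closed
begin

text \<open>The Yoneda element: \<open>p\<close> in \<open>\<phi> b\<close> corresponds to \<open>B(-, b) \<rightarrow> \<phi>\<close>, \<open>r \<mapsto> \<phi>(r) p\<close>.\<close>

definition yel :: "('a, 'o, 'm) vcat \<Rightarrow> ('a, 'o, 'm) vfun \<Rightarrow> 'a \<Rightarrow> 'm" where
  "yel B \<phi> b = nat_lift V (vop V B) (vself V) (yo B b) \<phi> (fob \<phi> b)
     (\<lambda>a. curry_arr V (fob \<phi> b) (Hom B a b) (fob \<phi> a)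
        (evl V (fob \<phi> b) (fob \<phi> a) \<cdot> (far \<phi> b a \<otimes> idn V (fob \<phi> b)) \<cdot> brd V (fob \<phi> b) (Hom B a b)))"

context
  fixes B :: "('a, 'o, 'm) vcat"
  assumes E: "has_ends B" and E': "has_ends (vop V B)"
begin

lemmas B_facts [simp] = unit_facts[OF E E']

lemma yel_simps [simp]:
  assumes \<phi>: "vpre (vop V B) \<phi>" and b: "b \<in> Ob B"
  shows "yel B \<phi> b \<in> arr V" "src V (yel B \<phi> b) = fob \<phi> b"
    "trg V (yel B \<phi> b) = NT (vop V B) (yo B b) \<phi>"
    "\<lbrakk>a \<in> Ob B; val p; ty p = fob \<phi> b; val r; ty r = Hom B a b; dj p r; dj r p; x = Hom B a b; y = fob \<phi> a\<rbrakk>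
     \<Longrightarrow> app x y (ap (pr (vop V B) (yo B b) \<phi> a) (ap (yel B \<phi> b) p)) r = act \<phi> b a r p"
proof -
  let ?\<tau> = "\<lambda>a. curry_arr V (fob \<phi> b) (Hom B a b) (fob \<phi> a)
        (evl V (fob \<phi> b) (fob \<phi> a) \<cdot> (far \<phi> b a \<otimes> idn V (fob \<phi> b)) \<cdot> brd V (fob \<phi> b) (Hom B a b))"
  have r: "vpre (vop V B) (yo B b)" using b by simp
  have w: "wedge V (vop V B) (vself V) (yo B b) \<phi> (fob \<phi> b) ?\<tau>"
  proof (rule wedgeI)
    fix x y k t u
    assume *: "x \<in> Ob (vop V B)" "y \<in> Ob (vop V B)" "val k" "val t" "val u" "ty k = Hom (vop V B) x y"
      "ty t = fob \<phi> b" "ty u = fob (yo B b) x" "dj k t" "dj t k" "dj k u" "dj u k" "dj t u" "dj u t"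
    then show "act \<phi> x y k (app (fob (yo B b) x) (fob \<phi> x) (ap (?\<tau> x) t) u) =
      app (fob (yo B b) y) (fob \<phi> y) (ap (?\<tau> y) t) (act (yo B b) x y k u)"
      using b \<phi> app_far_cm[OF \<phi>, of b x y k u t] by simp
  qed (use \<phi> b r vfunctor_vself_objD[OF \<phi>] in simp_all)
  note l = nat_lift_simps[OF E' r \<phi> w]
  show "yel B \<phi> b \<in> arr V" "src V (yel B \<phi> b) = fob \<phi> b"
    "trg V (yel B \<phi> b) = NT (vop V B) (yo B b) \<phi>"
    unfolding yel_def by (rule l)+
  assume "a \<in> Ob B" "val p" "ty p = fob \<phi> b" "val r" "ty r = Hom B a b" "dj p r" "dj r p" "x = Hom B a b" "y = fob \<phi> a"
  then show "app x y (ap (pr (vop V B) (yo B b) \<phi> a) (ap (yel B \<phi> b) p)) r = act \<phi> b a r p"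
    unfolding yel_def using l \<phi> b by simp
qed

text \<open>Density of the Yoneda embedding. A cocone on Yoneda elements is turned back into a
  natural transformation by evaluation at identities.\<close>

lemma yoneda_universal_cocone:
  assumes \<phi>: "vpre (vop V B) \<phi>"
  shows "universal_cocone B (vpsh V (vop V B)) \<phi> (yoneda V B) \<phi>
    (\<lambda>b. name_arr V (fob \<phi> b) (NT (vop V B) (yo B b) \<phi>) (yel B \<phi> b))"
proof -
  let ?P = "vpsh V (vop V B)" and ?Y = "yoneda V B" and ?y = "\<lambda>b. yo B b"
  let ?l = "\<lambda>b. name_arr V (fob \<phi> b) (NT (vop V B) (?y b) \<phi>) (yel B \<phi> b)"
  have P: "vcategory V ?P" and Y: "vfunctor V B ?P ?Y" using E' by simp_all
  have N: "vpre (vop V B) (nerve_ob B ?P ?Y \<chi>)" if "vpre (vop V B) \<chi>" for \<chi>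
    by (rule vpre_nerve_ob[OF _ P Y]) (use that in simp_all)
  have Nact: "act (nerve_ob B ?P ?Y \<chi>) b b' k n = cm ?P (?y b') (?y b) \<chi> n (ap (far ?Y b' b) k)"
    if "vpre (vop V B) \<chi>" "b \<in> Ob B" "b' \<in> Ob B" "val k" "ty k = Hom B b' b" "val n"
      "ty n = NT (vop V B) (?y b) \<chi>" "dj k n" "dj n k" for \<chi> b b' k n
    using nerve_ob_act[OF _ P Y, of \<chi> b b' k n] that E' by simp
  have Yv: "nv (vop V B) (?y b') \<chi> a (cm ?P (?y b') (?y b) \<chi> n (ap (far ?Y b' b) k)) r =
      nv (vop V B) (?y b) \<chi> a n (cm B a b' b k r)"
    if "vpre (vop V B) \<chi>" "b \<in> Ob B" "b' \<in> Ob B" "a \<in> Ob B" "val k" "ty k = Hom B b' b" "val n"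
      "ty n = NT (vop V B) (?y b) \<chi>" "val r" "ty r = Hom B a b'" "dj n k" "dj n r" "dj k r" "dj r k" for \<chi> a b b' k n r
    using that E' by simp
  show ?thesis unfolding universal_cocone_def
  proof (intro conjI ballI allI impI)
    show "\<phi> \<in> Ob ?P" using \<phi> by simp
    show "wedge V (vop V B) (vself V) \<phi> (nerve_ob B ?P ?Y \<phi>) (unt V) ?l"
    proof (rule wedgeI_on_iso[of _ _ _ star])
      fix b b' k p
      assume *: "b \<in> Ob (vop V B)" "b' \<in> Ob (vop V B)" "val k" "val p" "ty k = Hom (vop V B) b b'"
        "ty p = fob \<phi> b" "dj k star" "dj star k" "dj k p" "dj p k" "dj star p" "dj p star"
      have "cm ?P (?y b') (?y b) \<phi> (ap (yel B \<phi> b) p) (ap (far ?Y b' b) k) = ap (yel B \<phi> b') (act \<phi> b b' k p)"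
      proof (rule nat_ob_eqI[OF E', of "?y b'" \<phi>])
        fix a r assume r: "a \<in> Ob (vop V B)" "val r" "ty r = fob (?y b') a"
          "dj (cm ?P (?y b') (?y b) \<phi> (ap (yel B \<phi> b) p) (ap (far ?Y b' b) k)) r"
          "dj r (cm ?P (?y b') (?y b) \<phi> (ap (yel B \<phi> b) p) (ap (far ?Y b' b) k))"
        show "nv (vop V B) (?y b') \<phi> a (cm ?P (?y b') (?y b) \<phi> (ap (yel B \<phi> b) p) (ap (far ?Y b' b) k)) r =
          nv (vop V B) (?y b') \<phi> a (ap (yel B \<phi> b') (act \<phi> b b' k p)) r"
          using * r \<phi> E' app_far_cm[OF \<phi>, of b b' a r k p] by simp
      qed (use * \<phi> E' in \<open>simp_all add: Un_ac\<close>)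
      then show "act (nerve_ob B ?P ?Y \<phi>) b b' k (app (fob \<phi> b) (fob (nerve_ob B ?P ?Y \<phi>) b) (gl (?l b)) p) =
        app (fob \<phi> b') (fob (nerve_ob B ?P ?Y \<phi>) b') (gl (?l b')) (act \<phi> b b' k p)"
        using * \<phi> E' Nact[OF \<phi>, of b b' k "ap (yel B \<phi> b) p"] by simp
    qed (use \<phi> E' N in simp_all)
  next
    fix \<chi> X \<tau>
    assume "\<chi> \<in> Ob ?P" and t: "wedge V (vop V B) (vself V) \<phi> (nerve_ob B ?P ?Y \<chi>) X \<tau>"
    then have \<chi>: "vpre (vop V B) \<chi>" by simp
    note W = wedgeD[OF t _ \<phi> N[OF \<chi>]]
    have X [simp]: "X \<in> obj V" using W(1) by simp
    have \<tau> [simp]: "\<tau> b \<in> arr V" "src V (\<tau> b) = X" "trg V (\<tau> b) = ihom V (fob \<phi> b) (NT (vop V B) (?y b) \<chi>)"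
      if "b \<in> Ob B" for b using W(2-4) that \<chi> E' by simp_all
    have \<tau>n: "app (fob \<phi> b') (NT (vop V B) (?y b') \<chi>) (ap (\<tau> b') x) (act \<phi> b b' k p) =
        cm ?P (?y b') (?y b) \<chi> (app (fob \<phi> b) (NT (vop V B) (?y b) \<chi>) (ap (\<tau> b) x) p) (ap (far ?Y b' b) k)"
      if "b \<in> Ob B" "b' \<in> Ob B" "val k" "ty k = Hom B b' b" "val x" "ty x = X" "val p" "ty p = fob \<phi> b"
        "dj k x" "dj x k" "dj k p" "dj p k" "dj x p" for b b' k x p
      using W(5)[of b b' k x p] Nact[OF \<chi>, of b b' k "app (fob \<phi> b) (NT (vop V B) (?y b) \<chi>) (ap (\<tau> b) x) p"]
        that \<phi> \<chi> E' by simp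
    \<comment> \<open>For elements \<open>x\<close> and \<open>p\<close> the cocone gives a
      transformation from B(-, b) to \<chi>; its value at the identity of \<open>b\<close> is
      taken.\<close>
    let ?\<sigma> = "\<lambda>b. curry_arr V X (fob \<phi> b) (fob \<chi> b) (evl V (Hom B b b) (fob \<chi> b) \<cdot>
      ((pr (vop V B) (?y b) \<chi> b \<cdot> evl V (fob \<phi> b) (NT (vop V B) (?y b) \<chi>) \<cdot> (\<tau> b \<otimes> idn V (fob \<phi> b))) \<otimes> Id B b) \<cdot>
      runi (X \<odot> fob \<phi> b))"
    have s: "wedge V (vop V B) (vself V) \<phi> \<chi> X ?\<sigma>"
    proof (rule wedgeI)
      fix b b' k x p
      assume *: "b \<in> Ob (vop V B)" "b' \<in> Ob (vop V B)" "val k" "val x" "val p" "ty k = Hom (vop V B) b b'"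
        "ty x = X" "ty p = fob \<phi> b" "dj k x" "dj x k" "dj k p" "dj p k" "dj x p" "dj p x"
      let ?n = "app (fob \<phi> b) (NT (vop V B) (?y b) \<chi>) (ap (\<tau> b) x) p"
      have "nv (vop V B) (?y b) \<chi> b' ?n (act (?y b) b b' k (gl (Id B b))) =
          act \<chi> b b' k (nv (vop V B) (?y b) \<chi> b ?n (gl (Id B b)))"
        by (rule nv_act[OF E' _ \<chi>]) (use * \<phi> \<chi> E' in simp_all)
      then show "act \<chi> b b' k (app (fob \<phi> b) (fob \<chi> b) (ap (?\<sigma> b) x) p) =
        app (fob \<phi> b') (fob \<chi> b') (ap (?\<sigma> b') x) (act \<phi> b b' k p)"
        using * \<phi> \<chi> E' by (simp add: \<tau>n)
    qed (use \<phi> \<chi> E' in simp_all)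
    let ?h = "nat_lift V (vop V B) (vself V) \<phi> \<chi> X ?\<sigma>"
    note l = nat_lift_simps[OF E' \<phi> \<chi> s]
    have "?h \<in> hom V X (NT (vop V B) \<phi> \<chi>)" using l by simp
    moreover have "cm ?P (?y b) \<phi> \<chi> (ap ?h x) (ap (yel B \<phi> b) p) = app (fob \<phi> b) (NT (vop V B) (?y b) \<chi>) (ap (\<tau> b) x) p"
      if *: "b \<in> Ob B" "val x" "ty x = X" "val p" "ty p = fob \<phi> b" "dj x p" for b x p
    proof (rule nat_ob_eqI[OF E', of "?y b" \<chi>])
      fix a r assume r: "a \<in> Ob (vop V B)" "val r" "ty r = fob (?y b) a"
        "dj (cm ?P (?y b) \<phi> \<chi> (ap ?h x) (ap (yel B \<phi> b) p)) r" "dj r (cm ?P (?y b) \<phi> \<chi> (ap ?h x) (ap (yel B \<phi> b) p))"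
      then show "nv (vop V B) (?y b) \<chi> a (cm ?P (?y b) \<phi> \<chi> (ap ?h x) (ap (yel B \<phi> b) p)) r =
        nv (vop V B) (?y b) \<chi> a (app (fob \<phi> b) (NT (vop V B) (?y b) \<chi>) (ap (\<tau> b) x) p) r"
        using * \<phi> \<chi> E' l dj_sym[of p x] by (simp add: \<tau>n)
    qed (use * \<phi> \<chi> E' l dj_sym[of p x] in simp_all)
    ultimately show "\<exists>h \<in> hom V X (Hom ?P \<phi> \<chi>). \<forall>k \<in> Ob B. \<forall>x w. val x \<and> ty x = X \<and> val w \<and> ty w = fob \<phi> k \<and> dj x w \<longrightarrow>
           cm ?P (fob ?Y k) \<phi> \<chi> (ap h x) (app (fob \<phi> k) (Hom ?P (fob ?Y k) \<phi>) (gl (?l k)) w) =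
           app (fob \<phi> k) (Hom ?P (fob ?Y k) \<chi>) (ap (\<tau> k) x) w"
      using \<phi> by (intro bexI[of _ ?h]) (auto simp del: hom_iff)
  next
    fix \<chi> u u'
    assume "\<chi> \<in> Ob ?P" and u: "val u \<and> val u' \<and> ty u = Hom ?P \<phi> \<chi> \<and> ty u' = Hom ?P \<phi> \<chi> \<and> stg u = stg u' \<and>
        (\<forall>k \<in> Ob B. \<forall>w. val w \<and> ty w = fob \<phi> k \<and> dj u w \<longrightarrow>
           cm ?P (fob ?Y k) \<phi> \<chi> u (app (fob \<phi> k) (Hom ?P (fob ?Y k) \<phi>) (gl (?l k)) w) =
           cm ?P (fob ?Y k) \<phi> \<chi> u' (app (fob \<phi> k) (Hom ?P (fob ?Y k) \<phi>) (gl (?l k)) w))"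
    then have \<chi>: "vpre (vop V B) \<chi>" by simp
    show "u = u'"
    proof (rule nat_ob_eqI[OF E' \<phi> \<chi>])
      fix b p assume *: "b \<in> Ob (vop V B)" "val p" "ty p = fob \<phi> b" "dj u p" "dj p u"
      have e: "cm ?P (?y b) \<phi> \<chi> u (ap (yel B \<phi> b) p) = cm ?P (?y b) \<phi> \<chi> u' (ap (yel B \<phi> b) p)"
        using u * \<phi> by simp
      \<comment> \<open>The Yoneda element of \<open>p\<close> sends the identity of
        \<open>b\<close> to \<open>p\<close>, so \<open>v\<close> is known from its composites with
        Yoneda elements.\<close>
      have "nv (vop V B) \<phi> \<chi> b v p = nv (vop V B) (?y b) \<chi> b (cm ?P (?y b) \<phi> \<chi> v (ap (yel B \<phi> b) p)) (gl (Id B b))"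
        if "val v" "ty v = NT (vop V B) \<phi> \<chi>" "dj v p" for v
        using that * \<phi> \<chi> E' app_far_Id[OF \<phi>, of b p] by simp
      then show "nv (vop V B) \<phi> \<chi> b u p = nv (vop V B) \<phi> \<chi> b u' p"
        using e u * dj_stg[of u u' p] by simp
    qed (use u in simp_all)
  qed
qed

end

text \<open>
  An element \<open>q\<close> of \<open>L \<phi> b\<close> followed by the Yoneda element of \<open>p\<close> is the endomorphism
  \<open>r \<mapsto> \<phi>(q r) p\<close> of \<open>\<phi>\<close>. If \<open>[B\<^sup>o\<^sup>p, V](\<phi>, -)\<close> preserves \<open>\<phi> * Y\<close>, these endomorphisms exhibit
  \<open>[B\<^sup>o\<^sup>p, V](\<phi>, \<phi>)\<close> as the coend of \<open>\<phi> b \<otimes> L \<phi> b\<close>.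
\<close>

abbreviation rank_one :: "('a, 'o, 'm) vcat \<Rightarrow> ('a, 'o, 'm) vfun \<Rightarrow> 'a \<Rightarrow> (nat \<times> 'o) list \<times> 'm \<Rightarrow>
    (nat \<times> 'o) list \<times> 'm \<Rightarrow> (nat \<times> 'o) list \<times> 'm" where
  "rank_one B \<phi> b p q \<equiv> cm (vpsh V (vop V B)) \<phi> (yo B b) \<phi> (ap (yel B \<phi> b) p) q"

text \<open>Phrased through maps out of the object of endomorphisms, so no coend has to be
  constructed. The parameter \<open>X\<close> makes the factorization enriched; the last clause says
  that a map into any \<open>v\<close> is known from its values on rank-one endomorphisms.\<close>

definition coend_end :: "('a, 'o, 'm) vcat \<Rightarrow> ('a, 'o, 'm) vfun \<Rightarrow> bool" where
  "coend_end B \<phi> \<longleftrightarrow>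
    (\<forall>v \<in> obj V. \<forall>X \<in> obj V. \<forall>\<tau>.
      (\<forall>b \<in> Ob B. \<tau> b \<in> hom V X (ihom V (fob \<phi> b) (ihom V (NT (vop V B) \<phi> (yo B b)) v))) \<and>
      (\<forall>b \<in> Ob B. \<forall>b' \<in> Ob B. \<forall>k x p q. val k \<and> val x \<and> val p \<and> val q \<and> ty k = Hom B b' b \<and> ty x = X \<and>
        ty p = fob \<phi> b \<and> ty q = NT (vop V B) \<phi> (yo B b') \<and>
        dj k x \<and> dj k p \<and> dj k q \<and> dj x p \<and> dj x q \<and> dj p q \<and> dj x k \<and> dj p k \<and> dj q k \<and> dj p x \<and> dj q x \<and> dj q p \<longrightarrow>
        app (NT (vop V B) \<phi> (yo B b')) v
          (app (fob \<phi> b') (ihom V (NT (vop V B) \<phi> (yo B b')) v) (ap (\<tau> b') x) (act \<phi> b b' k p)) q =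
        app (NT (vop V B) \<phi> (yo B b)) v
          (app (fob \<phi> b) (ihom V (NT (vop V B) \<phi> (yo B b)) v) (ap (\<tau> b) x) p) (act (Lf B \<phi>) b' b k q)) \<longrightarrow>
      (\<exists>h \<in> hom V X (ihom V (NT (vop V B) \<phi> \<phi>) v). \<forall>b \<in> Ob B. \<forall>x p q. val x \<and> ty x = X \<and> val p \<and> ty p = fob \<phi> b \<and>
         val q \<and> ty q = NT (vop V B) \<phi> (yo B b) \<and> dj x p \<and> dj x q \<and> dj p q \<and> dj p x \<and> dj q x \<and> dj q p \<longrightarrow>
         app (NT (vop V B) \<phi> \<phi>) v (ap h x) (rank_one B \<phi> b p q) =
         app (NT (vop V B) \<phi> (yo B b)) v
          (app (fob \<phi> b) (ihom V (NT (vop V B) \<phi> (yo B b)) v) (ap (\<tau> b) x) p) q)) \<and>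
    (\<forall>v \<in> obj V. \<forall>u u'. val u \<and> val u' \<and> ty u = ihom V (NT (vop V B) \<phi> \<phi>) v \<and> ty u' = ihom V (NT (vop V B) \<phi> \<phi>) v \<and>
      stg u = stg u' \<and>
      (\<forall>b \<in> Ob B. \<forall>p q. val p \<and> ty p = fob \<phi> b \<and> val q \<and> ty q = NT (vop V B) \<phi> (yo B b) \<and>
        dj u p \<and> dj u q \<and> dj p q \<and> dj p u \<and> dj q u \<and> dj q p \<longrightarrow>
        app (NT (vop V B) \<phi> \<phi>) v u (rank_one B \<phi> b p q) = app (NT (vop V B) \<phi> \<phi>) v u' (rank_one B \<phi> b p q)) \<longrightarrow> u = u')"

text \<open>Preservation is applied with \<open>B\<close> itself as the shape, which is why its
  objects are taken from the type \<open>'u\<close> of \<kappa>.\<close>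

lemma small_projective_coend_end:
  fixes \<kappa> :: "'u rel" and B :: "('u, 'o, 'm) vcat"
  assumes E: "has_ends B" and E': "has_ends (vop V B)" and sm: "vsmall \<kappa> V B"
    and sp: "small_projective \<kappa> V B \<phi>"
  shows "coend_end B \<phi>"
proof -
  note [simp] = B_facts[OF E E'] yel_simps[OF E E']
  let ?P = "vpsh V (vop V B)" and ?Y = "yoneda V B" and ?y = "\<lambda>b. yo B b"
  let ?l = "\<lambda>b. name_arr V (fob \<phi> b) (NT (vop V B) (?y b) \<phi>) (yel B \<phi> b)"
  let ?F = "rep V ?P \<phi>" and ?N = "NT (vop V B)"
  have \<phi>: "vpre (vop V B) \<phi>" using sp by (simp add: small_projective_def)
  have B: "vcategory V B" and P: "vcategory V ?P" and Y: "vfunctor V B ?P ?Y" using E E' by simp_all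
  have pres: "preserves_small_colimits \<kappa> V ?P (vself V) ?F"
    using sp by (simp add: small_projective_def)
  obtain \<beta> where \<beta>: "weighted_colimit V B ?P \<phi> ?Y \<phi> \<beta>" "\<And>b. b \<in> Ob B \<Longrightarrow> colimit_unit V B ?P \<phi> ?Y \<phi> \<beta> b = ?l b"
    using weighted_colimit_universal_cocone[OF B E' P \<phi> Y yoneda_universal_cocone[OF E E' \<phi>]] by blast
  have "preserves_colimit V B ?P (vself V) ?F \<phi> ?Y \<phi> \<beta>"
    using pres B sm \<phi> Y \<beta>(1) unfolding preserves_small_colimits_def by blast
  then obtain \<beta>' where \<beta>': "weighted_colimit V B (vself V) \<phi> (vcompose V B ?F ?Y) (fob ?F \<phi>) \<beta>'"
    and u: "\<And>b. b \<in> Ob B \<Longrightarrow> colimit_unit V B (vself V) \<phi> (vcompose V B ?F ?Y) (fob ?F \<phi>) \<beta>' b =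
      ecomp V (vself V) (fob \<phi> b) (Hom ?P (fob ?Y b) \<phi>) (Hom (vself V) (fob ?F (fob ?Y b)) (fob ?F \<phi>))
        (name_arr V (Hom ?P (fob ?Y b) \<phi>) (Hom (vself V) (fob ?F (fob ?Y b)) (fob ?F \<phi>)) (far ?F (fob ?Y b) \<phi>))
        (colimit_unit V B ?P \<phi> ?Y \<phi> \<beta> b)"
    unfolding preserves_colimit_def by blast
  define l' where "l' = colimit_unit V B (vself V) \<phi> (Lf B \<phi>) (?N \<phi> \<phi>) \<beta>'"
  have L: "vcompose V B ?F ?Y = Lf B \<phi>" using Lf_eq[OF \<phi>] by simp
  have c: "fob ?F \<phi> = ?N \<phi> \<phi>" using \<phi> by simp
  have LB: "vpre B (Lf B \<phi>)" using \<phi> by simp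
  have uc: "universal_cocone B (vself V) \<phi> (Lf B \<phi>) (?N \<phi> \<phi>) l'"
    using universal_cocone_colimit_unit[OF B E' vcategory_vself \<phi> LB \<beta>'[unfolded L c]] by (simp add: l'_def)
  \<comment> \<open>The preserved cocone is postcomposition with Yoneda elements, that is, the
    rank-one endomorphisms.\<close>
  have l': "l' b \<in> hom V (unt V) (ihom V (fob \<phi> b) (ihom V (?N \<phi> (?y b)) (?N \<phi> \<phi>)))"
    "\<lbrakk>val p; ty p = fob \<phi> b; val q; ty q = ?N \<phi> (?y b); dj p q; dj q p\<rbrakk> \<Longrightarrow>
     app (?N \<phi> (?y b)) (?N \<phi> \<phi>) (app (fob \<phi> b) (ihom V (?N \<phi> (?y b)) (?N \<phi> \<phi>)) (gl (l' b)) p) q = rank_one B \<phi> b p q"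
    if b: "b \<in> Ob B" for b p q
    using u[OF b] \<beta>(2)[OF b] b \<phi> E' P vfunctor_vself_objD[OF \<phi>] unfolding l'_def L c
    by (simp_all add: rep_sel)
  have NL: "vpre (vop V B) (nerve_ob B (vself V) (Lf B \<phi>) v)" if "v \<in> obj V" for v
    by (rule vpre_nerve_ob[OF B _ LB]) (use that in simp_all)
  show ?thesis unfolding coend_end_def
  proof (intro conjI ballI allI impI, goal_cases)
    case (1 v X \<tau>)
    then have v: "v \<in> obj V" and X: "X \<in> obj V" and
      t: "\<And>b. b \<in> Ob B \<Longrightarrow> \<tau> b \<in> hom V X (ihom V (fob \<phi> b) (ihom V (?N \<phi> (?y b)) v))" and
      tn: "\<And>b b' k x p q. \<lbrakk>b \<in> Ob B; b' \<in> Ob B; val k; val x; val p; val q; ty k = Hom B b' b; ty x = X;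
        ty p = fob \<phi> b; ty q = ?N \<phi> (?y b'); dj k x; dj k p; dj k q; dj x p; dj x q; dj p q;
        dj x k; dj p k; dj q k; dj p x; dj q x; dj q p\<rbrakk> \<Longrightarrow>
        app (?N \<phi> (?y b')) v (app (fob \<phi> b') (ihom V (?N \<phi> (?y b')) v) (ap (\<tau> b') x) (act \<phi> b b' k p)) q =
        app (?N \<phi> (?y b)) v (app (fob \<phi> b) (ihom V (?N \<phi> (?y b)) v) (ap (\<tau> b) x) p) (act (Lf B \<phi>) b' b k q)"
      by blast+
    \<comment> \<open>A wedge from \<phi> to [L \<phi>-, v] is an extranatural family on \<phi> and
      L \<phi> in curried form.\<close>
    have "wedge V (vop V B) (vself V) \<phi> (nerve_ob B (vself V) (Lf B \<phi>) v) X \<tau>"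
    proof (rule wedgeI)
      fix b b' k x p
      assume *: "b \<in> Ob (vop V B)" "b' \<in> Ob (vop V B)" "val k" "val x" "val p" "ty k = Hom (vop V B) b b'"
        "ty x = X" "ty p = fob \<phi> b" "dj k x" "dj x k" "dj k p" "dj p k" "dj x p" "dj p x"
      have "cm (vself V) (?N \<phi> (?y b')) (?N \<phi> (?y b)) v (app (fob \<phi> b) (ihom V (?N \<phi> (?y b)) v) (ap (\<tau> b) x) p) (ap (far (Lf B \<phi>) b' b) k) =
         app (fob \<phi> b') (ihom V (?N \<phi> (?y b')) v) (ap (\<tau> b') x) (act \<phi> b b' k p)"
        by (rule ihom_eqI[of _ _ "?N \<phi> (?y b')" v])
          (use * v t[of b] t[of b'] \<phi> E' tn[of b b' k x p] in \<open>simp_all add: Un_ac\<close>)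
      then show "act (nerve_ob B (vself V) (Lf B \<phi>) v) b b' k (app (fob \<phi> b) (fob (nerve_ob B (vself V) (Lf B \<phi>) v) b) (ap (\<tau> b) x) p) =
        app (fob \<phi> b') (fob (nerve_ob B (vself V) (Lf B \<phi>) v) b') (ap (\<tau> b') x) (act \<phi> b b' k p)"
        using nerve_ob_act[OF B vcategory_vself LB, of v b b' k "app (fob \<phi> b) (ihom V (?N \<phi> (?y b)) v) (ap (\<tau> b) x) p"]
          * v t[of b] \<phi> E' by simp
    qed (use \<phi> v X t E' NL in simp_all)
    then obtain h where h: "h \<in> hom V X (ihom V (?N \<phi> \<phi>) v)" and
      hv: "\<And>b x p. \<lbrakk>b \<in> Ob B; val x; ty x = X; val p; ty p = fob \<phi> b; dj x p\<rbrakk> \<Longrightarrow>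
         cm (vself V) (fob (Lf B \<phi>) b) (?N \<phi> \<phi>) v (ap h x) (app (fob \<phi> b) (ihom V (fob (Lf B \<phi>) b) (?N \<phi> \<phi>)) (gl (l' b)) p) =
         app (fob \<phi> b) (ihom V (fob (Lf B \<phi>) b) v) (ap (\<tau> b) x) p"
      using uc v unfolding universal_cocone_def by (simp del: hom_iff) blast
    show ?case
    proof (rule bexI[OF _ h], intro ballI allI impI, elim conjE)
      fix b x p q assume *: "b \<in> Ob B" "val x" "ty x = X" "val p" "ty p = fob \<phi> b" "val q"
         "ty q = ?N \<phi> (?y b)" "dj x p" "dj x q" "dj p q" "dj p x" "dj q x" "dj q p"
      then show "app (?N \<phi> \<phi>) v (ap h x) (rank_one B \<phi> b p q) =
         app (?N \<phi> (?y b)) v (app (fob \<phi> b) (ihom V (?N \<phi> (?y b)) v) (ap (\<tau> b) x) p) q"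
        using arg_cong[OF hv[of b x p], of "\<lambda>f. app (?N \<phi> (?y b)) v f q"] h v \<phi> E' l'(1)[of b] by (simp add: l'(2))
    qed
  next
    case (2 v u u')
    then have v: "v \<in> obj V" and u: "val u" "val u'" "ty u = ihom V (?N \<phi> \<phi>) v" "ty u' = ihom V (?N \<phi> \<phi>) v" "stg u = stg u'"
      and eq: "\<And>b p q. \<lbrakk>b \<in> Ob B; val p; ty p = fob \<phi> b; val q; ty q = ?N \<phi> (?y b);
        dj u p; dj u q; dj p q; dj p u; dj q u; dj q p\<rbrakk> \<Longrightarrow>
        app (?N \<phi> \<phi>) v u (rank_one B \<phi> b p q) = app (?N \<phi> \<phi>) v u' (rank_one B \<phi> b p q)"
      by blast+
    have "cm (vself V) (?N \<phi> (?y b)) (?N \<phi> \<phi>) v u (app (fob \<phi> b) (ihom V (?N \<phi> (?y b)) (?N \<phi> \<phi>)) (gl (l' b)) p) =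
      cm (vself V) (?N \<phi> (?y b)) (?N \<phi> \<phi>) v u' (app (fob \<phi> b) (ihom V (?N \<phi> (?y b)) (?N \<phi> \<phi>)) (gl (l' b)) p)"
      if "b \<in> Ob B" "val p" "ty p = fob \<phi> b" "dj u p" for b p
      by (rule ihom_eqI[of _ _ "?N \<phi> (?y b)" v])
        (use that v u \<phi> E' l'(1)[of b] l'(2)[of b p] eq[of b p] dj_stg[OF u(5)] dj_sym[of p u] dj_sym[of p u'] in simp_all)
    then show ?case using uc v u \<phi> unfolding universal_cocone_def by (simp del: hom_iff)
  qed
qed

end

section \<open>Invertibility of the unit at a small projective\<close>

context sym_mon_closed
begin

text \<open>Pointwise inverses of a natural transformation are automatically natural, so they form
  an inverse in the functor category.\<close>

lemma viso_vpshI: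
  assumes A: "has_ends A" and F: "vpre A F" and G: "vpre A G"
    and n: "n \<in> hom V (unt V) (NT A F G)"
    and c: "\<And>x. x \<in> Ob A \<Longrightarrow> c x \<in> hom V (fob F x) (fob G x)"
    and j: "\<And>x. x \<in> Ob A \<Longrightarrow> j x \<in> hom V (fob G x) (fob F x)"
    and nc: "\<And>x u. \<lbrakk>x \<in> Ob A; val u; ty u = fob F x\<rbrakk> \<Longrightarrow> nv A F G x (gl n) u = ap (c x) u"
    and jc: "\<And>x u. \<lbrakk>x \<in> Ob A; val u; ty u = fob F x\<rbrakk> \<Longrightarrow> ap (j x) (ap (c x) u) = u"
    and cj: "\<And>x u. \<lbrakk>x \<in> Ob A; val u; ty u = fob G x\<rbrakk> \<Longrightarrow> ap (c x) (ap (j x) u) = u"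
  shows "viso V (vpsh V A) F G n"
proof -
  let ?\<tau> = "\<lambda>x. name_arr V (fob G x) (fob F x) (j x)"
  have w: "wedge V A (vself V) G F (unt V) ?\<tau>"
  proof (rule wedgeI_on_iso[of _ _ _ star])
    fix x y k v
    assume *: "x \<in> Ob A" "y \<in> Ob A" "val k" "val v" "ty k = Hom A x y" "ty v = fob G x"
      "dj k star" "dj star k" "dj k v" "dj v k" "dj star v" "dj v star"
    have "act F x y k (ap (j x) v) = ap (j y) (ap (c y) (act F x y k (ap (j x) v)))"
      by (rule jc[symmetric]) (use * F A j[of x] in simp_all)
    also have "ap (c y) (act F x y k (ap (j x) v)) = act G x y k (ap (c x) (ap (j x) v))"
      using nv_act[OF A F G, of x y k "gl n" "ap (j x) v"] * n F G A j[of x] nc by simp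
    finally show "act F x y k (app (fob G x) (fob F x) (gl (?\<tau> x)) v) = app (fob G y) (fob F y) (gl (?\<tau> y)) (act G x y k v)"
      using * F G A j[of x] j[of y] cj by simp
  qed (use A F G j in simp_all)
  let ?m = "nat_lift V A (vself V) G F (unt V) ?\<tau>"
  note l = nat_lift_simps[OF A G F w]
  have mv: "nv A G F x (gl ?m) u = ap (j x) u" if "x \<in> Ob A" "val u" "ty u = fob G x" for x u
    using l that j[of x] by simp
  show ?thesis
  proof (subst viso_iff, simp_all add: A F G, intro conjI bexI[of _ ?m])
    show "cm (vpsh V A) F G F (gl ?m) (gl n) = gl (Id (vpsh V A) F)"
      by (rule nat_ob_eqI[OF A F F]) (use n l A F G c nc jc mv in simp_all)
    show "cm (vpsh V A) G F G (gl n) (gl ?m) = gl (Id (vpsh V A) G)"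
      by (rule nat_ob_eqI[OF A G G]) (use n l A F G j nc cj mv in simp_all)
  qed (use n l in simp_all)
qed

text \<open>Integration: an extranatural family is extended from rank-one endomorphisms to all
  endomorphisms, to be evaluated at the identity.\<close>

lemma coend_endE:
  assumes R: "coend_end B \<phi>" and v: "v \<in> obj V" and X: "X \<in> obj V"
    and t: "\<And>b. b \<in> Ob B \<Longrightarrow> \<tau> b \<in> hom V X (ihom V (fob \<phi> b) (ihom V (NT (vop V B) \<phi> (yo B b)) v))"
    and n: "\<And>b b' k x p q. \<lbrakk>b \<in> Ob B; b' \<in> Ob B; val k; val x; val p; val q; ty k = Hom B b' b; ty x = X;
        ty p = fob \<phi> b; ty q = NT (vop V B) \<phi> (yo B b');
        dj k x; dj k p; dj k q; dj x p; dj x q; dj p q; dj x k; dj p k; dj q k; dj p x; dj q x; dj q p\<rbrakk> \<Longrightarrow>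
        app (NT (vop V B) \<phi> (yo B b')) v
          (app (fob \<phi> b') (ihom V (NT (vop V B) \<phi> (yo B b')) v) (ap (\<tau> b') x) (act \<phi> b b' k p)) q =
        app (NT (vop V B) \<phi> (yo B b)) v
          (app (fob \<phi> b) (ihom V (NT (vop V B) \<phi> (yo B b)) v) (ap (\<tau> b) x) p) (act (Lf B \<phi>) b' b k q)"
  obtains h where "h \<in> arr V" "src V h = X" "trg V h = ihom V (NT (vop V B) \<phi> \<phi>) v"
    "\<And>b x p q. \<lbrakk>b \<in> Ob B; val x; ty x = X; val p; ty p = fob \<phi> b; val q;
       ty q = NT (vop V B) \<phi> (yo B b); dj x p; dj x q; dj p q; dj p x; dj q x; dj q p\<rbrakk> \<Longrightarrow>
         app (NT (vop V B) \<phi> \<phi>) v (ap h x) (rank_one B \<phi> b p q) =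
         app (NT (vop V B) \<phi> (yo B b)) v
          (app (fob \<phi> b) (ihom V (NT (vop V B) \<phi> (yo B b)) v) (ap (\<tau> b) x) p) q"
proof -
  have "\<exists>h \<in> hom V X (ihom V (NT (vop V B) \<phi> \<phi>) v). \<forall>b \<in> Ob B. \<forall>x p q. val x \<and> ty x = X \<and> val p \<and> ty p = fob \<phi> b \<and>
         val q \<and> ty q = NT (vop V B) \<phi> (yo B b) \<and> dj x p \<and> dj x q \<and> dj p q \<and> dj p x \<and> dj q x \<and> dj q p \<longrightarrow>
         app (NT (vop V B) \<phi> \<phi>) v (ap h x) (rank_one B \<phi> b p q) =
         app (NT (vop V B) \<phi> (yo B b)) v
          (app (fob \<phi> b) (ihom V (NT (vop V B) \<phi> (yo B b)) v) (ap (\<tau> b) x) p) q"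
    by (rule R[unfolded coend_end_def, THEN conjunct1, rule_format, OF v X])
      (intro conjI ballI allI impI t n; (elim conjE)?; assumption)
  then obtain h where "h \<in> hom V X (ihom V (NT (vop V B) \<phi> \<phi>) v)" and
    "\<And>b x p q. \<lbrakk>b \<in> Ob B; val x; ty x = X; val p; ty p = fob \<phi> b; val q;
       ty q = NT (vop V B) \<phi> (yo B b); dj x p; dj x q; dj p q; dj p x; dj q x; dj q p\<rbrakk> \<Longrightarrow>
         app (NT (vop V B) \<phi> \<phi>) v (ap h x) (rank_one B \<phi> b p q) =
         app (NT (vop V B) \<phi> (yo B b)) v
          (app (fob \<phi> b) (ihom V (NT (vop V B) \<phi> (yo B b)) v) (ap (\<tau> b) x) p) q"
    by (elim bexE) (rule that; blast)
  then show thesis by (intro that[of h]) simp_all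
qed

lemma coend_end_eqI:
  assumes R: "coend_end B \<phi>" and v: "v \<in> obj V"
    and u: "val u" "val u'" "ty u = ihom V (NT (vop V B) \<phi> \<phi>) v" "ty u' = ihom V (NT (vop V B) \<phi> \<phi>) v" "stg u = stg u'"
    and eq: "\<And>b p q. \<lbrakk>b \<in> Ob B; val p; ty p = fob \<phi> b; val q; ty q = NT (vop V B) \<phi> (yo B b);
        dj u p; dj u q; dj p q; dj p u; dj q u; dj q p\<rbrakk> \<Longrightarrow>
        app (NT (vop V B) \<phi> \<phi>) v u (rank_one B \<phi> b p q) = app (NT (vop V B) \<phi> \<phi>) v u' (rank_one B \<phi> b p q)"
  shows "u = u'"
  by (rule R[unfolded coend_end_def, THEN conjunct2, rule_format, OF v])
    (intro conjI ballI allI impI u eq; (elim conjE)?; assumption)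

context
  fixes B :: "('a, 'o, 'm) vcat" and \<phi>
  assumes E: "has_ends B" and E': "has_ends (vop V B)" and \<phi>: "vpre (vop V B) \<phi>" and R: "coend_end B \<phi>"
begin

lemmas phi_facts [simp] = B_facts[OF E E'] yel_simps[OF E E']

lemma phi_obj [simp]: "b \<in> Ob B \<Longrightarrow> fob \<phi> b \<in> obj V"
  using vfunctor_vself_objD[OF \<phi>] by simp

lemma end_phi_simps [simp]: "NT (vop V B) \<phi> \<phi> \<in> obj V"
  "Id (vpsh V (vop V B)) \<phi> \<in> arr V" "src V (Id (vpsh V (vop V B)) \<phi>) = unt V"
  "trg V (Id (vpsh V (vop V B)) \<phi>) = NT (vop V B) \<phi> \<phi>"
  using E' \<phi> by simp_all

lemma rank_one_el [simp]:
  assumes "b \<in> Ob B" "val p" "ty p = fob \<phi> b" "val q" "ty q = NT (vop V B) \<phi> (yo B b)" "dj p q"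
  shows "val (rank_one B \<phi> b p q)" "ty (rank_one B \<phi> b p q) = NT (vop V B) \<phi> \<phi>"
    "\<lbrakk>a \<in> Ob B; val r; ty r = fob \<phi> a; dj p r; dj r p; dj q r; dj r q\<rbrakk> \<Longrightarrow>
      nv (vop V B) \<phi> \<phi> a (rank_one B \<phi> b p q) r =
        act \<phi> b a (app (fob \<phi> a) (Hom B a b) (ap (pr (vop V B) \<phi> (yo B b) a) q) r) p"
  using assms E' \<phi> dj_sym[of q p] by simp_all

text \<open>By naturality the value of q' at \<phi>(q r) p is q'(p) after q(r); so the composite is
  \<open>q\<close> translated by the morphism q'(p).\<close>

lemma comp_rank_one:
  assumes "c \<in> Ob B" "d \<in> Ob B" "val p" "ty p = fob \<phi> c" "val q" "ty q = NT (vop V B) \<phi> (yo B c)"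
    "val q'" "ty q' = NT (vop V B) \<phi> (yo B d)" "dj p q" "dj p q'" "dj q q'"
  shows "cm (vpsh V (vop V B)) \<phi> \<phi> (yo B d) q' (rank_one B \<phi> c p q) =
    act (Lf B \<phi>) c d (app (fob \<phi> c) (Hom B c d) (ap (pr (vop V B) \<phi> (yo B d) c) q') p) q"
proof -
  have y: "vpre (vop V B) (yo B d)" using assms by simp
  have s [simp]: "dj q p" "dj q' p" "dj q' q" using assms dj_sym by blast+
  show ?thesis
  proof (rule nat_ob_eqI[OF E' \<phi> y])
    fix a r assume r: "a \<in> Ob (vop V B)" "val r" "ty r = fob \<phi> a"
      "dj (cm (vpsh V (vop V B)) \<phi> \<phi> (yo B d) q' (rank_one B \<phi> c p q)) r"
      "dj r (cm (vpsh V (vop V B)) \<phi> \<phi> (yo B d) q' (rank_one B \<phi> c p q))"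
    then show "nv (vop V B) \<phi> (yo B d) a (cm (vpsh V (vop V B)) \<phi> \<phi> (yo B d) q' (rank_one B \<phi> c p q)) r =
      nv (vop V B) \<phi> (yo B d) a (act (Lf B \<phi>) c d (app (fob \<phi> c) (Hom B c d) (ap (pr (vop V B) \<phi> (yo B d) c) q') p) q) r"
      using assms \<phi> E' nv_precomp[OF E E' \<phi>] by simp
  qed (use assms \<phi> E' in \<open>simp_all add: Un_ac\<close>)
qed

text \<open>Each of the two equations compares two maps out of the endomorphism object. On rank-one
  endomorphisms they agree by naturality; at the identity their agreement is the claim.\<close>

lemma unit_cmp_iso:
  assumes b: "b \<in> Ob B"
  obtains j where "j \<in> hom V (NT B (Lf B \<phi>) (rep V B b)) (fob \<phi> b)"
    "\<And>x. \<lbrakk>val x; ty x = fob \<phi> b\<rbrakk> \<Longrightarrow> ap j (ap (unit_cmp B \<phi> b) x) = x"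
    "\<And>s. \<lbrakk>val s; ty s = NT B (Lf B \<phi>) (rep V B b)\<rbrakk> \<Longrightarrow> ap (unit_cmp B \<phi> b) (ap j s) = s"
proof -
  let ?y = "\<lambda>b. yo B b" and ?N = "NT (vop V B)" and ?L = "Lf B \<phi>" and ?P = "vpsh V (vop V B)"
  let ?M = "NT B ?L (rep V B b)" and ?E = "NT (vop V B) \<phi> \<phi>"
  have L: "vpre B ?L" and rb: "vpre B (rep V B b)" using \<phi> b by simp_all
  have N [simp]: "?N \<phi> (?y c) \<in> obj V" if "c \<in> Ob B" for c using E' \<phi> that by simp
  have M [simp]: "?M \<in> obj V" using E L rb by simp
  let ?ev = "\<lambda>c. evl V (?N \<phi> (?y c)) (Hom B b c) \<cdot> (pr B ?L (rep V B b) c \<otimes> idn V (?N \<phi> (?y c)))"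
  \<comment> \<open>On elements this is \<phi>(s q) p; the constraints only reorder the
    factors.\<close>
  define \<tau> where "\<tau> c = curry_arr V ?M (fob \<phi> c) (ihom V (?N \<phi> (?y c)) (fob \<phi> b))
    (curry_arr V (?M \<odot> fob \<phi> c) (?N \<phi> (?y c)) (fob \<phi> b)
      (evl V (fob \<phi> c) (fob \<phi> b) \<cdot> ((far \<phi> c b \<cdot> ?ev c) \<otimes> idn V (fob \<phi> c)) \<cdot>
        asci ?M (?N \<phi> (?y c)) (fob \<phi> c) \<cdot> (idn V ?M \<otimes> brd V (fob \<phi> c) (?N \<phi> (?y c))) \<cdot>
        asc V ?M (fob \<phi> c) (?N \<phi> (?y c))))" for c
  have t: "\<tau> c \<in> hom V ?M (ihom V (fob \<phi> c) (ihom V (?N \<phi> (?y c)) (fob \<phi> b)))" if "c \<in> Ob B" for c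
    using that b \<phi> E E' L rb by (simp add: \<tau>_def)
  have tv: "app (?N \<phi> (?y c)) (fob \<phi> b) (app (fob \<phi> c) (ihom V (?N \<phi> (?y c)) (fob \<phi> b)) (ap (\<tau> c) s) p) q =
      act \<phi> c b (app (?N \<phi> (?y c)) (Hom B b c) (ap (pr B ?L (rep V B b) c) s) q) p"
    if "c \<in> Ob B" "val s" "ty s = ?M" "val p" "ty p = fob \<phi> c" "val q" "ty q = ?N \<phi> (?y c)" "dj s p" "dj s q" "dj p q" "dj q p"
    for c s p q
    using that b \<phi> E E' L rb by (simp add: \<tau>_def)
  show thesis
  proof (rule coend_endE[OF R, of "fob \<phi> b" ?M \<tau>])
    fix c c' k s p q
    assume *: "c \<in> Ob B" "c' \<in> Ob B" "val k" "val s" "val p" "val q" "ty k = Hom B c' c" "ty s = ?M"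
        "ty p = fob \<phi> c" "ty q = ?N \<phi> (?y c')"
        "dj k s" "dj k p" "dj k q" "dj s p" "dj s q" "dj p q" "dj s k" "dj p k" "dj q k" "dj p s" "dj q s" "dj q p"
    have 1: "app (?N \<phi> (?y c)) (Hom B b c) (ap (pr B ?L (rep V B b) c) s) (act ?L c' c k q) =
      cm B b c' c k (app (?N \<phi> (?y c')) (Hom B b c') (ap (pr B ?L (rep V B b) c') s) q)"
      using nv_postcomp[OF E E' L b, of c' c k s q] * \<phi> by simp
    have 2: "act \<phi> c b (cm B b c' c k m) p = act \<phi> c' b m (act \<phi> c c' k p)"
      if "val m" "ty m = Hom B b c'" "dj m k" "dj k m" "dj m p" for m
      using app_far_cm[OF \<phi>, of c c' b m k p] that * b by simp
    show "app (?N \<phi> (?y c')) (fob \<phi> b) (app (fob \<phi> c') (ihom V (?N \<phi> (?y c')) (fob \<phi> b)) (ap (\<tau> c') s) (act \<phi> c c' k p)) q =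
      app (?N \<phi> (?y c)) (fob \<phi> b) (app (fob \<phi> c) (ihom V (?N \<phi> (?y c)) (fob \<phi> b)) (ap (\<tau> c) s) p) (act ?L c' c k q)"
      using * b \<phi> E E' L rb tv[of c' s "act \<phi> c c' k p" q] tv[of c s p "act ?L c' c k q"] 1 2 by simp
  next
    fix h assume h [simp]: "h \<in> arr V" "src V h = ?M" "trg V h = ihom V ?E (fob \<phi> b)"
    and hv: "\<And>c s p q. \<lbrakk>c \<in> Ob B; val s; ty s = ?M; val p; ty p = fob \<phi> c; val q; ty q = ?N \<phi> (?y c);
       dj s p; dj s q; dj p q; dj p s; dj q s; dj q p\<rbrakk> \<Longrightarrow>
         app ?E (fob \<phi> b) (ap h s) (rank_one B \<phi> c p q) =
         app (?N \<phi> (?y c)) (fob \<phi> b) (app (fob \<phi> c) (ihom V (?N \<phi> (?y c)) (fob \<phi> b)) (ap (\<tau> c) s) p) q"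
  let ?j = "evl V ?E (fob \<phi> b) \<cdot> (h \<otimes> Id ?P \<phi>) \<cdot> runi ?M"
  have j: "?j \<in> hom V ?M (fob \<phi> b)" using b by simp
  have jv: "ap ?j s = app ?E (fob \<phi> b) (ap h s) (gl (Id ?P \<phi>))" if "val s" "ty s = ?M" for s
    using that b by simp
  have hv': "app ?E (fob \<phi> b) (ap h s) (rank_one B \<phi> c p q) =
      act \<phi> c b (app (?N \<phi> (?y c)) (Hom B b c) (ap (pr B ?L (rep V B b) c) s) q) p"
    if "c \<in> Ob B" "val s" "ty s = ?M" "val p" "ty p = fob \<phi> c" "val q" "ty q = ?N \<phi> (?y c)"
       "dj s p" "dj s q" "dj p q" "dj p s" "dj q s" "dj q p" for c s p q
    using hv[OF that] tv[of c s p q] that by simp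
  have 1: "ap ?j (ap (unit_cmp B \<phi> b) x) = x" if x: "val x" "ty x = fob \<phi> b" for x
  proof -
    \<comment> \<open>Evaluation at \<open>x\<close> as a map out of the endomorphisms. It is
      compared with \<open>h\<close> of the unit at \<open>x\<close>: on a rank-one endomorphism
      both give \<phi>(q x) p.\<close>
    let ?g = "curry_arr V (fob \<phi> b) ?E (fob \<phi> b) (evl V (fob \<phi> b) (fob \<phi> b) \<cdot> (pr (vop V B) \<phi> \<phi> b \<otimes> idn V (fob \<phi> b)) \<cdot> brd V (fob \<phi> b) ?E)"
    have g: "?g \<in> arr V" "src V ?g = fob \<phi> b" "trg V ?g = ihom V ?E (fob \<phi> b)" using b \<phi> E' by simp_all
    have gv: "app ?E (fob \<phi> b) (ap ?g x) n = nv (vop V B) \<phi> \<phi> b n x" if "val n" "ty n = ?E" "dj n x" "dj x n" for n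
      using that x b \<phi> E' by simp
    have "ap h (ap (unit_cmp B \<phi> b) x) = ap ?g x"
    proof (rule coend_end_eqI[OF R, of "fob \<phi> b"])
      fix c p q assume *: "c \<in> Ob B" "val p" "ty p = fob \<phi> c" "val q" "ty q = ?N \<phi> (?y c)"
        "dj (ap h (ap (unit_cmp B \<phi> b) x)) p" "dj (ap h (ap (unit_cmp B \<phi> b) x)) q" "dj p q"
        "dj p (ap h (ap (unit_cmp B \<phi> b) x))" "dj q (ap h (ap (unit_cmp B \<phi> b) x))" "dj q p"
      then show "app ?E (fob \<phi> b) (ap h (ap (unit_cmp B \<phi> b) x)) (rank_one B \<phi> c p q) =
        app ?E (fob \<phi> b) (ap ?g x) (rank_one B \<phi> c p q)"
        using x b \<phi> g gv[of "rank_one B \<phi> c p q"] hv'[of c "ap (unit_cmp B \<phi> b) x" p q] by simp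
    qed (use x b \<phi> g in simp_all)
    then show ?thesis using x b \<phi> E' jv[of "ap (unit_cmp B \<phi> b) x"] gv[of "gl (Id ?P \<phi>)"] by simp
  qed
  have 2: "ap (unit_cmp B \<phi> b) (ap ?j s) = s" if s: "val s" "ty s = ?M" for s
  proof (rule nat_ob_eqI[OF E L rb])
    fix d q' assume d: "d \<in> Ob B" and q': "val q'" "ty q' = fob ?L d"
      "dj (ap (unit_cmp B \<phi> b) (ap ?j s)) q'" "dj q' (ap (unit_cmp B \<phi> b) (ap ?j s))"
    have q: "val q'" "ty q' = ?N \<phi> (?y d)" "dj s q'" "dj q' s" using q' d \<phi> s by simp_all
    let ?f = "curry_arr V (?N \<phi> (?y d)) ?E (?N \<phi> (?y d)) (Comp ?P \<phi> \<phi> (?y d))"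
    have f: "?f \<in> arr V" "src V ?f = ?N \<phi> (?y d)" "trg V ?f = ihom V ?E (?N \<phi> (?y d))"
      using d \<phi> E' by simp_all
    \<comment> \<open>On an endomorphism n the first map is q' at h(s)(n), and the second is
      \<open>s\<close> at the composite of q' after n. At the identity these are the two sides of
      the claim.\<close>
    let ?u = "cm (vself V) ?E (fob \<phi> b) (Hom B b d) (ap (pr (vop V B) \<phi> (?y d) b) q') (ap h s)"
    let ?u' = "cm (vself V) ?E (?N \<phi> (?y d)) (Hom B b d) (ap (pr B ?L (rep V B b) d) s) (ap ?f q')"
    have fv: "app ?E (?N \<phi> (?y d)) (ap ?f q') n = cm ?P \<phi> \<phi> (?y d) q' n" if "val n" "ty n = ?E" "dj n q'" "dj q' n" for n
      using that q d \<phi> E' by simp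
    have "?u = ?u'"
    proof (rule coend_end_eqI[OF R, of "Hom B b d"])
      fix c p q assume *: "c \<in> Ob B" "val p" "ty p = fob \<phi> c" "val q" "ty q = ?N \<phi> (?y c)"
        "dj ?u p" "dj ?u q" "dj p q" "dj p ?u" "dj q ?u" "dj q p"
      let ?k = "app (fob \<phi> c) (Hom B c d) (ap (pr (vop V B) \<phi> (?y d) c) q') p"
      let ?m = "app (?N \<phi> (?y c)) (Hom B b c) (ap (pr B ?L (rep V B b) c) s) q"
      have "app ?E (Hom B b d) ?u (rank_one B \<phi> c p q) = app (fob \<phi> b) (Hom B b d) (ap (pr (vop V B) \<phi> (?y d) b) q') (act \<phi> c b ?m p)"
        using * d s b q \<phi> E' L rb E hv'[of c s p q] by simp
      also have "\<dots> = cm B b c d ?k ?m"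
        by (rule nv_precomp[OF E E' \<phi>]) (use * d s b q \<phi> E' L rb E in simp_all)
      also have "\<dots> = app (?N \<phi> (?y d)) (Hom B b d) (ap (pr B ?L (rep V B b) d) s) (act ?L c d ?k q)"
        using nv_postcomp[OF E E' L b, of c d ?k s q] * d s b q \<phi> E' L rb E by simp
      also have "\<dots> = app ?E (Hom B b d) ?u' (rank_one B \<phi> c p q)"
        using * d s b q \<phi> E' L rb E f fv[of "rank_one B \<phi> c p q"] comp_rank_one[of c d p q q'] by simp
      finally show "app ?E (Hom B b d) ?u (rank_one B \<phi> c p q) = app ?E (Hom B b d) ?u' (rank_one B \<phi> c p q)" .
    qed (use d s b q \<phi> E' L rb E f in \<open>simp_all add: Un_ac\<close>)
    then have "app ?E (Hom B b d) ?u (gl (Id ?P \<phi>)) = app ?E (Hom B b d) ?u' (gl (Id ?P \<phi>))" by simp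
    then show "nv B ?L (rep V B b) d (ap (unit_cmp B \<phi> b) (ap ?j s)) q' = nv B ?L (rep V B b) d s q'"
      using d s b q \<phi> E' L rb E f j fv[of "gl (Id ?P \<phi>)"] jv[OF s] by (simp del: ap_cmp add: app_vself ap_tar)
  qed (use s b \<phi> in simp_all)
  show thesis by (rule that[OF j 1 2])
  qed (use t b in simp_all)
qed

lemma isbell_unit_iso: "viso V (vpsh V (vop V B)) \<phi> (Lf (vop V B) (Lf B \<phi>)) (isbell_unit V B \<phi>)"
proof -
  have "\<exists>j. j \<in> hom V (NT B (Lf B \<phi>) (rep V B b)) (fob \<phi> b) \<and>
    (\<forall>x. val x \<and> ty x = fob \<phi> b \<longrightarrow> ap j (ap (unit_cmp B \<phi> b) x) = x) \<and>
    (\<forall>s. val s \<and> ty s = NT B (Lf B \<phi>) (rep V B b) \<longrightarrow> ap (unit_cmp B \<phi> b) (ap j s) = s)" if "b \<in> Ob B" for b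
    by (rule unit_cmp_iso[OF that]) blast
  then obtain j where j: "\<And>b. b \<in> Ob B \<Longrightarrow> j b \<in> hom V (NT B (Lf B \<phi>) (rep V B b)) (fob \<phi> b) \<and>
    (\<forall>x. val x \<and> ty x = fob \<phi> b \<longrightarrow> ap (j b) (ap (unit_cmp B \<phi> b) x) = x) \<and>
    (\<forall>s. val s \<and> ty s = NT B (Lf B \<phi>) (rep V B b) \<longrightarrow> ap (unit_cmp B \<phi> b) (ap (j b) s) = s)" by metis
  show ?thesis
    by (rule viso_vpshI[OF E' \<phi>, where c = "unit_cmp B \<phi>" and j = j]) (use j \<phi> in simp_all)
qed

end

end

text \<open>
  For small projective \<open>\<phi>\<close> the functor \<open>[B, V](L \<phi>, -)\<close> has the right adjoint \<open>v \<mapsto> [\<phi>-, v]\<close>; so it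
  preserves all weighted colimits. The bijection is \<open>rho\<close>, obtained by precomposition with \<open>theta\<close>.
\<close>

context sym_mon_closed
begin

text \<open>On elements, g \<otimes> p becomes the transformation q \<mapsto> G(q p) g. These are
  the injections that exhibit \<open>NT B (Lf B \<phi>) G\<close> as the coend of \<phi> c \<otimes>
  G c.\<close>

definition theta :: "('a, 'o, 'm) vcat \<Rightarrow> ('a, 'o, 'm) vfun \<Rightarrow> ('a, 'o, 'm) vfun \<Rightarrow> 'a \<Rightarrow> 'm" where
  "theta B \<phi> G c = nat_lift V B (vself V) (Lf B \<phi>) G (fob G c \<odot> fob \<phi> c) (\<lambda>d.
     let Ld = NT (vop V B) \<phi> (yo B d) in
     curry_arr V (fob G c \<odot> fob \<phi> c) Ld (fob G d)
       (evl V (fob G c) (fob G d) \<cdot>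
        ((far G c d \<cdot> evl V (fob \<phi> c) (Hom B c d) \<cdot> (pr (vop V B) \<phi> (yo B d) c \<otimes> idn V (fob \<phi> c))) \<otimes> idn V (fob G c)) \<cdot>
        brd V (fob G c) (Ld \<odot> fob \<phi> c) \<cdot> (idn V (fob G c) \<otimes> brd V (fob \<phi> c) Ld) \<cdot>
        asc V (fob G c) (fob \<phi> c) Ld))"

text \<open>The functor [\<phi>-, v] on \<open>B\<close>; writing it as a nerve supplies its
  functoriality.\<close>

abbreviation cot :: "('a, 'o, 'm) vcat \<Rightarrow> ('a, 'o, 'm) vfun \<Rightarrow> 'o \<Rightarrow> ('a, 'o, 'm) vfun" where
  "cot B \<phi> v \<equiv> nerve_ob (vop V B) (vself V) \<phi> v"

definition rho :: "('a, 'o, 'm) vcat \<Rightarrow> ('a, 'o, 'm) vfun \<Rightarrow> ('a, 'o, 'm) vfun \<Rightarrow> 'o \<Rightarrow> 'm" where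
  "rho B \<phi> G v = (let N = NT B (Lf B \<phi>) G; M = ihom V N v in
     nat_lift V B (vself V) G (cot B \<phi> v) M (\<lambda>c.
     curry_arr V M (fob G c) (ihom V (fob \<phi> c) v)
       (curry_arr V (M \<odot> fob G c) (fob \<phi> c) v
         (evl V N v \<cdot> (idn V M \<otimes> theta B \<phi> G c) \<cdot> asc V M (fob G c) (fob \<phi> c)))))"

context
  fixes B :: "('a, 'o, 'm) vcat" and \<phi>
  assumes E: "has_ends B" and E': "has_ends (vop V B)" and \<phi>: "vpre (vop V B) \<phi>" and R: "coend_end B \<phi>"
begin

lemmas proj_facts [simp] = phi_facts[OF E E' \<phi> R] phi_obj[OF E E' \<phi> R] end_phi_simps[OF E E' \<phi> R]
  rank_one_el[OF E E' \<phi> R]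

lemma L_obj [simp]: "c \<in> Ob B \<Longrightarrow> NT (vop V B) \<phi> (yo B c) \<in> obj V"
  using E' \<phi> by simp

lemma L_vpre [simp]: "vpre B (Lf B \<phi>)"
  using \<phi> by simp

lemma L_end_obj [simp]: "vpre B G \<Longrightarrow> NT B (Lf B \<phi>) G \<in> obj V"
  using E by simp

lemma theta_simps [simp]:
  assumes G: "vpre B G" and c: "c \<in> Ob B"
  shows "theta B \<phi> G c \<in> arr V" "src V (theta B \<phi> G c) = fob G c \<odot> fob \<phi> c"
    "trg V (theta B \<phi> G c) = NT B (Lf B \<phi>) G"
    "\<lbrakk>d \<in> Ob B; val g; ty g = fob G c; val p; ty p = fob \<phi> c; val q; ty q = NT (vop V B) \<phi> (yo B d);
      dj g p; dj g q; dj p q; dj q p; dj p g; dj q g; x = NT (vop V B) \<phi> (yo B d); y = fob G d\<rbrakk>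
     \<Longrightarrow> app x y (ap (pr B (Lf B \<phi>) G d) (ap (theta B \<phi> G c) (tn g p))) q =
      act G c d (app (fob \<phi> c) (Hom B c d) (ap (pr (vop V B) \<phi> (yo B d) c) q) p) g"
proof -
  define \<tau> where "\<tau> d = (let Ld = NT (vop V B) \<phi> (yo B d) in
     curry_arr V (fob G c \<odot> fob \<phi> c) Ld (fob G d)
       (evl V (fob G c) (fob G d) \<cdot>
        ((far G c d \<cdot> evl V (fob \<phi> c) (Hom B c d) \<cdot> (pr (vop V B) \<phi> (yo B d) c \<otimes> idn V (fob \<phi> c))) \<otimes> idn V (fob G c)) \<cdot>
        brd V (fob G c) (Ld \<odot> fob \<phi> c) \<cdot> (idn V (fob G c) \<otimes> brd V (fob \<phi> c) Ld) \<cdot>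
        asc V (fob G c) (fob \<phi> c) Ld))" for d
  have th: "theta B \<phi> G c = nat_lift V B (vself V) (Lf B \<phi>) G (fob G c \<odot> fob \<phi> c) \<tau>"
    unfolding theta_def \<tau>_def ..
  have t: "\<tau> d \<in> hom V (fob G c \<odot> fob \<phi> c) (ihom V (NT (vop V B) \<phi> (yo B d)) (fob G d))" if "d \<in> Ob B" for d
    using that G c E' \<phi> by (simp add: \<tau>_def Let_def)
  have tv: "app (NT (vop V B) \<phi> (yo B d)) (fob G d) (ap (\<tau> d) (tn g p)) q =
      act G c d (app (fob \<phi> c) (Hom B c d) (ap (pr (vop V B) \<phi> (yo B d) c) q) p) g"
    if "d \<in> Ob B" "val g" "ty g = fob G c" "val p" "ty p = fob \<phi> c" "val q" "ty q = NT (vop V B) \<phi> (yo B d)"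
      "dj g p" "dj g q" "dj p q" "dj q p" "dj p g" "dj q g" for d g p q
    using that G c E' \<phi> by (simp add: \<tau>_def Let_def)
  have w: "wedge V B (vself V) (Lf B \<phi>) G (fob G c \<odot> fob \<phi> c) \<tau>"
  proof (rule wedgeI2)
    fix x y k g p q
    assume *: "x \<in> Ob B" "y \<in> Ob B" "val k" "val g" "val p" "val q" "ty k = Hom B x y" "ty g = fob G c"
      "ty p = fob \<phi> c" "ty q = fob (Lf B \<phi>) x" "dj g p" "dj p g" "dj k g" "dj g k" "dj k p" "dj p k" "dj k q" "dj q k"
      "dj g q" "dj q g" "dj p q" "dj q p"
    let ?m = "app (fob \<phi> c) (Hom B c x) (ap (pr (vop V B) \<phi> (yo B x) c) q) p"
    have "app (NT (vop V B) \<phi> (yo B y)) (fob G y) (ap (\<tau> y) (tn g p)) (act (Lf B \<phi>) x y k q) =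
      act G c y (cm B c x y k ?m) g"
      using * c \<phi> E' tv[of y g p "act (Lf B \<phi>) x y k q"] by simp
    also have "\<dots> = act G x y k (act G c x ?m g)"
      by (rule app_far_cm[OF G]) (use * c \<phi> E' in simp_all)
    finally show "act G x y k (app (fob (Lf B \<phi>) x) (fob G x) (ap (\<tau> x) (tn g p)) q) =
      app (fob (Lf B \<phi>) y) (fob G y) (ap (\<tau> y) (tn g p)) (act (Lf B \<phi>) x y k q)"
      using * c \<phi> tv[of x g p q] by simp
  qed (use G c t \<phi> in simp_all)
  note l = nat_lift_simps[OF E L_vpre G w]
  show "theta B \<phi> G c \<in> arr V" "src V (theta B \<phi> G c) = fob G c \<odot> fob \<phi> c"
    "trg V (theta B \<phi> G c) = NT B (Lf B \<phi>) G"
    unfolding th by (rule l)+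
  assume "d \<in> Ob B" "val g" "ty g = fob G c" "val p" "ty p = fob \<phi> c" "val q" "ty q = NT (vop V B) \<phi> (yo B d)"
      "dj g p" "dj g q" "dj p q" "dj q p" "dj p g" "dj q g" "x = NT (vop V B) \<phi> (yo B d)" "y = fob G d"
  then show "app x y (ap (pr B (Lf B \<phi>) G d) (ap (theta B \<phi> G c) (tn g p))) q =
      act G c d (app (fob \<phi> c) (Hom B c d) (ap (pr (vop V B) \<phi> (yo B d) c) q) p) g"
    unfolding th using l(4)[of d "tn g p"] tv[of d g p q] G c by simp
qed

text \<open>Naturality of \<open>m\<close> at the morphism q(p). It makes \<open>rho\<close> natural
  in \<open>G\<close>.\<close>

lemma theta_nat:
  assumes G: "vpre B G" and G': "vpre B G'" and c: "c \<in> Ob B"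
    and el: "val m" "ty m = NT B G G'" "val g" "ty g = fob G c" "val p" "ty p = fob \<phi> c" "dj m g" "dj m p" "dj g p" "dj g m" "dj p m" "dj p g"
  shows "cm (vpsh V B) (Lf B \<phi>) G G' m (ap (theta B \<phi> G c) (tn g p)) = ap (theta B \<phi> G' c) (tn (nv B G G' c m g) p)"
proof (rule nat_ob_eqI[OF E L_vpre G'])
  fix d q assume d: "d \<in> Ob B" "val q" "ty q = fob (Lf B \<phi>) d"
    "dj (cm (vpsh V B) (Lf B \<phi>) G G' m (ap (theta B \<phi> G c) (tn g p))) q"
    "dj q (cm (vpsh V B) (Lf B \<phi>) G G' m (ap (theta B \<phi> G c) (tn g p)))"
  let ?m = "app (fob \<phi> c) (Hom B c d) (ap (pr (vop V B) \<phi> (yo B d) c) q) p"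
  have "nv B G G' d m (act G c d ?m g) = act G' c d ?m (nv B G G' c m g)"
    by (rule nv_act[OF E G G' c]) (use d el c \<phi> E' in simp_all)
  then show "nv B (Lf B \<phi>) G' d (cm (vpsh V B) (Lf B \<phi>) G G' m (ap (theta B \<phi> G c) (tn g p))) q =
    nv B (Lf B \<phi>) G' d (ap (theta B \<phi> G' c) (tn (nv B G G' c m g) p)) q"
    using d el c \<phi> E E' G G' by simp
qed (use el c \<phi> E E' G G' in \<open>simp_all add: Un_ac\<close>)

text \<open>Naturality of \<open>q\<close> and functoriality of \<open>G\<close> move
  \<open>k\<close> from one factor to the other. This is why \<open>rho\<close> takes values in
  natural transformations.\<close>

lemma theta_dinat:
  assumes G: "vpre B G" and c: "c \<in> Ob B" "c' \<in> Ob B"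
    and el: "val k" "ty k = Hom B c c'" "val g" "ty g = fob G c" "val p" "ty p = fob \<phi> c'" "dj k g" "dj k p" "dj g p" "dj g k" "dj p k" "dj p g"
  shows "ap (theta B \<phi> G c) (tn g (act \<phi> c' c k p)) = ap (theta B \<phi> G c') (tn (act G c c' k g) p)"
proof (rule nat_ob_eqI[OF E L_vpre G])
  fix d q assume d: "d \<in> Ob B" "val q" "ty q = fob (Lf B \<phi>) d"
    "dj (ap (theta B \<phi> G c) (tn g (act \<phi> c' c k p))) q" "dj q (ap (theta B \<phi> G c) (tn g (act \<phi> c' c k p)))"
  let ?m = "app (fob \<phi> c') (Hom B c' d) (ap (pr (vop V B) \<phi> (yo B d) c') q) p"
  have "app (fob \<phi> c) (Hom B c d) (ap (pr (vop V B) \<phi> (yo B d) c) q) (act \<phi> c' c k p) = cm B c c' d ?m k"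
    by (rule nv_precomp[OF E E' \<phi>]) (use d el c \<phi> in simp_all)
  moreover have "act G c d (cm B c c' d ?m k) g = act G c' d ?m (act G c c' k g)"
    by (rule app_far_cm[OF G]) (use d el c \<phi> E' in simp_all)
  ultimately show "nv B (Lf B \<phi>) G d (ap (theta B \<phi> G c) (tn g (act \<phi> c' c k p))) q =
    nv B (Lf B \<phi>) G d (ap (theta B \<phi> G c') (tn (act G c c' k g) p)) q"
    using d el c \<phi> E E' G by simp
qed (use el c \<phi> E E' G in \<open>simp_all add: Un_ac\<close>)

text \<open>The link between the two coends. With the identity of \<phi> in place of the rank-one
  endomorphism the right side would be \<open>s\<close>; through this a coend for the endomorphisms
  of \<phi> becomes one for \<open>NT B (Lf B \<phi>) G\<close>.\<close>

lemma theta_rank_one: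
  assumes G: "vpre B G" and c: "c \<in> Ob B"
    and el: "val s" "ty s = NT B (Lf B \<phi>) G" "val p" "ty p = fob \<phi> c" "val q" "ty q = NT (vop V B) \<phi> (yo B c)"
      "dj s p" "dj s q" "dj p q" "dj p s" "dj q s" "dj q p"
  shows "ap (theta B \<phi> G c) (tn (nv B (Lf B \<phi>) G c s q) p) =
    cm (vpsh V B) (Lf B \<phi>) (Lf B \<phi>) G s (ap (far (isbell_L V B) \<phi> \<phi>) (rank_one B \<phi> c p q))"
proof (rule nat_ob_eqI[OF E L_vpre G])
  fix d q' assume d: "d \<in> Ob B" "val q'" "ty q' = fob (Lf B \<phi>) d"
    "dj (ap (theta B \<phi> G c) (tn (nv B (Lf B \<phi>) G c s q) p)) q'" "dj q' (ap (theta B \<phi> G c) (tn (nv B (Lf B \<phi>) G c s q) p))"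
  let ?m = "app (fob \<phi> c) (Hom B c d) (ap (pr (vop V B) \<phi> (yo B d) c) q') p"
  have q': "ty q' = NT (vop V B) \<phi> (yo B d)" using d \<phi> by simp
  have "nv B (Lf B \<phi>) G d s (act (Lf B \<phi>) c d ?m q) = act G c d ?m (nv B (Lf B \<phi>) G c s q)"
    by (rule nv_act[OF E L_vpre G c]) (use d q' el c \<phi> E' in simp_all)
  moreover have "cm (vpsh V (vop V B)) \<phi> \<phi> (yo B d) q' (rank_one B \<phi> c p q) = act (Lf B \<phi>) c d ?m q"
    by (subst comp_rank_one[OF E E' \<phi> R c d(1)]) (use d q' el c \<phi> in simp_all)
  ultimately show "nv B (Lf B \<phi>) G d (ap (theta B \<phi> G c) (tn (nv B (Lf B \<phi>) G c s q) p)) q' =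
    nv B (Lf B \<phi>) G d (cm (vpsh V B) (Lf B \<phi>) (Lf B \<phi>) G s (ap (far (isbell_L V B) \<phi> \<phi>) (rank_one B \<phi> c p q))) q'"
    using d q' el c \<phi> E E' G by simp
qed (use el c \<phi> E E' G in \<open>simp_all add: Un_ac\<close>)

lemma cot_facts:
  assumes v: "v \<in> obj V"
  shows "vpre B (cot B \<phi> v)"
    "c \<in> Ob B \<Longrightarrow> fob (cot B \<phi> v) c = ihom V (fob \<phi> c) v"
    "\<lbrakk>c \<in> Ob B; d \<in> Ob B; val k; ty k = Hom B c d; val f; ty f = ihom V (fob \<phi> c) v; val p; ty p = fob \<phi> d;
      dj k f; dj k p; dj f p; dj f k; dj p k; dj p f; x = fob \<phi> d; y = ihom V (fob \<phi> c) v; z = ihom V (fob \<phi> d) v\<rbrakk> \<Longrightarrow>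
      app x v (app y z (ap (far (cot B \<phi> v) c d) k) f) p = app (fob \<phi> c) v f (act \<phi> d c k p)"
proof -
  have B: "vcategory V (vop V B)" by simp
  show "vpre B (cot B \<phi> v)" using vpre_nerve_ob[OF B vcategory_vself \<phi>, of v] v by simp
  show "c \<in> Ob B \<Longrightarrow> fob (cot B \<phi> v) c = ihom V (fob \<phi> c) v" by simp
  assume *: "c \<in> Ob B" "d \<in> Ob B" "val k" "ty k = Hom B c d" "val f" "ty f = ihom V (fob \<phi> c) v" "val p" "ty p = fob \<phi> d"
      "dj k f" "dj k p" "dj f p" "dj f k" "dj p k" "dj p f" "x = fob \<phi> d" "y = ihom V (fob \<phi> c) v" "z = ihom V (fob \<phi> d) v"
  then show "app x v (app y z (ap (far (cot B \<phi> v) c d) k) f) p = app (fob \<phi> c) v f (act \<phi> d c k p)"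
    using nerve_ob_act[OF B vcategory_vself \<phi>, of v c d k f] v \<phi> by simp
qed

lemma rho_simps:
  assumes G: "vpre B G" and v: "v \<in> obj V"
  shows "rho B \<phi> G v \<in> arr V" "src V (rho B \<phi> G v) = ihom V (NT B (Lf B \<phi>) G) v"
    "trg V (rho B \<phi> G v) = NT B G (cot B \<phi> v)"
    "\<lbrakk>c \<in> Ob B; val e; ty e = ihom V (NT B (Lf B \<phi>) G) v; val g; ty g = fob G c; val p; ty p = fob \<phi> c;
      dj e g; dj e p; dj g p; dj p e; dj g e; dj p g; y = fob G c; z = ihom V (fob \<phi> c) v; x = fob \<phi> c\<rbrakk>
     \<Longrightarrow> app x v (app y z (ap (pr B G (cot B \<phi> v) c) (ap (rho B \<phi> G v) e)) g) p =
      app (NT B (Lf B \<phi>) G) v e (ap (theta B \<phi> G c) (tn g p))"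
proof -
  let ?N = "NT B (Lf B \<phi>) G" and ?M = "ihom V (NT B (Lf B \<phi>) G) v"
  note C = cot_facts[OF v]
  define \<tau> where "\<tau> c = curry_arr V ?M (fob G c) (ihom V (fob \<phi> c) v)
       (curry_arr V (?M \<odot> fob G c) (fob \<phi> c) v
         (evl V ?N v \<cdot> (idn V ?M \<otimes> theta B \<phi> G c) \<cdot> asc V ?M (fob G c) (fob \<phi> c)))" for c
  have r: "rho B \<phi> G v = nat_lift V B (vself V) G (cot B \<phi> v) ?M \<tau>"
    unfolding rho_def \<tau>_def Let_def ..
  have t: "\<tau> c \<in> hom V ?M (ihom V (fob G c) (ihom V (fob \<phi> c) v))" if "c \<in> Ob B" for c
    using that G v by (simp add: \<tau>_def)
  have tv: "app (fob \<phi> c) v (app (fob G c) (ihom V (fob \<phi> c) v) (ap (\<tau> c) e) g) p =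
      app ?N v e (ap (theta B \<phi> G c) (tn g p))"
    if "c \<in> Ob B" "val e" "ty e = ?M" "val g" "ty g = fob G c" "val p" "ty p = fob \<phi> c"
      "dj e g" "dj e p" "dj g p" "dj p e" "dj g e" "dj p g" for c e g p
    using that G v by (simp add: \<tau>_def)
  have w: "wedge V B (vself V) G (cot B \<phi> v) ?M \<tau>"
  proof (rule wedgeI)
    fix x y k e g
    assume *: "x \<in> Ob B" "y \<in> Ob B" "val k" "val e" "val g" "ty k = Hom B x y" "ty e = ?M" "ty g = fob G x"
      "dj k e" "dj e k" "dj k g" "dj g k" "dj e g" "dj g e"
    have ty: "far (cot B \<phi> v) x y \<in> arr V" "src V (far (cot B \<phi> v) x y) = Hom B x y"
      "trg V (far (cot B \<phi> v) x y) = ihom V (ihom V (fob \<phi> x) v) (ihom V (fob \<phi> y) v)"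
      using vfunctor_arr(2-4)[OF C(1) *(1,2)] * by simp_all
    have "app (ihom V (fob \<phi> x) v) (ihom V (fob \<phi> y) v) (ap (far (cot B \<phi> v) x y) k)
        (app (fob G x) (ihom V (fob \<phi> x) v) (ap (\<tau> x) e) g) =
      app (fob G y) (ihom V (fob \<phi> y) v) (ap (\<tau> y) e) (act G x y k g)"
    proof (rule ihom_eqI[of _ _ "fob \<phi> y" v])
      fix p assume p: "val p" "ty p = fob \<phi> y"
        "dj (app (ihom V (fob \<phi> x) v) (ihom V (fob \<phi> y) v) (ap (far (cot B \<phi> v) x y) k) (app (fob G x) (ihom V (fob \<phi> x) v) (ap (\<tau> x) e) g)) p"
        "dj p (app (ihom V (fob \<phi> x) v) (ihom V (fob \<phi> y) v) (ap (far (cot B \<phi> v) x y) k) (app (fob G x) (ihom V (fob \<phi> x) v) (ap (\<tau> x) e) g))"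
      have "app (fob \<phi> y) v (app (ihom V (fob \<phi> x) v) (ihom V (fob \<phi> y) v) (ap (far (cot B \<phi> v) x y) k)
          (app (fob G x) (ihom V (fob \<phi> x) v) (ap (\<tau> x) e) g)) p =
        app (fob \<phi> x) v (app (fob G x) (ihom V (fob \<phi> x) v) (ap (\<tau> x) e) g) (act \<phi> y x k p)"
        by (rule C(3)) (use * p G v t[of x] in simp_all)
      also have "\<dots> = app ?N v e (ap (theta B \<phi> G x) (tn g (act \<phi> y x k p)))"
        by (rule tv) (use * p G v \<phi> in simp_all)
      also have "\<dots> = app ?N v e (ap (theta B \<phi> G y) (tn (act G x y k g) p))"
        by (subst theta_dinat[OF G *(1,2)]) (use * p in simp_all)
      also have "\<dots> = app (fob \<phi> y) v (app (fob G y) (ihom V (fob \<phi> y) v) (ap (\<tau> y) e) (act G x y k g)) p"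
        by (rule tv[symmetric]) (use * p G v in simp_all)
      finally show "app (fob \<phi> y) v (app (ihom V (fob \<phi> x) v) (ihom V (fob \<phi> y) v) (ap (far (cot B \<phi> v) x y) k)
          (app (fob G x) (ihom V (fob \<phi> x) v) (ap (\<tau> x) e) g)) p =
        app (fob \<phi> y) v (app (fob G y) (ihom V (fob \<phi> y) v) (ap (\<tau> y) e) (act G x y k g)) p" .
    qed (use * G v ty t[of x] t[of y] in \<open>simp_all add: Un_ac\<close>)
    then show "act (cot B \<phi> v) x y k (app (fob G x) (fob (cot B \<phi> v) x) (ap (\<tau> x) e) g) =
      app (fob G y) (fob (cot B \<phi> v) y) (ap (\<tau> y) e) (act G x y k g)"
      using * by simp
  qed (use G v t C(1) in simp_all)
  note l = nat_lift_simps[OF E G C(1) w]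
  show "rho B \<phi> G v \<in> arr V" "src V (rho B \<phi> G v) = ?M" "trg V (rho B \<phi> G v) = NT B G (cot B \<phi> v)"
    unfolding r by (rule l)+
  assume "c \<in> Ob B" "val e" "ty e = ?M" "val g" "ty g = fob G c" "val p" "ty p = fob \<phi> c"
      "dj e g" "dj e p" "dj g p" "dj p e" "dj g e" "dj p g" "y = fob G c" "z = ihom V (fob \<phi> c) v" "x = fob \<phi> c"
  then show "app x v (app y z (ap (pr B G (cot B \<phi> v) c) (ap (rho B \<phi> G v) e)) g) p =
      app ?N v e (ap (theta B \<phi> G c) (tn g p))"
    unfolding r using l(4)[of c e] tv[of c e g p] by simp
qed

lemma rho_nat:
  assumes G: "vpre B G" and G': "vpre B G'" and v: "v \<in> obj V"
    and el: "val e" "ty e = ihom V (NT B (Lf B \<phi>) G') v" "val m" "ty m = NT B G G'" "dj e m" "dj m e"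
  shows "cm (vpsh V B) G G' (cot B \<phi> v) (ap (rho B \<phi> G' v) e) m =
    ap (rho B \<phi> G v) (cm (vself V) (NT B (Lf B \<phi>) G) (NT B (Lf B \<phi>) G') v e (ap (far (rep V (vpsh V B) (Lf B \<phi>)) G G') m))"
    (is "?l = ap _ ?e")
proof (rule nat_ob_eqI[OF E G cot_facts(1)[OF v]])
  note C = cot_facts(1)[OF v]
  note r = rho_simps[OF G v] and r' = rho_simps[OF G' v]
  fix c g assume c: "c \<in> Ob B" "val g" "ty g = fob G c" "dj ?l g" "dj g ?l"
  have "app (fob G c) (ihom V (fob \<phi> c) v) (ap (pr B G (cot B \<phi> v) c) ?l) g =
    app (fob G c) (ihom V (fob \<phi> c) v) (ap (pr B G (cot B \<phi> v) c) (ap (rho B \<phi> G v) ?e)) g"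
  proof (rule ihom_eqI[of _ _ "fob \<phi> c" v])
    fix p assume p: "val p" "ty p = fob \<phi> c"
      "dj (app (fob G c) (ihom V (fob \<phi> c) v) (ap (pr B G (cot B \<phi> v) c) ?l) g) p"
      "dj p (app (fob G c) (ihom V (fob \<phi> c) v) (ap (pr B G (cot B \<phi> v) c) ?l) g)"
    show "app (fob \<phi> c) v (app (fob G c) (ihom V (fob \<phi> c) v) (ap (pr B G (cot B \<phi> v) c) ?l) g) p =
      app (fob \<phi> c) v (app (fob G c) (ihom V (fob \<phi> c) v) (ap (pr B G (cot B \<phi> v) c) (ap (rho B \<phi> G v) ?e)) g) p"
      using c p el G G' v E C r r' theta_nat[OF G G' c(1), of m g p] by simp
  qed (use c el G G' v E C r r' in \<open>simp_all add: Un_ac\<close>)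
  then show "nv B G (cot B \<phi> v) c ?l g = nv B G (cot B \<phi> v) c (ap (rho B \<phi> G v) ?e) g"
    using c by simp
qed (use el G G' v E cot_facts(1)[OF v] rho_simps(1-3)[OF G v] rho_simps(1-3)[OF G' v] in simp_all)

end

end

section \<open>Inverting the transposition \<open>rho\<close>\<close>

context sym_mon_closed
begin

context
  fixes B :: "('a, 'o, 'm) vcat" and \<phi>
  assumes E: "has_ends B" and E': "has_ends (vop V B)" and \<phi>: "vpre (vop V B) \<phi>" and R: "coend_end B \<phi>"
begin

lemmas adj_facts [simp] = proj_facts[OF E E' \<phi> R] L_obj[OF E E' \<phi> R] L_vpre[OF E E' \<phi> R] L_end_obj[OF E E' \<phi> R]
  theta_simps[OF E E' \<phi> R]

text \<open>From \<open>y\<close> and \<open>s\<close> the family y(s q)(p) is integrated and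
  evaluated at the identity of \<phi>; abstracting \<open>s\<close> gives the inverse at
  \<open>y\<close>.\<close>

lemma rho_inverse:
  assumes G: "vpre B G" and v: "v \<in> obj V"
  obtains j where "j \<in> arr V" "src V j = NT B G (cot B \<phi> v)" "trg V j = ihom V (NT B (Lf B \<phi>) G) v"
    "\<And>e. \<lbrakk>val e; ty e = ihom V (NT B (Lf B \<phi>) G) v\<rbrakk> \<Longrightarrow> ap j (ap (rho B \<phi> G v) e) = e"
    "\<And>y. \<lbrakk>val y; ty y = NT B G (cot B \<phi> v)\<rbrakk> \<Longrightarrow> ap (rho B \<phi> G v) (ap j y) = y"
proof -
  define H where "H = cot B \<phi> v"
  let ?L = "Lf B \<phi>" and ?N = "NT B (Lf B \<phi>) G" and ?E = "NT (vop V B) \<phi> \<phi>"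
  let ?M = "NT B G H" and ?P = "vpsh V (vop V B)" and ?Q = "vpsh V B"
  let ?Lo = "\<lambda>c. NT (vop V B) \<phi> (yo B c)"
  note C = cot_facts[OF E E' \<phi> R v, folded H_def]
  note r = rho_simps[OF E E' \<phi> R G v, folded H_def]
  have L: "vpre B ?L" by simp
  have N [simp]: "?N \<in> obj V" using G by simp
  have M [simp]: "?M \<in> obj V" using E G C(1) by simp
  let ?X = "?M \<odot> ?N"
  \<comment> \<open>The parameter is \<open>?M \<odot> ?N\<close>, so that \<open>y\<close> and
    \<open>s\<close> are integrated jointly before \<open>s\<close> is abstracted.\<close>
  define \<tau> where "\<tau> c = curry_arr V ?X (fob \<phi> c) (ihom V (?Lo c) v)
    (curry_arr V (?X \<odot> fob \<phi> c) (?Lo c) v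
      (evl V (fob \<phi> c) v \<cdot>
        ((evl V (fob G c) (ihom V (fob \<phi> c) v) \<cdot> (pr B G H c \<otimes> (evl V (?Lo c) (fob G c) \<cdot> (pr B ?L G c \<otimes> idn V (?Lo c))))) \<otimes> idn V (fob \<phi> c)) \<cdot>
        (asc V ?M ?N (?Lo c) \<otimes> idn V (fob \<phi> c)) \<cdot> asci ?X (?Lo c) (fob \<phi> c) \<cdot>
        (idn V ?X \<otimes> brd V (fob \<phi> c) (?Lo c)) \<cdot> asc V ?X (fob \<phi> c) (?Lo c)))" for c
  have t: "\<tau> c \<in> hom V ?X (ihom V (fob \<phi> c) (ihom V (?Lo c) v))" if "c \<in> Ob B" for c
    using that G v E C(1,2) \<phi> by (simp add: \<tau>_def)
  have tv: "app (?Lo c) v (app (fob \<phi> c) (ihom V (?Lo c) v) (ap (\<tau> c) (tn y s)) p) q =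
      app (fob \<phi> c) v (app (fob G c) (ihom V (fob \<phi> c) v) (ap (pr B G H c) y) (app (?Lo c) (fob G c) (ap (pr B ?L G c) s) q)) p"
    if "c \<in> Ob B" "val y" "ty y = ?M" "val s" "ty s = ?N" "val p" "ty p = fob \<phi> c" "val q" "ty q = ?Lo c"
      "dj y s" "dj y p" "dj y q" "dj s p" "dj s q" "dj p q" "dj q p" for c y s p q
    using that G v E C(1,2) \<phi> by (simp add: \<tau>_def)
  \<comment> \<open>Naturality of \<open>y\<close>, combined with the action on [\<phi>-, v], which
    is precomposition with the action on \<phi>.\<close>
  have Cact: "app (fob \<phi> b') v (app (fob G b') (ihom V (fob \<phi> b') v) (ap (pr B G H b') y) (act G b b' k g)) p =
      app (fob \<phi> b) v (app (fob G b) (ihom V (fob \<phi> b) v) (ap (pr B G H b) y) g) (act \<phi> b' b k p)"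
    if "b \<in> Ob B" "b' \<in> Ob B" "val k" "ty k = Hom B b b'" "val y" "ty y = ?M" "val g" "ty g = fob G b" "val p" "ty p = fob \<phi> b'"
      "dj k y" "dj k g" "dj k p" "dj y k" "dj y g" "dj y p" "dj g k" "dj g y" "dj g p" "dj p k" "dj p y" "dj p g" for b b' k y g p
  proof -
    have e: "fob H b = ihom V (fob \<phi> b) v" "fob H b' = ihom V (fob \<phi> b') v" using C(2) that by blast+
    have "nv B G H b' y (act G b b' k g) = act H b b' k (nv B G H b y g)"
      by (rule nv_act[OF E G C(1)]) (use that in simp_all)
    moreover have "app (fob \<phi> b') v (app (ihom V (fob \<phi> b) v) (ihom V (fob \<phi> b') v) (ap (far H b b') k)
        (app (fob G b) (ihom V (fob \<phi> b) v) (ap (pr B G H b) y) g)) p =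
      app (fob \<phi> b) v (app (fob G b) (ihom V (fob \<phi> b) v) (ap (pr B G H b) y) g) (act \<phi> b' b k p)"
      by (rule C(3)) (use that e G v E C(1) in simp_all)
    ultimately show ?thesis unfolding e by simp
  qed
  show thesis
  proof (rule coend_endE[OF R, of v ?X \<tau>])
    fix c c' k x p q
    assume *: "c \<in> Ob B" "c' \<in> Ob B" "val k" "val x" "val p" "val q" "ty k = Hom B c' c" "ty x = ?X"
        "ty p = fob \<phi> c" "ty q = ?Lo c'"
        "dj k x" "dj k p" "dj k q" "dj x p" "dj x q" "dj p q" "dj x k" "dj p k" "dj q k" "dj p x" "dj q x" "dj q p"
    let ?Z = "ihom V (Hom B c' c \<odot> (fob \<phi> c \<odot> ?Lo c')) v"
    have arr: "far \<phi> c c' \<in> arr V" "src V (far \<phi> c c') = Hom B c' c" "trg V (far \<phi> c c') = ihom V (fob \<phi> c) (fob \<phi> c')"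
      using * \<phi> by simp_all
    \<comment> \<open>An element \<open>x\<close> of \<open>?X\<close> need not be a tensor of two
      elements, while \<open>tv\<close> computes \<tau> only on such tensors. Both sides of
      extranaturality are therefore made into arrows, which are compared on variables.\<close>
    define f where "f = evl V (?Lo c') v \<cdot>
      ((evl V (fob \<phi> c') (ihom V (?Lo c') v) \<cdot> (\<tau> c' \<otimes> (evl V (fob \<phi> c) (fob \<phi> c') \<cdot> (far \<phi> c c' \<otimes> idn V (fob \<phi> c))))) \<otimes> idn V (?Lo c')) \<cdot>
      asci ?X (Hom B c' c \<odot> fob \<phi> c) (?Lo c')"
    define f' where "f' = evl V (?Lo c) v \<cdot>
      ((evl V (fob \<phi> c) (ihom V (?Lo c) v) \<cdot> (\<tau> c \<otimes> idn V (fob \<phi> c))) \<otimes> (evl V (?Lo c') (?Lo c) \<cdot> (far ?L c' c \<otimes> idn V (?Lo c')))) \<cdot>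
      asci ?X (fob \<phi> c) (Hom B c' c \<odot> ?Lo c') \<cdot>
      (idn V ?X \<otimes> (asc V (fob \<phi> c) (Hom B c' c) (?Lo c') \<cdot> (brd V (Hom B c' c) (fob \<phi> c) \<otimes> idn V (?Lo c'))))"
    have fa: "f \<in> arr V" "src V f = ?X \<odot> ((Hom B c' c \<odot> fob \<phi> c) \<odot> ?Lo c')" "trg V f = v"
      "f' \<in> arr V" "src V f' = ?X \<odot> ((Hom B c' c \<odot> fob \<phi> c) \<odot> ?Lo c')" "trg V f' = v"
      using * arr \<phi> v t[of c] t[of c'] by (simp_all add: f_def f'_def)
    have fv: "ap f (tn z (tn (tn k p) q)) = app (?Lo c') v (app (fob \<phi> c') (ihom V (?Lo c') v) (ap (\<tau> c') z) (act \<phi> c c' k p)) q"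
      "ap f' (tn z (tn (tn k p) q)) = app (?Lo c) v (app (fob \<phi> c) (ihom V (?Lo c) v) (ap (\<tau> c) z) p) (act ?L c' c k q)"
      if "val k" "ty k = Hom B c' c" "val z" "ty z = ?X" "val p" "ty p = fob \<phi> c" "val q" "ty q = ?Lo c'"
        "dj k z" "dj k p" "dj k q" "dj z p" "dj z q" "dj p q" "dj z k" "dj p k" "dj q k" "dj p z" "dj q z" "dj q p" for k z p q
      using that * arr \<phi> v t[of c] t[of c'] by (simp_all add: f_def f'_def)
    have "f = f'"
    proof -
      let ?y = "var 0 ?M" and ?s = "var 1 ?N" and ?k = "var 2 (Hom B c' c)" and ?p = "var 3 (fob \<phi> c)" and ?q = "var 4 (?Lo c')"
      have Hk: "Hom B c' c \<in> obj V" using * by simp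
      have "ap f (tn (tn ?y ?s) (tn (tn ?k ?p) ?q)) = ap f' (tn (tn ?y ?s) (tn (tn ?k ?p) ?q))"
      proof -
        have 1: "nv B ?L G c ?s (act ?L c' c ?k ?q) = act G c' c ?k (nv B ?L G c' ?s ?q)"
          by (rule nv_act[OF E L G]) (use * Hk \<phi> in simp_all)
        have "ap f (tn (tn ?y ?s) (tn (tn ?k ?p) ?q)) =
          app (fob \<phi> c') v (app (fob G c') (ihom V (fob \<phi> c') v) (ap (pr B G H c') ?y) (nv B ?L G c' ?s ?q)) (act \<phi> c c' ?k ?p)"
          using * Hk \<phi> G E arr by (subst fv) (simp_all add: tv)
        also have "\<dots> = app (fob \<phi> c) v (app (fob G c) (ihom V (fob \<phi> c) v) (ap (pr B G H c) ?y) (act G c' c ?k (nv B ?L G c' ?s ?q))) ?p"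
          by (rule Cact[symmetric]) (use * Hk \<phi> G E in simp_all)
        also have "\<dots> = ap f' (tn (tn ?y ?s) (tn (tn ?k ?p) ?q))"
          using * Hk \<phi> G E arr 1 by (subst fv(2)) (simp_all add: tv)
        finally show ?thesis .
      qed
      then show ?thesis
        by - (rule arr_eq_on_iso[of _ _ "tn (tn ?y ?s) (tn (tn ?k ?p) ?q)"], use fa Hk * in simp_all)
    qed
    then show "app (?Lo c') v (app (fob \<phi> c') (ihom V (?Lo c') v) (ap (\<tau> c') x) (act \<phi> c c' k p)) q =
        app (?Lo c) v (app (fob \<phi> c) (ihom V (?Lo c) v) (ap (\<tau> c) x) p) (act ?L c' c k q)"
      using fv[of k x p q] * by simp
  next
    fix h assume h [simp]: "h \<in> arr V" "src V h = ?X" "trg V h = ihom V ?E v"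
      and hx: "\<And>c x p q. \<lbrakk>c \<in> Ob B; val x; ty x = ?X; val p; ty p = fob \<phi> c; val q; ty q = ?Lo c;
        dj x p; dj x q; dj p q; dj p x; dj q x; dj q p\<rbrakk> \<Longrightarrow>
         app ?E v (ap h x) (rank_one B \<phi> c p q) =
         app (?Lo c) v (app (fob \<phi> c) (ihom V (?Lo c) v) (ap (\<tau> c) x) p) q"
    have hv: "app ?E v (ap h (tn y s)) (rank_one B \<phi> c p q) =
      app (fob \<phi> c) v (app (fob G c) (ihom V (fob \<phi> c) v) (ap (pr B G H c) y) (app (?Lo c) (fob G c) (ap (pr B ?L G c) s) q)) p"
      if "c \<in> Ob B" "val y" "ty y = ?M" "val s" "ty s = ?N" "val p" "ty p = fob \<phi> c" "val q" "ty q = ?Lo c"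
        "dj y s" "dj y p" "dj y q" "dj s p" "dj s q" "dj p q" "dj p y" "dj p s" "dj q y" "dj q s" "dj q p" for c y s p q
      using hx[of c "tn y s" p q] tv[of c y s p q] that by simp
    define j where "j = curry_arr V ?M ?N v (evl V ?E v \<cdot> (h \<otimes> Id ?P \<phi>) \<cdot> runi ?X)"
    have j: "j \<in> arr V" "src V j = ?M" "trg V j = ihom V ?N v" using v by (simp_all add: j_def)
    have jv: "app ?N v (ap j y) s = app ?E v (ap h (tn y s)) (gl (Id ?P \<phi>))"
      if "val y" "ty y = ?M" "val s" "ty s = ?N" "dj y s" for y s
      using that v by (simp add: j_def)
    have 1: "ap j (ap (rho B \<phi> G v) e) = e" if e: "val e" "ty e = ihom V ?N v" for e
    proof (rule ihom_eqI[of _ _ ?N v])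
      fix s assume s: "val s" "ty s = ?N" "dj (ap j (ap (rho B \<phi> G v) e)) s" "dj s (ap j (ap (rho B \<phi> G v) e))"
      then have d: "dj e s" "dj s e" by simp_all
      let ?m = "curry_arr V ?N ?E ?N (Comp ?Q ?L ?L G \<cdot> (idn V ?N \<otimes> far (isbell_L V B) \<phi> \<phi>))"
      have m: "?m \<in> arr V" "src V ?m = ?N" "trg V ?m = ihom V ?E ?N" using \<phi> E G by simp_all
      have mv: "app ?E ?N (ap ?m s) n = cm ?Q ?L ?L G s (ap (far (isbell_L V B) \<phi> \<phi>) n)"
        if "val n" "ty n = ?E" "dj n s" "dj s n" for n
        using that s(1,2) \<phi> E G by simp
      \<comment> \<open>On an endomorphism n the second map is \<open>e\<close> at the composite of
        \<open>s\<close> after L n. By \<open>theta_rank_one\<close> it agrees with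
        \<open>?u\<close> on rank-one endomorphisms, and at the identity it is \<open>e\<close> at
        \<open>s\<close>.\<close>
      let ?u = "ap h (tn (ap (rho B \<phi> G v) e) s)" and ?u' = "cm (vself V) ?E ?N v e (ap ?m s)"
      have "?u = ?u'"
      proof (rule coend_end_eqI[OF R v])
        fix c p q assume *: "c \<in> Ob B" "val p" "ty p = fob \<phi> c" "val q" "ty q = ?Lo c"
          "dj ?u p" "dj ?u q" "dj p q" "dj p ?u" "dj q ?u" "dj q p"
        have "app ?E v ?u (rank_one B \<phi> c p q) =
          app (fob \<phi> c) v (app (fob G c) (ihom V (fob \<phi> c) v) (ap (pr B G H c) (ap (rho B \<phi> G v) e)) (app (?Lo c) (fob G c) (ap (pr B ?L G c) s) q)) p"
          by (rule hv) (use * e s(1,2) d r in simp_all)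
        also have "\<dots> = app ?N v e (ap (theta B \<phi> G c) (tn (app (?Lo c) (fob G c) (ap (pr B ?L G c) s) q) p))"
          by (rule r(4)) (use * e s(1,2) d E G \<phi> in simp_all)
        also have "app (?Lo c) (fob G c) (ap (pr B ?L G c) s) q = nv B ?L G c s q" using * \<phi> by simp
        also have "ap (theta B \<phi> G c) (tn (nv B ?L G c s q) p) = cm ?Q ?L ?L G s (ap (far (isbell_L V B) \<phi> \<phi>) (rank_one B \<phi> c p q))"
          by (rule theta_rank_one[OF E E' \<phi> R G]) (use * s(1,2) d in simp_all)
        also have "app ?N v e \<dots> = app ?E v ?u' (rank_one B \<phi> c p q)"
          using * e s(1,2) d v m mv[of "rank_one B \<phi> c p q"] by simp
        finally show "app ?E v ?u (rank_one B \<phi> c p q) = app ?E v ?u' (rank_one B \<phi> c p q)" .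
      qed (use e s(1,2) d r m v in simp_all)
      then have "app ?N v (ap j (ap (rho B \<phi> G v) e)) s = app ?E v ?u' (gl (Id ?P \<phi>))"
        using jv[of "ap (rho B \<phi> G v) e" s] e s(1,2) d r by simp
      also have "\<dots> = app ?N v e (cm ?Q ?L ?L G s (ap (far (isbell_L V B) \<phi> \<phi>) (gl (Id ?P \<phi>))))"
        using e s(1,2) d v m mv[of "gl (Id ?P \<phi>)"] by simp
      also have "ap (far (isbell_L V B) \<phi> \<phi>) (gl (Id ?P \<phi>)) = gl (Id ?Q ?L)"
        using far_Id[OF vfunctor_isbell_L[OF E E'], of \<phi>] \<phi> E E' by simp
      also have "cm ?Q ?L ?L G s (gl (Id ?Q ?L)) = s"
        using s E G by simp
      finally show "app ?N v (ap j (ap (rho B \<phi> G v) e)) s = app ?N v e s" .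
    qed (use e v r j in simp_all)
    have 2: "ap (rho B \<phi> G v) (ap j y) = y" if y: "val y" "ty y = ?M" for y
    proof (rule nat_ob_eqI[OF E G C(1)])
      fix c g assume c: "c \<in> Ob B" "val g" "ty g = fob G c" "dj (ap (rho B \<phi> G v) (ap j y)) g" "dj g (ap (rho B \<phi> G v) (ap j y))"
      then have d: "dj y g" "dj g y" by simp_all
      let ?g = "app (fob G c) (ihom V (fob \<phi> c) v) (ap (pr B G H c) y) g"
      have g: "val ?g" "ty ?g = ihom V (fob \<phi> c) v" using c d y G v E C(1) C(2)[of c] by simp_all
      have "app (fob G c) (ihom V (fob \<phi> c) v) (ap (pr B G H c) (ap (rho B \<phi> G v) (ap j y))) g = ?g"
      proof (rule ihom_eqI[of _ _ "fob \<phi> c" v])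
        fix p assume p: "val p" "ty p = fob \<phi> c"
          "dj (app (fob G c) (ihom V (fob \<phi> c) v) (ap (pr B G H c) (ap (rho B \<phi> G v) (ap j y))) g) p"
          "dj p (app (fob G c) (ihom V (fob \<phi> c) v) (ap (pr B G H c) (ap (rho B \<phi> G v) (ap j y))) g)"
        then have dp: "dj y p" "dj p y" "dj g p" "dj p g" by simp_all
        let ?m = "curry_arr V (fob \<phi> c) ?E (fob \<phi> c) (evl V (fob \<phi> c) (fob \<phi> c) \<cdot> (pr (vop V B) \<phi> \<phi> c \<otimes> idn V (fob \<phi> c)) \<cdot> brd V (fob \<phi> c) ?E)"
        have m: "?m \<in> arr V" "src V ?m = fob \<phi> c" "trg V ?m = ihom V ?E (fob \<phi> c)" using c \<phi> E' by simp_all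
        have mv: "app ?E (fob \<phi> c) (ap ?m p) n = nv (vop V B) \<phi> \<phi> c n p" if "val n" "ty n = ?E" "dj n p" "dj p n" for n
          using that p(1,2) c(1-3) \<phi> E' by simp
        let ?\<theta> = "ap (theta B \<phi> G c) (tn g p)"
        \<comment> \<open>On an endomorphism n the second map applies y(g) to n(p). On rank-one
          endomorphisms its agreement with \<open>?u\<close> is \<open>Cact\<close>; at the identity
          it is the claim.\<close>
        let ?u = "ap h (tn y ?\<theta>)" and ?u' = "cm (vself V) ?E (fob \<phi> c) v ?g (ap ?m p)"
        have th: "val ?\<theta>" "ty ?\<theta> = ?N" using c(1-3) p(1,2) dp G by simp_all
        have "?u = ?u'"
        proof (rule coend_end_eqI[OF R v])
          fix b p' q' assume *: "b \<in> Ob B" "val p'" "ty p' = fob \<phi> b" "val q'" "ty q' = ?Lo b"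
            "dj ?u p'" "dj ?u q'" "dj p' q'" "dj p' ?u" "dj q' ?u" "dj q' p'"
          let ?k = "app (fob \<phi> c) (Hom B c b) (ap (pr (vop V B) \<phi> (yo B b) c) q') p"
          have k: "val ?k" "ty ?k = Hom B c b" using * c(1-3) p(1,2) \<phi> E' by simp_all
          have "app ?E v ?u (rank_one B \<phi> b p' q') =
            app (fob \<phi> b) v (app (fob G b) (ihom V (fob \<phi> b) v) (ap (pr B G H b) y) (app (?Lo b) (fob G b) (ap (pr B ?L G b) ?\<theta>) q')) p'"
            by (rule hv) (use * y c(1-3) p(1,2) d dp th in simp_all)
          also have "app (?Lo b) (fob G b) (ap (pr B ?L G b) ?\<theta>) q' = act G c b ?k g"
            using * c(1-3) p(1,2) d dp G by simp
          also have "app (fob \<phi> b) v (app (fob G b) (ihom V (fob \<phi> b) v) (ap (pr B G H b) y) (act G c b ?k g)) p' =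
            app (fob \<phi> c) v ?g (act \<phi> b c ?k p')"
            by (rule Cact) (use * y c(1-3) p(1,2) d dp k in simp_all)
          also have "act \<phi> b c ?k p' = nv (vop V B) \<phi> \<phi> c (rank_one B \<phi> b p' q') p"
            using * c(1-3) p(1,2) dp by simp
          also have "app (fob \<phi> c) v ?g \<dots> = app ?E v ?u' (rank_one B \<phi> b p' q')"
            using * g y c(1-3) p(1,2) d dp v m mv[of "rank_one B \<phi> b p' q'"] by simp
          finally show "app ?E v ?u (rank_one B \<phi> b p' q') = app ?E v ?u' (rank_one B \<phi> b p' q')" .
        qed (use y c(1-3) p(1,2) d dp g th m v in \<open>simp_all add: Un_ac\<close>)
        then have "app ?E v ?u (gl (Id ?P \<phi>)) = app (fob \<phi> c) v ?g p"
          using g y c(1-3) p(1,2) d dp v m mv[of "gl (Id ?P \<phi>)"] \<phi> E' by simp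
        then show "app (fob \<phi> c) v (app (fob G c) (ihom V (fob \<phi> c) v) (ap (pr B G H c) (ap (rho B \<phi> G v) (ap j y))) g) p =
          app (fob \<phi> c) v ?g p"
          using r(4)[of c "ap j y" g p] jv[of y ?\<theta>] y c(1-3) p(1,2) d dp j th by simp
      qed (use y c(1-3) d g j r G E C(1) C(2)[of c] v in \<open>simp_all add: Un_ac\<close>)
      then show "nv B G H c (ap (rho B \<phi> G v) (ap j y)) g = nv B G H c y g" using c C(2)[of c] by simp
    qed (use y j r in simp_all)
    show thesis by (rule that[folded H_def, OF j 1 2])
  qed (use v t in simp_all)
qed

end

end

section \<open>Preservation of colimits by [B, V](L \<phi>, -)\<close>

context sym_mon_closed
begin

context
  fixes B :: "('a, 'o, 'm) vcat" and \<phi>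
  assumes E: "has_ends B" and E': "has_ends (vop V B)" and \<phi>: "vpre (vop V B) \<phi>" and R: "coend_end B \<phi>"
begin

lemma rho_inj:
  assumes "vpre B G" "v \<in> obj V" "val e" "ty e = ihom V (NT B (Lf B \<phi>) G) v"
    "val e'" "ty e' = ihom V (NT B (Lf B \<phi>) G) v" "ap (rho B \<phi> G v) e = ap (rho B \<phi> G v) e'"
  shows "e = e'"
  by (rule rho_inverse[OF E E' \<phi> R assms(1,2)]) (metis assms(3-7))

text \<open>Left adjoints preserve colimits: a cocone is transposed along \<open>rho\<close>,
  factored through the given colimit and transposed back. The object \<open>v\<close> stays fixed,
  so the adjunction enters through naturality in \<open>G\<close>.\<close>

lemma rep_L_universal_cocone:
  assumes K: "vcategory V K" and EK: "has_ends (vop V K)" and W: "vpre (vop V K) W"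
    and S: "vfunctor V K (vpsh V B) S" and uc: "universal_cocone K (vpsh V B) W S G l"
    and l': "\<And>k. k \<in> Ob K \<Longrightarrow>
      l' k \<in> hom V (unt V) (ihom V (fob W k) (ihom V (NT B (Lf B \<phi>) (fob S k)) (NT B (Lf B \<phi>) G)))"
    and l'v: "\<And>k w. \<lbrakk>k \<in> Ob K; val w; ty w = fob W k\<rbrakk> \<Longrightarrow>
      app (fob W k) (ihom V (NT B (Lf B \<phi>) (fob S k)) (NT B (Lf B \<phi>) G)) (gl (l' k)) w =
      ap (far (rep V (vpsh V B) (Lf B \<phi>)) (fob S k) G) (app (fob W k) (NT B (fob S k) G) (gl (l k)) w)"
  shows "universal_cocone K (vself V) W (vcompose V K (rep V (vpsh V B) (Lf B \<phi>)) S) (NT B (Lf B \<phi>) G) l'"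
proof -
  let ?L = "Lf B \<phi>" and ?Q = "vpsh V B" and ?F = "rep V (vpsh V B) (Lf B \<phi>)"
  let ?FS = "vcompose V K ?F S" and ?N = "NT B (Lf B \<phi>)"
  have Q: "vcategory V ?Q" using E by simp
  have L: "vpre B ?L" using \<phi> E E' by (rule vpre_Lf[rotated 2])
  have F: "vpre ?Q ?F" using L Q by (intro vpre_rep) simp_all
  have FS: "vpre K ?FS" by (rule vfunctor_vcompose[OF S F]) (use K Q in simp_all)
  have G: "vpre B G" and l0: "wedge V (vop V K) (vself V) W (nerve_ob K ?Q S G) (unt V) l"
    using uc by (simp_all add: universal_cocone_def)
  have Sk [simp]: "vpre B (fob S k)" if "k \<in> Ob K" for k using vfunctor_arr(1)[OF S that] by simp
  have N [simp]: "?N G' \<in> obj V" if "vpre B G'" for G' using E L that by simp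
  have Wk [simp]: "fob W k \<in> obj V" if "k \<in> Ob K" for k using vfunctor_vself_objD[OF W] that by simp
  have l [simp]: "l k \<in> arr V" "src V (l k) = unt V" "trg V (l k) = ihom V (fob W k) (NT B (fob S k) G)"
    if "k \<in> Ob K" for k
    using wedgeD(2-4)[OF l0 _ W vpre_nerve_ob[OF K Q S]] that K G S by simp_all
  have far: "far ?F G1 G2 \<in> arr V" "src V (far ?F G1 G2) = NT B G1 G2" "trg V (far ?F G1 G2) = ihom V (?N G1) (?N G2)"
    if "vpre B G1" "vpre B G2" for G1 G2
    using vfunctor_arr(2-4)[OF F, of G1 G2] that by simp_all
  have NSQ: "vpre (vop V K) (nerve_ob K ?Q S G')" if "vpre B G'" for G'
    using vpre_nerve_ob[OF K Q S, of G'] that by simp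
  have NSV: "vpre (vop V K) (nerve_ob K (vself V) ?FS v)" if "v \<in> obj V" for v
    using vpre_nerve_ob[OF K vcategory_vself FS, of v] that by simp
  have actQ: "app p q (ap (far (nerve_ob K ?Q S G') k k') i) f = cm ?Q (fob S k') (fob S k) G' f (ap (far S k' k) i)"
    if "vpre B G'" "k \<in> Ob K" "k' \<in> Ob K" "val i" "ty i = Hom K k' k" "val f" "ty f = NT B (fob S k) G'" "dj i f" "dj f i"
      "p = NT B (fob S k) G'" "q = NT B (fob S k') G'" for G' k k' i f p q
    using nerve_ob_act[OF K Q S, of G' k k' i f] that by simp
  have actV: "app p q (ap (far (nerve_ob K (vself V) ?FS v) k k') i) f =
      cm (vself V) (?N (fob S k')) (?N (fob S k)) v f (ap (far ?F (fob S k') (fob S k)) (ap (far S k' k) i))"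
    if "v \<in> obj V" "k \<in> Ob K" "k' \<in> Ob K" "val i" "ty i = Hom K k' k" "val f" "ty f = ihom V (?N (fob S k)) v" "dj i f" "dj f i"
      "p = ihom V (?N (fob S k)) v" "q = ihom V (?N (fob S k')) v" for v k k' i f p q
    using nerve_ob_act[OF K vcategory_vself FS, of v k k' i f] that far S by (simp del: rep_sel(2))
  have Si: "val (ap (far S k' k) i)" "ty (ap (far S k' k) i) = NT B (fob S k') (fob S k)"
    if "k \<in> Ob K" "k' \<in> Ob K" "val i" "ty i = Hom K k' k" for k k' i
    using that S by simp_all
  show ?thesis unfolding universal_cocone_def
  proof (intro conjI ballI allI impI)
    show "?N G \<in> Ob (vself V)" using G by simp
    show "wedge V (vop V K) (vself V) W (nerve_ob K (vself V) ?FS (?N G)) (unt V) l'"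
    proof (rule wedgeI_on_iso[of _ _ _ star])
      fix k k' i w
      assume *: "k \<in> Ob (vop V K)" "k' \<in> Ob (vop V K)" "val i" "val w" "ty i = Hom (vop V K) k k'"
        "ty w = fob W k" "dj i star" "dj star i" "dj i w" "dj w i" "dj star w" "dj w star"
      let ?e = "app (fob W k) (NT B (fob S k) G) (gl (l k)) w"
      have e: "val ?e" "ty ?e = NT B (fob S k) G" using * G E by simp_all
      have aw: "val (act W k k' i w)" "ty (act W k k' i w) = fob W k'" using * W by simp_all
      have "app (fob W k') (fob (nerve_ob K ?Q S G) k') (gl (l k')) (act W k k' i w) =
        act (nerve_ob K ?Q S G) k k' i (app (fob W k) (fob (nerve_ob K ?Q S G) k) (gl (l k)) w)"
        by (rule wedgeD(5)[OF l0 _ W NSQ[OF G]]) (use * K in simp_all)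
      then have "app (fob W k') (NT B (fob S k') G) (gl (l k')) (act W k k' i w) =
        cm ?Q (fob S k') (fob S k) G ?e (ap (far S k' k) i)"
        using * e G actQ[OF G, of k k' i ?e] by simp
      then have "app (fob W k') (ihom V (?N (fob S k')) (?N G)) (gl (l' k')) (act W k k' i w) =
        ap (far ?F (fob S k') G) (cm ?Q (fob S k') (fob S k) G ?e (ap (far S k' k) i))"
        using l'v[of k' "act W k k' i w"] * aw by simp
      also have "\<dots> = cm (vself V) (fob ?F (fob S k')) (fob ?F (fob S k)) (fob ?F G)
          (ap (far ?F (fob S k) G) ?e) (ap (far ?F (fob S k') (fob S k)) (ap (far S k' k) i))"
        by (rule far_cm[OF F Q]) (use * e Si[of k k' i] G in simp_all)
      also have "\<dots> = act (nerve_ob K (vself V) ?FS (?N G)) k k' i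
          (app (fob W k) (ihom V (?N (fob S k)) (?N G)) (gl (l' k)) w)"
        using * e G far actV[of "?N G" k k' i "ap (far ?F (fob S k) G) ?e"] l'v[of k w] by (simp del: rep_sel(2))
      finally show "act (nerve_ob K (vself V) ?FS (?N G)) k k' i
          (app (fob W k) (fob (nerve_ob K (vself V) ?FS (?N G)) k) (gl (l' k)) w) =
        app (fob W k') (fob (nerve_ob K (vself V) ?FS (?N G)) k') (gl (l' k')) (act W k k' i w)"
        using * G by simp
    qed (use K W l' NSV[of "?N G"] G in simp_all)
  next
    fix v X \<tau>
    assume "v \<in> Ob (vself V)" and t: "wedge V (vop V K) (vself V) W (nerve_ob K (vself V) ?FS v) X \<tau>"
    then have v: "v \<in> obj V" by simp
    note D = wedgeD[OF t _ W NSV[OF v]]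
    have X: "X \<in> obj V" using D(1) K by simp
    have \<tau> [simp]: "\<tau> k \<in> arr V" "src V (\<tau> k) = X" "trg V (\<tau> k) = ihom V (fob W k) (ihom V (?N (fob S k)) v)"
      if "k \<in> Ob K" for k using D(2-4)[of k] K that by simp_all
    note r = rho_simps(1-3)[OF E E' \<phi> R _ v]
    define H where "H = cot B \<phi> v"
    note r = r[folded H_def]
    have H: "vpre B H" unfolding H_def by (rule cot_facts[OF E E' \<phi> R v])
    \<comment> \<open>The transpose of \<tau>: a cocone over \<open>S\<close> with vertex
      [\<phi>-, v] and parameter \<open>X\<close>.\<close>
    define \<sigma> where "\<sigma> k = curry_arr V X (fob W k) (NT B (fob S k) H)
      (rho B \<phi> (fob S k) v \<cdot> evl V (fob W k) (ihom V (?N (fob S k)) v) \<cdot> (\<tau> k \<otimes> idn V (fob W k)))" for k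
    have \<sigma>: "\<sigma> k \<in> hom V X (ihom V (fob W k) (NT B (fob S k) H))" if "k \<in> Ob K" for k
      using that X v E H r by (simp add: \<sigma>_def)
    have \<sigma>v: "app (fob W k) (NT B (fob S k) H) (ap (\<sigma> k) x) w =
        ap (rho B \<phi> (fob S k) v) (app (fob W k) (ihom V (?N (fob S k)) v) (ap (\<tau> k) x) w)"
      if "k \<in> Ob K" "val x" "ty x = X" "val w" "ty w = fob W k" "dj x w" for k x w
      using that X v E H r by (simp add: \<sigma>_def)
    have "wedge V (vop V K) (vself V) W (nerve_ob K ?Q S H) X \<sigma>"
    proof (rule wedgeI)
      fix k k' i x w
      assume *: "k \<in> Ob (vop V K)" "k' \<in> Ob (vop V K)" "val i" "val x" "val w" "ty i = Hom (vop V K) k k'"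
        "ty x = X" "ty w = fob W k" "dj i x" "dj x i" "dj i w" "dj w i" "dj x w" "dj w x"
      let ?e = "app (fob W k) (ihom V (?N (fob S k)) v) (ap (\<tau> k) x) w"
      have e: "val ?e" "ty ?e = ihom V (?N (fob S k)) v" using * v by simp_all
      have re: "val (ap (rho B \<phi> (fob S k) v) ?e)" "ty (ap (rho B \<phi> (fob S k) v) ?e) = NT B (fob S k) H"
        using e r * by simp_all
      have aw: "val (act W k k' i w)" "ty (act W k k' i w) = fob W k'" using * W by simp_all
      have "app (fob W k') (fob (nerve_ob K (vself V) ?FS v) k') (ap (\<tau> k') x) (act W k k' i w) =
        act (nerve_ob K (vself V) ?FS v) k k' i (app (fob W k) (fob (nerve_ob K (vself V) ?FS v) k) (ap (\<tau> k) x) w)"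
        by (rule D(5)) (use * K in simp_all)
      then have 1: "app (fob W k') (ihom V (?N (fob S k')) v) (ap (\<tau> k') x) (act W k k' i w) =
        cm (vself V) (?N (fob S k')) (?N (fob S k)) v ?e (ap (far ?F (fob S k') (fob S k)) (ap (far S k' k) i))"
        using * e v actV[of v k k' i ?e] by (simp del: rep_sel(2))
      have "act (nerve_ob K ?Q S H) k k' i (app (fob W k) (fob (nerve_ob K ?Q S H) k) (ap (\<sigma> k) x) w) =
        cm ?Q (fob S k') (fob S k) H (ap (rho B \<phi> (fob S k) v) ?e) (ap (far S k' k) i)"
        using * re actQ[OF H, of k k' i "ap (rho B \<phi> (fob S k) v) ?e"] H by (simp add: \<sigma>v)
      also have "\<dots> = ap (rho B \<phi> (fob S k') v) (cm (vself V) (?N (fob S k')) (?N (fob S k)) v ?e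
          (ap (far ?F (fob S k') (fob S k)) (ap (far S k' k) i)))"
        unfolding H_def by (rule rho_nat[OF E E' \<phi> R _ _ v]) (use * e Si[of k k' i] in simp_all)
      also have "\<dots> = app (fob W k') (NT B (fob S k') H) (ap (\<sigma> k') x) (act W k k' i w)"
        unfolding 1[symmetric] by (rule \<sigma>v[symmetric]) (use * aw in simp_all)
      finally show "act (nerve_ob K ?Q S H) k k' i (app (fob W k) (fob (nerve_ob K ?Q S H) k) (ap (\<sigma> k) x) w) =
        app (fob W k') (fob (nerve_ob K ?Q S H) k') (ap (\<sigma> k') x) (act W k k' i w)"
        using * H by simp
    qed (use K W NSQ[OF H] X \<sigma> in simp_all)
    moreover have "H \<in> Ob ?Q" using H by simp
    ultimately obtain h where h: "h \<in> hom V X (Hom ?Q G H)" and hv0: "\<forall>k \<in> Ob K. \<forall>x w. val x \<and> ty x = X \<and> val w \<and> ty w = fob W k \<and> dj x w \<longrightarrow>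
           cm ?Q (fob S k) G H (ap h x) (app (fob W k) (Hom ?Q (fob S k) G) (gl (l k)) w) =
           app (fob W k) (Hom ?Q (fob S k) H) (ap (\<sigma> k) x) w"
      using uc unfolding universal_cocone_def by blast
    have h' [simp]: "h \<in> arr V" "src V h = X" "trg V h = NT B G H" using h by simp_all
    have "\<exists>j. j \<in> arr V \<and> src V j = NT B G H \<and> trg V j = ihom V (?N G) v \<and>
        (\<forall>y. val y \<and> ty y = NT B G H \<longrightarrow> ap (rho B \<phi> G v) (ap j y) = y)"
      by (rule rho_inverse[OF E E' \<phi> R G v, folded H_def]) blast
    then obtain j where j [simp]: "j \<in> arr V" "src V j = NT B G H" "trg V j = ihom V (?N G) v"
      and rj: "\<And>y. \<lbrakk>val y; ty y = NT B G H\<rbrakk> \<Longrightarrow> ap (rho B \<phi> G v) (ap j y) = y" by blast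
    \<comment> \<open>Injectivity of \<open>rho\<close> allows the factorization to be checked after
      transposing, where it is the one through \<open>G\<close>.\<close>
    have "cm (vself V) (?N (fob S k)) (?N G) v (ap (j \<cdot> h) x) (app (fob W k) (ihom V (?N (fob S k)) (?N G)) (gl (l' k)) w) =
        app (fob W k) (ihom V (?N (fob S k)) v) (ap (\<tau> k) x) w"
      if *: "k \<in> Ob K" "val x" "ty x = X" "val w" "ty w = fob W k" "dj x w" for k x w
    proof (rule rho_inj[OF Sk[OF *(1)] v])
      let ?e = "app (fob W k) (NT B (fob S k) G) (gl (l k)) w"
      have e: "val ?e" "ty ?e = NT B (fob S k) G" using * G E by simp_all
      have dj': "dj w x" using * dj_sym by blast
      have "ap (rho B \<phi> (fob S k) v) (cm (vself V) (?N (fob S k)) (?N G) v (ap j (ap h x)) (ap (far ?F (fob S k) G) ?e)) =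
        cm ?Q (fob S k) G H (ap (rho B \<phi> G v) (ap j (ap h x))) ?e"
        unfolding H_def by (rule rho_nat[OF E E' \<phi> R _ G v, symmetric]) (use * e dj' in simp_all)
      also have "\<dots> = ap (rho B \<phi> (fob S k) v) (app (fob W k) (ihom V (?N (fob S k)) v) (ap (\<tau> k) x) w)"
        using * rj[of "ap h x"] hv0[rule_format, of k x w] \<sigma>v[of k x w] by simp
      finally show "ap (rho B \<phi> (fob S k) v) (cm (vself V) (?N (fob S k)) (?N G) v (ap (j \<cdot> h) x)
          (app (fob W k) (ihom V (?N (fob S k)) (?N G)) (gl (l' k)) w)) =
        ap (rho B \<phi> (fob S k) v) (app (fob W k) (ihom V (?N (fob S k)) v) (ap (\<tau> k) x) w)"
        using * by (simp add: l'v del: rep_sel(2))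
    qed (use * v G l'[OF *(1)] in simp_all)
    then show "\<exists>h \<in> hom V X (Hom (vself V) (?N G) v). \<forall>k \<in> Ob K. \<forall>x w. val x \<and> ty x = X \<and> val w \<and> ty w = fob W k \<and> dj x w \<longrightarrow>
           cm (vself V) (fob ?FS k) (?N G) v (ap h x) (app (fob W k) (Hom (vself V) (fob ?FS k) (?N G)) (gl (l' k)) w) =
           app (fob W k) (Hom (vself V) (fob ?FS k) v) (ap (\<tau> k) x) w"
      by (intro bexI[of _ "j \<cdot> h"]) simp_all
  next
    fix v u u'
    assume "v \<in> Ob (vself V)" and a: "val u \<and> val u' \<and> ty u = Hom (vself V) (?N G) v \<and> ty u' = Hom (vself V) (?N G) v \<and> stg u = stg u' \<and>
        (\<forall>k \<in> Ob K. \<forall>w. val w \<and> ty w = fob W k \<and> dj u w \<longrightarrow>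
           cm (vself V) (fob ?FS k) (?N G) v u (app (fob W k) (Hom (vself V) (fob ?FS k) (?N G)) (gl (l' k)) w) =
           cm (vself V) (fob ?FS k) (?N G) v u' (app (fob W k) (Hom (vself V) (fob ?FS k) (?N G)) (gl (l' k)) w))"
    then have v: "v \<in> obj V" and u: "val u" "val u'" "ty u = ihom V (?N G) v" "ty u' = ihom V (?N G) v" "stg u = stg u'"
      and eq: "\<And>k w. \<lbrakk>k \<in> Ob K; val w; ty w = fob W k; dj u w\<rbrakk> \<Longrightarrow>
           cm (vself V) (?N (fob S k)) (?N G) v u (app (fob W k) (ihom V (?N (fob S k)) (?N G)) (gl (l' k)) w) =
           cm (vself V) (?N (fob S k)) (?N G) v u' (app (fob W k) (ihom V (?N (fob S k)) (?N G)) (gl (l' k)) w)"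
      by simp_all
    define H where "H = cot B \<phi> v"
    have H: "vpre B H" unfolding H_def by (rule cot_facts[OF E E' \<phi> R v])
    note r = rho_simps(1-3)[OF E E' \<phi> R G v, folded H_def]
    have k: "cm ?Q (fob S k) G H (ap (rho B \<phi> G v) z) (app (fob W k) (NT B (fob S k) G) (gl (l k)) w) =
        ap (rho B \<phi> (fob S k) v) (cm (vself V) (?N (fob S k)) (?N G) v z (app (fob W k) (ihom V (?N (fob S k)) (?N G)) (gl (l' k)) w))"
      if "k \<in> Ob K" "val w" "ty w = fob W k" "val z" "ty z = ihom V (?N G) v" "dj z w" "dj w z" for k w z
      unfolding H_def l'v[OF that(1-3)] by (rule rho_nat[OF E E' \<phi> R _ G v]) (use that G E in simp_all)
    \<comment> \<open>The transposes agree on the colimiting cocone, so the uniqueness in the given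
      colimit applies to them.\<close>
    have "ap (rho B \<phi> G v) u = ap (rho B \<phi> G v) u'"
    proof -
      have "cm ?Q (fob S k) G H (ap (rho B \<phi> G v) u) (app (fob W k) (Hom ?Q (fob S k) G) (gl (l k)) w) =
        cm ?Q (fob S k) G H (ap (rho B \<phi> G v) u') (app (fob W k) (Hom ?Q (fob S k) G) (gl (l k)) w)"
        if "k \<in> Ob K" "val w" "ty w = fob W k" "dj (ap (rho B \<phi> G v) u) w" for k w
        using that k[of k w u] k[of k w u'] eq[of k w] u dj_stg[OF u(5), of w] dj_sym[of w u] dj_sym[of w u'] by simp
      moreover have "val (ap (rho B \<phi> G v) u)" "val (ap (rho B \<phi> G v) u')" "ty (ap (rho B \<phi> G v) u) = Hom ?Q G H"
        "ty (ap (rho B \<phi> G v) u') = Hom ?Q G H" "stg (ap (rho B \<phi> G v) u) = stg (ap (rho B \<phi> G v) u')" "H \<in> Ob ?Q"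
        using u r H by simp_all
      ultimately show ?thesis using uc unfolding universal_cocone_def by blast
    qed
    then show "u = u'" by (rule rho_inj[OF G v u(1,3) u(2,4)])
  qed
qed

end

lemma small_projective_Lf:
  fixes \<kappa> :: "'u rel" and B :: "('u, 'o, 'm) vcat"
  assumes \<kappa>: "universe_card \<kappa>" and lim: "complete_cat \<kappa> V" and B: "vcategory V B" and sm: "vsmall \<kappa> V B"
    and sp: "small_projective \<kappa> V B \<phi>"
  shows "small_projective \<kappa> V (vop V B) (Lf B \<phi>)"
proof -
  have E: "has_ends B" by (rule has_ends_small[OF \<kappa> lim B sm])
  have E': "has_ends (vop V B)" by (rule has_ends_small[OF \<kappa> lim]) (use B sm vsmall_vop in auto)
  have \<phi>: "vpre (vop V B) \<phi>" using sp by (simp add: small_projective_def)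
  have R: "coend_end B \<phi>" by (rule small_projective_coend_end[OF E E' sm sp])
  have L: "vpre B (Lf B \<phi>)" by (rule vpre_Lf[OF E E' \<phi>])
  let ?Q = "vpsh V B" and ?L = "Lf B \<phi>"
  let ?F = "rep V ?Q ?L" and ?N = "NT B (Lf B \<phi>)"
  have Q: "vcategory V ?Q" using E by simp
  have F: "vpre ?Q ?F" using L Q by (intro vpre_rep) simp_all
  have far: "far ?F G1 G2 \<in> arr V" "src V (far ?F G1 G2) = NT B G1 G2" "trg V (far ?F G1 G2) = ihom V (?N G1) (?N G2)"
    if "vpre B G1" "vpre B G2" for G1 G2
    using vfunctor_arr(2-4)[OF F, of G1 G2] that by simp_all
  have "preserves_small_colimits \<kappa> V ?Q (vself V) ?F"
    unfolding preserves_small_colimits_def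
  proof (intro allI impI, elim conjE)
    fix K :: "('u, 'o, 'm) vcat" and W S G \<beta>
    assume K: "vcategory V K" "vsmall \<kappa> V K" and W: "vpre (vop V K) W" and S: "vfunctor V K ?Q S"
      and \<beta>: "weighted_colimit V K ?Q W S G \<beta>"
    have EK: "has_ends (vop V K)" by (rule has_ends_small[OF \<kappa> lim]) (use K vsmall_vop in auto)
    let ?l = "colimit_unit V K ?Q W S G \<beta>"
    \<comment> \<open>The unit that \<open>preserves_colimit\<close> prescribes for the image of the
      colimit; its universality is what remains to be shown.\<close>
    let ?l' = "\<lambda>k. ecomp V (vself V) (fob W k) (Hom ?Q (fob S k) G) (Hom (vself V) (fob ?F (fob S k)) (fob ?F G))
       (name_arr V (Hom ?Q (fob S k) G) (Hom (vself V) (fob ?F (fob S k)) (fob ?F G)) (far ?F (fob S k) G)) (?l k)"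
    have uc: "universal_cocone K ?Q W S G ?l"
      by (rule universal_cocone_colimit_unit[OF K(1) EK Q W S \<beta>])
    then have G: "vpre B G" and l0: "wedge V (vop V K) (vself V) W (nerve_ob K ?Q S G) (unt V) ?l"
      by (simp_all add: universal_cocone_def)
    have Sk [simp]: "vpre B (fob S k)" if "k \<in> Ob K" for k using vfunctor_arr(1)[OF S that] by simp
    have Wk [simp]: "fob W k \<in> obj V" if "k \<in> Ob K" for k using vfunctor_vself_objD[OF W] that by simp
    have l: "?l k \<in> arr V" "src V (?l k) = unt V" "trg V (?l k) = ihom V (fob W k) (NT B (fob S k) G)"
      if "k \<in> Ob K" for k
      using wedgeD(2-4)[OF l0 _ W vpre_nerve_ob[OF K(1) Q S]] that K G S by simp_all
    have "universal_cocone K (vself V) W (vcompose V K ?F S) (?N G) ?l'"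
    proof (rule rep_L_universal_cocone[OF E E' \<phi> R K(1) EK W S uc])
      show "?l' k \<in> hom V (unt V) (ihom V (fob W k) (ihom V (?N (fob S k)) (?N G)))" if "k \<in> Ob K" for k
        using that l[OF that] far[of "fob S k" G] G E L by (simp del: rep_sel(2))
      show "app (fob W k) (ihom V (?N (fob S k)) (?N G)) (gl (?l' k)) w =
        ap (far ?F (fob S k) G) (app (fob W k) (NT B (fob S k) G) (gl (?l k)) w)"
        if "k \<in> Ob K" "val w" "ty w = fob W k" for k w
        using that l[OF that(1)] far[of "fob S k" G] G E L by (simp del: rep_sel(2))
    qed
    then obtain \<beta>' where "weighted_colimit V K (vself V) W (vcompose V K ?F S) (?N G) \<beta>'"
      "\<And>k. k \<in> Ob K \<Longrightarrow> colimit_unit V K (vself V) W (vcompose V K ?F S) (?N G) \<beta>' k = ?l' k"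
      using weighted_colimit_universal_cocone[OF K(1) EK vcategory_vself W vfunctor_vcompose[OF S F K(1) Q vcategory_vself]]
      by blast
    then show "preserves_colimit V K ?Q (vself V) ?F W S G \<beta>"
      unfolding preserves_colimit_def using G by (intro exI[of _ \<beta>']) simp
  qed
  then show ?thesis unfolding small_projective_def using L B by simp
qed

section \<open>Restriction to small projectives\<close>

text \<open>Only agreement on objects is asked for: the opposite of a full subcategory and the full
  subcategory of the opposite can differ in the irrelevant values of \<open>Comp\<close>.\<close>

definition subcat :: "('a, 'o, 'm) vcat \<Rightarrow> ('a, 'o, 'm) vcat \<Rightarrow> bool" where
  "subcat A' A \<longleftrightarrow> Ob A' \<subseteq> Ob A \<and> (\<forall>x \<in> Ob A'. Id A' x = Id A x) \<and>
     (\<forall>x \<in> Ob A'. \<forall>y \<in> Ob A'. Hom A' x y = Hom A x y) \<and>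
     (\<forall>x \<in> Ob A'. \<forall>y \<in> Ob A'. \<forall>z \<in> Ob A'. Comp A' x y z = Comp A x y z)"

lemma subcat_full_sub: "P \<subseteq> Ob A \<Longrightarrow> subcat (full_sub A P) A"
  by (simp add: subcat_def)

lemma subcat_vop_full_sub: "P \<subseteq> Ob A \<Longrightarrow> subcat (vop V (full_sub A P)) (vop V A)"
  by (auto simp: subcat_def vop_def)

lemma vfunctor_restrict:
  assumes F: "vfunctor V A C F" and A: "subcat A' A" and C: "subcat C' C"
    and ob: "\<And>x. x \<in> Ob A' \<Longrightarrow> fob F x \<in> Ob C'"
  shows "vfunctor V A' C' (restrict_vfun A' F)"
proof -
  have m: "restrict_vfun A' F = mk_vfun A' (fob (restrict_vfun A' F)) (far (restrict_vfun A' F))"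
    unfolding restrict_vfun_def by (rule mk_vfun_idem[symmetric])
  have s: "x \<in> Ob A' \<Longrightarrow> fob (restrict_vfun A' F) x = fob F x"
    "\<lbrakk>x \<in> Ob A'; y \<in> Ob A'\<rbrakk> \<Longrightarrow> far (restrict_vfun A' F) x y = far F x y" for x y
    by (simp_all add: restrict_vfun_def)
  show ?thesis
    using F A C ob unfolding vfunctor_def subcat_def
    by (intro conjI m) (simp_all add: s subset_iff)
qed

lemma vnat_restrict:
  assumes n: "vnat V A C F G \<alpha>" and A: "subcat A' A" and C: "subcat C' C"
    and F: "\<And>x. x \<in> Ob A' \<Longrightarrow> fob F' x = fob F x \<and> fob F x \<in> Ob C'"
      "\<And>x y. \<lbrakk>x \<in> Ob A'; y \<in> Ob A'\<rbrakk> \<Longrightarrow> far F' x y = far F x y"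
    and G: "\<And>x. x \<in> Ob A' \<Longrightarrow> fob G' x = fob G x \<and> fob G x \<in> Ob C'"
      "\<And>x y. \<lbrakk>x \<in> Ob A'; y \<in> Ob A'\<rbrakk> \<Longrightarrow> far G' x y = far G x y"
  shows "vnat V A' C' F' G' \<alpha>"
  using n A C F G unfolding vnat_def subcat_def by (simp add: subset_iff)

lemma viso_full_sub [simp]: "viso V (full_sub A P) x y f = viso V A x y f"
  by (simp add: viso_def ecomp_def)

text \<open>Fullness lets the functors, the unit and the counit restrict unchanged. That R preserves
  small projectives and that the counit is invertible there are the results for L and the unit,
  taken at \<open>vop V B\<close>.\<close>

theorem isbell_equivalence:
  fixes \<kappa> :: "'u rel" and B :: "('u, 'o, 'm) vcat"
  assumes \<kappa>: "universe_card \<kappa>" and lim: "complete_cat \<kappa> V" and B: "vcategory V B" and sm: "vsmall \<kappa> V B"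
  shows "vadjunction V (vpsh V (vop V B)) (vop V (vpsh V B))
           (isbell_L V B) (isbell_R V B) (isbell_unit V B) (isbell_counit V B)
       \<and> vequivalence V (Qcat \<kappa> V B) (vop V (Qcat \<kappa> V (vop V B)))
           (restrict_vfun (Qcat \<kappa> V B) (isbell_L V B))
           (restrict_vfun (vop V (Qcat \<kappa> V (vop V B))) (isbell_R V B))
           (isbell_unit V B) (isbell_counit V B)"
proof
  have B': "vcategory V (vop V B)" and sm': "vsmall \<kappa> V (vop V B)" using B sm vsmall_vop by auto
  have E: "has_ends B" by (rule has_ends_small[OF \<kappa> lim B sm])
  have E': "has_ends (vop V B)" by (rule has_ends_small[OF \<kappa> lim B' sm'])
  have E'': "has_ends (vop V (vop V B))" using E B by simp
  let ?P = "vpsh V (vop V B)" and ?Q = "vpsh V B"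
  let ?A = "Qcat \<kappa> V B" and ?C = "Qcat \<kappa> V (vop V B)"
  let ?L = "isbell_L V B" and ?R = "isbell_R V B"
  show adj: "vadjunction V ?P (vop V ?Q) ?L ?R (isbell_unit V B) (isbell_counit V B)"
    by (rule isbell_adjunction[OF E E'])
  have Q: "vcategory V ?Q" and P: "vcategory V ?P" using E E' by simp_all
  let ?SA = "{\<phi>. small_projective \<kappa> V B \<phi>}" and ?SC = "{\<psi>. small_projective \<kappa> V (vop V B) \<psi>}"
  have A: "?A = full_sub ?P ?SA" and C: "?C = full_sub ?Q ?SC" using B by (simp_all add: Qcat_def)
  have SA: "?SA \<subseteq> Ob ?P" and SC: "?SC \<subseteq> Ob ?Q" using B by (auto simp: small_projective_def)
  have sA: "subcat ?A ?P" unfolding A by (rule subcat_full_sub[OF SA])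
  have sC: "subcat (vop V ?C) (vop V ?Q)" unfolding C by (rule subcat_vop_full_sub[OF SC])
  have ObA: "Ob ?A = ?SA" and ObC: "Ob (vop V ?C) = ?SC" unfolding A C by simp_all
  have vC: "vcategory V ?C" unfolding C by (rule vcategory_full_sub[OF Q SC])
  have Lm: "fob ?L \<phi> \<in> ?SC" if "\<phi> \<in> ?SA" for \<phi>
    using small_projective_Lf[OF \<kappa> lim B sm] that by simp
  have Rob: "fob ?R \<psi> = Lf (vop V B) \<psi>" for \<psi> using B by (simp add: isbell_R_eq)
  have Rm: "fob ?R \<psi> \<in> ?SA" if "\<psi> \<in> ?SC" for \<psi>
    using small_projective_Lf[OF \<kappa> lim B' sm'] that B by (simp add: Rob)
  let ?Lr = "restrict_vfun ?A ?L" and ?Rr = "restrict_vfun (vop V ?C) ?R"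
  have Lr: "fob ?Lr \<phi> = fob ?L \<phi>" "\<phi>' \<in> ?SA \<Longrightarrow> far ?Lr \<phi> \<phi>' = far ?L \<phi> \<phi>'" if "\<phi> \<in> ?SA" for \<phi> \<phi>'
    using that ObA by (simp_all add: restrict_vfun_def)
  have Rr: "fob ?Rr \<psi> = fob ?R \<psi>" "\<psi>' \<in> ?SC \<Longrightarrow> far ?Rr \<psi> \<psi>' = far ?R \<psi> \<psi>'" if "\<psi> \<in> ?SC" for \<psi> \<psi>'
    using that ObC by (simp_all add: restrict_vfun_def)
  have HA: "Hom ?A = Hom ?P" and HC: "Hom (vop V ?C) = Hom (vop V ?Q)"
    unfolding A C by (auto simp: fun_eq_iff)
  have "vfunctor V ?A (vop V ?C) ?Lr"
    by (rule vfunctor_restrict[OF vfunctor_isbell_L[OF E E'] sA sC]) (use Lm ObA ObC in auto)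
  moreover have "vfunctor V (vop V ?C) ?A ?Rr"
    by (rule vfunctor_restrict[OF vfunctor_isbell_R[OF E E'] sC sA]) (use Rm ObA ObC in auto)
  moreover have "vnat_iso V ?A ?A (vid V ?A) (vcompose V ?A ?Rr ?Lr) (isbell_unit V B)"
    unfolding vnat_iso_def
  proof (intro conjI ballI)
    show "vnat V ?A ?A (vid V ?A) (vcompose V ?A ?Rr ?Lr) (isbell_unit V B)"
      by (rule vnat_restrict[OF vnat_isbell_unit[OF E E'] sA sA])
        (use SA Lm Rm Lr Rr ObA HA in \<open>auto simp: subset_iff\<close>)
    fix \<phi> assume "\<phi> \<in> Ob ?A"
    then have sp: "small_projective \<kappa> V B \<phi>" using ObA by simp
    then have \<phi>: "vpre (vop V B) \<phi>" by (simp add: small_projective_def)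
    have "viso V ?P \<phi> (Lf (vop V B) (Lf B \<phi>)) (isbell_unit V B \<phi>)"
      by (rule isbell_unit_iso[OF E E' \<phi> small_projective_coend_end[OF E E' sm sp]])
    then show "viso V ?A (fob (vid V ?A) \<phi>) (fob (vcompose V ?A ?Rr ?Lr) \<phi>) (isbell_unit V B \<phi>)"
      using sp Lm[of \<phi>] Lr Rr ObA by (simp add: A Rob)
  qed
  moreover have "vnat_iso V (vop V ?C) (vop V ?C) (vcompose V (vop V ?C) ?Lr ?Rr) (vid V (vop V ?C)) (isbell_counit V B)"
    unfolding vnat_iso_def
  proof (intro conjI ballI)
    have "vnat V (vop V ?Q) (vop V ?Q) (vcompose V (vop V ?Q) ?L ?R) (vid V (vop V ?Q)) (isbell_counit V B)"
      using adj by (simp add: vadjunction_def)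
    then show "vnat V (vop V ?C) (vop V ?C) (vcompose V (vop V ?C) ?Lr ?Rr) (vid V (vop V ?C)) (isbell_counit V B)"
      by (rule vnat_restrict[OF _ sC sC])
        (use SC Lm Rm Lr Rr ObC HC in \<open>auto simp: subset_iff\<close>)
    fix \<psi> assume "\<psi> \<in> Ob (vop V ?C)"
    then have sp: "small_projective \<kappa> V (vop V B) \<psi>" using ObC by simp
    then have \<psi>: "vpre (vop V (vop V B)) \<psi>" by (simp add: small_projective_def)
    have "viso V (vpsh V (vop V (vop V B))) \<psi> (Lf (vop V (vop V B)) (Lf (vop V B) \<psi>)) (isbell_unit V (vop V B) \<psi>)"
      by (rule isbell_unit_iso[OF E' E'' \<psi> small_projective_coend_end[OF E' E'' sm' sp]])
    \<comment> \<open>In [B, V] the counit points from \<psi> to L (R \<psi>); passing to the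
      opposite category reverses it afterwards.\<close>
    then have i: "viso V ?C \<psi> (Lf B (Lf (vop V B) \<psi>)) (isbell_counit V B \<psi>)"
      using B by (simp add: C isbell_counit_def)
    have "Lf B (Lf (vop V B) \<psi>) \<in> ?SC" using Lm[OF Rm[of \<psi>]] sp by (simp add: Rob)
    then have "viso V (vop V ?C) (Lf B (Lf (vop V B) \<psi>)) \<psi> (isbell_counit V B \<psi>)"
      using i sp ObC by (subst viso_vop[OF vC]) simp_all
    then show "viso V (vop V ?C) (fob (vcompose V (vop V ?C) ?Lr ?Rr) \<psi>) (fob (vid V (vop V ?C)) \<psi>) (isbell_counit V B \<psi>)"
      using sp Rm[of \<psi>] Lr Rr ObC by (simp add: Rob)
  qed
  ultimately show "vequivalence V ?A (vop V ?C) ?Lr ?Rr (isbell_unit V B) (isbell_counit V B)"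
    by (simp add: vequivalence_def)
qed

end

theorem mainTheorem3:
  fixes \<kappa> :: "'u rel" and V :: "('o, 'm) smc" and B :: "('u, 'o, 'm) vcat"
  assumes "universe_card \<kappa>"
    and "sym_mon_closed V" and "locally_small \<kappa> V"
    and "complete_cat \<kappa> V" and "cocomplete_cat \<kappa> V"
    and "vcategory V B" and "vsmall \<kappa> V B"
  shows "vadjunction V (vpsh V (vop V B)) (vop V (vpsh V B))
           (isbell_L V B) (isbell_R V B) (isbell_unit V B) (isbell_counit V B)
       \<and> vequivalence V (Qcat \<kappa> V B) (vop V (Qcat \<kappa> V (vop V B)))
           (restrict_vfun (Qcat \<kappa> V B) (isbell_L V B))
           (restrict_vfun (vop V (Qcat \<kappa> V (vop V B))) (isbell_R V B))
           (isbell_unit V B) (isbell_counit V B)"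
  using sym_mon_closed.isbell_equivalence[OF assms(2,1,4,6,7)] .

end
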